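(* Under assumptions (B1), (B2), (C1) and (C2) described in the context, there is a constant $C>0$ such that for any $0\le t\le T$ and initial states $\zeta,\zeta'\in L^2(\Omega,\mathcal F_t,P;\mathbb R^n)$, $P$-a.s.: (i) $E\big[\sup_{t\le s\le T}|X_s^{t,\zeta}-X_s^{t,\zeta'}|^2+\sup_{t\le s\le T}|Y_s^{t,\zeta}-Y_s^{t,\zeta'}|^2+\int_t^T|Z_s^{t,\zeta}-Z_s^{t,\zeta'}|^2ds\,\big|\,\mathcal F_t\big]\le C|\zeta-\zeta'|^2$; (ii) $E\big[\sup_{t\le s\le T}|X_s^{t,\zeta}|^2+\sup_{t\le s\le T}|Y_s^{t,\zeta}|^2+\int_t^T|Z_s^{t,\zeta}|^2ds\,\big|\,\mathcal F_t\big]\le C(1+|\zeta|^2)$. If $\sigma$ also satisfies (C3): $|\sigma(t,x,y,z)|\le L(1+|x|+|y|)$ for any $t\in[0,T]$ and $(x,y,z)\in\mathbb R^n\times\mathbb R\times\mathbb R^d$, $P$-a.s., then (iii) $E\big[\sup_{t\le s\le t+\delta}|X_s^{t,\zeta}-\zeta|^2\,\big|\,\mathcal F_t\big]\le C\delta(1+|\zeta|^2)$, $P$-a.s., for $0\le\delta\le T-t$.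
   Context: $B$ is a $d$-dimensional Brownian motion on the classical Wiener space $(\Omega,\mathcal F,P)$ over $[0,T]$ with its natural augmented filtration $\mathbb F=(\mathcal F_s)_{0\le s\le T}$. $\mathcal S^2$: $\mathbb F$-adapted continuous processes with square-integrable supremum; $\mathcal H^2$: $\mathbb F$-progressively measurable processes square-integrable for $ds\otimes dP$. The (possibly random) coefficients are $b:\Omega\times[0,T]\times\mathbb R^n\times\mathbb R\times\mathbb R^d\to\mathbb R^n$, $\sigma:\Omega\times[0,T]\times\mathbb R^n\times\mathbb R\times\mathbb R^d\to\mathbb R^{n\times d}$, $f:\Omega\times[0,T]\times\mathbb R^n\times\mathbb R\times\mathbb R^d\to\mathbb R$, $\mathbb F$-progressively measurable for each $(x,y,z)$, and $\Phi:\Omega\times\mathbb R^n\to\mathbb R$ with $\Phi(x)$ $\mathcal F_T$-measurable for each $x$. $G$ is a fixed full-rank $1\times n$ matrix; for $\lambda=(x,y,z)$, $A(t,\lambda)=(-G^Tf,Gb,G\sigma)(t,\lambda)$. (B1) $A(t,\lambda)$ is uniformly Lipschitz in $\lambda$ and $A(\cdot,\lambda)\in\mathcal H^2$ on $[0,T]$ for each $\lambda$; $\Phi(x)$ is uniformly Lipschitz in $x$ and $\Phi(x)\in L^2(\Omega,\mathcal F_T,P;\mathbb R)$ for each $x$. (B2) For all $t,\lambda,\bar\lambda$ with $\hat x=x-\bar x$, $\hat y=y-\bar y$, $\hat z=z-\bar z$: (i) $\langle A(t,\lambda)-A(t,\bar\lambda),\lambda-\bar\lambda\rangle\le-\beta_1|G\hat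 x|^2-\beta_2(|G^T\hat y|^2+|G^T\hat z|^2)$; (ii) $\langle\Phi(x)-\Phi(\bar x),G\hat x\rangle\ge\mu_1|G\hat x|^2$; where $\beta_1,\beta_2,\mu_1\ge0$, $\beta_1+\beta_2>0$, $\beta_2+\mu_1>0$, and $\beta_2>0$ if $n>1$. (C1) There is $K\ge0$ such that $P$-a.s. for all $t$ and all arguments $|l(t,x,y,z)-l(t,x',y',z')|\le K(|x-x'|+|y-y'|+|z-z'|)$ for $l=b,\sigma,f$, and $|\Phi(x)-\Phi(x')|\le K|x-x'|$. (C2) There is $L\ge0$ such that $P$-a.s. for all $t,x,y,z$: $|b(t,x,y,z)|+|\sigma(t,x,y,z)|+|f(t,x,y,z)|+|\Phi(x)|\le L(1+|x|+|y|+|z|)$. $(X^{t,\zeta},Y^{t,\zeta},Z^{t,\zeta})\in\mathcal S^2(t,T;\mathbb R^n)\times\mathcal S^2(t,T;\mathbb R)\times\mathcal H^2(t,T;\mathbb R^d)$ denotes the solution (known to exist uniquely under (B1), (B2)) of $dX_s=b(s,X_s,Y_s,Z_s)ds+\sigma(s,X_s,Y_s,Z_s)dB_s$, $dY_s=-f(s,X_s,Y_s,Z_s)ds+Z_sdB_s$, $s\in[t,T]$, $X_t=\zeta$, $Y_T=\Phi(X_T)$. The constant $C$ does not depend on $t,\zeta,\zeta',\delta$. *)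

theory Defs
  imports "HOL-Probability.Probability"
begin

section \<open>Classical Wiener space\<close>

text \<open>Paths are functions on the whole real line; \<^const>\<open>extensional\<close> makes them determined by
  their restriction to \<open>[0,T]\<close>.\<close>

definition wiener_paths :: "real \<Rightarrow> (real \<Rightarrow> real ^ 'd) set" where
  "wiener_paths T = {w \<in> extensional {0..T}. continuous_on {0..T} w \<and> w 0 = 0}"

text \<open>The Wiener measure lives on the \<open>\<sigma>\<close>-algebra generated by the coordinates, which is the Borel
  \<open>\<sigma>\<close>-algebra of the path space; it makes the coordinate process \<open>(\<omega>, s) \<mapsto> \<omega> s\<close> a standard
  Brownian motion: along every partition, all components of all increments are independent centred
  Gaussians whose variance is the length of the time step.\<close>

definition wiener_measure :: "real \<Rightarrow> (real \<Rightarrow> real ^ 'd) measure \<Rightarrow> bool" where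
  "wiener_measure T W \<longleftrightarrow>
     prob_space W \<and>
     space W = wiener_paths T \<and>
     sets W = sets (restrict_space (PiM {0..T} (\<lambda>_. borel)) (wiener_paths T)) \<and>
     (\<forall>r s i. 0 \<le> r \<and> r < s \<and> s \<le> T \<longrightarrow>
        distributed W lborel (\<lambda>\<omega>. (\<omega> s - \<omega> r) $ i) (\<lambda>x. ennreal (normal_density 0 (sqrt (s - r)) x))) \<and>
     (\<forall>(m::nat) \<tau>. strict_mono_on {..m} \<tau> \<and> \<tau> ` {..m} \<subseteq> {0..T} \<longrightarrow>
        prob_space.indep_vars W (\<lambda>_. borel) (\<lambda>(k, i) \<omega>. (\<omega> (\<tau> (Suc k)) - \<omega> (\<tau> k)) $ i)
          ({..<m} \<times> (UNIV :: 'd set)))"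

text \<open>Natural filtration of the coordinate process, augmented by the null sets of the completed
  measure. Only times \<open>s \<in> [0,T]\<close> are meaningful.\<close>

definition aug_filtration ::
  "(real \<Rightarrow> real ^ 'd) measure \<Rightarrow> real \<Rightarrow> (real \<Rightarrow> real ^ 'd) measure" where
  "aug_filtration W s = sigma (space W)
     ({(\<lambda>\<omega>. \<omega> r) -` A \<inter> space W | r A. r \<in> {0..s} \<and> A \<in> sets borel} \<union> null_sets (completion W))"


section \<open>Spaces of random variables and processes\<close>

text \<open>Processes are functions of the sample point and the time; only their values at times of the
  relevant interval matter.\<close>

definition L2 :: "'w measure \<Rightarrow> 'w measure \<Rightarrow> ('w \<Rightarrow> 'a::real_normed_vector) set" where
  "L2 M N = {\<xi> \<in> borel_measurable N. integrable M (\<lambda>\<omega>. (norm (\<xi> \<omega>))\<^sup>2)}"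

definition progressive ::
  "(real \<Rightarrow> 'w measure) \<Rightarrow> real \<Rightarrow> real \<Rightarrow> ('w \<Rightarrow> real \<Rightarrow> 'a::topological_space) \<Rightarrow> bool" where
  "progressive F t T \<phi> \<longleftrightarrow>
     (\<forall>s\<in>{t..T}. (\<lambda>(r, \<omega>). \<phi> \<omega> r) \<in> borel_measurable (restrict_space borel {t..s} \<Otimes>\<^sub>M F s))"

definition S2 ::
  "'w measure \<Rightarrow> (real \<Rightarrow> 'w measure) \<Rightarrow> real \<Rightarrow> real \<Rightarrow> ('w \<Rightarrow> real \<Rightarrow> 'a::real_normed_vector) set" where
  "S2 M F t T = {X.
     (\<forall>s\<in>{t..T}. (\<lambda>\<omega>. X \<omega> s) \<in> borel_measurable (F s)) \<and>
     (\<forall>\<omega>\<in>space M. continuous_on {t..T} (X \<omega>)) \<and>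
     integrable M (\<lambda>\<omega>. (SUP s\<in>{t..T}. norm (X \<omega> s))\<^sup>2)}"

definition H2 ::
  "'w measure \<Rightarrow> (real \<Rightarrow> 'w measure) \<Rightarrow> real \<Rightarrow> real \<Rightarrow> ('w \<Rightarrow> real \<Rightarrow> 'a::real_normed_vector) set" where
  "H2 M F t T = {\<phi>. progressive F t T \<phi> \<and>
     integrable (restrict_space lborel {t..T} \<Otimes>\<^sub>M M) (\<lambda>(r, \<omega>). (norm (\<phi> \<omega> r))\<^sup>2)}"


section \<open>The It\^o integral\<close>

definition simple_integrand ::
  "(real \<Rightarrow> 'w measure) \<Rightarrow> real \<Rightarrow> real \<Rightarrow> nat \<Rightarrow> (nat \<Rightarrow> real) \<Rightarrow> (nat \<Rightarrow> 'w \<Rightarrow> real ^ 'd) \<Rightarrow> bool" where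
  "simple_integrand F t T m \<tau> \<xi> \<longleftrightarrow>
     mono_on {..m} \<tau> \<and> \<tau> ` {..m} \<subseteq> {t..T} \<and>
     (\<forall>i<m. \<xi> i \<in> borel_measurable (F (\<tau> i)) \<and> bounded (\<xi> i ` space (F (\<tau> i))))"

definition simple_process ::
  "nat \<Rightarrow> (nat \<Rightarrow> real) \<Rightarrow> (nat \<Rightarrow> 'w \<Rightarrow> real ^ 'd) \<Rightarrow> 'w \<Rightarrow> real \<Rightarrow> real ^ 'd" where
  "simple_process m \<tau> \<xi> \<omega> r = (\<Sum>i<m. indicat_real {\<tau> i<..\<tau> (Suc i)} r *\<^sub>R \<xi> i \<omega>)"

definition simple_ito ::
  "('w \<Rightarrow> real \<Rightarrow> real ^ 'd) \<Rightarrow> nat \<Rightarrow> (nat \<Rightarrow> real) \<Rightarrow> (nat \<Rightarrow> 'w \<Rightarrow> real ^ 'd) \<Rightarrow> 'w \<Rightarrow> real \<Rightarrow> real" where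
  "simple_ito B m \<tau> \<xi> \<omega> s =
     (\<Sum>i<m. \<xi> i \<omega> \<bullet> (B \<omega> (min s (\<tau> (Suc i))) - B \<omega> (min s (\<tau> i))))"

text \<open>\<open>I\<close> is a continuous version of the process \<open>s \<mapsto> \<integral>\<^sub>t\<^sup>s \<phi> dB\<close> on \<open>[t,T]\<close>: the \<open>L\<^sup>2\<close>-limit of the
  integrals of simple processes converging to \<open>\<phi>\<close> in \<open>L\<^sup>2(ds \<otimes> dP)\<close>. By the It\^o isometry this
  determines \<open>I\<close> up to indistinguishability, whatever the approximating sequence.\<close>

definition has_ito_integral ::
  "'w measure \<Rightarrow> (real \<Rightarrow> 'w measure) \<Rightarrow> ('w \<Rightarrow> real \<Rightarrow> real ^ 'd) \<Rightarrow> real \<Rightarrow> real \<Rightarrow>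
   ('w \<Rightarrow> real \<Rightarrow> real ^ 'd) \<Rightarrow> ('w \<Rightarrow> real \<Rightarrow> real) \<Rightarrow> bool" where
  "has_ito_integral M F B t T \<phi> I \<longleftrightarrow>
     \<phi> \<in> H2 M F t T \<and> I \<in> S2 M F t T \<and>
     (\<exists>m \<tau> \<xi>. (\<forall>k. simple_integrand F t T (m k) (\<tau> k) (\<xi> k)) \<and>
        (\<lambda>k. \<integral>\<^sup>+(r, \<omega>). ennreal ((norm (\<phi> \<omega> r - simple_process (m k) (\<tau> k) (\<xi> k) \<omega> r))\<^sup>2)
               \<partial>(restrict_space lborel {t..T} \<Otimes>\<^sub>M M)) \<longlonglongrightarrow> 0 \<and>
        (\<forall>s\<in>{t..T}. (\<lambda>k. \<integral>\<^sup>+\<omega>. ennreal ((I \<omega> s - simple_ito B (m k) (\<tau> k) (\<xi> k) \<omega> s)\<^sup>2) \<partial>M)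
               \<longlonglongrightarrow> 0))"


section \<open>Fully coupled forward-backward equations\<close>

text \<open>The row vector \<open>Z\<close> is represented by an element of \<^typ>\<open>real ^ 'd\<close>. The process \<open>\<Sigma>\<close> stands for
  \<open>\<sigma>(s, X\<^sub>s, Y\<^sub>s, Z\<^sub>s)\<close>: as \<open>\<sigma>\<close> is Lipschitz only outside a null set, this composition is in general
  progressively measurable only up to indistinguishability.\<close>

definition fbsde_solution ::
  "'w measure \<Rightarrow> (real \<Rightarrow> 'w measure) \<Rightarrow> ('w \<Rightarrow> real \<Rightarrow> real ^ 'd) \<Rightarrow> real \<Rightarrow>
   ('w \<Rightarrow> real \<Rightarrow> real ^ 'n \<Rightarrow> real \<Rightarrow> real ^ 'd \<Rightarrow> real ^ 'n) \<Rightarrow>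
   ('w \<Rightarrow> real \<Rightarrow> real ^ 'n \<Rightarrow> real \<Rightarrow> real ^ 'd \<Rightarrow> real ^ 'd ^ 'n) \<Rightarrow>
   ('w \<Rightarrow> real \<Rightarrow> real ^ 'n \<Rightarrow> real \<Rightarrow> real ^ 'd \<Rightarrow> real) \<Rightarrow>
   ('w \<Rightarrow> real ^ 'n \<Rightarrow> real) \<Rightarrow> real \<Rightarrow> ('w \<Rightarrow> real ^ 'n) \<Rightarrow>
   ('w \<Rightarrow> real \<Rightarrow> real ^ 'n) \<Rightarrow> ('w \<Rightarrow> real \<Rightarrow> real) \<Rightarrow> ('w \<Rightarrow> real \<Rightarrow> real ^ 'd) \<Rightarrow> bool" where
  "fbsde_solution M F B T b \<sigma> f \<Phi> t \<zeta> X Y Z \<longleftrightarrow>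
     X \<in> S2 M F t T \<and> Y \<in> S2 M F t T \<and> Z \<in> H2 M F t T \<and>
     (\<exists>\<Sigma> I J.
        (AE \<omega> in M. \<forall>s\<in>{t..T}. \<Sigma> \<omega> s = \<sigma> \<omega> s (X \<omega> s) (Y \<omega> s) (Z \<omega> s)) \<and>
        (\<forall>i. has_ito_integral M F B t T (\<lambda>\<omega> s. \<Sigma> \<omega> s $ i) (\<lambda>\<omega> s. I \<omega> s $ i)) \<and>
        has_ito_integral M F B t T Z J \<and>
        (AE \<omega> in M. X \<omega> t = \<zeta> \<omega> \<and> Y \<omega> T = \<Phi> \<omega> (X \<omega> T) \<and>
           (\<forall>s\<in>{t..T}.
              X \<omega> s = X \<omega> t + (LINT r:{t..s}|lborel. b \<omega> r (X \<omega> r) (Y \<omega> r) (Z \<omega> r)) + I \<omega> s \<and>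
              Y \<omega> s = Y \<omega> t - (LINT r:{t..s}|lborel. f \<omega> r (X \<omega> r) (Y \<omega> r) (Z \<omega> r)) + J \<omega> s)))"

text \<open>\<open>A(t, \<lambda>) = (- G\<^sup>T f, G b, G \<sigma>)(t, \<lambda>)\<close>. Scalars are turned into \<open>1\<close>-vectors and row vectors into
  \<open>1 \<times> d\<close> matrices by \<^const>\<open>vec\<close>, and back by selecting the only entry or row.\<close>

definition fbsde_A ::
  "real ^ 'n ^ 1 \<Rightarrow>
   ('w \<Rightarrow> real \<Rightarrow> real ^ 'n \<Rightarrow> real \<Rightarrow> real ^ 'd \<Rightarrow> real ^ 'n) \<Rightarrow>
   ('w \<Rightarrow> real \<Rightarrow> real ^ 'n \<Rightarrow> real \<Rightarrow> real ^ 'd \<Rightarrow> real ^ 'd ^ 'n) \<Rightarrow>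
   ('w \<Rightarrow> real \<Rightarrow> real ^ 'n \<Rightarrow> real \<Rightarrow> real ^ 'd \<Rightarrow> real) \<Rightarrow>
   'w \<Rightarrow> real \<Rightarrow> (real ^ 'n) \<times> real \<times> (real ^ 'd) \<Rightarrow> (real ^ 'n) \<times> real \<times> (real ^ 'd)" where
  "fbsde_A G b \<sigma> f \<omega> t = (\<lambda>(x, y, z).
     (- (transpose G *v vec (f \<omega> t x y z)), (G *v b \<omega> t x y z) $ 1, (G ** \<sigma> \<omega> t x y z) $ 1))"

definition fbsde_measurable ::
  "(real \<Rightarrow> 'w measure) \<Rightarrow> real \<Rightarrow>
   ('w \<Rightarrow> real \<Rightarrow> real ^ 'n \<Rightarrow> real \<Rightarrow> real ^ 'd \<Rightarrow> real ^ 'n) \<Rightarrow>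
   ('w \<Rightarrow> real \<Rightarrow> real ^ 'n \<Rightarrow> real \<Rightarrow> real ^ 'd \<Rightarrow> real ^ 'd ^ 'n) \<Rightarrow>
   ('w \<Rightarrow> real \<Rightarrow> real ^ 'n \<Rightarrow> real \<Rightarrow> real ^ 'd \<Rightarrow> real) \<Rightarrow>
   ('w \<Rightarrow> real ^ 'n \<Rightarrow> real) \<Rightarrow> bool" where
  "fbsde_measurable F T b \<sigma> f \<Phi> \<longleftrightarrow>
     (\<forall>x y z. progressive F 0 T (\<lambda>\<omega> s. b \<omega> s x y z) \<and>
              progressive F 0 T (\<lambda>\<omega> s. \<sigma> \<omega> s x y z) \<and>
              progressive F 0 T (\<lambda>\<omega> s. f \<omega> s x y z)) \<and>
     (\<forall>x. (\<lambda>\<omega>. \<Phi> \<omega> x) \<in> borel_measurable (F T))"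

definition cond_B1 ::
  "'w measure \<Rightarrow> (real \<Rightarrow> 'w measure) \<Rightarrow> real \<Rightarrow> real ^ 'n ^ 1 \<Rightarrow>
   ('w \<Rightarrow> real \<Rightarrow> real ^ 'n \<Rightarrow> real \<Rightarrow> real ^ 'd \<Rightarrow> real ^ 'n) \<Rightarrow>
   ('w \<Rightarrow> real \<Rightarrow> real ^ 'n \<Rightarrow> real \<Rightarrow> real ^ 'd \<Rightarrow> real ^ 'd ^ 'n) \<Rightarrow>
   ('w \<Rightarrow> real \<Rightarrow> real ^ 'n \<Rightarrow> real \<Rightarrow> real ^ 'd \<Rightarrow> real) \<Rightarrow>
   ('w \<Rightarrow> real ^ 'n \<Rightarrow> real) \<Rightarrow> bool" where
  "cond_B1 M F T G b \<sigma> f \<Phi> \<longleftrightarrow>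
     (\<exists>c\<ge>0. AE \<omega> in M. \<forall>t\<in>{0..T}. \<forall>u v.
        norm (fbsde_A G b \<sigma> f \<omega> t u - fbsde_A G b \<sigma> f \<omega> t v) \<le> c * norm (u - v)) \<and>
     (\<forall>u. (\<lambda>\<omega> t. fbsde_A G b \<sigma> f \<omega> t u) \<in> H2 M F 0 T) \<and>
     (\<exists>c\<ge>0. AE \<omega> in M. \<forall>x x'. \<bar>\<Phi> \<omega> x - \<Phi> \<omega> x'\<bar> \<le> c * norm (x - x')) \<and>
     (\<forall>x. (\<lambda>\<omega>. \<Phi> \<omega> x) \<in> L2 M (F T))"

text \<open>The norm on \<^typ>\<open>real ^ 'd ^ 'n\<close> is the Frobenius norm.\<close>

definition cond_B2 ::
  "'w measure \<Rightarrow> real \<Rightarrow> real ^ 'n ^ 1 \<Rightarrow>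
   ('w \<Rightarrow> real \<Rightarrow> real ^ 'n \<Rightarrow> real \<Rightarrow> real ^ 'd \<Rightarrow> real ^ 'n) \<Rightarrow>
   ('w \<Rightarrow> real \<Rightarrow> real ^ 'n \<Rightarrow> real \<Rightarrow> real ^ 'd \<Rightarrow> real ^ 'd ^ 'n) \<Rightarrow>
   ('w \<Rightarrow> real \<Rightarrow> real ^ 'n \<Rightarrow> real \<Rightarrow> real ^ 'd \<Rightarrow> real) \<Rightarrow>
   ('w \<Rightarrow> real ^ 'n \<Rightarrow> real) \<Rightarrow> real \<Rightarrow> real \<Rightarrow> real \<Rightarrow> bool" where
  "cond_B2 M T G b \<sigma> f \<Phi> \<beta>1 \<beta>2 \<mu>1 \<longleftrightarrow>
     \<beta>1 \<ge> 0 \<and> \<beta>2 \<ge> 0 \<and> \<mu>1 \<ge> 0 \<and> \<beta>1 + \<beta>2 > 0 \<and> \<beta>2 + \<mu>1 > 0 \<and> (CARD('n) > 1 \<longrightarrow> \<beta>2 > 0) \<and>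
     (AE \<omega> in M. \<forall>t\<in>{0..T}. \<forall>x y z x' y' z'.
        (fbsde_A G b \<sigma> f \<omega> t (x, y, z) - fbsde_A G b \<sigma> f \<omega> t (x', y', z')) \<bullet> ((x, y, z) - (x', y', z'))
        \<le> - \<beta>1 * (norm (G *v (x - x')))\<^sup>2
          - \<beta>2 * ((norm (transpose G *v vec (y - y')))\<^sup>2
                   + (norm (transpose G ** (vec (z - z') :: real ^ 'd ^ 1)))\<^sup>2)) \<and>
     (AE \<omega> in M. \<forall>x x'.
        (\<Phi> \<omega> x - \<Phi> \<omega> x') * (G *v (x - x')) $ 1 \<ge> \<mu>1 * (norm (G *v (x - x')))\<^sup>2)"

definition cond_C1 ::
  "'w measure \<Rightarrow> real \<Rightarrow>
   ('w \<Rightarrow> real \<Rightarrow> real ^ 'n \<Rightarrow> real \<Rightarrow> real ^ 'd \<Rightarrow> real ^ 'n) \<Rightarrow>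
   ('w \<Rightarrow> real \<Rightarrow> real ^ 'n \<Rightarrow> real \<Rightarrow> real ^ 'd \<Rightarrow> real ^ 'd ^ 'n) \<Rightarrow>
   ('w \<Rightarrow> real \<Rightarrow> real ^ 'n \<Rightarrow> real \<Rightarrow> real ^ 'd \<Rightarrow> real) \<Rightarrow>
   ('w \<Rightarrow> real ^ 'n \<Rightarrow> real) \<Rightarrow> real \<Rightarrow> bool" where
  "cond_C1 M T b \<sigma> f \<Phi> K \<longleftrightarrow> K \<ge> 0 \<and>
     (AE \<omega> in M. \<forall>t\<in>{0..T}. \<forall>x y z x' y' z'.
        norm (b \<omega> t x y z - b \<omega> t x' y' z') \<le> K * (norm (x - x') + \<bar>y - y'\<bar> + norm (z - z')) \<and>
        norm (\<sigma> \<omega> t x y z - \<sigma> \<omega> t x' y' z') \<le> K * (norm (x - x') + \<bar>y - y'\<bar> + norm (z - z')) \<and>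
        \<bar>f \<omega> t x y z - f \<omega> t x' y' z'\<bar> \<le> K * (norm (x - x') + \<bar>y - y'\<bar> + norm (z - z')) \<and>
        \<bar>\<Phi> \<omega> x - \<Phi> \<omega> x'\<bar> \<le> K * norm (x - x'))"

definition cond_C2 ::
  "'w measure \<Rightarrow> real \<Rightarrow>
   ('w \<Rightarrow> real \<Rightarrow> real ^ 'n \<Rightarrow> real \<Rightarrow> real ^ 'd \<Rightarrow> real ^ 'n) \<Rightarrow>
   ('w \<Rightarrow> real \<Rightarrow> real ^ 'n \<Rightarrow> real \<Rightarrow> real ^ 'd \<Rightarrow> real ^ 'd ^ 'n) \<Rightarrow>
   ('w \<Rightarrow> real \<Rightarrow> real ^ 'n \<Rightarrow> real \<Rightarrow> real ^ 'd \<Rightarrow> real) \<Rightarrow>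
   ('w \<Rightarrow> real ^ 'n \<Rightarrow> real) \<Rightarrow> real \<Rightarrow> bool" where
  "cond_C2 M T b \<sigma> f \<Phi> L \<longleftrightarrow> L \<ge> 0 \<and>
     (AE \<omega> in M. \<forall>t\<in>{0..T}. \<forall>x y z.
        norm (b \<omega> t x y z) + norm (\<sigma> \<omega> t x y z) + \<bar>f \<omega> t x y z\<bar> + \<bar>\<Phi> \<omega> x\<bar>
        \<le> L * (1 + norm x + \<bar>y\<bar> + norm z))"

definition cond_C3 ::
  "'w measure \<Rightarrow> real \<Rightarrow>
   ('w \<Rightarrow> real \<Rightarrow> real ^ 'n \<Rightarrow> real \<Rightarrow> real ^ 'd \<Rightarrow> real ^ 'd ^ 'n) \<Rightarrow> real \<Rightarrow> bool" where
  "cond_C3 M T \<sigma> L \<longleftrightarrow>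
     (AE \<omega> in M. \<forall>t\<in>{0..T}. \<forall>x y z. norm (\<sigma> \<omega> t x y z) \<le> L * (1 + norm x + \<bar>y\<bar>))"

end

theory Submission
  imports Defs
begin

text \<open>The conditional expectations are never computed. Every estimate is proved in the form
\<open>E[1\<^sub>A U] \<le> E[1\<^sub>A V]\<close> for all \<open>A \<in> F t\<close>, where \<open>U\<close> collects the suprema and the time integral and
\<open>V\<close> is the \<open>F t\<close>-measurable right-hand side; \<open>real_cond_exp_le_of_set_integrals_le\<close> turns this into
\<open>E[U | F t] \<le> V\<close> almost surely. As \<open>A\<close> belongs to the initial \<open>\<sigma>\<close>-algebra, multiplying by its
indicator respects adaptedness and martingale properties on \<open>[t,T]\<close>, so the usual \<open>L\<^sup>2\<close> theory applies
verbatim.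

  Parts (i) and (ii) are two instances of one a priori estimate, \<open>a_priori_estimate\<close>. It concerns
processes \<open>x\<close>, \<open>y\<close>, \<open>z\<close> in a forward-backward system whose drift, diffusion and generator are bounded by \<open>K (|x| + |y| + |z| + k)\<close>,
with \<open>|y\<^sub>T| \<le> K (|x\<^sub>T| + k)\<close>, and for which the monotonicity condition holds up to an error that is linear
in \<open>k\<close>; it bounds them by \<open>C (E[1\<^sub>A |x\<^sub>t|\<^sup>2] + k\<^sup>2 P(A))\<close>. The difference of two solutions is such a system
with \<open>k = 0\<close>, by the Lipschitz condition, and a single solution is one with \<open>k = 1\<close>, by linear growth and
comparison with the zero state.

  The estimate itself rests on the product rule applied to three products. For \<open>|x|\<^sup>2\<close>, a forward Gronwall
argument bounds \<open>x\<close> by its initial value and by \<open>y\<close>, \<open>z\<close> (\<open>forward_estimate\<close>). For \<open>y\<^sup>2\<close>, a backward one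
bounds \<open>y\<close>, \<open>z\<close> by \<open>x\<close> (\<open>backward_estimate\<close>). Since the equations are fully coupled, these two alone are
circular; the circle is broken by the product \<open>(G x) y\<close>, whose drift is the monotone expression
(\<open>monotone_estimate\<close>). If \<open>\<beta>\<^sub>2 > 0\<close> it controls \<open>y\<close> and \<open>z\<close>. Otherwise \<open>n = 1\<close> and \<open>\<beta>\<^sub>1, \<mu>\<^sub>1 > 0\<close>, so that
\<open>G x\<close> controls \<open>x\<close>. In both cases the price is a small multiple of the total energy, which is absorbed
(\<open>energy_estimate\<close>). Doob's inequality (\<open>doob_maximal\<close>) finally passes from these moments to suprema.

  Stochastic calculus enters only in expectation. The product rule \<open>ito_product_rule\<close> follows from the It\^o
isometry, the martingale property of the It\^o integral and Fubini's theorem; Doob's inequality comes from a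
deterministic inequality for sequences, \<open>doob_pathwise\<close>. The locale \<open>brownian_filtration\<close> collects the
properties of Brownian motion behind these facts, and \<open>wiener_brownian_filtration\<close> derives them for the
Wiener measure.

  For part (iii), the squared displacement of \<open>X\<close> on \<open>[t,t+\<delta>]\<close> is controlled in expectation by \<open>\<delta>\<close> times the
energy of the drift and by the integral of \<open>|\<sigma>|\<^sup>2\<close> over \<open>[t,t+\<delta>]\<close>. Under (C3), \<open>|\<sigma>|\<^sup>2\<close> is bounded by the suprema of \<open>|X|\<^sup>2\<close> and \<open>|Y|\<^sup>2\<close>, whose
integral over an interval of length \<open>\<delta>\<close> gains the factor \<open>\<delta>\<close>; the process \<open>Z\<close>, which is controlled only
after integration over all of \<open>[t,T]\<close>, does not occur in it (\<open>small_time_estimate\<close>).\<close>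

section \<open>Real analysis: suprema over intervals, Gronwall, Doob and Fubini\<close>

text \<open>Composing with a simple function \<open>L\<close> means selecting one of finitely many measurable functions;
  the general case is the pointwise limit, by continuity in the second argument.\<close>

lemma caratheodory_measurable:
  fixes g :: "'a \<Rightarrow> 'b::{metric_space, second_countable_topology} \<Rightarrow> 'c::metric_space"
  assumes meas: "\<And>l. (\<lambda>x. g x l) \<in> borel_measurable N"
    and cont: "\<And>x. x \<in> space N \<Longrightarrow> continuous_on UNIV (g x)"
    and L: "L \<in> borel_measurable N"
  shows "(\<lambda>x. g x (L x)) \<in> borel_measurable N"
proof -
  obtain S where S: "\<And>i. simple_function N (S i)" "\<And>x. x \<in> space N \<Longrightarrow> (\<lambda>i. S i x) \<longlonglongrightarrow> L x"
    using borel_measurable_implies_sequence_metric[OF L, of undefined] by blast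
  show ?thesis
  proof (rule borel_measurable_LIMSEQ_metric)
    fix i
    have fin: "finite (S i ` space N)" using S(1)[of i] by (simp add: simple_function_def)
    have "S i \<in> measurable N (count_space (S i ` space N))"
      unfolding measurable_count_space_eq2[OF fin] using S(1)[of i] by (simp add: simple_function_def)
    then show "(\<lambda>x. g x (S i x)) \<in> borel_measurable N"
      by (rule measurable_compose_countable'[where f = "\<lambda>l x. g x l", OF meas _ countable_finite[OF fin]])
  next
    fix x assume x: "x \<in> space N"
    have "isCont (g x) (L x)" using cont[OF x] by (simp add: continuous_on_eq_continuous_at)
    then show "(\<lambda>i. g x (S i x)) \<longlonglongrightarrow> g x (L x)"
      using isCont_tendsto_compose S(2)[OF x] by blast
  qed
qed

lemma SUP_interval_attained:
  fixes g :: "real \<Rightarrow> real"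
  assumes "continuous_on {a..b} g" "a \<le> b"
  shows "\<exists>s\<in>{a..b}. (\<forall>r\<in>{a..b}. g r \<le> g s) \<and> (SUP r\<in>{a..b}. g r) = g s"
proof -
  obtain s where s: "s \<in> {a..b}" "\<forall>r\<in>{a..b}. g r \<le> g s"
    using continuous_attains_sup[of "{a..b}" g] assms by auto
  moreover have "(SUP r\<in>{a..b}. g r) = g s"
    using s by (intro cSup_eq_maximum) auto
  ultimately show ?thesis by blast
qed

lemma SUP_interval_upper:
  fixes g :: "real \<Rightarrow> real"
  assumes "continuous_on {a..b} g" "s \<in> {a..b}"
  shows "g s \<le> (SUP r\<in>{a..b}. g r)"
proof -
  have "a \<le> b" using assms(2) by auto
  then show ?thesis using SUP_interval_attained[OF assms(1)] assms(2) by auto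
qed

lemma SUP_interval_power2:
  fixes g :: "real \<Rightarrow> 'a::real_normed_vector"
  assumes "continuous_on {a..b} g" "a \<le> b"
  shows "(SUP r\<in>{a..b}. norm (g r))\<^sup>2 = (SUP r\<in>{a..b}. (norm (g r))\<^sup>2)"
proof -
  have c: "continuous_on {a..b} (\<lambda>r. norm (g r))"
    by (intro continuous_intros assms)
  obtain s where s: "s \<in> {a..b}" "\<And>r. r \<in> {a..b} \<Longrightarrow> norm (g r) \<le> norm (g s)"
     "(SUP r\<in>{a..b}. norm (g r)) = norm (g s)"
    using SUP_interval_attained[OF c assms(2)] by blast
  have "(SUP r\<in>{a..b}. (norm (g r))\<^sup>2) = (norm (g s))\<^sup>2"
    using s by (intro cSup_eq_maximum) (auto intro!: power_mono)
  with s show ?thesis by simp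
qed

text \<open>The maximum over an equidistant grid. It makes the supremum of a continuous function a limit of maxima
  over finitely many points, which is how both the measurability of suprema and Doob's inequality are reached.\<close>

definition grid_max :: "real \<Rightarrow> real \<Rightarrow> nat \<Rightarrow> (real \<Rightarrow> real) \<Rightarrow> real" where
  "grid_max a b n g = (MAX k\<in>{..n}. g (a + (b - a) * real k / real n))"

lemma grid_point_in:
  assumes "a \<le> b" "k \<le> n"
  shows "a + (b - a) * real k / real n \<in> {a..b}"
proof -
  have "real k / real n \<le> 1" using assms(2) by (simp add: divide_le_eq)
  then have "(b - a) * (real k / real n) \<le> (b - a) * 1" using assms(1) by (intro mult_left_mono) auto
  then show ?thesis using assms by (auto simp: zero_le_mult_iff)
qed

text \<open>The grid points just below a point where the maximum is attained converge to it.\<close>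

lemma grid_max_tendsto_SUP:
  fixes g :: "real \<Rightarrow> real"
  assumes c: "continuous_on {a..b} g" and ab: "a \<le> b"
  shows "(\<lambda>n. grid_max a b n g) \<longlonglongrightarrow> (SUP r\<in>{a..b}. g r)"
proof -
  obtain s where s: "s \<in> {a..b}" "\<And>r. r \<in> {a..b} \<Longrightarrow> g r \<le> g s" "(SUP r\<in>{a..b}. g r) = g s"
    using SUP_interval_attained[OF c ab] by blast
  define th where "th = (if a = b then 0 else (s - a) / (b - a))"
  have th: "0 \<le> th" "th \<le> 1"
    using s(1) ab by (auto simp: th_def)
  have s_eq: "s = a + (b - a) * th"
    using s(1) ab by (simp add: th_def)
  define k where "k n = nat \<lfloor>th * real n\<rfloor>" for n
  have k1: "real (k n) \<le> th * real n" and k2: "th * real n < real (k n) + 1" for n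
    using th by (auto simp: k_def intro!: of_nat_floor)
  have kn: "k n \<le> n" for n
  proof -
    have "th * real n \<le> 1 * real n" by (intro mult_right_mono th) auto
    then show ?thesis using k1[of n] by linarith
  qed
  have "(\<lambda>n. real (k n) / real n) \<longlonglongrightarrow> th"
  proof (rule real_tendsto_sandwich)
    show "\<forall>\<^sub>F n in sequentially. th - 1 / real n \<le> real (k n) / real n"
    proof (intro eventually_sequentiallyI[of 1])
      fix n :: nat assume n: "1 \<le> n"
      have "th * real n - 1 \<le> real (k n)" using k2[of n] by linarith
      then have "(th * real n - 1) / real n \<le> real (k n) / real n"
        by (rule divide_right_mono) simp
      moreover have "(th * real n - 1) / real n = th - 1 / real n"
        using n by (simp add: field_simps)
      ultimately show "th - 1 / real n \<le> real (k n) / real n" by simp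
    qed
    show "\<forall>\<^sub>F n in sequentially. real (k n) / real n \<le> th"
      using k1 by (intro eventually_sequentiallyI[of 1]) (auto simp: field_simps)
    have "(\<lambda>n. th - 1 / real n) \<longlonglongrightarrow> th - 0" by (intro tendsto_diff tendsto_const lim_1_over_n)
    then show "(\<lambda>n. th - 1 / real n) \<longlonglongrightarrow> th" by simp
  qed simp
  then have "(\<lambda>n. a + (b - a) * (real (k n) / real n)) \<longlonglongrightarrow> a + (b - a) * th"
    by (intro tendsto_intros)
  then have lim: "(\<lambda>n. a + (b - a) * real (k n) / real n) \<longlonglongrightarrow> s" unfolding s_eq by simp
  have "(\<lambda>n. g (a + (b - a) * real (k n) / real n)) \<longlonglongrightarrow> g s"
    by (rule continuous_on_tendsto_compose[OF c lim s(1)])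
       (rule always_eventually, rule allI, rule grid_point_in[OF ab kn])
  moreover have "g (a + (b - a) * real (k n) / real n) \<le> grid_max a b n g" for n
    unfolding grid_max_def by (rule Max_ge) (use kn in blast)+
  moreover have "grid_max a b n g \<le> g s" for n
    unfolding grid_max_def by (subst Max_le_iff) (use grid_point_in[OF ab] s(2) in blast)+
  ultimately show ?thesis unfolding s(3)
    by (auto intro: tendsto_sandwich[where h = "\<lambda>_. g s"
          and f = "\<lambda>n. g (a + (b - a) * real (k n) / real n)"])
qed

lemma grid_max_power2_nonneg: "0 \<le> grid_max a b n (\<lambda>s. (g s :: real)\<^sup>2)"
proof -
  have "0 \<le> (g (a + (b - a) * real 0 / real n))\<^sup>2" by simp
  also have "\<dots> \<le> grid_max a b n (\<lambda>s. (g s)\<^sup>2)"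
    unfolding grid_max_def by (rule Max_ge) (rule finite_imageI, simp, rule image_eqI[of _ _ 0], simp_all)
  finally show ?thesis .
qed

lemma borel_measurable_grid_max:
  assumes "\<And>r. r \<in> {a..b} \<Longrightarrow> (\<lambda>x. g x r) \<in> borel_measurable N" "a \<le> b"
  shows "(\<lambda>x. grid_max a b n (g x)) \<in> borel_measurable N"
  unfolding grid_max_def using grid_point_in[OF assms(2)]
  by (intro borel_measurable_Max assms(1)) auto

lemma borel_measurable_SUP_interval:
  fixes g :: "'a \<Rightarrow> real \<Rightarrow> real"
  assumes "\<And>r. r \<in> {a..b} \<Longrightarrow> (\<lambda>x. g x r) \<in> borel_measurable N"
    "\<And>x. x \<in> space N \<Longrightarrow> continuous_on {a..b} (g x)" "a \<le> b"
  shows "(\<lambda>x. SUP r\<in>{a..b}. g x r) \<in> borel_measurable N"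
  by (rule borel_measurable_LIMSEQ_real[where u = "\<lambda>n x. grid_max a b n (g x)"])
     (auto intro!: grid_max_tendsto_SUP borel_measurable_grid_max assms)

text \<open>The function \<open>r \<mapsto> exp (- C r) (R + C \<integral>\<^sub>a\<^sup>r u)\<close> is decreasing.\<close>

lemma gronwall_forward:
  fixes u :: "real \<Rightarrow> real"
  assumes u: "continuous_on {a..b} u" and C: "0 \<le> C"
    and le: "\<And>s. s \<in> {a..b} \<Longrightarrow> u s \<le> R + C * integral {a..s} u"
    and s: "s \<in> {a..b}"
  shows "u s \<le> R * exp (C * (s - a))"
proof -
  define h where "h s = integral {a..s} u" for s
  have d: "(h has_real_derivative u r) (at r within {a..b})" if "r \<in> {a..b}" for r
    unfolding h_def using integral_has_real_derivative[OF u that] .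
  define w where "w r = exp (- C * r) * (R + C * h r)" for r
  have wd: "(w has_real_derivative exp (- C * r) * (C * u r) - C * exp (- C * r) * (R + C * h r)) (at r within {a..b})"
    if "r \<in> {a..b}" for r
    unfolding w_def by (auto intro!: derivative_eq_intros d that)
  have "w s \<le> w a"
  proof (rule DERIV_nonpos_imp_decreasing_open[where f = w])
    show "a \<le> s" using s by auto
    have "continuous_on {a..b} w" by (rule DERIV_continuous_on) (rule wd)
    then show "continuous_on {a..s} w" by (rule continuous_on_subset) (use s in auto)
    fix r assume r: "a < r" "r < s"
    then have "r \<in> {a<..<b}" using s by auto
    then have "(w has_real_derivative exp (- C * r) * (C * u r) - C * exp (- C * r) * (R + C * h r)) (at r)"
      using wd[of r] at_within_interior[of r "{a..b}"] by auto
    moreover have "exp (- C * r) * (C * u r) \<le> exp (- C * r) * (C * (R + C * h r))"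
      using le[of r] r s C unfolding h_def by (intro mult_left_mono) auto
    ultimately show "\<exists>y. (w has_real_derivative y) (at r) \<and> y \<le> 0"
      by (intro exI conjI) (auto simp: algebra_simps)
  qed
  also have "w a = exp (- C * a) * R" by (simp add: w_def h_def)
  finally have "exp (C * s) * w s \<le> exp (C * s) * (exp (- C * a) * R)"
    by (intro mult_left_mono) auto
  moreover have "exp (C * s) * w s = R + C * h s"
    by (simp add: w_def exp_minus)
  moreover have "exp (C * s) * exp (- C * a) = exp (C * (s - a))"
    by (simp add: mult_exp_exp right_diff_distrib)
  ultimately have "R + C * h s \<le> R * exp (C * (s - a))"
    by (metis mult.assoc mult.commute)
  then show ?thesis using le[OF s] by (simp add: h_def)
qed

text \<open>The forward version under time reversal.\<close>

lemma gronwall_backward: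
  fixes u :: "real \<Rightarrow> real"
  assumes u: "continuous_on {a..b} u" and C: "0 \<le> C"
    and le: "\<And>s. s \<in> {a..b} \<Longrightarrow> u s \<le> R + C * integral {s..b} u"
    and s: "s \<in> {a..b}"
  shows "u s \<le> R * exp (C * (b - s))"
proof -
  have "u (- (- s)) \<le> R * exp (C * ((- s) - (- b)))"
  proof (rule gronwall_forward[where u = "\<lambda>r. u (- r)" and b = "- a"])
    show "continuous_on {- b..- a} (\<lambda>r. u (- r))"
      by (rule continuous_on_compose2[OF u]) (auto intro!: continuous_intros)
    show "u (- r) \<le> R + C * integral {- b..r} (\<lambda>r. u (- r))" if "r \<in> {-b..-a}" for r
      using le[of "- r"] that Henstock_Kurzweil_Integration.integral_reflect_real[of b "- r" u] by auto
  qed (use C s in auto)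
  then show ?thesis by (simp add: algebra_simps)
qed

text \<open>Doob's inequality before taking expectations: for a nonnegative submartingale \<open>x\<close> the last sum has
  nonnegative expectation, because the running maximum \<open>S k\<close> is known at time \<open>k\<close>. The proof sums the
  inequality \<open>S\<^sub>k (x\<^sub>k\<^sub>+\<^sub>1 - x\<^sub>k) \<le> (S\<^sub>k\<^sub>+\<^sub>1 x\<^sub>k\<^sub>+\<^sub>1 - S\<^sub>k\<^sub>+\<^sub>1\<^sup>2/2) - (S\<^sub>k x\<^sub>k - S\<^sub>k\<^sup>2/2)\<close> and completes the square.\<close>

lemma doob_pathwise:
  fixes x :: "nat \<Rightarrow> real"
  assumes x: "\<And>k. 0 \<le> x k"
  defines "S \<equiv> \<lambda>n. Max (x ` {..n})"
  shows "(S n)\<^sup>2 \<le> 4 * (x n)\<^sup>2 - 4 * (\<Sum>k<n. S k * (x (Suc k) - x k))"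
proof -
  have S_Suc: "S (Suc k) = max (x (Suc k)) (S k)" for k
    unfolding S_def by (simp add: atMost_Suc)
  have S0: "S 0 = x 0" by (simp add: S_def)
  have "(\<Sum>k<n. S k * (x (Suc k) - x k)) \<le> S n * x n - (S n)\<^sup>2 / 2"
  proof (induction n)
    case 0 then show ?case using x[of 0] by (simp add: S0 power2_eq_square)
  next
    case (Suc n)
    have "S n * x (Suc n) - (S n)\<^sup>2 / 2 \<le> S (Suc n) * x (Suc n) - (S (Suc n))\<^sup>2 / 2"
    proof (cases "x (Suc n) \<le> S n")
      case False
      then have "S (Suc n) = x (Suc n)" using S_Suc by simp
      then show ?thesis using sum_squares_bound[of "S n" "x (Suc n)"]
        by (simp add: power2_eq_square)
    qed (simp add: S_Suc max_def)
    with Suc show ?case by (simp add: algebra_simps)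
  qed
  \<comment> \<open>completing the square: \<open>S x - S\<^sup>2/2 \<le> x\<^sup>2 - S\<^sup>2/4\<close>\<close>
  moreover have "0 \<le> (S n - 2 * x n)\<^sup>2" by simp
  then have "S n * x n - (S n)\<^sup>2 / 2 \<le> (x n)\<^sup>2 - (S n)\<^sup>2 / 4"
    by (simp add: power2_eq_square algebra_simps)
  ultimately show ?thesis by linarith
qed

text \<open>Both sides integrate \<open>f r * g q\<close> over the triangle \<open>a \<le> r < q \<le> s\<close>. In the product rule this plays
  the role of integration by parts for the drift terms.\<close>

lemma integral_triangle:
  fixes f g :: "real \<Rightarrow> real"
  assumes f: "set_integrable lborel {a..s} f" and g: "set_integrable lborel {a..s} g"
  shows "(LINT r:{a..s}|lborel. f r * ((LINT q:{a..s}|lborel. g q) - (LINT q:{a..r}|lborel. g q)))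
       = (LINT q:{a..s}|lborel. (LINT r:{a..q}|lborel. f r) * g q)"
proof -
  define F where "F r = indicator {a..s} r * f r" for r
  define G where "G r = indicator {a..s} r * g r" for r
  have F: "integrable lborel F" and G: "integrable lborel G"
    using f g by (simp_all add: F_def[abs_def] G_def[abs_def] set_integrable_def)
  have P: "integrable (lborel \<Otimes>\<^sub>M lborel) (\<lambda>x. F (fst x) * G (snd x))"
  proof (rule lborel_pair.Fubini_integrable)
    have "(\<lambda>x. F (fst x)) \<in> borel_measurable (lborel \<Otimes>\<^sub>M lborel)" "(\<lambda>x. G (snd x)) \<in> borel_measurable (lborel \<Otimes>\<^sub>M lborel)"
      using F G by (auto intro: measurable_compose[OF measurable_fst] measurable_compose[OF measurable_snd])
    then show "(\<lambda>x. F (fst x) * G (snd x)) \<in> borel_measurable (lborel \<Otimes>\<^sub>M lborel)" by (rule borel_measurable_times)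
    show "integrable lborel (\<lambda>x. \<integral>y. norm (F (fst (x, y)) * G (snd (x, y))) \<partial>lborel)"
      using F by (simp add: abs_mult)
    show "AE x in lborel. integrable lborel (\<lambda>y. F (fst (x, y)) * G (snd (x, y)))"
      using G by simp
  qed
  define E where "E = {x \<in> space (lborel \<Otimes>\<^sub>M (lborel :: real measure)). fst x < (snd x :: real)}"
  have E: "E \<in> sets (lborel \<Otimes>\<^sub>M lborel)" unfolding E_def by measurable
  define H where "H r q = indicator E (r, q) * (F r * G q)" for r q
  have Hi: "integrable (lborel \<Otimes>\<^sub>M lborel) (\<lambda>(r, q). H r q)"
    using integrable_mult_indicator[OF E P] by (simp add: H_def case_prod_beta')
  have "(\<integral>q. (\<integral>r. H r q \<partial>lborel) \<partial>lborel) = (\<integral>r. (\<integral>q. H r q \<partial>lborel) \<partial>lborel)"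
    by (rule lborel_pair.Fubini_integral[OF Hi])
  moreover have "(\<integral>q. H r q \<partial>lborel) = indicator {a..s} r * (f r * ((LINT q:{a..s}|lborel. g q) - (LINT q:{a..r}|lborel. g q)))" for r
  proof (cases "r \<in> {a..s}")
    case True
    have gr: "set_integrable lborel {a..r} g"
      by (rule set_integrable_subset[OF g]) (use True in auto)
    have "(\<integral>q. H r q \<partial>lborel) = (\<integral>q. f r * (indicator {a..s} q *\<^sub>R g q - indicator {a..r} q *\<^sub>R g q) \<partial>lborel)"
      using True by (intro Bochner_Integration.integral_cong refl)
        (auto simp: H_def E_def F_def G_def indicator_def space_pair_measure)
    also have "\<dots> = f r * ((LINT q:{a..s}|lborel. g q) - (LINT q:{a..r}|lborel. g q))"
      using g gr unfolding set_integrable_def set_lebesgue_integral_def by simp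
    finally show ?thesis using True by simp
  qed (simp add: H_def F_def)
  moreover have "(\<integral>r. H r q \<partial>lborel) = indicator {a..s} q * ((LINT r:{a..q}|lborel. f r) * g q)" for q
  proof (cases "q \<in> {a..s}")
    case True
    have ae: "AE r in lborel. r \<noteq> q" by (rule AE_lborel_singleton)
    have fi: "set_integrable lborel {a..q} f"
      by (rule set_integrable_subset[OF f]) (use True in auto)
    have "(\<integral>r. H r q \<partial>lborel) = (\<integral>r. (indicator {a..q} r *\<^sub>R f r) * g q \<partial>lborel)"
    proof (rule integral_cong_AE)
      have "(\<lambda>r. (r, q)) \<in> measurable lborel (lborel \<Otimes>\<^sub>M lborel)" by simp
      from measurable_compose[OF this borel_measurable_integrable[OF Hi]]
      show "(\<lambda>r. H r q) \<in> borel_measurable lborel" by simp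
      show "(\<lambda>r. (indicator {a..q} r *\<^sub>R f r) * g q) \<in> borel_measurable lborel"
        using fi unfolding set_integrable_def by auto
      show "AE r in lborel. H r q = (indicator {a..q} r *\<^sub>R f r) * g q"
        using ae by eventually_elim (use True in \<open>auto simp: H_def E_def F_def G_def indicator_def space_pair_measure\<close>)
    qed
    also have "\<dots> = (LINT r:{a..q}|lborel. f r) * g q"
      by (simp add: set_lebesgue_integral_def)
    finally show ?thesis using True by simp
  qed (simp add: H_def G_def)
  ultimately show ?thesis by (simp add: set_lebesgue_integral_def)
qed

section \<open>Square-integrable functions and conditional expectation\<close>

definition sq_int :: "'a measure \<Rightarrow> ('a \<Rightarrow> 'b::euclidean_space) \<Rightarrow> bool" where
  "sq_int M f \<longleftrightarrow> f \<in> borel_measurable M \<and> integrable M (\<lambda>x. (norm (f x))\<^sup>2)"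

lemma sq_int_measurable: "sq_int M f \<Longrightarrow> f \<in> borel_measurable M"
  by (simp add: sq_int_def)

lemma sq_int_integrable_norm2: "sq_int M f \<Longrightarrow> integrable M (\<lambda>x. (norm (f x))\<^sup>2)"
  by (simp add: sq_int_def)

lemma sq_int_integrable_power2: "sq_int M (f :: _ \<Rightarrow> real) \<Longrightarrow> integrable M (\<lambda>x. (f x)\<^sup>2)"
  by (simp add: sq_int_def)

lemma sq_int_bound:
  assumes "integrable M g" "f \<in> borel_measurable M" "AE x in M. (norm (f x))\<^sup>2 \<le> g x"
  shows "sq_int M f"
  unfolding sq_int_def
proof
  show "integrable M (\<lambda>x. (norm (f x))\<^sup>2)"
    by (rule Bochner_Integration.integrable_bound[OF assms(1)])
       (use assms(2,3) in \<open>auto elim!: eventually_mono\<close>)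
qed fact

lemma norm_add_power2_le:
  fixes x y :: "'b::real_normed_vector"
  shows "(norm (x + y))\<^sup>2 \<le> 2 * (norm x)\<^sup>2 + 2 * (norm y)\<^sup>2"
proof -
  have "(norm (x + y))\<^sup>2 \<le> (norm x + norm y)\<^sup>2"
    by (intro power_mono norm_triangle_ineq) auto
  also have "\<dots> \<le> 2 * (norm x)\<^sup>2 + 2 * (norm y)\<^sup>2"
    using sum_squares_bound[of "norm x" "norm y"] by (simp add: power2_sum)
  finally show ?thesis .
qed

lemma norm_diff_power2_le:
  fixes x y :: "'b::real_normed_vector"
  shows "(norm (x - y))\<^sup>2 \<le> 2 * (norm x)\<^sup>2 + 2 * (norm y)\<^sup>2"
  using norm_add_power2_le[of x "- y"] by simp

lemma sq_int_add: "sq_int M f \<Longrightarrow> sq_int M g \<Longrightarrow> sq_int M (\<lambda>x. f x + g x)"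
  by (rule sq_int_bound[where g = "\<lambda>x. 2 * (norm (f x))\<^sup>2 + 2 * (norm (g x))\<^sup>2"])
     (auto simp: sq_int_def norm_add_power2_le)

lemma sq_int_diff: "sq_int M f \<Longrightarrow> sq_int M g \<Longrightarrow> sq_int M (\<lambda>x. f x - g x)"
  by (rule sq_int_bound[where g = "\<lambda>x. 2 * (norm (f x))\<^sup>2 + 2 * (norm (g x))\<^sup>2"])
     (auto simp: sq_int_def norm_diff_power2_le)

lemma sq_int_scaleR: "sq_int M f \<Longrightarrow> sq_int M (\<lambda>x. c *\<^sub>R f x)"
  by (auto simp: sq_int_def power_mult_distrib)

lemma sq_int_minus: "sq_int M f \<Longrightarrow> sq_int M (\<lambda>x. - f x)"
  by (auto simp: sq_int_def)

lemma sq_int_zero: "sq_int M (\<lambda>x. 0)"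
  by (auto simp: sq_int_def)

lemma sq_int_sum: "(\<And>i. i \<in> I \<Longrightarrow> sq_int M (f i)) \<Longrightarrow> sq_int M (\<lambda>x. \<Sum>i\<in>I. f i x)"
  by (induction I rule: infinite_finite_induct) (auto intro: sq_int_zero sq_int_add)

lemma sq_int_norm: "sq_int M f \<Longrightarrow> sq_int M (\<lambda>x. norm (f x))"
  by (auto simp: sq_int_def)

lemma sq_int_abs: "sq_int M (f :: _ \<Rightarrow> real) \<Longrightarrow> sq_int M (\<lambda>x. \<bar>f x\<bar>)"
  using sq_int_norm[of M f] by simp

lemma sq_int_mono:
  assumes "sq_int M g" "f \<in> borel_measurable M" "AE x in M. norm (f x) \<le> norm (g x)"
  shows "sq_int M f"
  by (rule sq_int_bound[where g = "\<lambda>x. (norm (g x))\<^sup>2"])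
     (use assms in \<open>auto simp: sq_int_def intro!: power_mono elim!: eventually_mono\<close>)

lemma sq_int_bounded_scaleR:
  fixes c :: "_ \<Rightarrow> real"
  assumes f: "sq_int M f" and c: "c \<in> borel_measurable M" and b: "AE x in M. \<bar>c x\<bar> \<le> K"
  shows "sq_int M (\<lambda>x. c x *\<^sub>R f x)"
proof (rule sq_int_mono[OF sq_int_scaleR[OF f, of K]])
  show "(\<lambda>x. c x *\<^sub>R f x) \<in> borel_measurable M" using f c by (auto simp: sq_int_def)
  show "AE x in M. norm (c x *\<^sub>R f x) \<le> norm (K *\<^sub>R f x)"
    using b by eventually_elim (auto intro!: mult_right_mono)
qed

lemma sq_int_indicator:
  "sq_int M f \<Longrightarrow> A \<in> sets M \<Longrightarrow> sq_int M (\<lambda>x. indicator A x *\<^sub>R f x)"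
  by (rule sq_int_bounded_scaleR[where K = 1]) (auto simp: indicator_def)

lemma sq_int_indicator_mult:
  "sq_int M (f :: _ \<Rightarrow> real) \<Longrightarrow> A \<in> sets M \<Longrightarrow> sq_int M (\<lambda>x. indicator A x * f x)"
  using sq_int_indicator[of M f A] by simp

lemma sq_int_component:
  fixes f :: "_ \<Rightarrow> real ^ 'n"
  assumes "sq_int M f" shows "sq_int M (\<lambda>x. f x $ i)"
proof (rule sq_int_mono[OF assms])
  have [measurable]: "f \<in> borel_measurable M" using assms by (simp add: sq_int_def)
  show "(\<lambda>x. f x $ i) \<in> borel_measurable M"
    by (rule measurable_compose[OF _ borel_measurable_continuous_onI]) (auto intro!: continuous_intros)
qed (auto simp: component_le_norm_cart)

lemma sq_int_inner:
  assumes "sq_int M f" "sq_int M g"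
  shows "integrable M (\<lambda>x. f x \<bullet> g x)"
proof (rule Bochner_Integration.integrable_bound)
  show "integrable M (\<lambda>x. (norm (f x))\<^sup>2 + (norm (g x))\<^sup>2)"
    using assms by (auto simp: sq_int_def)
  show "(\<lambda>x. f x \<bullet> g x) \<in> borel_measurable M" using assms by (auto simp: sq_int_def)
  have "norm (f x \<bullet> g x) \<le> norm ((norm (f x))\<^sup>2 + (norm (g x))\<^sup>2)" for x
  proof -
    have "\<bar>f x \<bullet> g x\<bar> \<le> norm (f x) * norm (g x)" by (rule Cauchy_Schwarz_ineq2)
    also have "\<dots> \<le> (norm (f x))\<^sup>2 + (norm (g x))\<^sup>2"
      using sum_squares_bound[of "norm (f x)" "norm (g x)"]
        mult_nonneg_nonneg[OF norm_ge_zero[of "f x"] norm_ge_zero[of "g x"]] by linarith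
    finally show ?thesis by simp
  qed
  then show "AE x in M. norm (f x \<bullet> g x) \<le> norm ((norm (f x))\<^sup>2 + (norm (g x))\<^sup>2)" by simp
qed

lemma sq_int_mult:
  fixes f g :: "_ \<Rightarrow> real"
  assumes "sq_int M f" "sq_int M g"
  shows "integrable M (\<lambda>x. f x * g x)"
  using sq_int_inner[OF assms] by simp

lemma sq_int_const: "finite_measure M \<Longrightarrow> sq_int M (\<lambda>x. c)"
  by (simp add: sq_int_def finite_measure.integrable_const)

lemma sq_int_integrable:
  fixes f :: "_ \<Rightarrow> 'b::euclidean_space"
  assumes "finite_measure M" "sq_int M f" shows "integrable M f"
proof (rule Bochner_Integration.integrable_bound)
  show "integrable M (\<lambda>x. 1 + (norm (f x))\<^sup>2)"
    using assms by (auto simp: sq_int_def finite_measure.integrable_const)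
  show "f \<in> borel_measurable M" using assms by (simp add: sq_int_def)
  have "norm (f x) \<le> 1 + (norm (f x))\<^sup>2" for x
    using sum_squares_bound[of 1 "norm (f x)"] norm_ge_zero[of "f x"]
    by (simp add: power2_eq_square del: norm_ge_zero)
  then show "AE x in M. norm (f x) \<le> norm (1 + (norm (f x))\<^sup>2)" by (simp add: abs_of_nonneg)
qed

text \<open>The quadratic polynomial \<open>s \<mapsto> \<integral> |f + s g|\<^sup>2\<close> is nonnegative.\<close>

lemma L2_Cauchy_Schwarz:
  assumes f: "sq_int M f" and g: "sq_int M g"
  shows "\<bar>\<integral>x. f x \<bullet> g x \<partial>M\<bar> \<le> sqrt (\<integral>x. (norm (f x))\<^sup>2 \<partial>M) * sqrt (\<integral>x. (norm (g x))\<^sup>2 \<partial>M)"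
proof -
  define a b c where "a = (\<integral>x. (norm (f x))\<^sup>2 \<partial>M)" and "b = (\<integral>x. (norm (g x))\<^sup>2 \<partial>M)"
    and "c = (\<integral>x. f x \<bullet> g x \<partial>M)"
  have q: "0 \<le> a + 2 * t * c + t\<^sup>2 * b" for t
  proof -
    have "0 \<le> (\<integral>x. (norm (f x + t *\<^sub>R g x))\<^sup>2 \<partial>M)" by simp
    also have "(\<lambda>x. (norm (f x + t *\<^sub>R g x))\<^sup>2)
        = (\<lambda>x. (norm (f x))\<^sup>2 + 2 * t * (f x \<bullet> g x) + t\<^sup>2 * (norm (g x))\<^sup>2)"
      unfolding power2_norm_eq_inner
      by (rule ext) (simp add: inner_simps inner_commute algebra_simps power2_eq_square)
    also have "(\<integral>x. (norm (f x))\<^sup>2 + 2 * t * (f x \<bullet> g x) + t\<^sup>2 * (norm (g x))\<^sup>2 \<partial>M)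
       = a + 2 * t * c + t\<^sup>2 * b"
      using sq_int_inner[OF f g] f g by (simp add: a_def b_def c_def sq_int_def)
    finally show ?thesis .
  qed
  have nn: "0 \<le> a" "0 \<le> b" by (simp_all add: a_def b_def)
  have "c\<^sup>2 \<le> a * b"
  proof (cases "b = 0")
    case True
    have "c = 0"
    proof (rule ccontr)
      assume "c \<noteq> 0"
      then show False using q[of "- (a + 1) / (2 * c)"] True by (simp add: field_simps)
    qed
    then show ?thesis using True by simp
  next
    case False
    then have "b > 0" using nn by simp
    moreover have "2 * (- c / b) * c = - 2 * (c\<^sup>2 / b)" by (simp add: power2_eq_square)
    moreover have "(- c / b)\<^sup>2 * b = c\<^sup>2 / b"
      using \<open>b > 0\<close> by (simp add: power2_eq_square)
    ultimately have "c\<^sup>2 / b \<le> a" using q[of "- c / b"] by linarith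
    then show ?thesis using \<open>b > 0\<close> by (simp add: pos_divide_le_eq)
  qed
  then have "sqrt (c\<^sup>2) \<le> sqrt (a * b)" by (rule real_sqrt_le_mono)
  then show ?thesis unfolding a_def[symmetric] b_def[symmetric] c_def[symmetric]
    by (simp add: real_sqrt_mult)
qed

text \<open>Distances are measured by nonnegative integrals because this is how the It\^o integral is defined as a
  limit.\<close>

lemma L2_tendsto_inner:
  assumes f: "sq_int M f" and g: "sq_int M g" and fk: "\<And>k. sq_int M (fk k)" and gk: "\<And>k. sq_int M (gk k)"
    and fl: "(\<lambda>k. \<integral>\<^sup>+x. ennreal ((norm (f x - fk k x))\<^sup>2) \<partial>M) \<longlonglongrightarrow> 0"
    and gl: "(\<lambda>k. \<integral>\<^sup>+x. ennreal ((norm (g x - gk k x))\<^sup>2) \<partial>M) \<longlonglongrightarrow> 0"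
  shows "(\<lambda>k. \<integral>x. fk k x \<bullet> gk k x \<partial>M) \<longlonglongrightarrow> (\<integral>x. f x \<bullet> g x \<partial>M)"
proof -
  have conv: "(\<lambda>k. sqrt (\<integral>x. (norm (h x - hk k x))\<^sup>2 \<partial>M)) \<longlonglongrightarrow> 0"
    if "sq_int M h" "\<And>k. sq_int M (hk k)"
      "(\<lambda>k. \<integral>\<^sup>+x. ennreal ((norm (h x - hk k x))\<^sup>2) \<partial>M) \<longlonglongrightarrow> 0" for h :: "'a \<Rightarrow> 'b" and hk
  proof -
    have "(\<integral>\<^sup>+x. ennreal ((norm (h x - hk k x))\<^sup>2) \<partial>M) = ennreal (\<integral>x. (norm (h x - hk k x))\<^sup>2 \<partial>M)" for k
      using sq_int_diff[OF that(1,2)] by (intro nn_integral_eq_integral) (auto simp: sq_int_def)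
    with that(3) have "(\<lambda>k. ennreal (\<integral>x. (norm (h x - hk k x))\<^sup>2 \<partial>M)) \<longlonglongrightarrow> ennreal 0" by simp
    then have "(\<lambda>k. \<integral>x. (norm (h x - hk k x))\<^sup>2 \<partial>M) \<longlonglongrightarrow> 0"
      by (subst (asm) tendsto_ennreal_iff) auto
    then have "(\<lambda>k. sqrt (\<integral>x. (norm (h x - hk k x))\<^sup>2 \<partial>M)) \<longlonglongrightarrow> sqrt 0"
      by (rule tendsto_real_sqrt)
    then show ?thesis by simp
  qed
  let ?n = "\<lambda>h. sqrt (\<integral>x. (norm (h x))\<^sup>2 \<partial>M)"
  define a where "a k = ?n (\<lambda>x. f x - fk k x)" for k
  define b where "b k = ?n (\<lambda>x. g x - gk k x)" for k
  have al: "a \<longlonglongrightarrow> 0" unfolding a_def by (rule conv[OF f fk fl])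
  have bl: "b \<longlonglongrightarrow> 0" unfolding b_def by (rule conv[OF g gk gl])
  have le: "\<bar>(\<integral>x. fk k x \<bullet> gk k x \<partial>M) - (\<integral>x. f x \<bullet> g x \<partial>M)\<bar> \<le> a k * b k + a k * ?n g + ?n f * b k" for k
  proof -
    note d1 = sq_int_diff[OF f fk[of k]] and d2 = sq_int_diff[OF g gk[of k]]
    have "(\<integral>x. fk k x \<bullet> gk k x \<partial>M) - (\<integral>x. f x \<bullet> g x \<partial>M)
      = (\<integral>x. fk k x \<bullet> gk k x - f x \<bullet> g x \<partial>M)"
      using sq_int_inner[OF f g] sq_int_inner[OF fk gk] by simp
    also have "\<dots> = (\<integral>x. (f x - fk k x) \<bullet> (g x - gk k x) - (f x - fk k x) \<bullet> g x - f x \<bullet> (g x - gk k x) \<partial>M)"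
      by (intro Bochner_Integration.integral_cong) (auto simp: inner_simps)
    also have "\<dots> = (\<integral>x. (f x - fk k x) \<bullet> (g x - gk k x) \<partial>M) - (\<integral>x. (f x - fk k x) \<bullet> g x \<partial>M)
        - (\<integral>x. f x \<bullet> (g x - gk k x) \<partial>M)"
      using sq_int_inner[OF d1 d2] sq_int_inner[OF d1 g] sq_int_inner[OF f d2] by simp
    finally have eq: "(\<integral>x. fk k x \<bullet> gk k x \<partial>M) - (\<integral>x. f x \<bullet> g x \<partial>M)
      = (\<integral>x. (f x - fk k x) \<bullet> (g x - gk k x) \<partial>M) - (\<integral>x. (f x - fk k x) \<bullet> g x \<partial>M)
        - (\<integral>x. f x \<bullet> (g x - gk k x) \<partial>M)" .
    show ?thesis unfolding eq a_def b_def
      using L2_Cauchy_Schwarz[OF d1 d2] L2_Cauchy_Schwarz[OF d1 g] L2_Cauchy_Schwarz[OF f d2] by linarith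
  qed
  have "(\<lambda>k. a k * b k + a k * ?n g + ?n f * b k) \<longlonglongrightarrow> 0 * 0 + 0 * ?n g + ?n f * 0"
    by (intro tendsto_intros al bl)
  then have z: "(\<lambda>k. a k * b k + a k * ?n g + ?n f * b k) \<longlonglongrightarrow> 0" by simp
  have "(\<lambda>k. (\<integral>x. fk k x \<bullet> gk k x \<partial>M) - (\<integral>x. f x \<bullet> g x \<partial>M)) \<longlonglongrightarrow> 0"
    by (rule Lim_null_comparison[OF _ z]) (use le in \<open>auto intro!: always_eventually\<close>)
  then show ?thesis by (simp add: LIM_zero_iff)
qed

lemma (in sigma_finite_subalgebra) integral_mult_eq_of_set_integrals_eq:
  fixes U V h :: "_ \<Rightarrow> real"
  assumes U: "integrable M U" and V: "integrable M V" "V \<in> borel_measurable F"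
    and eq: "\<And>A. A \<in> sets F \<Longrightarrow> (\<integral>x. indicator A x * U x \<partial>M) = (\<integral>x. indicator A x * V x \<partial>M)"
    and h: "h \<in> borel_measurable F" and hU: "integrable M (\<lambda>x. h x * U x)"
  shows "(\<integral>x. h x * U x \<partial>M) = (\<integral>x. h x * V x \<partial>M)"
proof -
  have "AE x in M. real_cond_exp M F U x = V x"
    by (rule real_cond_exp_charact) (use eq U V in \<open>auto simp: set_lebesgue_integral_def\<close>)
  moreover have "(\<integral>x. h x * real_cond_exp M F U x \<partial>M) = (\<integral>x. h x * U x \<partial>M)"
    using real_cond_exp_intg(2)[OF hU h] U by auto
  moreover have "h \<in> borel_measurable M" using measurable_from_subalg[OF subalg h] .
  ultimately show ?thesis
    using V by (subst integral_cong_AE[where g = "\<lambda>x. h x * real_cond_exp M F U x"])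
      (auto elim!: eventually_mono)
qed

text \<open>Test the assumption on the set where the conditional expectation exceeds \<open>V\<close>; that set is
  measurable with respect to the sub-\<open>\<sigma>\<close>-algebra.\<close>

lemma (in sigma_finite_subalgebra) real_cond_exp_le_of_set_integrals_le:
  fixes U V :: "_ \<Rightarrow> real"
  assumes U: "integrable M U" and V: "integrable M V" "V \<in> borel_measurable F"
    and le: "\<And>A. A \<in> sets F \<Longrightarrow> (\<integral>x. indicator A x * U x \<partial>M) \<le> (\<integral>x. indicator A x * V x \<partial>M)"
  shows "AE x in M. real_cond_exp M F U x \<le> V x"
proof -
  define c where "c = real_cond_exp M F U"
  have cF[measurable]: "c \<in> borel_measurable F" unfolding c_def by simp
  have ci: "integrable M c" unfolding c_def using U by auto
  have [measurable]: "V \<in> borel_measurable F" by fact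
  define A where "A = {x \<in> space F. V x < c x}"
  have A[measurable]: "A \<in> sets F" unfolding A_def by measurable
  have AM: "A \<in> sets M" using A subalg by (auto simp: subalgebra_def)
  have sp: "space F = space M" using subalg by (simp add: subalgebra_def)
  have int: "integrable M (\<lambda>x. indicator A x * (c x - V x))"
    using integrable_mult_indicator[OF AM Bochner_Integration.integrable_diff[OF ci V(1)]] by simp
  have iU: "integrable M (\<lambda>x. indicator A x * U x)"
    using integrable_mult_indicator[OF AM U] by simp
  have "(\<integral>x. indicator A x * (c x - V x) \<partial>M) = (\<integral>x. indicator A x * c x \<partial>M) - (\<integral>x. indicator A x * V x \<partial>M)"
    using integrable_mult_indicator[OF AM ci] integrable_mult_indicator[OF AM V(1)]
    by (simp add: right_diff_distrib)
  also have "(\<integral>x. indicator A x * c x \<partial>M) = (\<integral>x. indicator A x * U x \<partial>M)"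
    unfolding c_def by (rule real_cond_exp_intg(2)[OF iU]) (use U in auto)
  finally have "(\<integral>x. indicator A x * (c x - V x) \<partial>M) \<le> 0" using le[OF A] by simp
  moreover have nn: "0 \<le> indicator A x * (c x - V x)" for x by (auto simp: A_def indicator_def)
  ultimately have "(\<integral>x. indicator A x * (c x - V x) \<partial>M) = 0"
    by (intro antisym) (auto intro!: integral_nonneg_AE nn)
  then have "AE x in M. indicator A x * (c x - V x) = 0"
    using integral_nonneg_eq_0_iff_AE[OF int] nn by simp
  then show ?thesis unfolding c_def[symmetric] using AE_space
    by eventually_elim (auto simp: A_def sp indicator_def split: if_splits)
qed

text \<open>The sets over which the integral of \<open>h\<close> vanishes are closed under complements and countable disjoint
  unions, so Dynkin's \<open>\<pi>\<close>-\<open>\<lambda>\<close> theorem applies.\<close>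

lemma set_integral_zero_of_pi_system:
  fixes h :: "'a \<Rightarrow> real"
  assumes h: "integrable M h" and G: "Int_stable G" "G \<subseteq> sets M" "space M \<in> G"
    and z: "\<And>A. A \<in> G \<Longrightarrow> (\<integral>x. indicator A x * h x \<partial>M) = 0"
    and A: "A \<in> sigma_sets (space M) G"
  shows "(\<integral>x. indicator A x * h x \<partial>M) = 0"
proof -
  have sub: "sigma_sets (space M) G \<subseteq> sets M" using G(2) by (simp add: sets.sigma_sets_subset)
  have si: "set_integrable M B h" if "B \<in> sets M" for B
    unfolding set_integrable_def by (rule integrable_mult_indicator[OF that h])
  have "G \<subseteq> Pow (space M)" using G(2) sets.sets_into_space by blast
  from G(1) this A show ?thesis
  proof (induction rule: sigma_sets_induct_disjoint)
    case (basic A) then show ?case by (rule z)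
  next
    case empty show ?case by simp
  next
    case (compl A)
    have AM: "A \<in> sets M" using compl sub by auto
    have "(\<integral>x. indicator (space M - A) x * h x \<partial>M)
        = (\<integral>x. indicator (space M) x * h x - indicator A x * h x \<partial>M)"
      using sets.sets_into_space[OF AM]
      by (intro Bochner_Integration.integral_cong) (auto simp: indicator_def)
    also have "\<dots> = 0"
      using si[OF AM] si[OF sets.top] z[OF G(3)] compl
      by (subst Bochner_Integration.integral_diff) (auto simp: set_integrable_def)
    finally show ?case .
  next
    case (union A)
    have AM: "A i \<in> sets M" for i using union sub by auto
    have "(LINT x:(\<Union>i. A i)|M. h x) = (\<Sum>i. (LINT x:(A i)|M. h x))"
      by (rule lebesgue_integral_countable_add)
         (use AM union(1) si[of "\<Union>i. A i"] in \<open>auto simp: disjoint_family_on_def\<close>)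
    then show ?case using union by (simp add: set_lebesgue_integral_def)
  qed
qed

section \<open>Brownian motion relative to a filtration\<close>

text \<open>The increments enter only through their first two moments conditional on the past, written as integrals over
  the sets of the past. Together with adaptedness this yields the isometry and the martingale property of the
  It\^o integral. The null sets are required in every \<open>F s\<close> because the coefficients are regular only
  outside of a null set.\<close>

locale brownian_filtration = prob_space M for M :: "'w measure" +
  fixes F :: "real \<Rightarrow> 'w measure" and B :: "'w \<Rightarrow> real \<Rightarrow> real ^ 'd" and T :: real
  assumes filtration_subalgebra: "s \<in> {0..T} \<Longrightarrow> subalgebra M (F s)"
    and filtration_mono: "0 \<le> r \<Longrightarrow> r \<le> s \<Longrightarrow> s \<le> T \<Longrightarrow> sets (F r) \<subseteq> sets (F s)"
    and filtration_null: "s \<in> {0..T} \<Longrightarrow> N \<in> null_sets M \<Longrightarrow> N \<in> sets (F s)"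
    and adapted: "s \<in> {0..T} \<Longrightarrow> (\<lambda>w. B w s) \<in> borel_measurable (F s)"
    and increment_sq_int: "0 \<le> r \<Longrightarrow> r \<le> s \<Longrightarrow> s \<le> T \<Longrightarrow> sq_int M (\<lambda>w. B w s - B w r)"
    and increment_mean: "0 \<le> r \<Longrightarrow> r \<le> s \<Longrightarrow> s \<le> T \<Longrightarrow> A \<in> sets (F r) \<Longrightarrow>
      (\<integral>w. indicator A w * (B w s - B w r) $ i \<partial>M) = 0"
    and increment_cov: "0 \<le> r \<Longrightarrow> r \<le> s \<Longrightarrow> s \<le> T \<Longrightarrow> A \<in> sets (F r) \<Longrightarrow>
      (\<integral>w. indicator A w * ((B w s - B w r) $ i * (B w s - B w r) $ j) \<partial>M)
        = (if i = j then s - r else 0) * prob A"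

text \<open>Functions of disjoint blocks of an independent family are independent, so their expectations multiply.\<close>

lemma (in prob_space) indep_vars_integral_mult:
  fixes X :: "'i \<Rightarrow> 'a \<Rightarrow> real" and g h :: "('i \<Rightarrow> real) \<Rightarrow> real"
  assumes ind: "indep_vars (\<lambda>_. borel) X I" and sub: "A \<subseteq> I" "C \<subseteq> I" "A \<inter> C = {}"
    and g: "g \<in> borel_measurable (PiM A (\<lambda>_. borel))" and h: "h \<in> borel_measurable (PiM C (\<lambda>_. borel))"
    and gi: "integrable M (\<lambda>w. g (\<lambda>i\<in>A. X i w))" and hi: "integrable M (\<lambda>w. h (\<lambda>i\<in>C. X i w))"
  shows "(\<integral>w. g (\<lambda>i\<in>A. X i w) * h (\<lambda>i\<in>C. X i w) \<partial>M)
    = (\<integral>w. g (\<lambda>i\<in>A. X i w) \<partial>M) * (\<integral>w. h (\<lambda>i\<in>C. X i w) \<partial>M)"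
proof -
  have "indep_var borel (g \<circ> (\<lambda>w. \<lambda>i\<in>A. X i w)) borel (h \<circ> (\<lambda>w. \<lambda>i\<in>C. X i w))"
    by (rule indep_var_compose[OF indep_var_restrict[OF ind sub(3) sub(1,2)] g h])
  from indep_var_lebesgue_integral[OF this, unfolded comp_def, OF gi hi] show ?thesis .
qed

lemma power2_norm_vec:
  fixes v :: "real ^ 'n" shows "(norm v)\<^sup>2 = (\<Sum>i\<in>UNIV. (v $ i)\<^sup>2)"
  unfolding power2_norm_eq_inner inner_vec_def by (simp add: power2_eq_square)

lemma sq_int_vecI:
  fixes f :: "_ \<Rightarrow> real ^ 'n"
  assumes "f \<in> borel_measurable M" "\<And>i. sq_int M (\<lambda>x. f x $ i)"
  shows "sq_int M f"
proof (rule sq_int_bound)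
  show "integrable M (\<lambda>x. \<Sum>i\<in>UNIV. (f x $ i)\<^sup>2)"
    using assms(2) by (auto simp: sq_int_def)
  show "AE x in M. (norm (f x))\<^sup>2 \<le> (\<Sum>i\<in>UNIV. (f x $ i)\<^sup>2)"
    by (simp add: power2_norm_vec)
qed fact

context
  fixes T :: real and W :: "(real \<Rightarrow> real ^ 'd) measure"
  assumes W: "wiener_measure T W"
begin

lemma wiener_prob: "prob_space W"
  using W by (simp add: wiener_measure_def)

lemma wiener_coordinate_measurable:
  assumes "s \<in> {0..T}" shows "(\<lambda>w. w s) \<in> borel_measurable W"
proof -
  have "(\<lambda>w. w s) \<in> borel_measurable (restrict_space (PiM {0..T} (\<lambda>_. borel)) (wiener_paths T))"
    by (intro measurable_restrict_space1 measurable_component_singleton assms)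
  moreover have "sets W = sets (restrict_space (PiM {0..T} (\<lambda>_. borel)) (wiener_paths T))"
    using W by (simp add: wiener_measure_def)
  ultimately show ?thesis using measurable_cong_sets by blast
qed

lemma wiener_path_zero: "w \<in> space W \<Longrightarrow> w 0 = 0"
  using W by (simp add: wiener_measure_def wiener_paths_def)

lemma wiener_increment_moments:
  assumes "0 \<le> r" "r < s" "s \<le> T"
  shows "sq_int W (\<lambda>w. (w s - w r) $ i)" "(\<integral>w. (w s - w r) $ i \<partial>W) = 0"
    "(\<integral>w. ((w s - w r) $ i)\<^sup>2 \<partial>W) = s - r"
proof -
  interpret prob_space W by (rule wiener_prob)
  have D: "distributed W lborel (\<lambda>w. (w s - w r) $ i) (\<lambda>x. ennreal (normal_density 0 (sqrt (s - r)) x))"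
    using W assms by (simp add: wiener_measure_def)
  have pos: "0 < sqrt (s - r)" using assms by simp
  show mean: "(\<integral>w. (w s - w r) $ i \<partial>W) = 0"
    by (rule normal_distributed_expectation[OF pos D])
  show "(\<integral>w. ((w s - w r) $ i)\<^sup>2 \<partial>W) = s - r"
    using normal_distributed_variance[OF pos D] mean assms by simp
  have "integrable W (\<lambda>w. ((w s - w r) $ i)\<^sup>2)"
    using integrable_normal_moment[OF pos, of 0 2]
    by (subst distributed_integrable[OF D, of "\<lambda>x. x\<^sup>2", symmetric]) auto
  moreover have "(\<lambda>w. (w s - w r) $ i) \<in> borel_measurable W"
    using distributed_measurable[OF D] by simp
  ultimately show "sq_int W (\<lambda>w. (w s - w r) $ i)"
    by (simp add: sq_int_def)
qed

text \<open>The times \<open>U\<close> of the cylinder, together with \<open>0\<close> and \<open>r\<close>, form a partition of \<open>[0,r]\<close>. The path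
  starts at \<open>0\<close>, hence its values at these times are sums of increments over this partition, and the
  cylinder set is independent of the increment from \<open>r\<close> to \<open>s\<close>.\<close>

lemma wiener_cylinder_increment:
  assumes rs: "0 \<le> r" "r < s" "s \<le> T" and U: "finite U" "U \<subseteq> {0..r}" and A: "\<And>u. A u \<in> sets borel"
  defines "C \<equiv> {w \<in> space W. \<forall>u\<in>U. w u \<in> A u}"
  shows "(\<integral>w. indicator C w * (w s - w r) $ i \<partial>W) = 0"
    "(\<integral>w. indicator C w * ((w s - w r) $ i * (w s - w r) $ j - (if i = j then s - r else 0)) \<partial>W) = 0"
proof -
  interpret prob_space W by (rule wiener_prob)
  \<comment> \<open>the partition \<open>\<tau>\<close> consists of the times in \<open>S\<close>, the last of which is \<open>r\<close>, followed by \<open>s\<close>\<close>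
  define S where "S = insert 0 (insert r U)"
  define xs where "xs = sorted_list_of_set S"
  define m where "m = length xs"
  define \<tau> where "\<tau> k = (xs @ [s]) ! k" for k
  have S: "finite S" "S \<subseteq> {0..r}" "S \<noteq> {}" using U rs by (auto simp: S_def)
  have setxs: "set xs = S" using S by (simp add: xs_def)
  have "sorted_wrt (<) xs" by (simp add: xs_def)
  then have sorted: "sorted_wrt (<) (xs @ [s])"
    using S rs by (auto simp: sorted_wrt_append setxs)
  have m0: "0 < m" using setxs S by (auto simp: m_def)
  have mono: "strict_mono_on {..m} \<tau>"
    unfolding strict_mono_on_def \<tau>_def using sorted_wrt_nth_less[OF sorted] by (auto simp: m_def)
  have tau_in: "\<tau> k \<in> S" if "k < m" for k
    using that nth_mem[of k xs] by (auto simp: \<tau>_def nth_append m_def setxs)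
  have tau_m: "\<tau> m = s" by (simp add: \<tau>_def m_def nth_append)
  have tau_idx: "\<exists>k<m. \<tau> k = u" if "u \<in> S" for u
    using that unfolding setxs[symmetric] in_set_conv_nth by (auto simp: \<tau>_def m_def nth_append)
  have le: "\<tau> k \<le> \<tau> l" if "k \<le> l" "l \<le> m" for k l
    using strict_mono_onD[OF mono, of k l] that by (cases "k = l") auto
  have range: "\<tau> ` {..m} \<subseteq> {0..T}"
  proof
    fix x assume "x \<in> \<tau> ` {..m}"
    then obtain k where "k \<le> m" "x = \<tau> k" by auto
    then show "x \<in> {0..T}" using tau_in[of k] tau_m S rs by (cases "k = m") auto
  qed
  have tau0: "\<tau> 0 = 0"
  proof -
    obtain k where "k < m" "\<tau> k = 0" using tau_idx[of 0] by (auto simp: S_def)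
    then have "\<tau> 0 \<le> 0" using le[of 0 k] by simp
    then show ?thesis using tau_in[OF m0] S by auto
  qed
  define l where "l = m - 1"
  have ml: "m = Suc l" using m0 by (simp add: l_def)
  have tau_last: "\<tau> (l) = r"
  proof -
    obtain k where "k < m" "\<tau> k = r" using tau_idx[of r] by (auto simp: S_def)
    then have "r \<le> \<tau> (l)" using le[of k "l"] by (simp add: ml)
    then show ?thesis using tau_in[of "l"] ml S by auto
  qed
  obtain idx where idx: "\<And>u. u \<in> U \<Longrightarrow> idx u < m \<and> \<tau> (idx u) = u"
    using tau_idx by (metis S_def insertCI)
  define X where "X = (\<lambda>(k, i :: 'd) (w :: real \<Rightarrow> real ^ 'd). (w (\<tau> (Suc k)) - w (\<tau> k)) $ i :: real)"
  have ind: "indep_vars (\<lambda>_. borel) X ({..<m} \<times> (UNIV :: 'd set))"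
    unfolding X_def using W mono range by (simp add: wiener_measure_def)
  define K1 K2 where "K1 = {..<l} \<times> (UNIV :: 'd set)" and "K2 = {l} \<times> (UNIV :: 'd set)"
  have K: "K1 \<subseteq> {..<m} \<times> UNIV" "K2 \<subseteq> {..<m} \<times> UNIV" "K1 \<inter> K2 = {}"
    by (auto simp: K1_def K2_def ml)
  have XK2: "X (l, i) w = (w s - w r) $ i" for i w
    using tau_m by (simp add: X_def tau_last ml)
  \<comment> \<open>the value of the path at time \<open>u\<close>, recovered from the increments before \<open>r\<close>\<close>
  define val where "val u p = (\<Sum>i\<in>UNIV. (\<Sum>k<idx u. p (k, i)) *\<^sub>R (axis i 1 :: real ^ 'd))" for u and p :: "nat \<times> 'd \<Rightarrow> real"
  have val_eq: "val u (\<lambda>i\<in>K1. X i w) = w u" if "w \<in> space W" "u \<in> U" for w u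
  proof -
    have sub: "{..<idx u} \<subseteq> {..<l}" using idx[OF that(2)] by (auto simp: ml)
    have "(\<Sum>k<idx u. (\<lambda>i\<in>K1. X i w) (k, i)) = w u $ i" for i
    proof -
      have "(\<Sum>k<idx u. (\<lambda>i\<in>K1. X i w) (k, i)) = (\<Sum>k<idx u. w (\<tau> (Suc k)) $ i - w (\<tau> k) $ i)"
        using sub by (intro sum.cong) (auto simp: K1_def X_def)
      also have "\<dots> = w u $ i"
        using idx[OF that(2)] tau0 wiener_path_zero[OF that(1)]
        using sum_lessThan_telescope[of "\<lambda>k. w (\<tau> k) $ i" "idx u"] by simp
      finally show ?thesis .
    qed
    then show ?thesis
      by (simp add: val_def basis_expansion scalar_mult_eq_scaleR[symmetric])
  qed
  \<comment> \<open>the indicator of the cylinder, as a function of the increments before \<open>r\<close>\<close>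
  define g where "g p = (\<Prod>u\<in>U. indicator (A u) (val u p) :: real)" for p
  have val_meas: "val u \<in> borel_measurable (PiM K1 (\<lambda>_. borel))" if "u \<in> U" for u
    unfolding val_def using idx[OF that, unfolded ml]
    by (intro borel_measurable_sum borel_measurable_scaleR measurable_const measurable_component_singleton)
       (auto simp: K1_def)
  have g_meas: "g \<in> borel_measurable (PiM K1 (\<lambda>_. borel))"
    unfolding g_def
    by (intro borel_measurable_prod measurable_compose[OF val_meas borel_measurable_indicator] A)
  have gC: "g (\<lambda>i\<in>K1. X i w) = indicator C w" if "w \<in> space W" for w
  proof -
    have "g (\<lambda>i\<in>K1. X i w) = (\<Prod>u\<in>U. indicator (A u) (w u))"
      unfolding g_def using val_eq[OF that] by (intro prod.cong) auto
    also have "\<dots> = indicator C w"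
      using U(1) that by (auto simp: C_def indicator_def prod_zero_iff)
    finally show ?thesis .
  qed
  have [measurable]: "(\<lambda>w. w u) \<in> borel_measurable W" if "u \<in> {0..T}" for u
    using wiener_coordinate_measurable that .
  have CM: "C \<in> sets W"
  proof -
    have "{w \<in> space W. w u \<in> A u} \<in> sets W" if "u \<in> U" for u
      using measurable_sets[OF wiener_coordinate_measurable A[of u], of u] that U rs
      by (auto simp: vimage_def Int_def conj_commute)
    then show ?thesis unfolding C_def
      by (intro sets.sets_Collect_finite_All U(1)) auto
  qed
  have gi: "integrable W (\<lambda>w. g (\<lambda>i\<in>K1. X i w))"
    using CM by (subst Bochner_Integration.integrable_cong[OF refl gC])
      (auto simp: integrable_indicator_iff emeasure_eq_measure)
  have key: "(\<integral>w. indicator C w * h (\<lambda>i\<in>K2. X i w) \<partial>W) = 0"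
    if h: "h \<in> borel_measurable (PiM K2 (\<lambda>_. borel))" "integrable W (\<lambda>w. h (\<lambda>i\<in>K2. X i w))"
      "(\<integral>w. h (\<lambda>i\<in>K2. X i w) \<partial>W) = 0" for h :: "_ \<Rightarrow> real"
  proof -
    have "(\<integral>w. indicator C w * h (\<lambda>i\<in>K2. X i w) \<partial>W) = (\<integral>w. g (\<lambda>i\<in>K1. X i w) * h (\<lambda>i\<in>K2. X i w) \<partial>W)"
      by (intro Bochner_Integration.integral_cong) (auto simp: gC)
    also have "\<dots> = 0"
      unfolding indep_vars_integral_mult[OF ind K g_meas h(1) gi h(2)] h(3) by (rule mult_zero_right)
    finally show ?thesis .
  qed
  note mom = wiener_increment_moments[OF rs]
  have p: "(\<lambda>p. p (l, i) :: real) \<in> borel_measurable (PiM K2 (\<lambda>_. borel))" for i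
    by (rule measurable_component_singleton) (simp add: K2_def)
  have rK2: "(\<lambda>i\<in>K2. X i w) (l, i) = (w s - w r) $ i" for w i
    by (simp add: K2_def XK2)
  have fm: "finite_measure W" by unfold_locales
  show "(\<integral>w. indicator C w * (w s - w r) $ i \<partial>W) = 0"
    using key[of "\<lambda>p. p (l, i)"] p mom sq_int_integrable[OF fm mom(1)] unfolding rK2 by simp
  have prod_int: "integrable W (\<lambda>w. (w s - w r) $ i * (w s - w r) $ j)"
    by (rule sq_int_mult[OF mom(1) mom(1)])
  have prod_val: "(\<integral>w. (w s - w r) $ i * (w s - w r) $ j \<partial>W) = (if i = j then s - r else 0)"
  proof (cases "i = j")
    case True then show ?thesis using mom(3) by (simp add: power2_eq_square)
  next
    case False
    let ?I = "{(l, i)}" and ?J = "{(l, j)}"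
    have "(\<integral>w. (\<lambda>p. p (l, i)) (\<lambda>i\<in>?I. X i w) * (\<lambda>p. p (l, j)) (\<lambda>i\<in>?J. X i w) \<partial>W)
      = (\<integral>w. (\<lambda>p. p (l, i)) (\<lambda>i\<in>?I. X i w) \<partial>W) * (\<integral>w. (\<lambda>p. p (l, j)) (\<lambda>i\<in>?J. X i w) \<partial>W)"
      by (rule indep_vars_integral_mult[OF ind])
         (use False ml sq_int_integrable[OF fm mom(1)] in
           \<open>auto simp: XK2 simp del: vector_minus_component intro!: measurable_component_singleton\<close>)
    then show ?thesis using False mom(2) by (simp add: XK2 del: vector_minus_component)
  qed
  define c where "c = (if i = j then s - r else 0)"
  have z: "(\<integral>w. (w s - w r) $ i * (w s - w r) $ j - c \<partial>W) = 0"
    unfolding Bochner_Integration.integral_diff[OF prod_int integrable_const] prod_val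
    by (simp add: c_def prob_space)
  have m: "(\<lambda>p. p (l, i) * p (l, j) - c) \<in> borel_measurable (PiM K2 (\<lambda>_. borel))"
    by (intro borel_measurable_diff borel_measurable_times p borel_measurable_const)
  show "(\<integral>w. indicator C w * ((w s - w r) $ i * (w s - w r) $ j - (if i = j then s - r else 0)) \<partial>W) = 0"
    unfolding c_def[symmetric]
    by (rule key[OF m, unfolded rK2, OF Bochner_Integration.integrable_diff[OF prod_int integrable_const] z])
qed

lemma space_aug_filtration: "space (aug_filtration W r) = space W"
  unfolding aug_filtration_def by (rule space_measure_of_conv)

lemma sets_aug_filtration: "sets (aug_filtration W r) = sigma_sets (space W)
     ({(\<lambda>w. w q) -` A \<inter> space W | q A. q \<in> {0..r} \<and> A \<in> sets borel} \<union> null_sets (completion W))"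
proof -
  have "null_sets (completion W) \<subseteq> Pow (space W)"
  proof
    fix N assume "N \<in> null_sets (completion W)"
    then have "N \<subseteq> space (completion W)" by (intro sets.sets_into_space null_setsD2)
    then show "N \<in> Pow (space W)" by simp
  qed
  then show ?thesis unfolding aug_filtration_def by (intro sets_measure_of Un_least) auto
qed

lemma wiener_null_sets_aug: "N \<in> null_sets (completion W) \<Longrightarrow> N \<in> sets (aug_filtration W r)"
  unfolding sets_aug_filtration by (rule sigma_sets.Basic) (rule UnI2)

lemma sets_aug_filtration_subset:
  assumes "r \<le> T" shows "sets (aug_filtration W r) \<subseteq> sets (completion W)"
  unfolding sets_aug_filtration space_completion[of W, symmetric]
proof (rule sets.sigma_sets_subset, rule Un_least, rule subsetI)
  fix D assume "D \<in> {(\<lambda>w. w q) -` A \<inter> space (completion W) | q A. q \<in> {0..r} \<and> A \<in> sets borel}"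
  then obtain q A where qA: "D = (\<lambda>w. w q) -` A \<inter> space W" "q \<in> {0..r}" "A \<in> sets borel" by auto
  then have "D \<in> sets W"
    using measurable_sets[OF wiener_coordinate_measurable, of q A] assms by auto
  then show "D \<in> sets (completion W)" by (rule sets_completionI_sets)
qed (auto simp: null_sets_def)

lemma aug_filtration_mono: "r \<le> s \<Longrightarrow> sets (aug_filtration W r) \<subseteq> sets (aug_filtration W s)"
  unfolding sets_aug_filtration by (rule sigma_sets_mono') fastforce

lemma aug_filtration_adapted:
  assumes "q \<in> {0..r}" shows "(\<lambda>w. w q) \<in> borel_measurable (aug_filtration W r)"
proof (rule measurableI)
  fix A :: "(real ^ 'd) set" assume "A \<in> sets borel"
  then show "(\<lambda>w. w q) -` A \<inter> space (aug_filtration W r) \<in> sets (aug_filtration W r)"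
    unfolding space_aug_filtration sets_aug_filtration
    by (intro sigma_sets.Basic UnI1 CollectI exI[of _ q] exI[of _ A]) (use assms in auto)
qed simp

text \<open>Finite-dimensional cylinder sets and null sets together form a \<open>\<pi>\<close>-system that generates the augmented
  filtration. This transfers an identity from cylinder sets to the whole past.\<close>

lemma aug_filtration_integral_zero:
  fixes h :: "(real \<Rightarrow> real ^ 'd) \<Rightarrow> real"
  assumes h: "integrable W h" and r: "0 \<le> r" "r \<le> T"
    and cyl: "\<And>U A. finite U \<Longrightarrow> U \<subseteq> {0..r} \<Longrightarrow> (\<And>u. A u \<in> sets borel) \<Longrightarrow>
      (\<integral>w. indicator {w \<in> space W. \<forall>u\<in>U. w u \<in> A u} w * h w \<partial>W) = 0"
    and D: "D \<in> sets (aug_filtration W r)"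
  shows "(\<integral>w. indicator D w * h w \<partial>completion W) = 0"
proof -
  define G1 where "G1 = {{w \<in> space W. \<forall>u\<in>U. w u \<in> A u} | U A.
    finite U \<and> U \<subseteq> {0..r} \<and> (\<forall>u. A u \<in> sets (borel :: (real ^ 'd) measure))}"
  define G where "G = G1 \<union> null_sets (completion W)"
  have G1_sets: "C \<in> sets W" if "C \<in> G1" for C
  proof -
    obtain U A where UA: "C = {w \<in> space W. \<forall>u\<in>U. w u \<in> A u}" "finite U" "U \<subseteq> {0..r}"
      "\<And>u. A u \<in> sets borel" using \<open>C \<in> G1\<close> by (auto simp: G1_def)
    have "{w \<in> space W. w u \<in> A u} \<in> sets W" if "u \<in> U" for u
      using measurable_sets[OF wiener_coordinate_measurable UA(4)[of u], of u] that UA(3) r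
      by (auto simp: vimage_def Int_def conj_commute)
    then show ?thesis unfolding UA(1)
      by (intro sets.sets_Collect_finite_All UA(2)) auto
  qed
  have G_sets: "G \<subseteq> sets (completion W)"
    using G1_sets by (auto simp: G_def null_sets_def intro: sets_completionI_sets)
  have Int1: "a \<inter> b \<in> G1" if a: "a \<in> G1" and b: "b \<in> G1" for a b
  proof -
    obtain U A where UA: "a = {w \<in> space W. \<forall>u\<in>U. w u \<in> A u}" "finite U" "U \<subseteq> {0..r}"
      "\<And>u. A u \<in> sets borel" using a by (auto simp: G1_def)
    obtain V C where VC: "b = {w \<in> space W. \<forall>u\<in>V. w u \<in> C u}" "finite V" "V \<subseteq> {0..r}"
      "\<And>u. C u \<in> sets borel" using b by (auto simp: G1_def)
    let ?E = "\<lambda>u. (if u \<in> U then A u else UNIV) \<inter> (if u \<in> V then C u else UNIV)"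
    have "a \<inter> b = {w \<in> space W. \<forall>u\<in>U \<union> V. w u \<in> ?E u}"
      unfolding UA(1) VC(1) by auto
    moreover have "finite (U \<union> V)" "U \<union> V \<subseteq> {0..r}" "\<forall>u. ?E u \<in> sets borel"
      using UA VC by auto
    ultimately show ?thesis unfolding G1_def mem_Collect_eq
      by (intro exI[of _ "U \<union> V"] exI[of _ ?E]) simp
  qed
  have null_Int: "a \<inter> b \<in> null_sets (completion W)"
    if "a \<in> null_sets (completion W)" for a b
    using null_sets_completion_subset[OF Int_lower1 that] .
  have stable: "Int_stable G"
  proof (rule Int_stableI)
    fix a b assume "a \<in> G" "b \<in> G"
    then show "a \<inter> b \<in> G"
      using Int1[of a b] null_Int[of a b] null_Int[of b a] by (auto simp: G_def Int_commute)
  qed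
  have sp: "space (completion W) \<in> G"
  proof -
    have "space W = {w \<in> space W. \<forall>u\<in>{}. w u \<in> (UNIV :: (real ^ 'd) set)}" by simp
    then have "space W \<in> G1" unfolding G1_def
      by (intro CollectI exI[of _ "{}"] exI[of _ "\<lambda>_. UNIV"]) auto
    then show ?thesis by (simp add: G_def)
  qed
  have zero: "(\<integral>w. indicator C w * h w \<partial>completion W) = 0" if "C \<in> G" for C
  proof (cases "C \<in> G1")
    case True
    then obtain U A where UA: "C = {w \<in> space W. \<forall>u\<in>U. w u \<in> A u}" "finite U" "U \<subseteq> {0..r}"
      "\<And>u. A u \<in> sets borel" by (auto simp: G1_def)
    have "(\<lambda>w. indicator C w * h w) \<in> borel_measurable W"
      using G1_sets[OF True] h by auto
    then show ?thesis
      using cyl[OF UA(2,3,4)] by (simp add: integral_completion UA(1))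
  next
    case False
    then have "C \<in> null_sets (completion W)" using that by (simp add: G_def)
    then have "AE w in completion W. indicator C w * h w = 0"
      by (auto dest!: AE_not_in elim!: eventually_mono)
    then show ?thesis by (rule integral_eq_zero_AE)
  qed
  have gens: "{(\<lambda>w. w q) -` A \<inter> space W | q A. q \<in> {0..r} \<and> A \<in> sets borel} \<subseteq> G1"
  proof (safe)
    fix q and A :: "(real ^ 'd) set" assume "q \<in> {0..r}" "A \<in> sets borel"
    then show "(\<lambda>w. w q) -` A \<inter> space W \<in> G1" unfolding G1_def
      by (intro CollectI exI[of _ "{q}"] exI[of _ "\<lambda>_. A"]) auto
  qed
  have "D \<in> sigma_sets (space (completion W)) G"
    unfolding space_completion G_def
    by (rule subsetD[OF sigma_sets_mono'[OF Un_mono[OF gens order_refl]] D[unfolded sets_aug_filtration]])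
  moreover have "integrable (completion W) h" using h by (simp add: integrable_completion)
  ultimately show ?thesis
    by (intro set_integral_zero_of_pi_system[OF _ stable G_sets sp zero])
qed

theorem wiener_brownian_filtration:
  "brownian_filtration (completion W) (aug_filtration W) (\<lambda>w s. w s) T"
proof -
  interpret W: prob_space W by (rule wiener_prob)
  interpret prob_space "completion W" by (rule W.prob_space_completion)
  have sq: "sq_int W (\<lambda>w. (w s - w r) $ i)" if "0 \<le> r" "r \<le> s" "s \<le> T" for r s i
    using wiener_increment_moments(1)[of r s i] that by (cases "r = s") (auto simp: sq_int_zero)
  have vec: "(\<lambda>w. w s - w r) \<in> borel_measurable W" if "0 \<le> r" "r \<le> s" "s \<le> T" for r s
    using that by (intro borel_measurable_diff wiener_coordinate_measurable) auto
  have sqc: "sq_int (completion W) (\<lambda>w. w s - w r)" if "0 \<le> r" "r \<le> s" "s \<le> T" for r s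
    using sq_int_vecI[OF vec[OF that] sq[OF that]] unfolding sq_int_def
    by (auto simp: integrable_completion measurable_completion)
  show ?thesis
  proof unfold_locales
    fix s assume s: "s \<in> {0..T}"
    show "subalgebra (completion W) (aug_filtration W s)"
      using sets_aug_filtration_subset[of s] s by (auto simp: subalgebra_def space_aug_filtration)
    show "(\<lambda>w. w s) \<in> borel_measurable (aug_filtration W s)"
      using s by (intro aug_filtration_adapted) auto
    fix N assume "N \<in> null_sets (completion W)"
    then show "N \<in> sets (aug_filtration W s)" by (rule wiener_null_sets_aug)
  next
    fix r s :: real assume rs: "0 \<le> r" "r \<le> s" "s \<le> T"
    show "sets (aug_filtration W r) \<subseteq> sets (aug_filtration W s)"
      by (rule aug_filtration_mono[OF rs(2)])
    show "sq_int (completion W) (\<lambda>w. w s - w r)" by (rule sqc[OF rs])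
    fix A i assume A: "A \<in> sets (aug_filtration W r)"
    show "(\<integral>w. indicator A w * (w s - w r) $ i \<partial>completion W) = 0"
    proof (cases "r = s")
      case False
      then have "r < s" using rs by simp
      show ?thesis
        by (rule aug_filtration_integral_zero[OF sq_int_integrable[OF W.finite_measure_axioms sq[OF rs]]
              rs(1) order_trans[OF rs(2,3)] _ A])
           (rule wiener_cylinder_increment(1)[OF rs(1) \<open>r < s\<close> rs(3)])
    qed simp
    fix j
    show "(\<integral>w. indicator A w * ((w s - w r) $ i * (w s - w r) $ j) \<partial>completion W)
        = (if i = j then s - r else 0) * prob A"
    proof (cases "r = s")
      case False
      then have "r < s" using rs by simp
      define c where "c = (if i = j then s - r else 0)"
      define p where "p w = (w s - w r) $ i * (w s - w r) $ j" for w :: "real \<Rightarrow> real ^ 'd"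
      have p: "integrable W p" unfolding p_def by (rule sq_int_mult[OF sq[OF rs] sq[OF rs]])
      have pc: "integrable (completion W) p" using p by (simp add: integrable_completion)
      have zero: "(\<integral>w. indicator A w * (p w - c) \<partial>completion W) = 0"
      proof (rule aug_filtration_integral_zero[OF Bochner_Integration.integrable_diff[OF p W.integrable_const]
            rs(1) order_trans[OF rs(2,3)] _ A])
        fix U and E :: "real \<Rightarrow> (real ^ 'd) set"
        assume "finite U" "U \<subseteq> {0..r}" "\<And>u. E u \<in> sets borel"
        then show "(\<integral>w. indicator {w \<in> space W. \<forall>u\<in>U. w u \<in> E u} w * (p w - c) \<partial>W) = 0"
          unfolding p_def c_def
          by (rule wiener_cylinder_increment(2)[OF rs(1) \<open>r < s\<close> rs(3)])
      qed
      have AM: "A \<in> sets (completion W)" using A sets_aug_filtration_subset[of r] rs by auto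
      have ip: "integrable (completion W) (\<lambda>w. indicator A w * p w)"
        using integrable_mult_indicator[OF AM pc] by simp
      have ic: "integrable (completion W) (\<lambda>w. indicator A w * c)"
        using integrable_mult_indicator[OF AM integrable_const[of c]] by simp
      have "(\<integral>w. indicator A w * (p w - c) \<partial>completion W)
        = (\<integral>w. indicator A w * p w \<partial>completion W) - (\<integral>w. indicator A w * c \<partial>completion W)"
        unfolding right_diff_distrib by (rule Bochner_Integration.integral_diff[OF ip ic])
      also have "(\<integral>w. indicator A w * c \<partial>completion W) = c * prob A"
        using AM sets.sets_into_space[OF AM] by (simp add: Int_absorb2)
      finally have "(\<integral>w. indicator A w * p w \<partial>completion W) = c * prob A"
        using zero by simp
      then show ?thesis unfolding p_def c_def .
    qed simp
  qed
qed

end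

section \<open>Increments of Brownian motion\<close>

lemma integrable_bounded_mult:
  fixes f g :: "_ \<Rightarrow> real"
  assumes g: "integrable M g" and f: "f \<in> borel_measurable M" and b: "\<And>x. x \<in> space M \<Longrightarrow> \<bar>f x\<bar> \<le> K"
  shows "integrable M (\<lambda>x. f x * g x)"
proof (rule Bochner_Integration.integrable_bound)
  show "integrable M (\<lambda>x. K * g x)" using g by simp
  show "(\<lambda>x. f x * g x) \<in> borel_measurable M" using g f by auto
  have "\<bar>f x\<bar> * \<bar>g x\<bar> \<le> \<bar>K\<bar> * \<bar>g x\<bar>" if "x \<in> space M" for x
    using b[OF that] by (intro mult_right_mono) auto
  then show "AE x in M. norm (f x * g x) \<le> norm (K * g x)"
    by (intro AE_I2) (simp add: abs_mult)
qed

context brownian_filtration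
begin

text \<open>The quantities \<open>E[1\<^sub>A V]\<close> with \<open>A\<close> in the initial \<open>\<sigma>\<close>-algebra replace conditional expectations
  throughout.\<close>

abbreviation expect_on :: "'w set \<Rightarrow> ('w \<Rightarrow> real) \<Rightarrow> real" where
  "expect_on A V \<equiv> \<integral>w. indicator A w * V w \<partial>M"

lemma sets_F_M: "s \<in> {0..T} \<Longrightarrow> A \<in> sets (F s) \<Longrightarrow> A \<in> sets M"
  using filtration_subalgebra by (auto simp: subalgebra_def)

lemma space_F: "s \<in> {0..T} \<Longrightarrow> space (F s) = space M"
  using filtration_subalgebra by (auto simp: subalgebra_def)

lemma measurable_F_M: "s \<in> {0..T} \<Longrightarrow> f \<in> borel_measurable (F s) \<Longrightarrow> f \<in> borel_measurable M"
  using filtration_subalgebra measurable_from_subalg by blast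

lemma measurable_F_mono:
  assumes "0 \<le> r" "r \<le> s" "s \<le> T" "f \<in> borel_measurable (F r)" shows "f \<in> borel_measurable (F s)"
proof -
  have "subalgebra (F s) (F r)"
    using filtration_mono[OF assms(1-3)] space_F[of r] space_F[of s] assms by (auto simp: subalgebra_def)
  then show ?thesis using assms(4) measurable_from_subalg by blast
qed

lemma sigma_finite_F: "s \<in> {0..T} \<Longrightarrow> sigma_finite_subalgebra M (F s)"
  by (intro finite_measure_subalgebra_is_sigma_finite finite_measure_subalgebra.intro
      finite_measure_axioms finite_measure_subalgebra_axioms.intro filtration_subalgebra)

abbreviation dB :: "real \<Rightarrow> real \<Rightarrow> 'd \<Rightarrow> 'w \<Rightarrow> real" where
  "dB a b i w \<equiv> (B w b - B w a) $ i"

lemma dB_sq_int: "0 \<le> a \<Longrightarrow> a \<le> b \<Longrightarrow> b \<le> T \<Longrightarrow> sq_int M (dB a b i)"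
  by (intro sq_int_component increment_sq_int)

lemma dB_measurable:
  assumes "0 \<le> a" "a \<le> b" "b \<le> c" "c \<le> T" shows "dB a b i \<in> borel_measurable (F c)"
proof -
  have "(\<lambda>w. B w b) \<in> borel_measurable (F c)" "(\<lambda>w. B w a) \<in> borel_measurable (F c)"
    using assms by (auto intro!: measurable_F_mono[OF _ _ _ adapted])
  then have "(\<lambda>w. B w b - B w a) \<in> borel_measurable (F c)" by (rule borel_measurable_diff)
  then show ?thesis by (rule measurable_compose[OF _ borel_measurable_nth])
qed

text \<open>The defining property of the increments extends from indicators to all factors known at time \<open>r\<close>.\<close>

lemma dB_mult_mean:
  assumes rs: "0 \<le> r" "r \<le> s" "s \<le> T" and h: "h \<in> borel_measurable (F r)"
    and i: "integrable M (\<lambda>w. h w * dB r s i w)"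
  shows "(\<integral>w. h w * dB r s i w \<partial>M) = 0"
proof -
  have r: "r \<in> {0..T}" using rs by simp
  have "(\<integral>w. h w * dB r s i w \<partial>M) = (\<integral>w. h w * 0 \<partial>M)"
    by (rule sigma_finite_subalgebra.integral_mult_eq_of_set_integrals_eq[OF sigma_finite_F[OF r]
          sq_int_integrable[OF finite_measure_axioms dB_sq_int[OF rs]] _ _ _ h i])
       (simp_all add: increment_mean[OF rs] del: vector_minus_component)
  then show ?thesis by simp
qed

lemma dB_mult_cov:
  assumes rs: "0 \<le> r" "r \<le> s" "s \<le> T" and h: "h \<in> borel_measurable (F r)"
    and i: "integrable M (\<lambda>w. h w * (dB r s i w * dB r s j w))"
  shows "(\<integral>w. h w * (dB r s i w * dB r s j w) \<partial>M) = (if i = j then s - r else 0) * (\<integral>w. h w \<partial>M)"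
proof -
  have r: "r \<in> {0..T}" using rs by simp
  define c where "c = (if i = j then s - r else 0)"
  have "(\<integral>w. h w * (dB r s i w * dB r s j w) \<partial>M) = (\<integral>w. h w * c \<partial>M)"
  proof (rule sigma_finite_subalgebra.integral_mult_eq_of_set_integrals_eq[OF sigma_finite_F[OF r]
          sq_int_mult[OF dB_sq_int[OF rs] dB_sq_int[OF rs]] _ _ _ h i])
    fix A assume A: "A \<in> sets (F r)"
    have "A \<subseteq> space M" using sets_F_M[OF r A] by (rule sets.sets_into_space)
    then show "expect_on A (\<lambda>w. dB r s i w * dB r s j w) = expect_on A (\<lambda>w. c)"
      unfolding increment_cov[OF rs A] c_def[symmetric] by (simp add: Int_absorb2)
  qed simp_all
  then show ?thesis by (simp add: c_def)
qed

lemma dB_split: "dB a c i w = dB a b i w + dB b c i w"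
  by simp

text \<open>Cut both increments at the end points of the other one. Disjoint pieces contribute nothing, as the later one is
  centred given the past; the common piece contributes its length.\<close>

lemma dB_cov_le:
  assumes ab: "0 \<le> a" "a \<le> c" "a \<le> b" "b \<le> T" and cd: "c \<le> d" "d \<le> T"
    and h: "h \<in> borel_measurable (F c)" and K: "\<And>w. w \<in> space M \<Longrightarrow> \<bar>h w\<bar> \<le> K"
  shows "(\<integral>w. h w * (dB a b i w * dB c d j w) \<partial>M)
    = (if i = j then max 0 (min b d - c) else 0) * (\<integral>w. h w \<partial>M)"
proof -
  have c: "0 \<le> c" "c \<le> T" "c \<in> {0..T}" using ab cd by auto
  have hM: "h \<in> borel_measurable M" by (rule measurable_F_M[OF c(3) h])
  have int: "integrable M (\<lambda>w. h w * (dB p q i w * dB u v j w))"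
    if "0 \<le> p" "p \<le> q" "q \<le> T" "0 \<le> u" "u \<le> v" "v \<le> T" for p q u v i j
    by (rule integrable_bounded_mult[OF sq_int_mult[OF dB_sq_int dB_sq_int] hM K]) (use that in auto)
  have zero: "(\<integral>w. h w * (dB p q i w * dB u v j w) \<partial>M) = 0"
    if "0 \<le> p" "p \<le> q" "q \<le> u" "c \<le> u" "u \<le> v" "v \<le> T" for p q u v i j
  proof -
    have "(\<integral>w. (h w * dB p q i w) * dB u v j w \<partial>M) = 0"
    proof (rule dB_mult_mean)
      show "(\<lambda>w. h w * dB p q i w) \<in> borel_measurable (F u)"
        using that c by (intro borel_measurable_times dB_measurable measurable_F_mono[OF _ _ _ h]) auto
      show "integrable M (\<lambda>w. (h w * dB p q i w) * dB u v j w)"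
        using int[of p q u v i j] that by (simp add: mult.assoc del: vector_minus_component)
    qed (use that in auto)
    then show ?thesis by (simp add: mult.assoc del: vector_minus_component)
  qed
  show ?thesis
  proof (cases "b \<le> c")
    case True
    then show ?thesis using zero[of a b c d i j] ab cd by simp
  next
    case False
    then have cb: "c \<le> b" by simp
    have "(\<integral>w. h w * (dB a b i w * dB c d j w) \<partial>M)
      = (\<integral>w. h w * (dB a c i w * dB c d j w) + h w * (dB c b i w * dB c d j w) \<partial>M)"
      unfolding dB_split[where a = a and c = b and b = c] by (simp only: distrib_left distrib_right)
    also have "\<dots> = (\<integral>w. h w * (dB a c i w * dB c d j w) \<partial>M) + (\<integral>w. h w * (dB c b i w * dB c d j w) \<partial>M)"
      by (rule Bochner_Integration.integral_add) (use ab cd c cb in \<open>auto intro!: int simp del: vector_minus_component\<close>)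
    also have "(\<integral>w. h w * (dB a c i w * dB c d j w) \<partial>M) = 0"
      by (rule zero) (use ab cd c in auto)
    also have "(\<integral>w. h w * (dB c b i w * dB c d j w) \<partial>M) = (if i = j then min b d - c else 0) * (\<integral>w. h w \<partial>M)"
    proof (cases "b \<le> d")
      case True
      have "(\<integral>w. h w * (dB c b i w * dB c d j w) \<partial>M)
        = (\<integral>w. h w * (dB c b i w * dB c b j w) + h w * (dB c b i w * dB b d j w) \<partial>M)"
        unfolding dB_split[where a = c and c = d and b = b] by (simp only: distrib_left distrib_right)
      also have "\<dots> = (\<integral>w. h w * (dB c b i w * dB c b j w) \<partial>M) + (\<integral>w. h w * (dB c b i w * dB b d j w) \<partial>M)"
        by (rule Bochner_Integration.integral_add) (use True ab cd c cb in \<open>auto intro!: int simp del: vector_minus_component\<close>)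
      also have "(\<integral>w. h w * (dB c b i w * dB b d j w) \<partial>M) = 0"
        by (rule zero) (use True ab cd c cb in auto)
      also have "(\<integral>w. h w * (dB c b i w * dB c b j w) \<partial>M) = (if i = j then b - c else 0) * (\<integral>w. h w \<partial>M)"
        by (rule dB_mult_cov) (use True ab cd c cb h in \<open>auto intro!: int simp del: vector_minus_component\<close>)
      finally show ?thesis using True by (simp add: min_def)
    next
      case False
      then have db: "d \<le> b" by simp
      have "(\<integral>w. h w * (dB c b i w * dB c d j w) \<partial>M)
        = (\<integral>w. h w * (dB c d i w * dB c d j w) + h w * (dB c d j w * dB d b i w) \<partial>M)"
        unfolding dB_split[where a = c and c = b and b = d]
        by (rule Bochner_Integration.integral_cong) (simp_all only: distrib_left distrib_right mult.commute)
      also have "\<dots> = (\<integral>w. h w * (dB c d i w * dB c d j w) \<partial>M) + (\<integral>w. h w * (dB c d j w * dB d b i w) \<partial>M)"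
        by (rule Bochner_Integration.integral_add) (use db ab cd c cb in \<open>auto intro!: int simp del: vector_minus_component\<close>)
      also have "(\<integral>w. h w * (dB c d j w * dB d b i w) \<partial>M) = 0"
        by (rule zero) (use db ab cd c cb in auto)
      also have "(\<integral>w. h w * (dB c d i w * dB c d j w) \<partial>M) = (if i = j then d - c else 0) * (\<integral>w. h w \<partial>M)"
        by (rule dB_mult_cov) (use db ab cd c cb h in \<open>auto intro!: int simp del: vector_minus_component\<close>)
      finally show ?thesis using db by (simp add: min_def)
    qed
    finally show ?thesis using cb cd by simp
  qed
qed

lemma dB_cov:
  assumes "0 \<le> a" "a \<le> b" "b \<le> T" and "0 \<le> c" "c \<le> d" "d \<le> T"
    and h: "h \<in> borel_measurable (F (max a c))" and K: "\<And>w. w \<in> space M \<Longrightarrow> \<bar>h w\<bar> \<le> K"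
  shows "(\<integral>w. h w * (dB a b i w * dB c d j w) \<partial>M)
    = (if i = j then max 0 (min b d - max a c) else 0) * (\<integral>w. h w \<partial>M)"
proof (cases "a \<le> c")
  case True
  then show ?thesis using dB_cov_le[of a c b d h K i j] assms by (simp add: max_def)
next
  case False
  then have "(\<integral>w. h w * (dB c d j w * dB a b i w) \<partial>M)
    = (if j = i then max 0 (min d b - a) else 0) * (\<integral>w. h w \<partial>M)"
    using dB_cov_le[of c a d b h K j i] assms by (simp add: max_def del: vector_minus_component)
  then show ?thesis using False by (simp only: mult.commute[of "dB c d j _"] min.commute max_def eq_commute[of i j]) simp
qed

text \<open>Expand both inner products into components and apply \<open>dB_cov\<close> to each pair, with the product of
  the two coefficients as the factor that is known at the later starting time.\<close>

lemma elementary_ito_isometry: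
  fixes \<xi> \<eta> :: "'w \<Rightarrow> real ^ 'd"
  assumes ab: "0 \<le> a" "a \<le> b" "b \<le> T" and cd: "0 \<le> c" "c \<le> d" "d \<le> T"
    and x: "\<xi> \<in> borel_measurable (F a)" "\<And>w. w \<in> space M \<Longrightarrow> norm (\<xi> w) \<le> K"
    and y: "\<eta> \<in> borel_measurable (F c)" "\<And>w. w \<in> space M \<Longrightarrow> norm (\<eta> w) \<le> K'"
    and A: "A \<in> sets (F (max a c))"
  shows "integrable M (\<lambda>w. indicator A w * ((\<xi> w \<bullet> (B w b - B w a)) * (\<eta> w \<bullet> (B w d - B w c))))"
    "expect_on A (\<lambda>w. (\<xi> w \<bullet> (B w b - B w a)) * (\<eta> w \<bullet> (B w d - B w c)))
     = max 0 (min b d - max a c) * expect_on A (\<lambda>w. \<xi> w \<bullet> \<eta> w)"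
proof -
  \<comment> \<open>both coefficients are known at time \<open>e\<close>, the later of the two starting times\<close>
  define e where "e = max a c"
  have e: "e \<in> {0..T}" "0 \<le> e" "e \<le> T" "a \<le> e" "c \<le> e" using ab cd by (auto simp: e_def)
  have A': "A \<in> sets (F e)" using A by (simp add: e_def)
  have x': "\<xi> \<in> borel_measurable (F e)" by (rule measurable_F_mono[OF ab(1) e(4) e(3) x(1)])
  have y': "\<eta> \<in> borel_measurable (F e)" by (rule measurable_F_mono[OF cd(1) e(5) e(3) y(1)])
  define h where "h i j w = indicator A w * (\<xi> w $ i * \<eta> w $ j)" for i j w
  have hF: "h i j \<in> borel_measurable (F e)" for i j
    unfolding h_def using A' by (intro borel_measurable_times borel_measurable_indicator
        measurable_compose[OF x' borel_measurable_nth] measurable_compose[OF y' borel_measurable_nth])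
  have hM: "h i j \<in> borel_measurable M" for i j by (rule measurable_F_M[OF e(1) hF])
  have hK: "\<bar>h i j w\<bar> \<le> \<bar>K\<bar> * \<bar>K'\<bar>" if "w \<in> space M" for i j w
  proof -
    have "\<bar>\<xi> w $ i\<bar> * \<bar>\<eta> w $ j\<bar> \<le> \<bar>K\<bar> * \<bar>K'\<bar>"
      using x(2)[OF that] y(2)[OF that] component_le_norm_cart[of "\<xi> w" i] component_le_norm_cart[of "\<eta> w" j]
      by (intro mult_mono) auto
    then show ?thesis by (auto simp: h_def indicator_def abs_mult)
  qed
  have int: "integrable M (\<lambda>w. h i j w * (dB a b i w * dB c d j w))" for i j
    by (rule integrable_bounded_mult[OF sq_int_mult[OF dB_sq_int[OF ab] dB_sq_int[OF cd]] hM hK])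
  have eq: "indicator A w * ((\<xi> w \<bullet> (B w b - B w a)) * (\<eta> w \<bullet> (B w d - B w c)))
    = (\<Sum>i\<in>UNIV. \<Sum>j\<in>UNIV. h i j w * (dB a b i w * dB c d j w))" for w
    by (simp add: inner_vec_def sum_product sum_distrib_left h_def ac_simps del: vector_minus_component)
  have hi: "integrable M (h i j)" for i j
    by (rule integrable_const_bound[where B = "\<bar>K\<bar> * \<bar>K'\<bar>"]) (use hK hM in auto)
  show "integrable M (\<lambda>w. indicator A w * ((\<xi> w \<bullet> (B w b - B w a)) * (\<eta> w \<bullet> (B w d - B w c))))"
    unfolding eq by (intro Bochner_Integration.integrable_sum int)
  have "expect_on A (\<lambda>w. (\<xi> w \<bullet> (B w b - B w a)) * (\<eta> w \<bullet> (B w d - B w c)))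
    = (\<Sum>i\<in>UNIV. \<Sum>j\<in>UNIV. (\<integral>w. h i j w * (dB a b i w * dB c d j w) \<partial>M))"
    unfolding eq by (simp add: Bochner_Integration.integral_sum Bochner_Integration.integrable_sum int del: vector_minus_component)
  also have "\<dots> = (\<Sum>i\<in>UNIV. \<Sum>j\<in>UNIV. (if i = j then max 0 (min b d - max a c) else 0) * (\<integral>w. h i j w \<partial>M))"
    by (intro sum.cong refl dB_cov[OF ab cd hF[unfolded e_def] hK])
  also have "\<dots> = (\<Sum>i\<in>UNIV. max 0 (min b d - max a c) * (\<integral>w. h i i w \<partial>M))"
    by (simp add: if_distrib[of "\<lambda>x. x * _"] cong: if_cong)
  also have "\<dots> = max 0 (min b d - max a c) * (\<integral>w. (\<Sum>i\<in>UNIV. h i i w) \<partial>M)"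
    by (simp add: Bochner_Integration.integral_sum hi sum_distrib_left)
  also have "(\<lambda>w. \<Sum>i\<in>UNIV. h i i w) = (\<lambda>w. indicator A w * (\<xi> w \<bullet> \<eta> w))"
    by (simp add: h_def inner_vec_def sum_distrib_left)
  finally show "expect_on A (\<lambda>w. (\<xi> w \<bullet> (B w b - B w a)) * (\<eta> w \<bullet> (B w d - B w c)))
     = max 0 (min b d - max a c) * expect_on A (\<lambda>w. \<xi> w \<bullet> \<eta> w)" .
qed

section \<open>Processes\<close>

text \<open>Square integrability of integrands refers to this product measure on \<open>[t,T] \<times> \<Omega>\<close>.\<close>

definition time_prod :: "real \<Rightarrow> (real \<times> 'w) measure" where
  "time_prod t = restrict_space lborel {t..T} \<Otimes>\<^sub>M M"

lemma finite_time: "finite_measure (restrict_space lborel {t..T})"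
  by (rule finite_measureI) (simp add: emeasure_restrict_space emeasure_lborel_Icc_eq)

lemma pair_sigma_finite_time: "pair_sigma_finite (restrict_space lborel {t..T}) M"
  using finite_time[of t] by (simp add: pair_sigma_finite_def finite_measure.sigma_finite_measure sigma_finite_measure_axioms)

lemma finite_time_prod: "finite_measure (time_prod t)"
  unfolding time_prod_def by (rule finite_measure_pair_measure[OF finite_measure_axioms finite_time])

lemma space_time_prod: "space (time_prod t) = {t..T} \<times> space M"
  by (simp add: time_prod_def space_pair_measure space_restrict_space)

lemma fst_time_prod_measurable: "fst \<in> borel_measurable (time_prod t)"
  unfolding time_prod_def by (rule measurable_compose[OF measurable_fst]) (simp add: measurable_restrict_space1)

lemma time_prod_snd_measurable: "f \<in> borel_measurable M \<Longrightarrow> (\<lambda>(r, w). f w) \<in> borel_measurable (time_prod t)"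
  unfolding time_prod_def case_prod_beta by (rule measurable_compose[OF measurable_snd])

lemma time_prod_snd_integrable:
  fixes f :: "'w \<Rightarrow> real"
  assumes "integrable M f" shows "integrable (time_prod t) (\<lambda>(r, w). f w)"
  unfolding time_prod_def
proof (rule pair_sigma_finite.Fubini_integrable[OF pair_sigma_finite_time])
  show "(\<lambda>(r, w). f w) \<in> borel_measurable (restrict_space lborel {t..T} \<Otimes>\<^sub>M M)"
    using time_prod_snd_measurable[of f t] assms by (simp add: time_prod_def)
qed (use assms finite_measure.integrable_const[OF finite_time] in auto)

lemma AE_time_prod:
  assumes "AE w in M. \<forall>r\<in>{t..T}. Q w r"
  shows "AE x in time_prod t. Q (snd x) (fst x)"
proof -
  obtain N where N: "N \<in> null_sets M" "{w \<in> space M. \<not> (\<forall>r\<in>{t..T}. Q w r)} \<subseteq> N"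
    using assms by (auto simp: eventually_ae_filter)
  let ?R = "restrict_space lborel {t..T}"
  have "space ?R \<times> N \<in> null_sets (time_prod t)"
    unfolding time_prod_def null_sets_def mem_Collect_eq
    using N(1) by (auto simp: emeasure_pair_measure_Times null_sets_def simp del: space_restrict_space2)
  moreover have "{x \<in> space (time_prod t). \<not> Q (snd x) (fst x)} \<subseteq> space ?R \<times> N"
  proof
    fix x assume "x \<in> {x \<in> space (time_prod t). \<not> Q (snd x) (fst x)}"
    then have x: "fst x \<in> {t..T}" "snd x \<in> space M" "\<not> Q (snd x) (fst x)"
      by (auto simp: space_time_prod)
    then have "snd x \<in> {w \<in> space M. \<not> (\<forall>r\<in>{t..T}. Q w r)}" by blast
    then have "snd x \<in> N" using N(2) by blast
    then show "x \<in> space ?R \<times> N" using x(1) by (simp add: space_restrict_space mem_Times_iff)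
  qed
  ultimately show ?thesis by (auto simp: eventually_ae_filter)
qed

definition sq_process :: "real \<Rightarrow> ('w \<Rightarrow> real \<Rightarrow> 'b::euclidean_space) \<Rightarrow> bool" where
  "sq_process t \<phi> \<longleftrightarrow> sq_int (time_prod t) (\<lambda>(r, w). \<phi> w r)"

lemma progressive_restrict:
  assumes "progressive F u T \<phi>" "0 \<le> u" "u \<le> t"
  shows "progressive F t T \<phi>"
  unfolding progressive_def
proof
  fix s assume s: "s \<in> {t..T}"
  have "(\<lambda>x. x) \<in> measurable (restrict_space borel {t..s} \<Otimes>\<^sub>M F s) (restrict_space borel {u..s} \<Otimes>\<^sub>M F s)"
  proof (rule measurable_pair)
    show "fst \<circ> (\<lambda>x. x) \<in> measurable (restrict_space borel {t..s} \<Otimes>\<^sub>M F s) (restrict_space borel {u..s})"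
      unfolding comp_def
    proof (rule measurable_restrict_space2)
      show "fst \<in> space (restrict_space borel {t..s} \<Otimes>\<^sub>M F s) \<rightarrow> {u..s}"
        using assms(3) by (auto simp: space_pair_measure space_restrict_space)
      show "fst \<in> borel_measurable (restrict_space borel {t..s} \<Otimes>\<^sub>M F s)"
        by (rule measurable_compose[OF measurable_fst]) (simp add: measurable_restrict_space1)
    qed
  qed (simp add: comp_def)
  moreover have "(\<lambda>(r, w). \<phi> w r) \<in> borel_measurable (restrict_space borel {u..s} \<Otimes>\<^sub>M F s)"
    using assms s by (simp add: progressive_def)
  ultimately show "(\<lambda>(r, w). \<phi> w r) \<in> borel_measurable (restrict_space borel {t..s} \<Otimes>\<^sub>M F s)"
    by (rule measurable_compose)
qed

lemma progressive_time_prod: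
  assumes "progressive F t T \<phi>" "0 \<le> t" "t \<le> T"
  shows "(\<lambda>(r, w). \<phi> w r) \<in> borel_measurable (time_prod t)"
proof -
  have TT: "T \<in> {0..T}" using assms by simp
  have "(\<lambda>x. x) \<in> measurable (time_prod t) (restrict_space borel {t..T} \<Otimes>\<^sub>M F T)"
    unfolding time_prod_def
  proof (rule measurable_pair)
    show "fst \<circ> (\<lambda>x. x) \<in> measurable (restrict_space lborel {t..T} \<Otimes>\<^sub>M M) (restrict_space borel {t..T})"
      by (auto simp: comp_def measurable_cong_sets[OF refl, of "restrict_space borel {t..T}" "restrict_space lborel {t..T}"] sets_restrict_space)
    have "(\<lambda>x. x) \<in> measurable M (F T)"
      by (rule measurable_from_subalg[OF filtration_subalgebra[OF TT]]) simp
    then show "snd \<circ> (\<lambda>x. x) \<in> measurable (restrict_space lborel {t..T} \<Otimes>\<^sub>M M) (F T)"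
      unfolding comp_def by (rule measurable_compose[OF measurable_snd])
  qed
  moreover have "(\<lambda>(r, w). \<phi> w r) \<in> borel_measurable (restrict_space borel {t..T} \<Otimes>\<^sub>M F T)"
    using assms by (simp add: progressive_def)
  ultimately show ?thesis by (rule measurable_compose)
qed

lemma progressive_section:
  assumes "progressive F t T \<phi>" "s \<in> {t..T}"
  shows "(\<lambda>w. \<phi> w s) \<in> borel_measurable (F s)"
proof -
  have "(\<lambda>(r, w). \<phi> w r) \<in> borel_measurable (restrict_space borel {t..s} \<Otimes>\<^sub>M F s)"
    using assms by (simp add: progressive_def)
  moreover have "s \<in> space (restrict_space borel {t..s})" using assms by (simp add: space_restrict_space)
  ultimately show ?thesis
    using measurable_compose[OF measurable_Pair1'[of s "restrict_space borel {t..s}" "F s"], of "\<lambda>(r, w). \<phi> w r" borel]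
    by simp
qed

lemma H2_sq_process:
  assumes "\<phi> \<in> H2 M F t T" "0 \<le> t" "t \<le> T" shows "sq_process t \<phi>"
  using assms progressive_time_prod[of t \<phi>]
  by (simp add: H2_def sq_process_def sq_int_def time_prod_def case_prod_beta')

lemma H2_I:
  assumes "progressive F t T \<phi>" "sq_process t \<phi>" shows "\<phi> \<in> H2 M F t T"
  using assms by (simp add: H2_def sq_process_def sq_int_def time_prod_def case_prod_beta')

lemma H2_progressive: "\<phi> \<in> H2 M F t T \<Longrightarrow> progressive F t T \<phi>"
  by (simp add: H2_def)

lemma H2_diff:
  fixes \<phi> \<psi> :: "'w \<Rightarrow> real \<Rightarrow> 'b::euclidean_space"
  assumes "\<phi> \<in> H2 M F t T" "\<psi> \<in> H2 M F t T" "0 \<le> t" "t \<le> T"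
  shows "(\<lambda>w r. \<phi> w r - \<psi> w r) \<in> H2 M F t T"
proof (rule H2_I)
  show "progressive F t T (\<lambda>w r. \<phi> w r - \<psi> w r)"
    unfolding progressive_def
  proof
    fix s assume s: "s \<in> {t..T}"
    have "(\<lambda>x. \<phi> (snd x) (fst x)) \<in> borel_measurable (restrict_space borel {t..s} \<Otimes>\<^sub>M F s)"
      "(\<lambda>x. \<psi> (snd x) (fst x)) \<in> borel_measurable (restrict_space borel {t..s} \<Otimes>\<^sub>M F s)"
      using H2_progressive[OF assms(1)] H2_progressive[OF assms(2)] s
      by (simp_all add: progressive_def case_prod_beta')
    from borel_measurable_diff[OF this]
    show "(\<lambda>(r, w). \<phi> w r - \<psi> w r) \<in> borel_measurable (restrict_space borel {t..s} \<Otimes>\<^sub>M F s)"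
      by (simp add: case_prod_beta')
  qed
  have "sq_int (time_prod t) (\<lambda>x. \<phi> (snd x) (fst x) - \<psi> (snd x) (fst x))"
    using H2_sq_process[OF assms(1,3,4)] H2_sq_process[OF assms(2,3,4)]
    unfolding sq_process_def case_prod_beta' by (rule sq_int_diff)
  then show "sq_process t (\<lambda>w r. \<phi> w r - \<psi> w r)"
    unfolding sq_process_def case_prod_beta' .
qed

lemma S2_adapted: "X \<in> S2 M F t T \<Longrightarrow> s \<in> {t..T} \<Longrightarrow> (\<lambda>w. X w s) \<in> borel_measurable (F s)"
  by (simp add: S2_def)

lemma S2_continuous: "X \<in> S2 M F t T \<Longrightarrow> w \<in> space M \<Longrightarrow> continuous_on {t..T} (X w)"
  by (simp add: S2_def)

definition sup_norm2 :: "real \<Rightarrow> real \<Rightarrow> ('w \<Rightarrow> real \<Rightarrow> 'b::real_normed_vector) \<Rightarrow> 'w \<Rightarrow> real" where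
  "sup_norm2 t u X w = (SUP s\<in>{t..u}. (norm (X w s))\<^sup>2)"

lemma S2_sup_integrable:
  assumes "X \<in> S2 M F t T" "t \<le> T" shows "integrable M (sup_norm2 t T X)"
proof -
  have "integrable M (\<lambda>w. (SUP s\<in>{t..T}. norm (X w s))\<^sup>2)" using assms by (simp add: S2_def)
  moreover have "(SUP s\<in>{t..T}. norm (X w s))\<^sup>2 = sup_norm2 t T X w" if "w \<in> space M" for w
    unfolding sup_norm2_def by (rule SUP_interval_power2[OF S2_continuous[OF assms(1) that] assms(2)])
  ultimately show ?thesis by (simp cong: Bochner_Integration.integrable_cong)
qed

lemma sup_norm2_upper:
  assumes "continuous_on {t..u} (X w)" "s \<in> {t..u}"
  shows "(norm (X w s))\<^sup>2 \<le> sup_norm2 t u X w"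
  unfolding sup_norm2_def
  by (rule SUP_interval_upper[where g = "\<lambda>s. (norm (X w s))\<^sup>2", OF _ assms(2)])
    (intro continuous_on_power continuous_on_norm assms(1))

lemma sup_norm2_le:
  assumes "t \<le> u" "\<And>s. s \<in> {t..u} \<Longrightarrow> (norm (X w s))\<^sup>2 \<le> c"
  shows "sup_norm2 t u X w \<le> c"
  unfolding sup_norm2_def using assms by (intro cSUP_least) auto

lemma sup_norm2_measurable:
  fixes X :: "'w \<Rightarrow> real \<Rightarrow> 'b::euclidean_space"
  assumes "\<And>s. s \<in> {t..u} \<Longrightarrow> (\<lambda>w. X w s) \<in> borel_measurable M"
    "\<And>w. w \<in> space M \<Longrightarrow> continuous_on {t..u} (X w)" "t \<le> u"
  shows "sup_norm2 t u X \<in> borel_measurable M"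
proof -
  have "(\<lambda>w. SUP s\<in>{t..u}. (norm (X w s))\<^sup>2) \<in> borel_measurable M"
  proof (rule borel_measurable_SUP_interval[OF _ _ assms(3)])
    fix s assume "s \<in> {t..u}"
    then show "(\<lambda>w. (norm (X w s))\<^sup>2) \<in> borel_measurable M"
      by (intro borel_measurable_power measurable_compose[OF assms(1) borel_measurable_norm])
  next
    fix w assume "w \<in> space M"
    then show "continuous_on {t..u} (\<lambda>s. (norm (X w s))\<^sup>2)"
      by (intro continuous_on_power continuous_on_norm assms(2))
  qed
  then show ?thesis by (simp add: sup_norm2_def[abs_def])
qed

lemma S2_measurable:
  assumes "X \<in> S2 M F t T" "s \<in> {t..T}" "0 \<le> t"
  shows "(\<lambda>w. X w s) \<in> borel_measurable M"
  using assms by (intro measurable_F_M[OF _ S2_adapted]) auto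

lemma S2_sq_int:
  fixes X :: "'w \<Rightarrow> real \<Rightarrow> 'b::euclidean_space"
  assumes "X \<in> S2 M F t T" "s \<in> {t..T}" "0 \<le> t"
  shows "sq_int M (\<lambda>w. X w s)"
proof (rule sq_int_bound)
  show "integrable M (sup_norm2 t T X)" by (rule S2_sup_integrable[OF assms(1)]) (use assms(2) in simp)
  show "AE w in M. (norm (X w s))\<^sup>2 \<le> sup_norm2 t T X w"
    by (rule AE_I2) (rule sup_norm2_upper[where X = X, OF S2_continuous[OF assms(1)] assms(2)])
qed (rule S2_measurable[OF assms])

lemma S2_diff:
  fixes X Y :: "'w \<Rightarrow> real \<Rightarrow> 'b::euclidean_space"
  assumes X: "X \<in> S2 M F t T" and Y: "Y \<in> S2 M F t T" and t: "0 \<le> t" "t \<le> T"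
  shows "(\<lambda>w s. X w s - Y w s) \<in> S2 M F t T"
proof -
  let ?D = "\<lambda>w s. X w s - Y w s"
  have cont: "continuous_on {t..T} (?D w)" if "w \<in> space M" for w
    by (intro continuous_intros S2_continuous[OF X that] S2_continuous[OF Y that])
  have "integrable M (sup_norm2 t T ?D)"
  proof (rule Bochner_Integration.integrable_bound)
    show "integrable M (\<lambda>w. 2 * sup_norm2 t T X w + 2 * sup_norm2 t T Y w)"
      using S2_sup_integrable[OF X t(2)] S2_sup_integrable[OF Y t(2)] by simp
    show "sup_norm2 t T ?D \<in> borel_measurable M"
      by (rule sup_norm2_measurable)
        (auto intro!: borel_measurable_diff S2_measurable[OF X _ t(1)] S2_measurable[OF Y _ t(1)] cont t)
    show "AE w in M. norm (sup_norm2 t T ?D w) \<le> norm (2 * sup_norm2 t T X w + 2 * sup_norm2 t T Y w)"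
    proof (rule AE_I2)
      fix w assume w: "w \<in> space M"
      have "0 \<le> (norm (?D w t))\<^sup>2" by simp
      also have "\<dots> \<le> sup_norm2 t T ?D w"
        by (rule sup_norm2_upper[where X = ?D, OF cont[OF w]]) (use t in auto)
      finally have nn: "0 \<le> sup_norm2 t T ?D w" .
      have "sup_norm2 t T ?D w \<le> 2 * sup_norm2 t T X w + 2 * sup_norm2 t T Y w"
      proof (rule sup_norm2_le[OF t(2)])
        fix s assume s: "s \<in> {t..T}"
        show "(norm (?D w s))\<^sup>2 \<le> 2 * sup_norm2 t T X w + 2 * sup_norm2 t T Y w"
          using norm_diff_power2_le[of "X w s" "Y w s"] sup_norm2_upper[where X = X, OF S2_continuous[OF X w] s]
            sup_norm2_upper[where X = Y, OF S2_continuous[OF Y w] s] by linarith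
      qed
      with nn show "norm (sup_norm2 t T ?D w) \<le> norm (2 * sup_norm2 t T X w + 2 * sup_norm2 t T Y w)"
        by simp
    qed
  qed
  moreover have "(SUP s\<in>{t..T}. norm (?D w s))\<^sup>2 = sup_norm2 t T ?D w" if "w \<in> space M" for w
    unfolding sup_norm2_def by (rule SUP_interval_power2[OF cont[OF that] t(2)])
  ultimately have "integrable M (\<lambda>w. (SUP s\<in>{t..T}. norm (?D w s))\<^sup>2)"
    by (simp cong: Bochner_Integration.integrable_cong)
  then show ?thesis unfolding S2_def
    using S2_adapted[OF X] S2_adapted[OF Y] cont by (auto intro!: borel_measurable_diff)
qed

lemma S2_component:
  fixes X :: "'w \<Rightarrow> real \<Rightarrow> real ^ 'n"
  assumes X: "X \<in> S2 M F t T" and t: "0 \<le> t" "t \<le> T"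
  shows "(\<lambda>w s. X w s $ i) \<in> S2 M F t T"
proof -
  let ?D = "\<lambda>w s. X w s $ i"
  have cont: "continuous_on {t..T} (?D w)" if "w \<in> space M" for w
    by (intro continuous_intros S2_continuous[OF X that])
  have "integrable M (sup_norm2 t T ?D)"
  proof (rule Bochner_Integration.integrable_bound)
    show "integrable M (sup_norm2 t T X)" by (rule S2_sup_integrable[OF X t(2)])
    show "sup_norm2 t T ?D \<in> borel_measurable M"
      by (rule sup_norm2_measurable)
        (auto intro!: measurable_compose[OF S2_measurable[OF X _ t(1)] borel_measurable_nth] cont t)
    show "AE w in M. norm (sup_norm2 t T ?D w) \<le> norm (sup_norm2 t T X w)"
    proof (rule AE_I2)
      fix w assume w: "w \<in> space M"
      have "0 \<le> (norm (?D w t))\<^sup>2" by simp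
      also have "\<dots> \<le> sup_norm2 t T ?D w"
        by (rule sup_norm2_upper[where X = ?D, OF cont[OF w]]) (use t in auto)
      finally have nn: "0 \<le> sup_norm2 t T ?D w" .
      have "sup_norm2 t T ?D w \<le> sup_norm2 t T X w"
      proof (rule sup_norm2_le[OF t(2)])
        fix s assume s: "s \<in> {t..T}"
        have "(norm (?D w s))\<^sup>2 \<le> (norm (X w s))\<^sup>2"
          by (intro power_mono) (auto simp: component_le_norm_cart)
        also have "\<dots> \<le> sup_norm2 t T X w" by (rule sup_norm2_upper[where X = X, OF S2_continuous[OF X w] s])
        finally show "(norm (?D w s))\<^sup>2 \<le> sup_norm2 t T X w" .
      qed
      with nn show "norm (sup_norm2 t T ?D w) \<le> norm (sup_norm2 t T X w)" by simp
    qed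
  qed
  moreover have "(SUP s\<in>{t..T}. norm (?D w s))\<^sup>2 = sup_norm2 t T ?D w" if "w \<in> space M" for w
    unfolding sup_norm2_def by (rule SUP_interval_power2[OF cont[OF that] t(2)])
  ultimately have "integrable M (\<lambda>w. (SUP s\<in>{t..T}. norm (?D w s))\<^sup>2)"
    by (simp cong: Bochner_Integration.integrable_cong)
  then show ?thesis unfolding S2_def
    using cont by (auto intro!: measurable_compose[OF S2_adapted[OF X] borel_measurable_nth])
qed

text \<open>A continuous adapted process is the composition of a function that is continuous in time with the time
  projection. Times outside of \<open>[t,s]\<close> are clamped to this interval to make the function continuous on the whole line.\<close>

lemma S2_progressive:
  fixes X :: "'w \<Rightarrow> real \<Rightarrow> 'b::euclidean_space"
  assumes X: "X \<in> S2 M F t T" and t: "0 \<le> t"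
  shows "progressive F t T X"
  unfolding progressive_def
proof
  fix s assume s: "s \<in> {t..T}"
  let ?N = "restrict_space borel {t..s} \<Otimes>\<^sub>M F s"
  define clamp where "clamp q = max t (min s q)" for q
  have cl: "clamp q \<in> {t..s}" for q using s by (auto simp: clamp_def)
  have sT: "s \<in> {0..T}" using s t by simp
  have "(\<lambda>x. X (snd x) (clamp (fst x))) \<in> borel_measurable ?N"
  proof (rule caratheodory_measurable[where g = "\<lambda>x q. X (snd x) (clamp q)" and L = fst])
    fix q :: real
    have "(\<lambda>w. X w (clamp q)) \<in> borel_measurable (F (clamp q))"
      using cl[of q] s by (intro S2_adapted[OF X]) auto
    then have "(\<lambda>w. X w (clamp q)) \<in> borel_measurable (F s)"
      using cl[of q] s t by (intro measurable_F_mono[of "clamp q" s]) auto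
    then show "(\<lambda>x. X (snd x) (clamp q)) \<in> borel_measurable ?N"
      by (rule measurable_compose[OF measurable_snd])
  next
    fix x assume "x \<in> space ?N"
    then have w: "snd x \<in> space M" by (auto simp: space_pair_measure space_F[OF sT])
    show "continuous_on UNIV (\<lambda>q. X (snd x) (clamp q))"
    proof (rule continuous_on_compose2[OF S2_continuous[OF X w]])
      show "continuous_on UNIV clamp" unfolding clamp_def by (intro continuous_intros)
      show "clamp ` UNIV \<subseteq> {t..T}"
      proof (rule image_subsetI)
        fix q show "clamp q \<in> {t..T}" using cl[of q] s by auto
      qed
    qed
  next
    show "fst \<in> borel_measurable ?N"
      by (rule measurable_compose[OF measurable_fst]) (simp add: measurable_restrict_space1)
  qed
  moreover have "X (snd x) (clamp (fst x)) = (\<lambda>(r, w). X w r) x" if "x \<in> space ?N" for x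
    using that by (auto simp: space_pair_measure space_restrict_space clamp_def)
  ultimately show "(\<lambda>(r, w). X w r) \<in> borel_measurable ?N"
    by (simp cong: measurable_cong)
qed

lemma S2_H2:
  fixes X :: "'w \<Rightarrow> real \<Rightarrow> 'b::euclidean_space"
  assumes X: "X \<in> S2 M F t T" and t: "0 \<le> t" "t \<le> T"
  shows "X \<in> H2 M F t T"
proof (rule H2_I[OF S2_progressive[OF X t(1)]])
  show "sq_process t X" unfolding sq_process_def
  proof (rule sq_int_bound)
    show "integrable (time_prod t) (\<lambda>(r, w). sup_norm2 t T X w)"
      by (rule time_prod_snd_integrable[OF S2_sup_integrable[OF X t(2)]])
    show "(\<lambda>(r, w). X w r) \<in> borel_measurable (time_prod t)"
      by (rule progressive_time_prod[OF S2_progressive[OF X t(1)] t])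
    show "AE x in time_prod t. (norm (case x of (r, w) \<Rightarrow> X w r))\<^sup>2 \<le> (case x of (r, w) \<Rightarrow> sup_norm2 t T X w)"
      by (rule AE_I2) (auto simp: space_time_prod intro!: sup_norm2_upper S2_continuous[OF X])
  qed
qed

end

section \<open>The It\^o integral\<close>

lemma L2_tendsto_inner_indicator:
  assumes f: "sq_int M f" and g: "sq_int M g" and fk: "\<And>k. sq_int M (fk k)" and gk: "\<And>k. sq_int M (gk k)"
    and fl: "(\<lambda>k. \<integral>\<^sup>+x. ennreal ((norm (f x - fk k x))\<^sup>2) \<partial>M) \<longlonglongrightarrow> 0"
    and gl: "(\<lambda>k. \<integral>\<^sup>+x. ennreal ((norm (g x - gk k x))\<^sup>2) \<partial>M) \<longlonglongrightarrow> 0"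
    and S: "S \<in> sets M"
  shows "(\<lambda>k. \<integral>x. indicator S x * (fk k x \<bullet> gk k x) \<partial>M) \<longlonglongrightarrow> (\<integral>x. indicator S x * (f x \<bullet> g x) \<partial>M)"
proof -
  have "(\<lambda>k. \<integral>x. (indicator S x *\<^sub>R fk k x) \<bullet> gk k x \<partial>M) \<longlonglongrightarrow> (\<integral>x. (indicator S x *\<^sub>R f x) \<bullet> g x \<partial>M)"
  proof (rule L2_tendsto_inner[OF sq_int_indicator[OF f S] g sq_int_indicator[OF fk S] gk _ gl])
    show "(\<lambda>k. \<integral>\<^sup>+x. ennreal ((norm (indicator S x *\<^sub>R f x - indicator S x *\<^sub>R fk k x))\<^sup>2) \<partial>M) \<longlonglongrightarrow> 0"
    proof (rule tendsto_sandwich[OF _ _ tendsto_const fl])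
      show "\<forall>\<^sub>F k in sequentially. (\<integral>\<^sup>+x. ennreal ((norm (indicator S x *\<^sub>R f x - indicator S x *\<^sub>R fk k x))\<^sup>2) \<partial>M)
          \<le> (\<integral>\<^sup>+x. ennreal ((norm (f x - fk k x))\<^sup>2) \<partial>M)"
        by (intro always_eventually allI nn_integral_mono) (simp add: indicator_def)
    qed simp
  qed
  then show ?thesis by simp
qed

context brownian_filtration
begin

lemma sq_process_iff: "sq_process t \<phi> \<longleftrightarrow> sq_int (time_prod t) (\<lambda>x. \<phi> (snd x) (fst x))"
  by (simp add: sq_process_def case_prod_beta')

text \<open>\<open>\<integral>\<^sub>t\<^sup>s E[1\<^sub>A h\<^sub>r] dr\<close>, written as a single integral over the product space so that the order of
  integration can be chosen later (\<open>tint_section\<close>, \<open>tint_time\<close>).\<close>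

definition tint :: "real \<Rightarrow> 'w set \<Rightarrow> real \<Rightarrow> ('w \<Rightarrow> real \<Rightarrow> real) \<Rightarrow> real" where
  "tint t A s h = (\<integral>x. indicator ({t..s} \<times> A) x * h (snd x) (fst x) \<partial>time_prod t)"

lemma sets_time_prod:
  assumes "A \<in> sets M" "s \<le> T" shows "{t..s} \<times> A \<in> sets (time_prod t)"
proof -
  have "{t..s} \<in> sets (restrict_space lborel {t..T})"
    using assms(2) by (subst sets_restrict_space_iff) auto
  then show ?thesis unfolding time_prod_def using assms(1) by (rule pair_measureI)
qed

lemma integral_time_prod_mult:
  fixes f g :: "_ \<Rightarrow> real"
  assumes S: "S \<in> sets borel" "S \<subseteq> {t..T}" and g: "integrable M g"
  shows "integrable (time_prod t) (\<lambda>x. indicator S (fst x) * g (snd x))"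
    "(\<integral>x. indicator S (fst x) * g (snd x) \<partial>time_prod t) = measure lborel S * (\<integral>w. g w \<partial>M)"
proof -
  have gi: "integrable (time_prod t) (\<lambda>x. g (snd x))"
    using time_prod_snd_integrable[OF g, of t] by (simp add: case_prod_beta')
  have im: "(\<lambda>x. indicator S (fst x) :: real) \<in> borel_measurable (time_prod t)"
    by (rule measurable_compose[OF fst_time_prod_measurable]) (use S in auto)
  show int: "integrable (time_prod t) (\<lambda>x. indicator S (fst x) * g (snd x))"
    by (rule integrable_bounded_mult[OF gi im, where K = 1]) (simp add: indicator_def)
  have "(\<integral>x. indicator S (fst x) * g (snd x) \<partial>time_prod t)
     = (\<integral>r. (\<integral>w. indicator S r * g w \<partial>M) \<partial>restrict_space lborel {t..T})"
    using pair_sigma_finite.integral_fst'[OF pair_sigma_finite_time int[unfolded time_prod_def]]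
    by (simp add: time_prod_def)
  also have "\<dots> = (\<integral>r. indicator S r \<partial>restrict_space lborel {t..T}) * (\<integral>w. g w \<partial>M)"
    by simp
  also have "(\<integral>r. indicator S r \<partial>restrict_space lborel {t..T}) = measure lborel S"
    using S by (subst Bochner_Integration.integral_indicator)
      (auto simp: space_restrict_space measure_restrict_space Int_absorb2)
  finally show "(\<integral>x. indicator S (fst x) * g (snd x) \<partial>time_prod t) = measure lborel S * (\<integral>w. g w \<partial>M)" .
qed

lemma inner_bounded_integrable:
  fixes \<xi> \<eta> :: "'w \<Rightarrow> real ^ 'd"
  assumes x: "\<xi> \<in> borel_measurable M" "\<And>w. w \<in> space M \<Longrightarrow> norm (\<xi> w) \<le> K"
    and y: "\<eta> \<in> borel_measurable M" "\<And>w. w \<in> space M \<Longrightarrow> norm (\<eta> w) \<le> K'"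
    and A: "A \<in> sets M"
  shows "integrable M (\<lambda>w. indicator A w * (\<xi> w \<bullet> \<eta> w))"
proof -
  have sx: "sq_int M \<xi>"
  proof (rule sq_int_bound[OF _ x(1)])
    show "integrable M (\<lambda>_. K\<^sup>2)" by simp
    show "AE w in M. (norm (\<xi> w))\<^sup>2 \<le> K\<^sup>2" by (intro AE_I2 power_mono x(2)) auto
  qed
  have sy: "sq_int M \<eta>"
  proof (rule sq_int_bound[OF _ y(1)])
    show "integrable M (\<lambda>_. K'\<^sup>2)" by simp
    show "AE w in M. (norm (\<eta> w))\<^sup>2 \<le> K'\<^sup>2" by (intro AE_I2 power_mono y(2)) auto
  qed
  show ?thesis using integrable_mult_indicator[OF A sq_int_inner[OF sx sy]] by simp
qed

text \<open>Stopping at time \<open>s\<close> replaces all end points by their minimum with \<open>s\<close>. If \<open>s\<close> precedes one of the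
  starting points, then the corresponding increment and the overlap of the two intervals both disappear.\<close>

lemma elementary_ito_isometry_at:
  fixes \<xi> \<eta> :: "'w \<Rightarrow> real ^ 'd"
  assumes t: "0 \<le> t" and ab: "t \<le> a" "a \<le> b" "b \<le> T" and cd: "t \<le> c" "c \<le> d" "d \<le> T"
    and s: "s \<in> {t..T}"
    and x: "\<xi> \<in> borel_measurable (F a)" "\<And>w. w \<in> space M \<Longrightarrow> norm (\<xi> w) \<le> K"
    and y: "\<eta> \<in> borel_measurable (F c)" "\<And>w. w \<in> space M \<Longrightarrow> norm (\<eta> w) \<le> K'"
    and A: "A \<in> sets (F t)"
  defines "g \<equiv> \<lambda>w. (\<xi> w \<bullet> (B w (min s b) - B w (min s a))) * (\<eta> w \<bullet> (B w (min s d) - B w (min s c)))"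
    and "h \<equiv> \<lambda>w r. (indicat_real {a<..b} r *\<^sub>R \<xi> w) \<bullet> (indicat_real {c<..d} r *\<^sub>R \<eta> w)"
  shows "integrable M (\<lambda>w. indicator A w * g w)"
    "integrable (time_prod t) (\<lambda>x. indicator ({t..s} \<times> A) x * h (snd x) (fst x))"
    "expect_on A (\<lambda>w. g w) = tint t A s h"
proof -
  have AM: "A \<in> sets M" using sets_F_M[OF _ A] t s by auto
  \<comment> \<open>\<open>{u<..v}\<close> is the overlap of the two intervals up to time \<open>s\<close>\<close>
  define u v where "u = max a c" and "v = min s (min b d)"
  define S where "S = {u<..v}"
  have S: "S \<in> sets borel" "S \<subseteq> {t..T}" using ab s by (auto simp: S_def u_def v_def)
  have a: "a \<in> {0..T}" and c: "c \<in> {0..T}" using t ab cd by auto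
  define q where "q w = indicator A w * (\<xi> w \<bullet> \<eta> w)" for w
  have qi: "integrable M q" unfolding q_def
    by (rule inner_bounded_integrable[OF measurable_F_M[OF a x(1)] x(2) measurable_F_M[OF c y(1)] y(2) AM])
  have eq: "indicator ({t..s} \<times> A) z * h (snd z) (fst z) = indicator S (fst z) * q (snd z)" for z
    using ab cd s by (auto simp: h_def q_def S_def u_def v_def indicator_def mem_Times_iff)
  show "integrable (time_prod t) (\<lambda>x. indicator ({t..s} \<times> A) x * h (snd x) (fst x))"
    unfolding eq by (rule integral_time_prod_mult(1)[OF S qi])
  have R: "tint t A s h = max 0 (v - u) * (\<integral>w. q w \<partial>M)"
    unfolding tint_def eq integral_time_prod_mult(2)[OF S qi] by (simp add: S_def measure_def max_def)
  have L: "integrable M (\<lambda>w. indicator A w * g w) \<and> expect_on A (\<lambda>w. g w) = max 0 (v - u) * (\<integral>w. q w \<partial>M)"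
  proof (cases "a \<le> s \<and> c \<le> s")
    case True
    have A': "A \<in> sets (F (max a c))"
    proof (rule subsetD[OF filtration_mono[OF t] A])
      show "t \<le> max a c" using ab by simp
      show "max a c \<le> T" using ab cd by simp
    qed
    have m: "min s a = a" "min s c = c" using True by auto
    have mm: "min (min s b) (min s d) = v" by (auto simp: v_def)
    show ?thesis unfolding g_def q_def m
      using elementary_ito_isometry[OF _ _ _ _ _ _ x y A', of "min s b" "min s d"] True t ab cd s
      unfolding mm u_def by auto
  next
    case False
    then have "g = (\<lambda>w. 0)"
      using ab cd by (auto simp: g_def min_def fun_eq_iff)
    moreover have "v \<le> u" using False by (auto simp: u_def v_def)
    ultimately show ?thesis by simp
  qed
  then show "integrable M (\<lambda>w. indicator A w * g w)" "expect_on A (\<lambda>w. g w) = tint t A s h"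
    using R by auto
qed

lemma simple_integrand_facts:
  assumes "simple_integrand F t T m \<tau> \<xi>" "i < m" "0 \<le> t"
  shows "t \<le> \<tau> i" "\<tau> i \<le> \<tau> (Suc i)" "\<tau> (Suc i) \<le> T" "\<xi> i \<in> borel_measurable (F (\<tau> i))"
    "\<exists>K. \<forall>w\<in>space M. norm (\<xi> i w) \<le> K"
proof -
  have mono: "mono_on {..m} \<tau>" and sub: "\<tau> ` {..m} \<subseteq> {t..T}"
    and x: "\<xi> i \<in> borel_measurable (F (\<tau> i))" "bounded (\<xi> i ` space (F (\<tau> i)))"
    using assms by (auto simp: simple_integrand_def)
  show "\<tau> i \<le> \<tau> (Suc i)" using assms(2) by (intro mono_onD[OF mono]) auto
  have "\<tau> i \<in> {t..T}" "\<tau> (Suc i) \<in> {t..T}" using subsetD[OF sub imageI, of i] subsetD[OF sub imageI, of "Suc i"] assms(2) by simp_all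
  then show "t \<le> \<tau> i" "\<tau> (Suc i) \<le> T" by auto
  have "\<tau> i \<in> {0..T}" using \<open>\<tau> i \<in> {t..T}\<close> assms(3) by auto
  then show "\<exists>K. \<forall>w\<in>space M. norm (\<xi> i w) \<le> K"
    using x(2) by (auto simp: bounded_iff space_F)
  show "\<xi> i \<in> borel_measurable (F (\<tau> i))" by (rule x(1))
qed

lemma simple_ito_isometry:
  assumes X: "simple_integrand F t T m \<tau> \<xi>" and Y: "simple_integrand F t T n \<rho> \<eta>"
    and t: "0 \<le> t" and s: "s \<in> {t..T}" and A: "A \<in> sets (F t)"
  shows "expect_on A (\<lambda>w. simple_ito B m \<tau> \<xi> w s * simple_ito B n \<rho> \<eta> w s)
    = tint t A s (\<lambda>w r. simple_process m \<tau> \<xi> w r \<bullet> simple_process n \<rho> \<eta> w r)"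
proof -
  define g where "g i j w = (\<xi> i w \<bullet> (B w (min s (\<tau> (Suc i))) - B w (min s (\<tau> i))))
      * (\<eta> j w \<bullet> (B w (min s (\<rho> (Suc j))) - B w (min s (\<rho> j))))" for i j w
  define h where "h i j w r = (indicat_real {\<tau> i<..\<tau> (Suc i)} r *\<^sub>R \<xi> i w) \<bullet> (indicat_real {\<rho> j<..\<rho> (Suc j)} r *\<^sub>R \<eta> j w)" for i j w r
  have *: "integrable M (\<lambda>w. indicator A w * g i j w) \<and>
      integrable (time_prod t) (\<lambda>x. indicator ({t..s} \<times> A) x * h i j (snd x) (fst x)) \<and>
      expect_on A (\<lambda>w. g i j w) = tint t A s (h i j)" if "i < m" "j < n" for i j
  proof -
    note fx = simple_integrand_facts[OF X that(1) t]
    note fy = simple_integrand_facts[OF Y that(2) t]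
    obtain K where K: "\<And>w. w \<in> space M \<Longrightarrow> norm (\<xi> i w) \<le> K" using fx(5) by blast
    obtain K' where K': "\<And>w. w \<in> space M \<Longrightarrow> norm (\<eta> j w) \<le> K'" using fy(5) by blast
    show ?thesis unfolding g_def h_def
      using elementary_ito_isometry_at[OF t fx(1-3) fy(1-3) s fx(4) K fy(4) K' A] by simp
  qed
  have "indicator A w * (simple_ito B m \<tau> \<xi> w s * simple_ito B n \<rho> \<eta> w s)
    = (\<Sum>i<m. \<Sum>j<n. indicator A w * g i j w)" for w
    unfolding simple_ito_def g_def sum_product by (simp only: sum_distrib_left)
  then have "expect_on A (\<lambda>w. simple_ito B m \<tau> \<xi> w s * simple_ito B n \<rho> \<eta> w s)
    = (\<integral>w. (\<Sum>i<m. \<Sum>j<n. indicator A w * g i j w) \<partial>M)"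
    by simp
  also have "\<dots> = (\<Sum>i<m. \<Sum>j<n. expect_on A (\<lambda>w. g i j w))"
    using * by (subst Bochner_Integration.integral_sum, force intro!: Bochner_Integration.integrable_sum)
      (intro sum.cong refl Bochner_Integration.integral_sum, auto)
  also have "\<dots> = (\<Sum>i<m. \<Sum>j<n. tint t A s (h i j))"
    using * by (intro sum.cong refl) auto
  also have "\<dots> = (\<integral>x. (\<Sum>i<m. \<Sum>j<n. indicator ({t..s} \<times> A) x * h i j (snd x) (fst x)) \<partial>time_prod t)"
    unfolding tint_def
    using * by (subst Bochner_Integration.integral_sum, force intro!: Bochner_Integration.integrable_sum)
      (intro sum.cong refl Bochner_Integration.integral_sum[symmetric], auto)
  also have "\<dots> = tint t A s (\<lambda>w r. simple_process m \<tau> \<xi> w r \<bullet> simple_process n \<rho> \<eta> w r)"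
    unfolding tint_def simple_process_def h_def inner_sum_left
    by (simp only: inner_sum_right sum_distrib_left)
  finally show ?thesis .
qed

lemma simple_ito_sq_int:
  assumes X: "simple_integrand F t T m \<tau> \<xi>" and t: "0 \<le> t" and s: "s \<in> {t..T}"
  shows "sq_int M (\<lambda>w. simple_ito B m \<tau> \<xi> w s)"
  unfolding simple_ito_def
proof (rule sq_int_sum)
  fix i assume "i \<in> {..<m}"
  then have i: "i < m" by simp
  note f = simple_integrand_facts[OF X i t]
  obtain K where K: "\<And>w. w \<in> space M \<Longrightarrow> norm (\<xi> i w) \<le> K" using f(5) by blast
  have ti: "\<tau> i \<in> {0..T}" using f t by auto
  let ?D = "\<lambda>w. B w (min s (\<tau> (Suc i))) - B w (min s (\<tau> i))"
  have D: "sq_int M ?D" by (rule increment_sq_int) (use f s t in auto)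
  show "sq_int M (\<lambda>w. \<xi> i w \<bullet> ?D w)"
  proof (rule sq_int_mono[OF sq_int_scaleR[OF D, of K]])
    show "(\<lambda>w. \<xi> i w \<bullet> ?D w) \<in> borel_measurable M"
      by (rule borel_measurable_inner[OF measurable_F_M[OF ti f(4)] sq_int_measurable[OF D]])
    show "AE w in M. norm (\<xi> i w \<bullet> ?D w) \<le> norm (K *\<^sub>R ?D w)"
    proof (rule AE_I2)
      fix w assume "w \<in> space M"
      then have "norm (\<xi> i w) * norm (?D w) \<le> \<bar>K\<bar> * norm (?D w)"
        using K[of w] by (intro mult_right_mono) auto
      then show "norm (\<xi> i w \<bullet> ?D w) \<le> norm (K *\<^sub>R ?D w)"
        using Cauchy_Schwarz_ineq2[of "\<xi> i w" "?D w"] by simp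
    qed
  qed
qed

lemma simple_process_sq_process:
  assumes X: "simple_integrand F t T m \<tau> \<xi>" and t: "0 \<le> t"
  shows "sq_process t (simple_process m \<tau> \<xi>)"
  unfolding sq_process_iff simple_process_def
proof (rule sq_int_sum)
  fix i assume "i \<in> {..<m}"
  then have i: "i < m" by simp
  note f = simple_integrand_facts[OF X i t]
  obtain K where K: "\<And>w. w \<in> space M \<Longrightarrow> norm (\<xi> i w) \<le> K" using f(5) by blast
  have ti: "\<tau> i \<in> {0..T}" using f t by auto
  let ?f = "\<lambda>x. indicat_real {\<tau> i<..\<tau> (Suc i)} (fst x) *\<^sub>R \<xi> i (snd x)"
  show "sq_int (time_prod t) ?f"
  proof (rule sq_int_bound)
    show "integrable (time_prod t) (\<lambda>_. K\<^sup>2)"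
      by (rule finite_measure.integrable_const[OF finite_time_prod])
    have "(\<lambda>x. \<xi> i (snd x)) \<in> borel_measurable (time_prod t)"
      using time_prod_snd_measurable[OF measurable_F_M[OF ti f(4)], of t] by (simp add: case_prod_beta')
    moreover have "(\<lambda>x. indicat_real {\<tau> i<..\<tau> (Suc i)} (fst x)) \<in> borel_measurable (time_prod t)"
      by (rule measurable_compose[OF fst_time_prod_measurable]) simp
    ultimately show "?f \<in> borel_measurable (time_prod t)" by (rule borel_measurable_scaleR[rotated])
    show "AE x in time_prod t. (norm (?f x))\<^sup>2 \<le> K\<^sup>2"
    proof (rule AE_I2)
      fix x assume "x \<in> space (time_prod t)"
      then have "norm (\<xi> i (snd x)) \<le> K" using K by (simp add: space_time_prod mem_Times_iff)
      moreover have "0 \<le> K" using norm_ge_zero \<open>norm (\<xi> i (snd x)) \<le> K\<close> by (rule order_trans)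
      ultimately have "norm (?f x) \<le> K" by (auto simp: indicator_def)
      then show "(norm (?f x))\<^sup>2 \<le> K\<^sup>2" by (intro power_mono) auto
    qed
  qed
qed

text \<open>After time \<open>s\<close>, the \<open>i\<close>-th summand only gains the increment of \<open>B\<close> over the part of
  the \<open>i\<close>-th step that lies in \<open>(s,u]\<close>. Its coefficient and the set \<open>A\<close> are known at the beginning of that part.\<close>

lemma simple_ito_martingale:
  assumes X: "simple_integrand F t T m \<tau> \<xi>" and t: "0 \<le> t" and su: "t \<le> s" "s \<le> u" "u \<le> T"
    and A: "A \<in> sets (F s)"
  shows "expect_on A (\<lambda>w. simple_ito B m \<tau> \<xi> w u) = expect_on A (\<lambda>w. simple_ito B m \<tau> \<xi> w s)"
proof -
  have sT: "s \<in> {0..T}" using t su by simp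
  have AM: "A \<in> sets M" by (rule sets_F_M[OF sT A])
  have su': "s \<in> {t..T}" "u \<in> {t..T}" using su by auto
  \<comment> \<open>\<open>{p i<..q i}\<close> is the part of the \<open>i\<close>-th step in \<open>{s<..u}\<close>; for an empty part, \<open>p i = q i\<close>\<close>
  define p where "p i = min u (min (\<tau> (Suc i)) (max s (\<tau> i)))" for i
  define q where "q i = min u (\<tau> (Suc i))" for i
  have "simple_ito B m \<tau> \<xi> w u - simple_ito B m \<tau> \<xi> w s = (\<Sum>i<m. \<xi> i w \<bullet> (B w (q i) - B w (p i)))" for w
    unfolding simple_ito_def sum_subtractf[symmetric]
  proof (rule sum.cong[OF refl])
    fix i assume "i \<in> {..<m}"
    then have "\<tau> i \<le> \<tau> (Suc i)" using simple_integrand_facts(2)[OF X _ t] by auto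
    then have "B w (min u (\<tau> (Suc i))) - B w (min u (\<tau> i)) - (B w (min s (\<tau> (Suc i))) - B w (min s (\<tau> i)))
      = B w (q i) - B w (p i)"
      using su by (auto simp: p_def q_def min_def max_def)
    then show "\<xi> i w \<bullet> (B w (min u (\<tau> (Suc i))) - B w (min u (\<tau> i)))
      - \<xi> i w \<bullet> (B w (min s (\<tau> (Suc i))) - B w (min s (\<tau> i))) = \<xi> i w \<bullet> (B w (q i) - B w (p i))"
      by (simp only: inner_diff_right[symmetric])
  qed
  note diff = this
  have zero: "integrable M (\<lambda>w. indicator A w * (\<xi> i w \<bullet> (B w (q i) - B w (p i)))) \<and>
    expect_on A (\<lambda>w. \<xi> i w \<bullet> (B w (q i) - B w (p i))) = 0" if i: "i < m" for i
  proof (cases "p i = q i")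
    case False
    note f = simple_integrand_facts[OF X i t]
    obtain K where K: "\<And>w. w \<in> space M \<Longrightarrow> norm (\<xi> i w) \<le> K" using f(5) by blast
    have pq: "p i = max s (\<tau> i)" "p i \<le> q i" "q i \<le> T" "s \<le> p i" "\<tau> i \<le> p i" "0 \<le> p i" "p i \<in> {0..T}"
      using False f su t by (auto simp: p_def q_def min_def max_def split: if_splits)
    have x: "\<xi> i \<in> borel_measurable (F (p i))"
      using pq f t by (intro measurable_F_mono[OF _ pq(5) _ f(4)]) auto
    have A': "A \<in> sets (F (p i))" using filtration_mono[of s "p i"] A pq sT by auto
    have hF: "(\<lambda>w. indicator A w * \<xi> i w $ j) \<in> borel_measurable (F (p i))" for j
      using A' by (intro borel_measurable_times borel_measurable_indicator measurable_compose[OF x borel_measurable_nth])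
    have hK: "\<bar>indicator A w * \<xi> i w $ j\<bar> \<le> \<bar>K\<bar>" if "w \<in> space M" for j w
      using K[OF that] component_le_norm_cart[of "\<xi> i w" j] by (auto simp: indicator_def)
    have int: "integrable M (\<lambda>w. (indicator A w * \<xi> i w $ j) * dB (p i) (q i) j w)" for j
      by (rule integrable_bounded_mult[OF sq_int_integrable[OF finite_measure_axioms dB_sq_int[OF pq(6,2,3)]]
          measurable_F_M[OF pq(7) hF] hK])
    have eq: "indicator A w * (\<xi> i w \<bullet> (B w (q i) - B w (p i)))
      = (\<Sum>j\<in>UNIV. (indicator A w * \<xi> i w $ j) * dB (p i) (q i) j w)" for w
      by (simp add: inner_vec_def sum_distrib_left mult.assoc del: vector_minus_component)
    show ?thesis unfolding eq
      using int dB_mult_mean[OF pq(6,2,3) hF int]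
      by (simp add: Bochner_Integration.integral_sum Bochner_Integration.integrable_sum del: vector_minus_component)
  qed simp
  note iu = integrable_mult_indicator[OF AM sq_int_integrable[OF finite_measure_axioms simple_ito_sq_int[OF X t su'(2)]]]
  note i_s = integrable_mult_indicator[OF AM sq_int_integrable[OF finite_measure_axioms simple_ito_sq_int[OF X t su'(1)]]]
  have "expect_on A (\<lambda>w. simple_ito B m \<tau> \<xi> w u) - expect_on A (\<lambda>w. simple_ito B m \<tau> \<xi> w s)
    = (\<integral>w. indicator A w * simple_ito B m \<tau> \<xi> w u - indicator A w * simple_ito B m \<tau> \<xi> w s \<partial>M)"
    by (rule Bochner_Integration.integral_diff[symmetric]) (use iu i_s in simp_all)
  also have "\<dots> = (\<integral>w. (\<Sum>i<m. indicator A w * (\<xi> i w \<bullet> (B w (q i) - B w (p i)))) \<partial>M)"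
    by (simp only: right_diff_distrib[symmetric] diff sum_distrib_left)
  also have "\<dots> = 0"
    using zero by (subst Bochner_Integration.integral_sum) auto
  finally show ?thesis by simp
qed

lemma has_ito_sq:
  assumes "has_ito_integral M F B t T \<phi> I" "0 \<le> t" "t \<le> T"
  shows "sq_process t \<phi>" "s \<in> {t..T} \<Longrightarrow> sq_int M (\<lambda>w. I w s)"
proof -
  have "\<phi> \<in> H2 M F t T" "I \<in> S2 M F t T" using assms(1) by (auto simp: has_ito_integral_def)
  then show "sq_process t \<phi>" "s \<in> {t..T} \<Longrightarrow> sq_int M (\<lambda>w. I w s)"
    using H2_sq_process[OF _ assms(2,3)] S2_sq_int[OF _ _ assms(2)] by blast+
qed

lemma has_ito_integral_approx:
  assumes "has_ito_integral M F B t T \<phi> I"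
  obtains m \<tau> \<xi> where "\<And>k. simple_integrand F t T (m k) (\<tau> k) (\<xi> k)"
    "(\<lambda>k. \<integral>\<^sup>+x. ennreal ((norm (\<phi> (snd x) (fst x) - simple_process (m k) (\<tau> k) (\<xi> k) (snd x) (fst x)))\<^sup>2)
       \<partial>time_prod t) \<longlonglongrightarrow> 0"
    "\<And>s. s \<in> {t..T} \<Longrightarrow> (\<lambda>k. \<integral>\<^sup>+w. ennreal ((norm (I w s - simple_ito B (m k) (\<tau> k) (\<xi> k) w s))\<^sup>2) \<partial>M) \<longlonglongrightarrow> 0"
  using assms unfolding has_ito_integral_def time_prod_def real_norm_def power2_abs case_prod_beta' by blast

text \<open>Both sides are continuous in the \<open>L\<^sup>2\<close> norms in which the approximating simple processes converge.\<close>

lemma has_ito_isometry: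
  assumes X: "has_ito_integral M F B t T \<phi> I" and Y: "has_ito_integral M F B t T \<psi> J"
    and t: "0 \<le> t" "t \<le> T" and s: "s \<in> {t..T}" and A: "A \<in> sets (F t)"
  shows "expect_on A (\<lambda>w. I w s * J w s) = tint t A s (\<lambda>w r. \<phi> w r \<bullet> \<psi> w r)"
proof -
  have AM: "A \<in> sets M" using sets_F_M[OF _ A] t by auto
  have AP: "{t..s} \<times> A \<in> sets (time_prod t)" by (rule sets_time_prod[OF AM]) (use s in simp)
  obtain m \<tau> \<xi> where x: "\<And>k. simple_integrand F t T (m k) (\<tau> k) (\<xi> k)"
    "(\<lambda>k. \<integral>\<^sup>+x. ennreal ((norm (\<phi> (snd x) (fst x) - simple_process (m k) (\<tau> k) (\<xi> k) (snd x) (fst x)))\<^sup>2)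
       \<partial>time_prod t) \<longlonglongrightarrow> 0"
    "\<And>s. s \<in> {t..T} \<Longrightarrow> (\<lambda>k. \<integral>\<^sup>+w. ennreal ((norm (I w s - simple_ito B (m k) (\<tau> k) (\<xi> k) w s))\<^sup>2) \<partial>M) \<longlonglongrightarrow> 0"
    by (rule has_ito_integral_approx[OF X]) (rule that)
  obtain n \<rho> \<eta> where y: "\<And>k. simple_integrand F t T (n k) (\<rho> k) (\<eta> k)"
    "(\<lambda>k. \<integral>\<^sup>+x. ennreal ((norm (\<psi> (snd x) (fst x) - simple_process (n k) (\<rho> k) (\<eta> k) (snd x) (fst x)))\<^sup>2)
       \<partial>time_prod t) \<longlonglongrightarrow> 0"
    "\<And>s. s \<in> {t..T} \<Longrightarrow> (\<lambda>k. \<integral>\<^sup>+w. ennreal ((norm (J w s - simple_ito B (n k) (\<rho> k) (\<eta> k) w s))\<^sup>2) \<partial>M) \<longlonglongrightarrow> 0"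
    by (rule has_ito_integral_approx[OF Y]) (rule that)
  have 1: "(\<lambda>k. \<integral>w. indicator A w * (simple_ito B (m k) (\<tau> k) (\<xi> k) w s \<bullet> simple_ito B (n k) (\<rho> k) (\<eta> k) w s) \<partial>M)
      \<longlonglongrightarrow> expect_on A (\<lambda>w. I w s \<bullet> J w s)"
    by (rule L2_tendsto_inner_indicator[OF has_ito_sq(2)[OF X t s] has_ito_sq(2)[OF Y t s]
        simple_ito_sq_int[OF x(1) t(1) s] simple_ito_sq_int[OF y(1) t(1) s] x(3)[OF s] y(3)[OF s] AM])
  have 2: "(\<lambda>k. \<integral>x. indicator ({t..s} \<times> A) x * (simple_process (m k) (\<tau> k) (\<xi> k) (snd x) (fst x) \<bullet> simple_process (n k) (\<rho> k) (\<eta> k) (snd x) (fst x)) \<partial>time_prod t)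
      \<longlonglongrightarrow> (\<integral>x. indicator ({t..s} \<times> A) x * (\<phi> (snd x) (fst x) \<bullet> \<psi> (snd x) (fst x)) \<partial>time_prod t)"
    by (rule L2_tendsto_inner_indicator[OF has_ito_sq(1)[OF X t, unfolded sq_process_iff] has_ito_sq(1)[OF Y t, unfolded sq_process_iff]
        simple_process_sq_process[OF x(1) t(1), unfolded sq_process_iff]
        simple_process_sq_process[OF y(1) t(1), unfolded sq_process_iff] x(2) y(2) AP])
  have "expect_on A (\<lambda>w. simple_ito B (m k) (\<tau> k) (\<xi> k) w s \<bullet> simple_ito B (n k) (\<rho> k) (\<eta> k) w s)
    = (\<integral>x. indicator ({t..s} \<times> A) x * (simple_process (m k) (\<tau> k) (\<xi> k) (snd x) (fst x) \<bullet> simple_process (n k) (\<rho> k) (\<eta> k) (snd x) (fst x)) \<partial>time_prod t)" for k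
    using simple_ito_isometry[OF x(1) y(1) t(1) s A, of k k] unfolding tint_def inner_real_def .
  with 1 2 have "expect_on A (\<lambda>w. I w s \<bullet> J w s)
     = (\<integral>x. indicator ({t..s} \<times> A) x * (\<phi> (snd x) (fst x) \<bullet> \<psi> (snd x) (fst x)) \<partial>time_prod t)"
    by (simp only:) (rule LIMSEQ_unique)
  then show ?thesis unfolding tint_def inner_real_def .
qed

lemma has_ito_martingale:
  assumes X: "has_ito_integral M F B t T \<phi> I"
    and t: "0 \<le> t" "t \<le> T" and su: "t \<le> s" "s \<le> u" "u \<le> T" and A: "A \<in> sets (F s)"
  shows "expect_on A (\<lambda>w. I w u) = expect_on A (\<lambda>w. I w s)"
proof -
  have AM: "A \<in> sets M" using sets_F_M[OF _ A] t su by auto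
  have su': "s \<in> {t..T}" "u \<in> {t..T}" using su by auto
  obtain m \<tau> \<xi> where x: "\<And>k. simple_integrand F t T (m k) (\<tau> k) (\<xi> k)"
    "(\<lambda>k. \<integral>\<^sup>+x. ennreal ((norm (\<phi> (snd x) (fst x) - simple_process (m k) (\<tau> k) (\<xi> k) (snd x) (fst x)))\<^sup>2)
       \<partial>time_prod t) \<longlonglongrightarrow> 0"
    "\<And>s. s \<in> {t..T} \<Longrightarrow> (\<lambda>k. \<integral>\<^sup>+w. ennreal ((norm (I w s - simple_ito B (m k) (\<tau> k) (\<xi> k) w s))\<^sup>2) \<partial>M) \<longlonglongrightarrow> 0"
    by (rule has_ito_integral_approx[OF X]) (rule that)
  note c = sq_int_const[OF finite_measure_axioms, of "1::real"]
  have lim: "(\<lambda>k. \<integral>w. indicator A w * (simple_ito B (m k) (\<tau> k) (\<xi> k) w q \<bullet> 1) \<partial>M)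
      \<longlonglongrightarrow> expect_on A (\<lambda>w. I w q \<bullet> 1)" if q: "q \<in> {t..T}" for q
    by (rule L2_tendsto_inner_indicator[OF has_ito_sq(2)[OF X t q] c
        simple_ito_sq_int[OF x(1) t(1) q] c x(3)[OF q] _ AM]) simp
  have "expect_on A (\<lambda>w. simple_ito B (m k) (\<tau> k) (\<xi> k) w u \<bullet> 1)
      = expect_on A (\<lambda>w. simple_ito B (m k) (\<tau> k) (\<xi> k) w s \<bullet> 1)" for k
    using simple_ito_martingale[OF x(1) t(1) su A, of k] by simp
  with lim[OF su'(1)] lim[OF su'(2)]
  have "expect_on A (\<lambda>w. I w u \<bullet> 1) = expect_on A (\<lambda>w. I w s \<bullet> 1)"
    by (simp only:) (rule LIMSEQ_unique)
  then show ?thesis by simp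
qed

text \<open>Two It\^o integrals come with approximating simple processes over unrelated partitions. Closing under
  differences makes linearity hold by construction, and the isometry and the martingale property extend
  to the differences by (bi)linearity.\<close>

inductive ito_span :: "real \<Rightarrow> ('w \<Rightarrow> real \<Rightarrow> real ^ 'd) \<Rightarrow> ('w \<Rightarrow> real \<Rightarrow> real) \<Rightarrow> bool" for t where
  base: "has_ito_integral M F B t T \<phi> I \<Longrightarrow> ito_span t \<phi> I"
| diff: "ito_span t \<phi> I \<Longrightarrow> ito_span t \<psi> J \<Longrightarrow> ito_span t (\<lambda>w r. \<phi> w r - \<psi> w r) (\<lambda>w s. I w s - J w s)"

lemma ito_span_H2_S2:
  assumes "ito_span t \<phi> I" "0 \<le> t" "t \<le> T" shows "\<phi> \<in> H2 M F t T \<and> I \<in> S2 M F t T"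
  using assms(1)
proof induction
  case (base \<phi> I) then show ?case by (simp add: has_ito_integral_def)
next
  case (diff \<phi> I \<psi> J) then show ?case by (simp add: H2_diff S2_diff assms)
qed

lemma sq_process_inner_integrable:
  assumes "sq_process t \<phi>" "sq_process t \<psi>" "A \<in> sets M" "s \<le> T"
  shows "integrable (time_prod t) (\<lambda>x. indicator ({t..s} \<times> A) x * (\<phi> (snd x) (fst x) \<bullet> \<psi> (snd x) (fst x)))"
  using integrable_mult_indicator[OF sets_time_prod[OF assms(3,4)]
      sq_int_inner[OF assms(1)[unfolded sq_process_iff] assms(2)[unfolded sq_process_iff]]] by simp

lemma ito_span_martingale:
  assumes X: "ito_span t \<phi> I"
    and t: "0 \<le> t" "t \<le> T" and su: "t \<le> s" "s \<le> u" "u \<le> T" and A: "A \<in> sets (F s)"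
  shows "expect_on A (\<lambda>w. I w u) = expect_on A (\<lambda>w. I w s)"
  using X
proof induction
  case (base \<phi> I) then show ?case by (rule has_ito_martingale[OF _ t su A])
next
  case (diff \<phi> I \<psi> J)
  have AM: "A \<in> sets M" using sets_F_M[OF _ A] t su by auto
  have int: "integrable M (\<lambda>w. indicator A w * I w q)" if "ito_span t \<phi> I" "q \<in> {t..T}" for \<phi> I q
    using integrable_mult_indicator[OF AM sq_int_integrable[OF finite_measure_axioms
      S2_sq_int[OF conjunct2[OF ito_span_H2_S2[OF that(1) t]] that(2) t(1)]]] by simp
  have su': "s \<in> {t..T}" "u \<in> {t..T}" using su by auto
  show ?case
    unfolding right_diff_distrib
      Bochner_Integration.integral_diff[OF int[OF diff.hyps(1) su'(1)] int[OF diff.hyps(2) su'(1)]]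
      Bochner_Integration.integral_diff[OF int[OF diff.hyps(1) su'(2)] int[OF diff.hyps(2) su'(2)]]
      diff.IH ..
qed

lemma ito_span_isometry:
  assumes X: "ito_span t \<phi> I" and Y: "ito_span t \<psi> J"
    and t: "0 \<le> t" "t \<le> T" and s: "s \<in> {t..T}" and A: "A \<in> sets (F t)"
  shows "expect_on A (\<lambda>w. I w s * J w s) = tint t A s (\<lambda>w r. \<phi> w r \<bullet> \<psi> w r)"
proof -
  have AM: "A \<in> sets M" using sets_F_M[OF _ A] t by auto
  have int: "integrable M (\<lambda>w. indicator A w * (I w s * J w s))"
    if "ito_span t \<phi> I" "ito_span t \<psi> J" for \<phi> \<psi> I J
    using integrable_mult_indicator[OF AM sq_int_mult[OF
      S2_sq_int[OF conjunct2[OF ito_span_H2_S2[OF that(1) t]] s t(1)]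
      S2_sq_int[OF conjunct2[OF ito_span_H2_S2[OF that(2) t]] s t(1)]]] by simp
  have int': "integrable (time_prod t) (\<lambda>x. indicator ({t..s} \<times> A) x * (\<phi> (snd x) (fst x) \<bullet> \<psi> (snd x) (fst x)))"
    if "ito_span t \<phi> I" "ito_span t \<psi> J" for \<phi> \<psi> I J
    by (rule sq_process_inner_integrable[OF H2_sq_process[OF conjunct1[OF ito_span_H2_S2[OF that(1) t]] t]
      H2_sq_process[OF conjunct1[OF ito_span_H2_S2[OF that(2) t]] t] AM]) (use s in simp)
  have one: "expect_on A (\<lambda>w. I w s * J w s) = tint t A s (\<lambda>w r. \<phi> w r \<bullet> \<psi> w r)"
    if X: "has_ito_integral M F B t T \<phi> I" and Y: "ito_span t \<psi> J" for \<phi> \<psi> I J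
    using Y
  proof induction
    case (base \<psi> J) then show ?case by (rule has_ito_isometry[OF X _ t s A])
  next
    case (diff \<psi> J \<psi>' J')
    note b = ito_span.base[OF X]
    show ?case
      using diff.IH unfolding right_diff_distrib inner_diff_right tint_def
      by (simp add: Bochner_Integration.integral_diff int[OF b diff.hyps(1)] int[OF b diff.hyps(2)]
          int'[OF b diff.hyps(1)] int'[OF b diff.hyps(2)])
  qed
  show ?thesis using X
  proof induction
    case (base \<phi> I) then show ?case by (rule one[OF _ Y])
  next
    case (diff \<phi> I \<phi>' I')
    show ?case
      using diff.IH unfolding right_diff_distrib left_diff_distrib inner_diff_left tint_def
      by (simp add: Bochner_Integration.integral_diff int[OF diff.hyps(1) Y] int[OF diff.hyps(2) Y]
          int'[OF diff.hyps(1) Y] int'[OF diff.hyps(2) Y])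
  qed
qed

end

section \<open>Doob's maximal inequality\<close>

context brownian_filtration
begin

lemma ito_span_sq:
  assumes "ito_span t \<phi> I" "0 \<le> t" "t \<le> T"
  shows "sq_process t \<phi>" "s \<in> {t..T} \<Longrightarrow> sq_int M (\<lambda>w. I w s)" "sq_process t I"
    "I \<in> S2 M F t T" "\<phi> \<in> H2 M F t T"
proof -
  show I: "I \<in> S2 M F t T" and p: "\<phi> \<in> H2 M F t T" using ito_span_H2_S2[OF assms] by auto
  show "sq_process t \<phi>" by (rule H2_sq_process[OF p assms(2,3)])
  show "sq_process t I" by (rule H2_sq_process[OF S2_H2[OF I assms(2,3)] assms(2,3)])
  show "sq_int M (\<lambda>w. I w s)" if "s \<in> {t..T}" by (rule S2_sq_int[OF I that assms(2)])
qed

text \<open>The martingale property, tested against functions instead of sets.\<close>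

lemma ito_span_martingale_mult:
  assumes X: "ito_span t \<phi> I" and t: "0 \<le> t" "t \<le> T" and su: "t \<le> s" "s \<le> u" "u \<le> T"
    and h: "h \<in> borel_measurable (F s)" "sq_int M h"
  shows "(\<integral>w. h w * I w u \<partial>M) = (\<integral>w. h w * I w s \<partial>M)"
proof -
  have s: "s \<in> {0..T}" "s \<in> {t..T}" "u \<in> {t..T}" using t su by auto
  note i = sq_int_integrable[OF finite_measure_axioms ito_span_sq(2)[OF X t]]
  show ?thesis
    by (rule sigma_finite_subalgebra.integral_mult_eq_of_set_integrals_eq[OF sigma_finite_F[OF s(1)]
          i[OF s(3)] i[OF s(2)] S2_adapted[OF ito_span_sq(4)[OF X t] s(2)]
          ito_span_martingale[OF X t su] h(1) sq_int_mult[OF h(2) ito_span_sq(2)[OF X t s(3)]]])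
qed

lemma sup_norm2_integrable_sub:
  fixes X :: "'w \<Rightarrow> real \<Rightarrow> 'b::euclidean_space"
  assumes X: "X \<in> S2 M F t T" and t: "0 \<le> t" and u: "t \<le> u" "u \<le> T"
  shows "integrable M (sup_norm2 t u X)"
    "\<And>w. w \<in> space M \<Longrightarrow> 0 \<le> sup_norm2 t u X w \<and> sup_norm2 t u X w \<le> sup_norm2 t T X w"
proof -
  have cont: "continuous_on {t..u} (X w)" if "w \<in> space M" for w
    by (rule continuous_on_subset[OF S2_continuous[OF X that]]) (use u in auto)
  show b: "0 \<le> sup_norm2 t u X w \<and> sup_norm2 t u X w \<le> sup_norm2 t T X w" if w: "w \<in> space M" for w
  proof
    have "0 \<le> (norm (X w t))\<^sup>2" by simp
    also have "\<dots> \<le> sup_norm2 t u X w" by (rule sup_norm2_upper[where X = X, OF cont[OF w]]) (use u in auto)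
    finally show "0 \<le> sup_norm2 t u X w" .
    show "sup_norm2 t u X w \<le> sup_norm2 t T X w"
      by (rule sup_norm2_le[OF u(1)], rule sup_norm2_upper[where X = X, OF S2_continuous[OF X w]]) (use u in auto)
  qed
  have tT: "t \<le> T" using u by simp
  show "integrable M (sup_norm2 t u X)"
  proof (rule Bochner_Integration.integrable_bound[OF S2_sup_integrable[OF X tT]])
    show "sup_norm2 t u X \<in> borel_measurable M"
      by (rule sup_norm2_measurable[OF _ cont u(1)], rule S2_measurable[OF X _ t]) (use u in auto)
    show "AE w in M. norm (sup_norm2 t u X w) \<le> norm (sup_norm2 t T X w)"
      by (rule AE_I2) (use b in force)
  qed
qed

text \<open>The pathwise inequality applied to \<open>|I|\<close> along the grid. With \<open>S\<close> the running maximum, the sum of the terms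
  \<open>S\<^sub>k (|I\<^sub>k\<^sub>+\<^sub>1| - |I\<^sub>k|)\<close> has nonnegative expectation: each term is at least \<open>S\<^sub>k sgn(I\<^sub>k) (I\<^sub>k\<^sub>+\<^sub>1 - I\<^sub>k)\<close>,
  which is centred by the martingale property.\<close>

lemma doob_grid:
  assumes X: "ito_span t \<phi> I" and t: "0 \<le> t" "t \<le> T" and u: "t \<le> u" "u \<le> T" and n: "0 < n"
    and A: "A \<in> sets (F t)"
  shows "expect_on A (\<lambda>w. grid_max t u n (\<lambda>s. (I w s)\<^sup>2)) \<le> 4 * expect_on A (\<lambda>w. (I w u)\<^sup>2)"
proof -
  have t0: "t \<in> {0..T}" using t by simp
  have AM: "A \<in> sets M" by (rule sets_F_M[OF t0 A])
  have IS: "I \<in> S2 M F t T" by (rule ito_span_sq(4)[OF X t])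
  define g where "g k = t + (u - t) * real (min k n) / real n" for k
  have gu: "g k \<in> {t..u}" for k unfolding g_def by (rule grid_point_in) (use u in auto)
  have gT: "g k \<in> {t..T}" for k using gu[of k] u by auto
  have gmono: "g k \<le> g l" if "k \<le> l" for k l
    unfolding g_def using that n u by (intro add_left_mono divide_right_mono mult_left_mono) auto
  have gn: "g n = u" using n by (simp add: g_def)
  define x where "x w k = \<bar>I w (g k)\<bar>" for w k
  define S where "S w k = Max (x w ` {..k})" for w k
  have x_le: "x w j \<le> S w k" if "j \<le> k" for j k w
    unfolding S_def using that by (intro Max_ge) auto
  have S_nn: "0 \<le> S w k" for w k
  proof -
    have "0 \<le> x w 0" by (simp add: x_def)
    also have "\<dots> \<le> S w k" by (rule x_le) simp
    finally show ?thesis .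
  qed
  have S_in: "\<exists>j\<le>k. S w k = x w j" for w k
  proof -
    have "S w k \<in> x w ` {..k}" unfolding S_def by (intro Max_in) auto
    then show ?thesis by auto
  qed
  have I_sq: "sq_int M (\<lambda>w. I w (g k))" for k by (rule ito_span_sq(2)[OF X t gT])
  have x_sq: "sq_int M (\<lambda>w. x w k)" for k unfolding x_def by (rule sq_int_abs[OF I_sq])
  have x_F: "(\<lambda>w. x w j) \<in> borel_measurable (F (g k))" if "j \<le> k" for j k
  proof -
    have "(\<lambda>w. I w (g j)) \<in> borel_measurable (F (g k))"
      by (rule measurable_F_mono[OF _ gmono[OF that] _ S2_adapted[OF IS gT]]) (use gT[of j] gT[of k] t in auto)
    then show ?thesis unfolding x_def by (rule borel_measurable_abs)
  qed
  have S_F: "(\<lambda>w. S w k) \<in> borel_measurable (F (g k))" for k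
    unfolding S_def by (rule borel_measurable_Max) (auto intro: x_F)
  have gk0: "g k \<in> {0..T}" for k using gT[of k] t by auto
  have S_sq: "sq_int M (\<lambda>w. S w k)" for k
  proof (rule sq_int_bound[OF S2_sup_integrable[OF IS t(2)] measurable_F_M[OF gk0 S_F]])
    show "AE w in M. (norm (S w k))\<^sup>2 \<le> sup_norm2 t T I w"
    proof (rule AE_I2)
      fix w assume w: "w \<in> space M"
      obtain j where "S w k = x w j" using S_in by blast
      then have "(norm (S w k))\<^sup>2 = (norm (I w (g j)))\<^sup>2" by (simp add: x_def)
      also have "\<dots> \<le> sup_norm2 t T I w" by (rule sup_norm2_upper[where X = I, OF S2_continuous[OF IS w] gT])
      finally show "(norm (S w k))\<^sup>2 \<le> sup_norm2 t T I w" .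
    qed
  qed
  have dx_sq: "sq_int M (\<lambda>w. x w (Suc k) - x w k)" for k by (rule sq_int_diff[OF x_sq x_sq])
  have prod_int: "integrable M (\<lambda>w. indicator A w * (S w k * (x w (Suc k) - x w k)))" for k
    using integrable_mult_indicator[OF AM sq_int_mult[OF S_sq dx_sq]] by simp
  have step: "0 \<le> expect_on A (\<lambda>w. S w k * (x w (Suc k) - x w k))" for k
  proof -
    \<comment> \<open>a factor known at time \<open>g k\<close>, so that \<open>h\<close> times the next increment of \<open>I\<close> is centred\<close>
    define h where "h w = indicator A w * (sgn (I w (g k)) * S w k)" for w
    have AF: "A \<in> sets (F (g k))"
      by (rule subsetD[OF filtration_mono[OF t(1)] A]) (use gT[of k] in auto)
    have sgnF: "(\<lambda>w. sgn (I w (g k))) \<in> borel_measurable (F (g k))"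
      by (rule measurable_compose[OF S2_adapted[OF IS gT]]) simp
    have hF: "h \<in> borel_measurable (F (g k))"
      unfolding h_def by (intro borel_measurable_times borel_measurable_indicator AF S_F sgnF)
    have h_sq: "sq_int M h"
      by (rule sq_int_mono[OF S_sq[of k] measurable_F_M[OF gk0 hF]])
        (auto simp: h_def indicator_def abs_mult abs_sgn_eq)
    have mart: "(\<integral>w. h w * I w (g (Suc k)) \<partial>M) = (\<integral>w. h w * I w (g k) \<partial>M)"
      by (rule ito_span_martingale_mult[OF X t _ gmono _ hF h_sq]) (use gT[of k] gT[of "Suc k"] in auto)
    have "0 = (\<integral>w. h w * I w (g (Suc k)) - h w * I w (g k) \<partial>M)"
      using mart sq_int_mult[OF h_sq I_sq] by simp
    also have "\<dots> \<le> expect_on A (\<lambda>w. S w k * (x w (Suc k) - x w k))"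
    proof (rule integral_mono)
      show "integrable M (\<lambda>w. h w * I w (g (Suc k)) - h w * I w (g k))"
        using sq_int_mult[OF h_sq I_sq] by simp
      fix w assume "w \<in> space M"
      have "sgn (I w (g k)) * (I w (g (Suc k)) - I w (g k)) \<le> x w (Suc k) - x w k"
        by (auto simp: x_def sgn_if)
      from mult_left_mono[OF this S_nn[of w k]]
      show "h w * I w (g (Suc k)) - h w * I w (g k) \<le> indicator A w * (S w k * (x w (Suc k) - x w k))"
        by (simp add: h_def indicator_def algebra_simps)
    qed (rule prod_int)
    finally show ?thesis .
  qed
  have gm_le: "grid_max t u n (\<lambda>s. (I w s)\<^sup>2) \<le> (S w n)\<^sup>2" for w
  proof -
    have "(I w (t + (u - t) * real k / real n))\<^sup>2 \<le> (S w n)\<^sup>2" if "k \<le> n" for k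
    proof -
      have "\<bar>I w (t + (u - t) * real k / real n)\<bar> = x w k" using that by (simp add: x_def g_def)
      also have "\<dots> \<le> S w n" by (rule x_le[OF that])
      finally show ?thesis using S_nn[of w n] by (intro power2_le_iff_abs_le[THEN iffD2]) auto
    qed
    then show ?thesis unfolding grid_max_def by (subst Max_le_iff) auto
  qed
  have path: "indicator A w * grid_max t u n (\<lambda>s. (I w s)\<^sup>2)
    \<le> 4 * (indicator A w * (I w u)\<^sup>2) - 4 * (\<Sum>k<n. indicator A w * (S w k * (x w (Suc k) - x w k)))" for w
  proof -
    have "(S w n)\<^sup>2 \<le> 4 * (x w n)\<^sup>2 - 4 * (\<Sum>k<n. S w k * (x w (Suc k) - x w k))"
      unfolding S_def by (rule doob_pathwise) (simp add: x_def)
    then have "grid_max t u n (\<lambda>s. (I w s)\<^sup>2) \<le> 4 * (I w u)\<^sup>2 - 4 * (\<Sum>k<n. S w k * (x w (Suc k) - x w k))"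
      using gm_le[of w] by (simp add: x_def gn)
    then show ?thesis by (cases "w \<in> A") auto
  qed
  have Iu: "integrable M (\<lambda>w. indicator A w * (I w u)\<^sup>2)"
    using integrable_mult_indicator[OF AM sq_int_integrable_power2[OF ito_span_sq(2)[OF X t, of u]]] u by simp
  have rhs_int: "integrable M (\<lambda>w. 4 * (indicator A w * (I w u)\<^sup>2) - 4 * (\<Sum>k<n. indicator A w * (S w k * (x w (Suc k) - x w k))))"
    by (intro Bochner_Integration.integrable_diff integrable_mult_right Iu Bochner_Integration.integrable_sum prod_int)
  have "expect_on A (\<lambda>w. grid_max t u n (\<lambda>s. (I w s)\<^sup>2))
     \<le> (\<integral>w. 4 * (indicator A w * (I w u)\<^sup>2) - 4 * (\<Sum>k<n. indicator A w * (S w k * (x w (Suc k) - x w k))) \<partial>M)"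
  proof (rule integral_mono'[OF rhs_int])
    show "indicator A w * grid_max t u n (\<lambda>s. (I w s)\<^sup>2)
      \<le> 4 * (indicator A w * (I w u)\<^sup>2) - 4 * (\<Sum>k<n. indicator A w * (S w k * (x w (Suc k) - x w k)))" for w
      by (rule path)
    have nn: "0 \<le> indicator A w * grid_max t u n (\<lambda>s. (I w s)\<^sup>2)" for w
      using grid_max_power2_nonneg by simp
    show "0 \<le> 4 * (indicator A w * (I w u)\<^sup>2) - 4 * (\<Sum>k<n. indicator A w * (S w k * (x w (Suc k) - x w k)))" for w
      by (rule order_trans[OF nn path])
  qed
  also have "\<dots> = 4 * expect_on A (\<lambda>w. (I w u)\<^sup>2) - 4 * (\<Sum>k<n. expect_on A (\<lambda>w. S w k * (x w (Suc k) - x w k)))"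
    by (simp only: Bochner_Integration.integral_diff Bochner_Integration.integral_sum integral_mult_right_zero
        integrable_mult_right Iu Bochner_Integration.integrable_sum prod_int)
  also have "\<dots> \<le> 4 * expect_on A (\<lambda>w. (I w u)\<^sup>2)"
    using sum_nonneg[of "{..<n}", OF step] by simp
  finally show ?thesis .
qed

text \<open>Refine the grid; the running supremum itself is an integrable dominating function.\<close>

lemma doob_maximal:
  assumes X: "ito_span t \<phi> I" and t: "0 \<le> t" "t \<le> T" and u: "t \<le> u" "u \<le> T"
    and A: "A \<in> sets (F t)"
  shows "expect_on A (sup_norm2 t u I) \<le> 4 * expect_on A (\<lambda>w. (I w u)\<^sup>2)"
proof -
  have t0: "t \<in> {0..T}" using t by simp
  have AM: "A \<in> sets M" by (rule sets_F_M[OF t0 A])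
  have IS: "I \<in> S2 M F t T" by (rule ito_span_sq(4)[OF X t])
  have cont: "continuous_on {t..u} (\<lambda>s. (I w s)\<^sup>2)" if "w \<in> space M" for w
    by (intro continuous_on_power continuous_on_subset[OF S2_continuous[OF IS that]]) (use u in auto)
  have sn: "sup_norm2 t u I w = (SUP s\<in>{t..u}. (I w s)\<^sup>2)" for w
    by (simp add: sup_norm2_def)
  note si = sup_norm2_integrable_sub[OF IS t(1) u]
  have lim: "(\<lambda>n. grid_max t u n (\<lambda>s. (I w s)\<^sup>2)) \<longlonglongrightarrow> sup_norm2 t u I w" if "w \<in> space M" for w
    unfolding sn by (rule grid_max_tendsto_SUP[OF cont[OF that] u(1)])
  have meas: "(\<lambda>w. grid_max t u n (\<lambda>s. (I w s)\<^sup>2)) \<in> borel_measurable M" for n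
  proof (rule borel_measurable_grid_max[OF _ u(1)])
    fix r assume "r \<in> {t..u}"
    then have "(\<lambda>w. I w r) \<in> borel_measurable M" by (intro S2_measurable[OF IS _ t(1)]) (use u in auto)
    then show "(\<lambda>w. (I w r)\<^sup>2) \<in> borel_measurable M" by (rule borel_measurable_power)
  qed
  have bnd: "\<bar>grid_max t u n (\<lambda>s. (I w s)\<^sup>2)\<bar> \<le> sup_norm2 t u I w" if w: "w \<in> space M" for n w
  proof -
    have "0 \<le> grid_max t u n (\<lambda>s. (I w s)\<^sup>2)" by (rule grid_max_power2_nonneg)
    moreover have "grid_max t u n (\<lambda>s. (I w s)\<^sup>2) \<le> sup_norm2 t u I w"
      unfolding grid_max_def
    proof (subst Max_le_iff)
      show "\<forall>a\<in>(\<lambda>k. (I w (t + (u - t) * real k / real n))\<^sup>2) ` {..n}. a \<le> sup_norm2 t u I w"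
      proof (rule ballI, elim imageE)
        fix a k assume "a = (I w (t + (u - t) * real k / real n))\<^sup>2" "k \<in> {..n}"
        then show "a \<le> sup_norm2 t u I w" unfolding sn
          using SUP_interval_upper[OF cont[OF w] grid_point_in[OF u(1), of k n]] by simp
      qed
    qed auto
    ultimately show ?thesis by simp
  qed
  have "(\<lambda>n. \<integral>w. indicator A w * grid_max t u n (\<lambda>s. (I w s)\<^sup>2) \<partial>M) \<longlonglongrightarrow> expect_on A (sup_norm2 t u I)"
  proof (rule integral_dominated_convergence[where w = "sup_norm2 t u I"])
    show "(\<lambda>w. indicator A w * sup_norm2 t u I w) \<in> borel_measurable M"
      using AM si(1) by auto
    show "(\<lambda>w. indicator A w * grid_max t u n (\<lambda>s. (I w s)\<^sup>2)) \<in> borel_measurable M" for n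
      using AM meas[of n] by auto
    show "integrable M (sup_norm2 t u I)" by (rule si(1))
    show "AE w in M. (\<lambda>n. indicator A w * grid_max t u n (\<lambda>s. (I w s)\<^sup>2)) \<longlonglongrightarrow> indicator A w * sup_norm2 t u I w"
      by (intro AE_I2 tendsto_mult_left lim)
    show "AE w in M. norm (indicator A w * grid_max t u n (\<lambda>s. (I w s)\<^sup>2)) \<le> sup_norm2 t u I w" for n
    proof (rule AE_I2)
      fix w assume w: "w \<in> space M"
      show "norm (indicator A w * grid_max t u n (\<lambda>s. (I w s)\<^sup>2)) \<le> sup_norm2 t u I w"
        using bnd[OF w, of n] si(2)[OF w] by (simp add: indicator_def)
    qed
  qed
  then show ?thesis
    by (rule LIMSEQ_le_const2) (use doob_grid[OF X t u _ A] in \<open>auto intro!: exI[of _ 1]\<close>)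
qed

section \<open>The product rule\<close>

definition proc_integrable :: "real \<Rightarrow> ('w \<Rightarrow> real \<Rightarrow> real) \<Rightarrow> bool" where
  "proc_integrable t h \<longleftrightarrow> integrable (time_prod t) (\<lambda>x. h (snd x) (fst x))"

lemma proc_integrable_mult:
  fixes \<phi> \<psi> :: "'w \<Rightarrow> real \<Rightarrow> real"
  shows "sq_process t \<phi> \<Longrightarrow> sq_process t \<psi> \<Longrightarrow> proc_integrable t (\<lambda>w r. \<phi> w r * \<psi> w r)"
  unfolding proc_integrable_def sq_process_iff by (rule sq_int_mult)

lemma proc_integrable_inner:
  "sq_process t \<phi> \<Longrightarrow> sq_process t \<psi> \<Longrightarrow> proc_integrable t (\<lambda>w r. \<phi> w r \<bullet> \<psi> w r)"
  unfolding proc_integrable_def sq_process_iff by (rule sq_int_inner)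

lemma proc_integrable_norm2:
  "sq_process t \<phi> \<Longrightarrow> proc_integrable t (\<lambda>w r. (norm (\<phi> w r))\<^sup>2)"
  unfolding proc_integrable_def sq_process_iff by (rule sq_int_integrable_norm2)

lemma proc_integrable_add: "proc_integrable t h \<Longrightarrow> proc_integrable t k \<Longrightarrow> proc_integrable t (\<lambda>w r. h w r + k w r)"
  unfolding proc_integrable_def by (rule Bochner_Integration.integrable_add)

lemma proc_integrable_diff: "proc_integrable t h \<Longrightarrow> proc_integrable t k \<Longrightarrow> proc_integrable t (\<lambda>w r. h w r - k w r)"
  unfolding proc_integrable_def by (rule Bochner_Integration.integrable_diff)

lemma proc_integrable_cmult: "proc_integrable t h \<Longrightarrow> proc_integrable t (\<lambda>w r. c * h w r)"
  unfolding proc_integrable_def by (rule integrable_mult_right) simp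

lemma proc_integrable_sum:
  "(\<And>i. i \<in> S \<Longrightarrow> proc_integrable t (h i)) \<Longrightarrow> proc_integrable t (\<lambda>w r. \<Sum>i\<in>S. h i w r)"
  unfolding proc_integrable_def by (rule Bochner_Integration.integrable_sum)

lemma proc_integrable_const: "proc_integrable t (\<lambda>w r. c)"
  unfolding proc_integrable_def by (rule finite_measure.integrable_const[OF finite_time_prod])

lemma sq_process_diff: "sq_process t \<phi> \<Longrightarrow> sq_process t \<psi> \<Longrightarrow> sq_process t (\<lambda>w r. \<phi> w r - \<psi> w r)"
  unfolding sq_process_iff by (rule sq_int_diff)

lemma sq_process_const: "sq_int M V \<Longrightarrow> sq_process t (\<lambda>w r. V w)"
  using time_prod_snd_measurable[of V t] time_prod_snd_integrable[of "\<lambda>w. (norm (V w))\<^sup>2" t]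
  by (auto simp: sq_process_iff sq_int_def case_prod_beta')

lemma tint_integrable:
  assumes "proc_integrable t h" "A \<in> sets M" "s \<le> T"
  shows "integrable (time_prod t) (\<lambda>x. indicator ({t..s} \<times> A) x * h (snd x) (fst x))"
  using integrable_mult_indicator[OF sets_time_prod[OF assms(2,3)] assms(1)[unfolded proc_integrable_def]] by simp

lemma tint_add:
  assumes "proc_integrable t h" "proc_integrable t k" "A \<in> sets M" "s \<le> T"
  shows "tint t A s (\<lambda>w r. h w r + k w r) = tint t A s h + tint t A s k"
  unfolding tint_def distrib_left
  by (rule Bochner_Integration.integral_add[OF tint_integrable[OF assms(1,3,4)] tint_integrable[OF assms(2,3,4)]])

lemma tint_diff:
  assumes "proc_integrable t h" "proc_integrable t k" "A \<in> sets M" "s \<le> T"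
  shows "tint t A s (\<lambda>w r. h w r - k w r) = tint t A s h - tint t A s k"
  unfolding tint_def right_diff_distrib
  by (rule Bochner_Integration.integral_diff[OF tint_integrable[OF assms(1,3,4)] tint_integrable[OF assms(2,3,4)]])

lemma tint_cmult: "tint t A s (\<lambda>w r. c * h w r) = c * tint t A s h"
  unfolding tint_def by (simp add: mult.left_commute)

lemma tint_sum:
  assumes "\<And>i. i \<in> S \<Longrightarrow> proc_integrable t (h i)" "A \<in> sets M" "s \<le> T"
  shows "tint t A s (\<lambda>w r. \<Sum>i\<in>S. h i w r) = (\<Sum>i\<in>S. tint t A s (h i))"
  unfolding tint_def sum_distrib_left
  by (rule Bochner_Integration.integral_sum) (rule tint_integrable[OF assms(1) assms(2,3)])

lemma tint_mono_AE:
  assumes h: "proc_integrable t h" and k: "proc_integrable t k" and A: "A \<in> sets M" and s: "s \<le> T"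
    and le: "AE w in M. \<forall>r\<in>{t..T}. h w r \<le> k w r"
  shows "tint t A s h \<le> tint t A s k"
  unfolding tint_def
proof (rule integral_mono_AE[OF tint_integrable[OF h A s] tint_integrable[OF k A s]])
  show "AE x in time_prod t. indicator ({t..s} \<times> A) x * h (snd x) (fst x) \<le> indicator ({t..s} \<times> A) x * k (snd x) (fst x)"
    using AE_time_prod[OF le] by eventually_elim (rule mult_left_mono, simp_all)
qed

lemma tint_nonneg: "(\<And>w r. 0 \<le> h w r) \<Longrightarrow> 0 \<le> tint t A s h"
  unfolding tint_def by (intro integral_nonneg_AE AE_I2 mult_nonneg_nonneg) auto

lemma tint_mono_time:
  assumes h: "proc_integrable t h" and nn: "\<And>w r. 0 \<le> h w r" and A: "A \<in> sets M" and s: "s \<le> u" "u \<le> T"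
  shows "tint t A s h \<le> tint t A u h"
  unfolding tint_def
proof (rule integral_mono[OF tint_integrable[OF h A] tint_integrable[OF h A s(2)]])
  show "s \<le> T" using s by simp
  fix x show "indicator ({t..s} \<times> A) x * h (snd x) (fst x) \<le> indicator ({t..u} \<times> A) x * h (snd x) (fst x)"
    using s nn by (intro mult_right_mono) (auto simp: indicator_def)
qed

text \<open>Fubini with time as the inner variable.\<close>

lemma tint_section:
  assumes h: "proc_integrable t h" and s: "s \<in> {t..T}" and A: "A \<in> sets M"
  shows "AE w in M. set_integrable lborel {t..s} (h w)"
    "integrable M (\<lambda>w. indicator A w * (LINT r:{t..s}|lborel. h w r))"
    "tint t A s h = expect_on A (\<lambda>w. LINT r:{t..s}|lborel. h w r)"
proof -
  note P = pair_sigma_finite_time[of t]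
  have hi: "integrable (restrict_space lborel {t..T} \<Otimes>\<^sub>M M) (\<lambda>(r, w). h w r)"
    using h by (simp add: proc_integrable_def time_prod_def case_prod_beta')
  have "AE w in M. integrable (restrict_space lborel {t..T}) (\<lambda>r. h w r)"
    by (rule pair_sigma_finite.AE_integrable_snd[OF P hi])
  then show "AE w in M. set_integrable lborel {t..s} (h w)"
  proof eventually_elim
    fix w assume "integrable (restrict_space lborel {t..T}) (\<lambda>r. h w r)"
    then have "set_integrable lborel {t..T} (h w)"
      by (simp add: integrable_restrict_space set_integrable_def)
    then show "set_integrable lborel {t..s} (h w)"
      by (rule set_integrable_subset) (use s in auto)
  qed
  have ti: "integrable (restrict_space lborel {t..T} \<Otimes>\<^sub>M M) (\<lambda>(r, w). indicator ({t..s} \<times> A) (r, w) * h w r)"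
    using tint_integrable[OF h A, of s] s by (simp add: time_prod_def case_prod_beta')
  have inner: "(\<integral>r. indicator ({t..s} \<times> A) (r, w) * h w r \<partial>restrict_space lborel {t..T})
     = indicator A w * (LINT r:{t..s}|lborel. h w r)" for w
  proof -
    have "(\<integral>r. indicator ({t..s} \<times> A) (r, w) * h w r \<partial>restrict_space lborel {t..T})
      = (\<integral>r. indicator {t..T} r *\<^sub>R (indicator ({t..s} \<times> A) (r, w) * h w r) \<partial>lborel)"
      by (rule integral_restrict_space) simp
    also have "\<dots> = (\<integral>r. indicator A w * (indicator {t..s} r *\<^sub>R h w r) \<partial>lborel)"
      using s by (intro Bochner_Integration.integral_cong refl) (auto simp: indicator_def)
    finally show ?thesis by (simp add: set_lebesgue_integral_def)
  qed
  show "integrable M (\<lambda>w. indicator A w * (LINT r:{t..s}|lborel. h w r))"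
    using pair_sigma_finite.integrable_snd[OF P ti] unfolding inner .
  show "tint t A s h = expect_on A (\<lambda>w. LINT r:{t..s}|lborel. h w r)"
    using pair_sigma_finite.integral_snd[OF P ti] unfolding inner
    by (simp add: tint_def time_prod_def case_prod_beta')
qed

text \<open>Fubini with the sample point as the inner variable.\<close>

lemma tint_time:
  assumes h: "proc_integrable t h" and s: "s \<in> {t..T}" and A: "A \<in> sets M"
  shows "tint t A s h = (LINT r:{t..s}|lborel. expect_on A (\<lambda>w. h w r))"
    "set_integrable lborel {t..s} (\<lambda>r. \<integral>w. indicator A w * h w r \<partial>M)"
proof -
  note P = pair_sigma_finite_time[of t]
  let ?k = "\<lambda>x. indicator ({t..s} \<times> A) x * h (snd x) (fst x)"
  have ti: "integrable (restrict_space lborel {t..T} \<Otimes>\<^sub>M M) ?k"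
    using tint_integrable[OF h A, of s] s by (simp add: time_prod_def)
  have inner: "(\<integral>w. ?k (r, w) \<partial>M) = indicator {t..s} r * expect_on A (\<lambda>w. h w r)" for r
    by (cases "r \<in> {t..s}") (auto simp: indicator_times)
  have eq: "indicator {t..T} r * (indicator {t..s} r * expect_on A (\<lambda>w. h w r))
    = indicator {t..s} r * expect_on A (\<lambda>w. h w r)" for r
    using s by (auto simp: indicator_def)
  have "integrable (restrict_space lborel {t..T}) (\<lambda>r. \<integral>w. ?k (r, w) \<partial>M)"
    by (rule pair_sigma_finite.integrable_fst'[OF P ti])
  then show "set_integrable lborel {t..s} (\<lambda>r. \<integral>w. indicator A w * h w r \<partial>M)"
    unfolding inner set_integrable_def by (subst (asm) integrable_restrict_space) (simp_all add: eq)
  have "tint t A s h = (\<integral>r. (\<integral>w. ?k (r, w) \<partial>M) \<partial>restrict_space lborel {t..T})"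
    unfolding tint_def time_prod_def by (rule pair_sigma_finite.integral_fst'[OF P ti, symmetric])
  also have "\<dots> = (LINT r:{t..s}|lborel. expect_on A (\<lambda>w. h w r))"
    unfolding inner set_lebesgue_integral_def by (subst integral_restrict_space) (simp_all add: eq)
  finally show "tint t A s h = (LINT r:{t..s}|lborel. expect_on A (\<lambda>w. h w r))" .
qed

text \<open>For almost every time \<open>r\<close>, the factor \<open>\<beta>\<^sub>r\<close> is square integrable and known at time \<open>r\<close>, so it is orthogonal to the
  later martingale increment.\<close>

lemma tint_martingale_increment:
  assumes X: "ito_span t \<phi> J" and t: "0 \<le> t" "t \<le> T" and s: "s \<in> {t..T}" and A: "A \<in> sets (F t)"
    and b: "\<beta> \<in> H2 M F t T"
  shows "tint t A s (\<lambda>w r. \<beta> w r * (J w s - J w r)) = 0"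
proof -
  have t0: "t \<in> {0..T}" using t by simp
  have AM: "A \<in> sets M" by (rule sets_F_M[OF t0 A])
  note J = ito_span_sq[OF X t]
  have bs: "sq_process t \<beta>" by (rule H2_sq_process[OF b t])
  have pi: "proc_integrable t (\<lambda>w r. \<beta> w r * (J w s - J w r))"
    by (rule proc_integrable_mult[OF bs sq_process_diff[OF sq_process_const[OF J(2)[OF s]] J(3)]])
  note P = pair_sigma_finite_time[of t]
  have "integrable (restrict_space lborel {t..T} \<Otimes>\<^sub>M M) (\<lambda>x. (norm (\<beta> (snd x) (fst x)))\<^sup>2)"
    using proc_integrable_norm2[OF bs] by (simp add: proc_integrable_def time_prod_def)
  from pair_sigma_finite.AE_integrable_fst'[OF P this]
  have ae: "AE r in restrict_space lborel {t..T}. integrable M (\<lambda>w. (norm (\<beta> w r))\<^sup>2)" by simp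
  then have "AE r in lborel. r \<in> {t..T} \<longrightarrow> integrable M (\<lambda>w. (norm (\<beta> w r))\<^sup>2)"
    by (subst (asm) AE_restrict_space_iff) auto
  then have z: "AE r in lborel. r \<in> {t..s} \<longrightarrow> expect_on A (\<lambda>w. \<beta> w r * (J w s - J w r)) = 0"
  proof eventually_elim
    fix r assume r: "r \<in> {t..T} \<longrightarrow> integrable M (\<lambda>w. (norm (\<beta> w r))\<^sup>2)"
    show "r \<in> {t..s} \<longrightarrow> expect_on A (\<lambda>w. \<beta> w r * (J w s - J w r)) = 0"
    proof
      assume rs: "r \<in> {t..s}"
      then have rT: "r \<in> {t..T}" "r \<in> {0..T}" using s t by auto
      have bF: "(\<lambda>w. \<beta> w r) \<in> borel_measurable (F r)"
        by (rule progressive_section[OF H2_progressive[OF b] rT(1)])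
      have bq: "sq_int M (\<lambda>w. \<beta> w r)"
        using r rT measurable_F_M[OF rT(2) bF] by (simp add: sq_int_def)
      have AF: "A \<in> sets (F r)"
        by (rule subsetD[OF filtration_mono[OF t(1)] A]) (use rT in auto)
      have hF: "(\<lambda>w. indicator A w * \<beta> w r) \<in> borel_measurable (F r)"
        by (intro borel_measurable_times borel_measurable_indicator AF bF)
      have hq: "sq_int M (\<lambda>w. indicator A w * \<beta> w r)" by (rule sq_int_indicator_mult[OF bq AM])
      have "expect_on A (\<lambda>w. \<beta> w r * (J w s - J w r))
        = (\<integral>w. (indicator A w * \<beta> w r) * J w s - (indicator A w * \<beta> w r) * J w r \<partial>M)"
        by (simp only: right_diff_distrib mult.assoc)
      also have "\<dots> = (\<integral>w. (indicator A w * \<beta> w r) * J w s \<partial>M) - (\<integral>w. (indicator A w * \<beta> w r) * J w r \<partial>M)"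
        by (rule Bochner_Integration.integral_diff[OF sq_int_mult[OF hq J(2)[OF s]] sq_int_mult[OF hq J(2)[OF rT(1)]]])
      also have "\<dots> = 0"
        using ito_span_martingale_mult[OF X t _ _ _ hF hq, of s] rs s by simp
      finally show "expect_on A (\<lambda>w. \<beta> w r * (J w s - J w r)) = 0" .
    qed
  qed
  show ?thesis unfolding tint_time(1)[OF pi s AM] set_lebesgue_integral_def
  proof (rule integral_eq_zero_AE)
    show "AE r in lborel. indicator {t..s} r *\<^sub>R expect_on A (\<lambda>w. \<beta> w r * (J w s - J w r)) = 0"
      using z by eventually_elim (auto simp: indicator_def)
  qed
qed

text \<open>The isometry at the initial time, where the time interval is a single point.\<close>

lemma ito_span_zero:
  assumes X: "ito_span t \<phi> I" and t: "0 \<le> t" "t \<le> T"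
  shows "AE w in M. I w t = 0"
proof -
  have tt: "t \<in> {t..T}" "t \<in> {0..T}" using t by auto
  have sp: "space M \<in> sets (F t)" using sets.top[of "F t"] space_F[OF tt(2)] by simp
  note J = ito_span_sq[OF X t]
  have "(\<integral>w. indicator (space M) w * (I w t * I w t) \<partial>M) = tint t (space M) t (\<lambda>w r. \<phi> w r \<bullet> \<phi> w r)"
    by (rule ito_span_isometry[OF X X t tt(1) sp])
  also have "\<dots> = (LINT r:{t..t}|lborel. (\<integral>w. indicator (space M) w * (\<phi> w r \<bullet> \<phi> w r) \<partial>M))"
    by (rule tint_time(1)[OF proc_integrable_inner[OF J(1) J(1)] tt(1) sets.top])
  also have "\<dots> = 0"
    unfolding set_lebesgue_integral_def
  proof (rule integral_eq_zero_AE)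
    show "AE r in lborel. indicator {t..t} r *\<^sub>R (\<integral>w. indicator (space M) w * (\<phi> w r \<bullet> \<phi> w r) \<partial>M) = 0"
      using AE_lborel_singleton[of t] by eventually_elim simp
  qed
  finally have "(\<integral>w. indicator (space M) w * (I w t * I w t) \<partial>M) = 0" .
  moreover have "(\<integral>w. indicator (space M) w * (I w t * I w t) \<partial>M) = (\<integral>w. (I w t)\<^sup>2 \<partial>M)"
    by (rule Bochner_Integration.integral_cong) (auto simp: power2_eq_square)
  ultimately have "AE w in M. (I w t)\<^sup>2 = 0"
    using integral_nonneg_eq_0_iff_AE[OF sq_int_integrable_power2[OF J(2)[OF tt(1)]]] by simp
  then show ?thesis by simp
qed

text \<open>The martingale part is taken from \<open>ito_span\<close> instead of being a single It\^o integral, so that the difference of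
  two It\^o processes is visibly one again.\<close>

definition ito_process :: "real \<Rightarrow> ('w \<Rightarrow> real \<Rightarrow> real) \<Rightarrow> ('w \<Rightarrow> real \<Rightarrow> real) \<Rightarrow> ('w \<Rightarrow> real \<Rightarrow> real ^ 'd) \<Rightarrow> bool" where
  "ito_process t x \<beta> \<phi> \<longleftrightarrow> x \<in> S2 M F t T \<and> \<beta> \<in> H2 M F t T \<and>
     (\<exists>I. ito_span t \<phi> I \<and>
       (AE w in M. \<forall>s\<in>{t..T}. x w s = x w t + (LINT r:{t..s}|lborel. \<beta> w r) + I w s))"

lemma sq_process_AE_set_integrable:
  fixes \<beta> :: "'w \<Rightarrow> real \<Rightarrow> 'b::euclidean_space"
  assumes "sq_process t \<beta>" "t \<le> T"
  shows "AE w in M. \<forall>s\<in>{t..T}. set_integrable lborel {t..s} (\<beta> w)"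
proof -
  have "integrable (time_prod t) (\<lambda>x. \<beta> (snd x) (fst x))"
    by (rule sq_int_integrable[OF finite_time_prod assms(1)[unfolded sq_process_iff]])
  then have "integrable (restrict_space lborel {t..T} \<Otimes>\<^sub>M M) (\<lambda>(r, w). \<beta> w r)"
    by (simp add: time_prod_def case_prod_beta')
  from pair_sigma_finite.AE_integrable_snd[OF pair_sigma_finite_time this]
  show ?thesis
  proof eventually_elim
    case (elim w)
    then have "set_integrable lborel {t..T} (\<beta> w)"
      by (simp add: integrable_restrict_space set_integrable_def)
    then show ?case by (auto intro: set_integrable_subset)
  qed
qed

lemma ito_process_diff:
  assumes x: "ito_process t x \<beta> \<phi>" and y: "ito_process t y \<gamma> \<psi>" and t: "0 \<le> t" "t \<le> T"
  shows "ito_process t (\<lambda>w s. x w s - y w s) (\<lambda>w s. \<beta> w s - \<gamma> w s) (\<lambda>w s. \<phi> w s - \<psi> w s)"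
proof -
  obtain I where x': "x \<in> S2 M F t T" "\<beta> \<in> H2 M F t T" "ito_span t \<phi> I"
    "AE w in M. \<forall>s\<in>{t..T}. x w s = x w t + (LINT r:{t..s}|lborel. \<beta> w r) + I w s"
    using x unfolding ito_process_def by blast
  obtain J where y': "y \<in> S2 M F t T" "\<gamma> \<in> H2 M F t T" "ito_span t \<psi> J"
    "AE w in M. \<forall>s\<in>{t..T}. y w s = y w t + (LINT r:{t..s}|lborel. \<gamma> w r) + J w s"
    using y unfolding ito_process_def by blast
  have "AE w in M. \<forall>s\<in>{t..T}. x w s - y w s = x w t - y w t + (LINT r:{t..s}|lborel. \<beta> w r - \<gamma> w r) + (I w s - J w s)"
    using x'(4) y'(4) sq_process_AE_set_integrable[OF H2_sq_process[OF x'(2) t] t(2)]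
      sq_process_AE_set_integrable[OF H2_sq_process[OF y'(2) t] t(2)]
  proof eventually_elim
    fix w assume w: "\<forall>s\<in>{t..T}. x w s = x w t + (LINT r:{t..s}|lborel. \<beta> w r) + I w s"
      "\<forall>s\<in>{t..T}. y w s = y w t + (LINT r:{t..s}|lborel. \<gamma> w r) + J w s"
      "\<forall>s\<in>{t..T}. set_integrable lborel {t..s} (\<beta> w)" "\<forall>s\<in>{t..T}. set_integrable lborel {t..s} (\<gamma> w)"
    show "\<forall>s\<in>{t..T}. x w s - y w s = x w t - y w t + (LINT r:{t..s}|lborel. \<beta> w r - \<gamma> w r) + (I w s - J w s)"
    proof
      fix s assume s: "s \<in> {t..T}"
      have "(LINT r:{t..s}|lborel. \<beta> w r - \<gamma> w r) = (LINT r:{t..s}|lborel. \<beta> w r) - (LINT r:{t..s}|lborel. \<gamma> w r)"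
        by (rule set_integral_diff(2)[OF bspec[OF w(3) s] bspec[OF w(4) s]])
      then show "x w s - y w s = x w t - y w t + (LINT r:{t..s}|lborel. \<beta> w r - \<gamma> w r) + (I w s - J w s)"
        using bspec[OF w(1) s] bspec[OF w(2) s] by linarith
    qed
  qed
  then show ?thesis unfolding ito_process_def
    using S2_diff[OF x'(1) y'(1) t] H2_diff[OF x'(2) y'(2) t] ito_span.diff[OF x'(3) y'(3)] by blast
qed

text \<open>Pulls the random factor \<open>V\<close>, which may depend on the future, under the time integral.\<close>

lemma drift_pairing:
  assumes b: "\<beta> \<in> H2 M F t T" and t: "0 \<le> t" "t \<le> T" and s: "s \<in> {t..T}" and A: "A \<in> sets M" and V: "sq_int M V"
    and c: "AE w in M. c w = (LINT r:{t..s}|lborel. \<beta> w r)" "c \<in> borel_measurable M"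
  shows "expect_on A (\<lambda>w. V w * c w) = tint t A s (\<lambda>w r. V w * \<beta> w r)"
proof -
  have pi: "proc_integrable t (\<lambda>w r. V w * \<beta> w r)"
    by (rule proc_integrable_mult[OF sq_process_const[OF V] H2_sq_process[OF b t]])
  note ts = tint_section(2,3)[OF pi s A]
  have "expect_on A (\<lambda>w. V w * c w) = expect_on A (\<lambda>w. LINT r:{t..s}|lborel. V w * \<beta> w r)"
  proof (rule integral_cong_AE)
    show "(\<lambda>w. indicator A w * (V w * c w)) \<in> borel_measurable M"
      using A c(2) V by (intro borel_measurable_times borel_measurable_indicator) (auto simp: sq_int_def)
    show "(\<lambda>w. indicator A w * (LINT r:{t..s}|lborel. V w * \<beta> w r)) \<in> borel_measurable M"
      using ts(1) by (rule borel_measurable_integrable)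
    show "AE w in M. indicator A w * (V w * c w) = indicator A w * (LINT r:{t..s}|lborel. V w * \<beta> w r)"
      using c(1) by eventually_elim simp
  qed
  then show ?thesis using ts(2) by simp
qed

text \<open>Write \<open>x = x\<^sub>t + b + I\<close> and \<open>y = y\<^sub>t + c + J\<close> with drift parts \<open>b\<close>, \<open>c\<close> and martingale parts \<open>I\<close>, \<open>J\<close>, and
  expand the product at time \<open>s\<close>. The isometry evaluates \<open>I J\<close>. In the other terms, the drift part is written as a
  time integral, which leaves factors at the final time \<open>s\<close>: for martingale parts these may be replaced by their
  value at the current time by \<open>tint_martingale_increment\<close>, and for drift parts \<open>integral_triangle\<close> exchanges
  the order of integration.\<close>

theorem ito_product_rule:
  assumes x: "ito_process t x \<beta> \<phi>" and y: "ito_process t y \<gamma> \<psi>" and t: "0 \<le> t" "t \<le> T"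
    and s: "s \<in> {t..T}" and A: "A \<in> sets (F t)"
  shows "expect_on A (\<lambda>w. x w s * y w s) = expect_on A (\<lambda>w. x w t * y w t)
    + tint t A s (\<lambda>w r. \<beta> w r * y w r + x w r * \<gamma> w r + \<phi> w r \<bullet> \<psi> w r)"
proof -
  obtain I where x': "x \<in> S2 M F t T" "\<beta> \<in> H2 M F t T" "ito_span t \<phi> I"
    "AE w in M. \<forall>s\<in>{t..T}. x w s = x w t + (LINT r:{t..s}|lborel. \<beta> w r) + I w s"
    using x unfolding ito_process_def by blast
  obtain J where y': "y \<in> S2 M F t T" "\<gamma> \<in> H2 M F t T" "ito_span t \<psi> J"
    "AE w in M. \<forall>s\<in>{t..T}. y w s = y w t + (LINT r:{t..s}|lborel. \<gamma> w r) + J w s"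
    using y unfolding ito_process_def by blast
  have tt: "t \<in> {t..T}" "t \<in> {0..T}" using t by auto
  have AM: "A \<in> sets M" by (rule sets_F_M[OF tt(2) A])
  have sT: "s \<le> T" "t \<le> s" using s by auto
  note I = ito_span_sq[OF x'(3) t] and J = ito_span_sq[OF y'(3) t]
  define b where "b w r = x w r - x w t - I w r" for w r
  define c where "c w r = y w r - y w t - J w r" for w r
  have xs: "sq_int M (\<lambda>w. x w q)" if "q \<in> {t..T}" for q by (rule S2_sq_int[OF x'(1) that t(1)])
  have ys: "sq_int M (\<lambda>w. y w q)" if "q \<in> {t..T}" for q by (rule S2_sq_int[OF y'(1) that t(1)])
  have bs: "sq_int M (\<lambda>w. b w s)" unfolding b_def by (intro sq_int_diff xs s tt I(2))
  have cs: "sq_int M (\<lambda>w. c w s)" unfolding c_def by (intro sq_int_diff ys s tt J(2))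
  have xp: "sq_process t x" by (rule H2_sq_process[OF S2_H2[OF x'(1) t] t])
  have yp: "sq_process t y" by (rule H2_sq_process[OF S2_H2[OF y'(1) t] t])
  have bep: "sq_process t \<beta>" by (rule H2_sq_process[OF x'(2) t])
  have gap: "sq_process t \<gamma>" by (rule H2_sq_process[OF y'(2) t])
  have bp: "sq_process t b" unfolding b_def[abs_def]
    by (intro sq_process_diff xp sq_process_const[OF xs[OF tt(1)]] I(3))
  have cp: "sq_process t c" unfolding c_def[abs_def]
    by (intro sq_process_diff yp sq_process_const[OF ys[OF tt(1)]] J(3))
  have bae: "AE w in M. \<forall>q\<in>{t..T}. b w q = (LINT r:{t..q}|lborel. \<beta> w r)"
    using x'(4) unfolding b_def
  proof eventually_elim
    case (elim w)
    show ?case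
    proof
      fix q assume q: "q \<in> {t..T}"
      show "x w q - x w t - I w q = (LINT r:{t..q}|lborel. \<beta> w r)" using bspec[OF elim q] by linarith
    qed
  qed
  have cae: "AE w in M. \<forall>q\<in>{t..T}. c w q = (LINT r:{t..q}|lborel. \<gamma> w r)"
    using y'(4) unfolding c_def
  proof eventually_elim
    case (elim w)
    show ?case
    proof
      fix q assume q: "q \<in> {t..T}"
      show "y w q - y w t - J w q = (LINT r:{t..q}|lborel. \<gamma> w r)" using bspec[OF elim q] by linarith
    qed
  qed
  have bs_ae: "AE w in M. b w s = (LINT r:{t..s}|lborel. \<beta> w r)" using bae by eventually_elim (use s in blast)
  have cs_ae: "AE w in M. c w s = (LINT r:{t..s}|lborel. \<gamma> w r)" using cae by eventually_elim (use s in blast)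
  define E where "E V = (\<integral>w. indicator A w * V w \<partial>M)" for V :: "'w \<Rightarrow> real"
  have Ei: "integrable M (\<lambda>w. indicator A w * (V w * U w))" if "sq_int M V" "sq_int M U" for U V :: "'w \<Rightarrow> real"
    using integrable_mult_indicator[OF AM sq_int_mult[OF that]] by simp
  \<comment> \<open>martingale parts, which start at \<open>0\<close>, paired with factors known at time \<open>t\<close>\<close>
  have mz: "E (\<lambda>w. V w * N w s) = 0"
    if N: "ito_span t \<theta> N" and V: "sq_int M V" "V \<in> borel_measurable (F t)" for N \<theta> V
  proof -
    have hF: "(\<lambda>w. indicator A w * V w) \<in> borel_measurable (F t)"
      by (intro borel_measurable_times borel_measurable_indicator A V(2))
    have "E (\<lambda>w. V w * N w s) = (\<integral>w. (indicator A w * V w) * N w s \<partial>M)"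
      by (simp add: E_def mult.assoc)
    also have "\<dots> = (\<integral>w. (indicator A w * V w) * N w t \<partial>M)"
      by (rule ito_span_martingale_mult[OF N t order_refl sT(2,1) hF sq_int_indicator_mult[OF V(1) AM]])
    also have "\<dots> = 0"
      by (rule integral_eq_zero_AE) (use ito_span_zero[OF N t] in \<open>eventually_elim, simp\<close>)
    finally show ?thesis .
  qed
  have split: "E (\<lambda>w. x w s * y w s) = E (\<lambda>w. x w t * y w t) + E (\<lambda>w. x w t * c w s) + E (\<lambda>w. x w t * J w s)
     + E (\<lambda>w. y w s * b w s) + E (\<lambda>w. y w t * I w s) + E (\<lambda>w. I w s * c w s) + E (\<lambda>w. I w s * J w s)"
  proof -
    have "E (\<lambda>w. x w s * y w s) = (\<integral>w. indicator A w * (x w t * y w t) + indicator A w * (x w t * c w s)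
        + indicator A w * (x w t * J w s) + indicator A w * (y w s * b w s) + indicator A w * (y w t * I w s)
        + indicator A w * (I w s * c w s) + indicator A w * (I w s * J w s) \<partial>M)"
      unfolding E_def
      by (rule Bochner_Integration.integral_cong[OF refl]) (simp add: b_def c_def algebra_simps)
    also have "\<dots> = E (\<lambda>w. x w t * y w t) + E (\<lambda>w. x w t * c w s) + E (\<lambda>w. x w t * J w s)
     + E (\<lambda>w. y w s * b w s) + E (\<lambda>w. y w t * I w s) + E (\<lambda>w. I w s * c w s) + E (\<lambda>w. I w s * J w s)"
      unfolding E_def
      by (simp only: Bochner_Integration.integral_add Bochner_Integration.integrable_add Ei xs[OF tt(1)] ys[OF tt(1)]
          ys[OF s] cs bs J(2)[OF s] I(2)[OF s])
    finally show ?thesis .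
  qed
  have e1: "E (\<lambda>w. x w t * c w s) = tint t A s (\<lambda>w r. x w t * \<gamma> w r)"
    unfolding E_def by (rule drift_pairing[OF y'(2) t s AM xs[OF tt(1)] cs_ae sq_int_measurable[OF cs]])
  have e2: "E (\<lambda>w. x w t * J w s) = 0"
    by (rule mz[OF y'(3) xs[OF tt(1)] S2_adapted[OF x'(1) tt(1)]])
  have e3: "E (\<lambda>w. y w s * b w s) = tint t A s (\<lambda>w r. y w s * \<beta> w r)"
    unfolding E_def by (rule drift_pairing[OF x'(2) t s AM ys[OF s] bs_ae sq_int_measurable[OF bs]])
  have e4: "E (\<lambda>w. y w t * I w s) = 0"
    by (rule mz[OF x'(3) ys[OF tt(1)] S2_adapted[OF y'(1) tt(1)]])
  have e5: "E (\<lambda>w. I w s * c w s) = tint t A s (\<lambda>w r. I w s * \<gamma> w r)"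
    unfolding E_def by (rule drift_pairing[OF y'(2) t s AM I(2)[OF s] cs_ae sq_int_measurable[OF cs]])
  have e6: "E (\<lambda>w. I w s * J w s) = tint t A s (\<lambda>w r. \<phi> w r \<bullet> \<psi> w r)"
    unfolding E_def by (rule ito_span_isometry[OF x'(3) y'(3) t s A])
  \<comment> \<open>in the drift terms, values at time \<open>s\<close> are replaced by values at the current time \<open>r\<close>\<close>
  note cst = sq_process_const[OF ys[OF s]] sq_process_const[OF ys[OF tt(1)]] sq_process_const[OF xs[OF tt(1)]]
    sq_process_const[OF cs] sq_process_const[OF J(2)[OF s]] sq_process_const[OF I(2)[OF s]]
  have p1: "proc_integrable t (\<lambda>w r. \<beta> w r * y w r)" by (rule proc_integrable_mult[OF bep yp])
  have p2: "proc_integrable t (\<lambda>w r. \<beta> w r * (J w s - J w r))"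
    by (rule proc_integrable_mult[OF bep sq_process_diff[OF cst(5) J(3)]])
  have p3: "proc_integrable t (\<lambda>w r. \<beta> w r * (c w s - c w r))"
    by (rule proc_integrable_mult[OF bep sq_process_diff[OF cst(4) cp]])
  have q1: "proc_integrable t (\<lambda>w r. I w r * \<gamma> w r)" by (rule proc_integrable_mult[OF I(3) gap])
  have q2: "proc_integrable t (\<lambda>w r. \<gamma> w r * (I w s - I w r))"
    by (rule proc_integrable_mult[OF gap sq_process_diff[OF cst(6) I(3)]])
  have q3: "proc_integrable t (\<lambda>w r. b w r * \<gamma> w r)" by (rule proc_integrable_mult[OF bp gap])
  have q4: "proc_integrable t (\<lambda>w r. x w t * \<gamma> w r)" by (rule proc_integrable_mult[OF cst(3) gap])
  have q5: "proc_integrable t (\<lambda>w r. \<phi> w r \<bullet> \<psi> w r)" by (rule proc_integrable_inner[OF I(1) J(1)])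
  have tri: "tint t A s (\<lambda>w r. \<beta> w r * (c w s - c w r)) = tint t A s (\<lambda>w r. b w r * \<gamma> w r)"
    unfolding tint_section(3)[OF p3 s AM] tint_section(3)[OF q3 s AM]
  proof (rule integral_cong_AE[OF borel_measurable_integrable[OF tint_section(2)[OF p3 s AM]]
        borel_measurable_integrable[OF tint_section(2)[OF q3 s AM]]])
    show "AE w in M. indicator A w * (LINT r:{t..s}|lborel. \<beta> w r * (c w s - c w r))
        = indicator A w * (LINT r:{t..s}|lborel. b w r * \<gamma> w r)"
      using bae cae sq_process_AE_set_integrable[OF bep t(2)] sq_process_AE_set_integrable[OF gap t(2)]
    proof eventually_elim
      case (elim w)
      have "(LINT r:{t..s}|lborel. \<beta> w r * (c w s - c w r))
        = (LINT r:{t..s}|lborel. \<beta> w r * ((LINT q:{t..s}|lborel. \<gamma> w q) - (LINT q:{t..r}|lborel. \<gamma> w q)))"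
        using elim(2) s by (intro set_lebesgue_integral_cong) auto
      also have "\<dots> = (LINT q:{t..s}|lborel. (LINT r:{t..q}|lborel. \<beta> w r) * \<gamma> w q)"
        by (rule integral_triangle[OF bspec[OF elim(3) s] bspec[OF elim(4) s]])
      also have "\<dots> = (LINT r:{t..s}|lborel. b w r * \<gamma> w r)"
        using elim(1) s by (intro set_lebesgue_integral_cong) auto
      finally show ?case by simp
    qed
  qed
  have "tint t A s (\<lambda>w r. y w s * \<beta> w r)
    = tint t A s (\<lambda>w r. \<beta> w r * y w r + \<beta> w r * (J w s - J w r) + \<beta> w r * (c w s - c w r))"
    by (rule arg_cong[where f = "tint t A s"]) (simp add: c_def fun_eq_iff algebra_simps)
  also have "\<dots> = tint t A s (\<lambda>w r. \<beta> w r * y w r) + tint t A s (\<lambda>w r. b w r * \<gamma> w r)"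
    unfolding tint_add[OF proc_integrable_add[OF p1 p2] p3 AM sT(1)] tint_add[OF p1 p2 AM sT(1)] tri
      tint_martingale_increment[OF y'(3) t s A x'(2)] by simp
  finally have f3: "tint t A s (\<lambda>w r. y w s * \<beta> w r) = tint t A s (\<lambda>w r. \<beta> w r * y w r) + tint t A s (\<lambda>w r. b w r * \<gamma> w r)" .
  have "tint t A s (\<lambda>w r. I w s * \<gamma> w r) = tint t A s (\<lambda>w r. I w r * \<gamma> w r + \<gamma> w r * (I w s - I w r))"
    by (rule arg_cong[where f = "tint t A s"]) (simp add: fun_eq_iff algebra_simps)
  also have "\<dots> = tint t A s (\<lambda>w r. I w r * \<gamma> w r)"
    unfolding tint_add[OF q1 q2 AM sT(1)] tint_martingale_increment[OF x'(3) t s A y'(2)] by simp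
  finally have f5: "tint t A s (\<lambda>w r. I w s * \<gamma> w r) = tint t A s (\<lambda>w r. I w r * \<gamma> w r)" .
  have "tint t A s (\<lambda>w r. \<beta> w r * y w r + x w r * \<gamma> w r + \<phi> w r \<bullet> \<psi> w r)
    = tint t A s (\<lambda>w r. \<beta> w r * y w r + x w t * \<gamma> w r + b w r * \<gamma> w r + I w r * \<gamma> w r + \<phi> w r \<bullet> \<psi> w r)"
    by (rule arg_cong[where f = "tint t A s"]) (simp add: b_def fun_eq_iff algebra_simps)
  also have "\<dots> = tint t A s (\<lambda>w r. \<beta> w r * y w r) + tint t A s (\<lambda>w r. x w t * \<gamma> w r) + tint t A s (\<lambda>w r. b w r * \<gamma> w r)
     + tint t A s (\<lambda>w r. I w r * \<gamma> w r) + tint t A s (\<lambda>w r. \<phi> w r \<bullet> \<psi> w r)"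
    by (simp only: tint_add[OF _ _ AM sT(1)] proc_integrable_add p1 q1 q3 q4 q5)
  finally show ?thesis using split unfolding e1 e2 e3 e4 e5 e6 f3 f5 E_def by simp
qed

end

section \<open>Moments of suprema of It\^o processes\<close>

lemma set_integral_Cauchy_Schwarz:
  fixes b :: "real \<Rightarrow> real"
  assumes b: "set_integrable lborel {a..u} b" and b2: "set_integrable lborel {a..u} (\<lambda>r. (b r)\<^sup>2)"
    and s: "s \<in> {a..u}"
  shows "(LINT r:{a..s}|lborel. b r)\<^sup>2 \<le> (u - a) * (LINT r:{a..u}|lborel. (b r)\<^sup>2)"
proof -
  define f where "f r = indicator {a..u} r * b r" for r
  define g where "g r = indicat_real {a..s} r" for r
  have f2: "(norm (f r))\<^sup>2 = indicator {a..u} r * (b r)\<^sup>2" for r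
    by (simp add: f_def indicator_def)
  have g2: "(norm (g r))\<^sup>2 = indicat_real {a..s} r" for r
    by (simp add: g_def indicator_def)
  have f: "sq_int lborel f"
    using b b2 unfolding sq_int_def f2 by (simp add: f_def[abs_def] set_integrable_def)
  have "integrable lborel (indicat_real {a..s})" by (simp add: emeasure_lborel_Icc_eq)
  then have g: "sq_int lborel g"
    unfolding sq_int_def g2 by (simp add: g_def[abs_def])
  have "\<bar>\<integral>r. f r \<bullet> g r \<partial>lborel\<bar> \<le> sqrt (\<integral>r. (norm (f r))\<^sup>2 \<partial>lborel) * sqrt (\<integral>r. (norm (g r))\<^sup>2 \<partial>lborel)"
    by (rule L2_Cauchy_Schwarz[OF f g])
  moreover have "(\<integral>r. f r \<bullet> g r \<partial>lborel) = (LINT r:{a..s}|lborel. b r)"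
    unfolding set_lebesgue_integral_def
    using s by (intro Bochner_Integration.integral_cong) (auto simp: f_def g_def indicator_def)
  moreover have "(\<integral>r. (norm (f r))\<^sup>2 \<partial>lborel) = (LINT r:{a..u}|lborel. (b r)\<^sup>2)"
    unfolding f2 by (simp add: set_lebesgue_integral_def)
  moreover have "(\<integral>r. (norm (g r))\<^sup>2 \<partial>lborel) = s - a"
    unfolding g2 using s by simp
  ultimately have le: "\<bar>LINT r:{a..s}|lborel. b r\<bar> \<le> sqrt ((LINT r:{a..u}|lborel. (b r)\<^sup>2) * (s - a))"
    by (simp add: real_sqrt_mult)
  have nn: "0 \<le> (LINT r:{a..u}|lborel. (b r)\<^sup>2)"
    unfolding set_lebesgue_integral_def by (intro integral_nonneg_AE AE_I2) auto
  have "(LINT r:{a..s}|lborel. b r)\<^sup>2 \<le> (sqrt ((LINT r:{a..u}|lborel. (b r)\<^sup>2) * (s - a)))\<^sup>2"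
    using power_mono[OF le abs_ge_zero, of 2] by simp
  also have "\<dots> = (LINT r:{a..u}|lborel. (b r)\<^sup>2) * (s - a)"
    using nn s by (intro real_sqrt_pow2 mult_nonneg_nonneg) auto
  also have "\<dots> \<le> (LINT r:{a..u}|lborel. (b r)\<^sup>2) * (u - a)"
    using nn s by (intro mult_left_mono) auto
  finally show ?thesis by (simp add: mult.commute)
qed

context brownian_filtration
begin

lemma S2_const:
  fixes V :: "'w \<Rightarrow> 'b::euclidean_space"
  assumes V: "V \<in> borel_measurable (F t)" "sq_int M V" and t: "0 \<le> t" "t \<le> T"
  shows "(\<lambda>w s. V w) \<in> S2 M F t T"
proof -
  have "(SUP s\<in>{t..T}. norm (V w)) = norm (V w)" for w using t by (intro cSUP_const) auto
  then show ?thesis unfolding S2_def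
    using V t by (auto simp: sq_int_def intro: measurable_F_mono[OF t(1)])
qed

text \<open>Dominated convergence, with the integrable supremum as the dominating function. The continuity makes Gronwall's
  inequality applicable.\<close>

lemma S2_moment_continuous:
  fixes X :: "'w \<Rightarrow> real \<Rightarrow> 'b::euclidean_space"
  assumes X: "X \<in> S2 M F t T" and t: "0 \<le> t" "t \<le> T" and A: "A \<in> sets M"
  shows "continuous_on {t..T} (\<lambda>s. \<integral>w. indicator A w * (norm (X w s))\<^sup>2 \<partial>M)"
proof (rule continuous_on_sequentiallyI)
  fix q :: "nat \<Rightarrow> real" and s assume q: "\<forall>n. q n \<in> {t..T}" and s: "s \<in> {t..T}" and lim: "q \<longlonglongrightarrow> s"
  have m: "(\<lambda>w. indicator A w * (norm (X w r))\<^sup>2) \<in> borel_measurable M" if "r \<in> {t..T}" for r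
    using S2_sq_int[OF X that t(1)] A by (auto simp: sq_int_def)
  show "(\<lambda>n. \<integral>w. indicator A w * (norm (X w (q n)))\<^sup>2 \<partial>M) \<longlonglongrightarrow> expect_on A (\<lambda>w. (norm (X w s))\<^sup>2)"
  proof (rule integral_dominated_convergence[OF m[OF s] m S2_sup_integrable[OF X t(2)]])
    show "q n \<in> {t..T}" for n using q by blast
    show "AE w in M. (\<lambda>n. indicator A w * (norm (X w (q n)))\<^sup>2) \<longlonglongrightarrow> indicator A w * (norm (X w s))\<^sup>2"
    proof (rule AE_I2)
      fix w assume w: "w \<in> space M"
      have "(\<lambda>n. X w (q n)) \<longlonglongrightarrow> X w s"
        by (rule continuous_on_tendsto_compose[OF S2_continuous[OF X w] lim s])
           (rule always_eventually[OF q])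
      then show "(\<lambda>n. indicator A w * (norm (X w (q n)))\<^sup>2) \<longlonglongrightarrow> indicator A w * (norm (X w s))\<^sup>2"
        by (intro tendsto_mult_left tendsto_power tendsto_norm)
    qed
    show "AE w in M. norm (indicator A w * (norm (X w (q n)))\<^sup>2) \<le> sup_norm2 t T X w" for n
    proof (rule AE_I2)
      fix w assume w: "w \<in> space M"
      have "(norm (X w (q n)))\<^sup>2 \<le> sup_norm2 t T X w"
        by (rule sup_norm2_upper[where X = X, OF S2_continuous[OF X w]]) (use q in blast)
      moreover from this have "0 \<le> sup_norm2 t T X w" by (rule order_trans[OF zero_le_power2])
      ultimately show "norm (indicator A w * (norm (X w (q n)))\<^sup>2) \<le> sup_norm2 t T X w"
        by (simp add: indicator_def)
    qed
  qed
qed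

lemma tint_norm2_integral:
  fixes X :: "'w \<Rightarrow> real \<Rightarrow> 'b::euclidean_space"
  assumes X: "X \<in> S2 M F t T" and t: "0 \<le> t" "t \<le> T" and A: "A \<in> sets M" and s: "s \<in> {t..T}"
  shows "tint t A s (\<lambda>w r. (norm (X w r))\<^sup>2) = integral {t..s} (\<lambda>r. \<integral>w. indicator A w * (norm (X w r))\<^sup>2 \<partial>M)"
proof -
  have pi: "proc_integrable t (\<lambda>w r. (norm (X w r))\<^sup>2)"
    by (rule proc_integrable_norm2[OF H2_sq_process[OF S2_H2[OF X t] t]])
  show ?thesis unfolding tint_time(1)[OF pi s A]
    by (rule set_borel_integral_eq_integral(2)[OF tint_time(2)[OF pi s A]])
qed

lemma tint_const:
  assumes "A \<in> sets M" "s \<in> {t..T}"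
  shows "tint t A s (\<lambda>w r. c) = (s - t) * (c * prob A)"
proof -
  have Ai: "integrable M (indicat_real A)" using assms(1) by (simp add: emeasure_eq_measure)
  have "tint t A s (\<lambda>w r. c) = c * (\<integral>x. indicator {t..s} (fst x) * indicator A (snd x) \<partial>time_prod t)"
    unfolding tint_def by (simp add: indicator_times)
  also have "(\<integral>x. indicator {t..s} (fst x) * indicator A (snd x) \<partial>time_prod t) = (s - t) * prob A"
    using integral_time_prod_mult(2)[of "{t..s}" t "indicat_real A"] assms Ai
      sets.sets_into_space[OF assms(1)] by (simp add: Int_absorb2)
  finally show ?thesis by simp
qed

lemma tint_const_le:
  assumes "A \<in> sets M" "s \<in> {t..T}" "0 \<le> t" "0 \<le> c"
  shows "tint t A s (\<lambda>w r. c) \<le> T * (c * prob A)"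
  unfolding tint_const[OF assms(1,2)] using assms by (intro mult_right_mono) auto

lemma tint_mono_increment:
  assumes h: "proc_integrable t h" and k: "proc_integrable t k" and A: "A \<in> sets M" and s: "s \<le> T"
    and le: "AE w in M. \<forall>r\<in>{t..T}. h w r \<le> k w r"
  shows "tint t A T h - tint t A s h \<le> tint t A T k - tint t A s k"
proof -
  have nn: "0 \<le> tint t A T (\<lambda>w r. k w r - h w r) - tint t A s (\<lambda>w r. k w r - h w r)"
  proof -
    note d = proc_integrable_diff[OF k h]
    have "tint t A s (\<lambda>w r. k w r - h w r) \<le> tint t A T (\<lambda>w r. k w r - h w r)"
      unfolding tint_def
    proof (rule integral_mono_AE[OF tint_integrable[OF d A s] tint_integrable[OF d A order_refl]])
      show "AE x in time_prod t. indicator ({t..s} \<times> A) x * (k (snd x) (fst x) - h (snd x) (fst x))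
          \<le> indicator ({t..T} \<times> A) x * (k (snd x) (fst x) - h (snd x) (fst x))"
        using AE_time_prod[OF le]
      proof eventually_elim
        case (elim x)
        then show ?case using s by (intro mult_right_mono) (auto simp: indicator_def)
      qed
    qed
    then show ?thesis by simp
  qed
  then show ?thesis
    unfolding tint_diff[OF k h A s] tint_diff[OF k h A order_refl] by simp
qed

lemma ito_process_S2: "ito_process t x \<beta> \<phi> \<Longrightarrow> x \<in> S2 M F t T"
  by (simp add: ito_process_def)

lemma ito_process_H2:
  assumes "ito_process t x \<beta> \<phi>" "0 \<le> t" "t \<le> T"
  shows "\<beta> \<in> H2 M F t T" "\<phi> \<in> H2 M F t T"
  using assms ito_span_H2_S2 unfolding ito_process_def by blast+

lemma centered_S2:
  fixes x :: "'w \<Rightarrow> real \<Rightarrow> 'b::euclidean_space"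
  assumes "x \<in> S2 M F t T" "0 \<le> t" "t \<le> T"
  shows "(\<lambda>w s. x w s - x w t) \<in> S2 M F t T"
proof -
  have tt: "t \<in> {t..T}" using assms by simp
  show ?thesis
    by (rule S2_diff[OF assms(1) S2_const[OF S2_adapted[OF assms(1) tt] S2_sq_int[OF assms(1) tt assms(2)] assms(2,3)] assms(2,3)])
qed

text \<open>The drift is estimated by the Cauchy--Schwarz inequality in time, the martingale part by Doob's inequality and
  the isometry.\<close>

lemma ito_process_sup:
  assumes x: "ito_process t x \<beta> \<phi>" and t: "0 \<le> t" "t \<le> T" and u: "t \<le> u" "u \<le> T" and A: "A \<in> sets (F t)"
  shows "expect_on A (\<lambda>w. sup_norm2 t u (\<lambda>w s. x w s - x w t) w)
    \<le> 2 * ((u - t) * tint t A u (\<lambda>w r. (\<beta> w r)\<^sup>2)) + 8 * tint t A u (\<lambda>w r. (norm (\<phi> w r))\<^sup>2)"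
proof -
  obtain I where x': "x \<in> S2 M F t T" "\<beta> \<in> H2 M F t T" "ito_span t \<phi> I"
    "AE w in M. \<forall>s\<in>{t..T}. x w s = x w t + (LINT r:{t..s}|lborel. \<beta> w r) + I w s"
    using x unfolding ito_process_def by blast
  have tt: "t \<in> {t..T}" "t \<in> {0..T}" using t by auto
  have AM: "A \<in> sets M" by (rule sets_F_M[OF tt(2) A])
  have ut: "u \<in> {t..T}" using u by simp
  let ?D = "\<lambda>w s. x w s - x w t"
  have DS: "?D \<in> S2 M F t T" by (rule centered_S2[OF x'(1) t])
  have bs: "sq_process t \<beta>" by (rule H2_sq_process[OF x'(2) t])
  have b2: "proc_integrable t (\<lambda>w r. (\<beta> w r)\<^sup>2)" using proc_integrable_norm2[OF bs] by simp
  note I = ito_span_sq[OF x'(3) t]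
  note sI = sup_norm2_integrable_sub[OF I(4) t(1) u]
  note sD = sup_norm2_integrable_sub[OF DS t(1) u]
  note tb = tint_section[OF b2 ut AM]
  have path: "AE w in M. sup_norm2 t u ?D w \<le> 2 * ((u - t) * (LINT r:{t..u}|lborel. (\<beta> w r)\<^sup>2)) + 2 * sup_norm2 t u I w"
    using x'(4) sq_process_AE_set_integrable[OF bs t(2)] tb(1) AE_space
  proof eventually_elim
    case (elim w)
    have cI: "continuous_on {t..u} (I w)"
      by (rule continuous_on_subset[OF S2_continuous[OF I(4) elim(4)]]) (use u in auto)
    show ?case
    proof (rule sup_norm2_le[OF u(1)])
      fix s assume s: "s \<in> {t..u}"
      then have sT: "s \<in> {t..T}" using u by auto
      have eq: "x w s - x w t = (LINT r:{t..s}|lborel. \<beta> w r) + I w s" using bspec[OF elim(1) sT] by simp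
      have "(norm (x w s - x w t))\<^sup>2 \<le> 2 * (norm (LINT r:{t..s}|lborel. \<beta> w r))\<^sup>2 + 2 * (norm (I w s))\<^sup>2"
        unfolding eq by (rule norm_add_power2_le)
      moreover have "(norm (LINT r:{t..s}|lborel. \<beta> w r))\<^sup>2 \<le> (u - t) * (LINT r:{t..u}|lborel. (\<beta> w r)\<^sup>2)"
        using set_integral_Cauchy_Schwarz[OF bspec[OF elim(2) ut] elim(3) s] by simp
      moreover have "(norm (I w s))\<^sup>2 \<le> sup_norm2 t u I w" by (rule sup_norm2_upper[where X = I, OF cI s])
      ultimately show "(norm (x w s - x w t))\<^sup>2 \<le> 2 * ((u - t) * (LINT r:{t..u}|lborel. (\<beta> w r)\<^sup>2)) + 2 * sup_norm2 t u I w"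
        by linarith
    qed
  qed
  have i1: "integrable M (\<lambda>w. indicator A w * sup_norm2 t u ?D w)"
    using integrable_mult_indicator[OF AM sD(1)] by simp
  have i2: "integrable M (\<lambda>w. indicator A w * sup_norm2 t u I w)"
    using integrable_mult_indicator[OF AM sI(1)] by simp
  have "expect_on A (\<lambda>w. sup_norm2 t u ?D w)
    \<le> (\<integral>w. 2 * ((u - t) * (indicator A w * (LINT r:{t..u}|lborel. (\<beta> w r)\<^sup>2))) + 2 * (indicator A w * sup_norm2 t u I w) \<partial>M)"
  proof (rule integral_mono_AE[OF i1])
    show "integrable M (\<lambda>w. 2 * ((u - t) * (indicator A w * (LINT r:{t..u}|lborel. (\<beta> w r)\<^sup>2))) + 2 * (indicator A w * sup_norm2 t u I w))"
      by (intro Bochner_Integration.integrable_add integrable_mult_right tb(2) i2)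
    show "AE w in M. indicator A w * sup_norm2 t u ?D w
      \<le> 2 * ((u - t) * (indicator A w * (LINT r:{t..u}|lborel. (\<beta> w r)\<^sup>2))) + 2 * (indicator A w * sup_norm2 t u I w)"
      using path by eventually_elim (simp add: indicator_def)
  qed
  also have "\<dots> = 2 * ((u - t) * tint t A u (\<lambda>w r. (\<beta> w r)\<^sup>2)) + 2 * expect_on A (sup_norm2 t u I)"
    unfolding tb(3)
    by (simp only: Bochner_Integration.integral_add integrable_mult_right tb(2) i2 integral_mult_right_zero)
  also have "expect_on A (sup_norm2 t u I) \<le> 4 * expect_on A (\<lambda>w. (I w u)\<^sup>2)"
    by (rule doob_maximal[OF x'(3) t u A])
  also have "expect_on A (\<lambda>w. (I w u)\<^sup>2) = tint t A u (\<lambda>w r. (norm (\<phi> w r))\<^sup>2)"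
    using ito_span_isometry[OF x'(3) x'(3) t ut A] by (simp add: power2_eq_square[of "I _ u"] power2_norm_eq_inner)
  finally show ?thesis by simp
qed

lemma sup_norm2_centered:
  fixes x :: "'w \<Rightarrow> real \<Rightarrow> 'b::euclidean_space"
  assumes x: "x \<in> S2 M F t T" and t: "0 \<le> t" "t \<le> T" and w: "w \<in> space M"
  shows "sup_norm2 t T x w \<le> 2 * (norm (x w t))\<^sup>2 + 2 * sup_norm2 t T (\<lambda>w s. x w s - x w t) w"
proof (rule sup_norm2_le[OF t(2)])
  fix s assume s: "s \<in> {t..T}"
  have "(norm (x w t + (x w s - x w t)))\<^sup>2 \<le> 2 * (norm (x w t))\<^sup>2 + 2 * (norm (x w s - x w t))\<^sup>2"
    by (rule norm_add_power2_le)
  moreover have "(norm (x w s - x w t))\<^sup>2 \<le> sup_norm2 t T (\<lambda>w s. x w s - x w t) w"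
    by (rule sup_norm2_upper[where X = "\<lambda>w s. x w s - x w t", OF S2_continuous[OF centered_S2[OF x t] w] s])
  ultimately show "(norm (x w s))\<^sup>2 \<le> 2 * (norm (x w t))\<^sup>2 + 2 * sup_norm2 t T (\<lambda>w s. x w s - x w t) w"
    by simp
qed

lemma sup_norm2_components:
  fixes x :: "'w \<Rightarrow> real \<Rightarrow> real ^ 'n"
  assumes x: "x \<in> S2 M F t T" and t: "0 \<le> t" and u: "t \<le> u" "u \<le> T" and w: "w \<in> space M"
  shows "sup_norm2 t u x w \<le> (\<Sum>i\<in>UNIV. sup_norm2 t u (\<lambda>w s. x w s $ i) w)"
proof (rule sup_norm2_le[OF u(1)])
  fix s assume s: "s \<in> {t..u}"
  have c: "continuous_on {t..u} (\<lambda>s. x w s $ i)" for i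
    by (intro continuous_intros continuous_on_subset[OF S2_continuous[OF x w]]) (use u in auto)
  have "(x w s $ i)\<^sup>2 \<le> sup_norm2 t u (\<lambda>w s. x w s $ i) w" for i
    using sup_norm2_upper[where X = "\<lambda>w s. x w s $ i", OF c s] by simp
  then show "(norm (x w s))\<^sup>2 \<le> (\<Sum>i\<in>UNIV. sup_norm2 t u (\<lambda>w s. x w s $ i) w)"
    unfolding power2_norm_vec by (intro sum_mono)
qed

lemma vector_process_sup:
  fixes x \<beta> :: "'w \<Rightarrow> real \<Rightarrow> real ^ 'n" and \<sigma> :: "'w \<Rightarrow> real \<Rightarrow> real ^ 'd ^ 'n"
  assumes x: "x \<in> S2 M F t T"
    and ip: "\<And>i. ito_process t (\<lambda>w s. x w s $ i) (\<lambda>w s. \<beta> w s $ i) (\<lambda>w s. \<sigma> w s $ i)"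
    and t: "0 \<le> t" "t \<le> T" and u: "t \<le> u" "u \<le> T" and A: "A \<in> sets (F t)"
  shows "expect_on A (\<lambda>w. sup_norm2 t u (\<lambda>w s. x w s - x w t) w)
    \<le> 2 * ((u - t) * tint t A u (\<lambda>w r. (norm (\<beta> w r))\<^sup>2)) + 8 * tint t A u (\<lambda>w r. (norm (\<sigma> w r))\<^sup>2)"
proof -
  have tt: "t \<in> {t..T}" "t \<in> {0..T}" using t by auto
  have AM: "A \<in> sets M" by (rule sets_F_M[OF tt(2) A])
  let ?D = "\<lambda>w s. x w s - x w t"
  have DS: "?D \<in> S2 M F t T" by (rule centered_S2[OF x t])
  have DSi: "(\<lambda>w s. ?D w s $ i) \<in> S2 M F t T" for i by (rule S2_component[OF DS t])
  have i1: "integrable M (\<lambda>w. indicator A w * sup_norm2 t u ?D w)"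
    using integrable_mult_indicator[OF AM sup_norm2_integrable_sub(1)[OF DS t(1) u]] by simp
  have i2: "integrable M (\<lambda>w. indicator A w * sup_norm2 t u (\<lambda>w s. ?D w s $ i) w)" for i
    using integrable_mult_indicator[OF AM sup_norm2_integrable_sub(1)[OF DSi t(1) u]] by simp
  have pb: "proc_integrable t (\<lambda>w r. (\<beta> w r $ i)\<^sup>2)" for i
    using proc_integrable_norm2[OF H2_sq_process[OF ito_process_H2(1)[OF ip[of i] t] t]] by simp
  have ps: "proc_integrable t (\<lambda>w r. (norm (\<sigma> w r $ i))\<^sup>2)" for i
    by (rule proc_integrable_norm2[OF H2_sq_process[OF ito_process_H2(2)[OF ip[of i] t] t]])
  have "expect_on A (\<lambda>w. sup_norm2 t u ?D w)
    \<le> (\<integral>w. (\<Sum>i\<in>UNIV. indicator A w * sup_norm2 t u (\<lambda>w s. ?D w s $ i) w) \<partial>M)"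
  proof (rule integral_mono[OF i1 Bochner_Integration.integrable_sum[OF i2]])
    fix w assume w: "w \<in> space M"
    show "indicator A w * sup_norm2 t u ?D w \<le> (\<Sum>i\<in>UNIV. indicator A w * sup_norm2 t u (\<lambda>w s. ?D w s $ i) w)"
      unfolding sum_distrib_left[symmetric] using sup_norm2_components[OF DS t(1) u w] by (rule mult_left_mono) simp
  qed
  also have "\<dots> = (\<Sum>i\<in>UNIV. expect_on A (\<lambda>w. sup_norm2 t u (\<lambda>w s. ?D w s $ i) w))"
    by (rule Bochner_Integration.integral_sum[OF i2])
  also have "\<dots> \<le> (\<Sum>i\<in>UNIV. 2 * ((u - t) * tint t A u (\<lambda>w r. (\<beta> w r $ i)\<^sup>2)) + 8 * tint t A u (\<lambda>w r. (norm (\<sigma> w r $ i))\<^sup>2))"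
    using ito_process_sup[OF ip t u A] by (intro sum_mono) simp
  also have "\<dots> = 2 * ((u - t) * tint t A u (\<lambda>w r. (norm (\<beta> w r))\<^sup>2)) + 8 * tint t A u (\<lambda>w r. (norm (\<sigma> w r))\<^sup>2)"
  proof -
    have "tint t A u (\<lambda>w r. (norm (\<beta> w r))\<^sup>2) = (\<Sum>i\<in>UNIV. tint t A u (\<lambda>w r. (\<beta> w r $ i)\<^sup>2))"
      unfolding power2_norm_vec by (rule tint_sum[OF pb AM u(2)])
    moreover have "(norm (\<sigma> w r))\<^sup>2 = (\<Sum>i\<in>UNIV. (norm (\<sigma> w r $ i))\<^sup>2)" for w r
      by (simp add: power2_norm_eq_inner inner_vec_def)
    then have "tint t A u (\<lambda>w r. (norm (\<sigma> w r))\<^sup>2) = (\<Sum>i\<in>UNIV. tint t A u (\<lambda>w r. (norm (\<sigma> w r $ i))\<^sup>2))"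
      using tint_sum[OF ps AM u(2)] by simp
    ultimately show ?thesis by (simp add: sum.distrib sum_distrib_left)
  qed
  finally show ?thesis .
qed

end

section \<open>Forward-backward systems\<close>

text \<open>Young's inequality, with the weight that makes the first term small.\<close>

lemma young_mult: "0 < e \<Longrightarrow> (a::real) * b \<le> e * a\<^sup>2 + b\<^sup>2 / (4 * e)"
proof -
  assume e: "0 < e"
  have "0 \<le> (2 * e * a - b)\<^sup>2 / (4 * e)" using e by simp
  also have "\<dots> = e * a\<^sup>2 + b\<^sup>2 / (4 * e) - a * b"
    using e by (simp add: power2_eq_square field_simps)
  finally show ?thesis by simp
qed

lemma power2_sum4_le:
  fixes a b c d :: real
  shows "(a + b + c + d)\<^sup>2 \<le> 4 * (a\<^sup>2 + b\<^sup>2 + c\<^sup>2 + d\<^sup>2)"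
proof -
  have "(a + b + c + d)\<^sup>2 = a\<^sup>2 + b\<^sup>2 + c\<^sup>2 + d\<^sup>2 + 2 * a * b + 2 * a * c + 2 * a * d + 2 * b * c + 2 * b * d + 2 * c * d"
    by (simp add: power2_eq_square algebra_simps)
  then show ?thesis
    using sum_squares_bound[of a b] sum_squares_bound[of a c] sum_squares_bound[of a d]
      sum_squares_bound[of b c] sum_squares_bound[of b d] sum_squares_bound[of c d] by argo
qed

lemma linear_growth_power2:
  fixes K :: real
  assumes "0 \<le> v" "v \<le> K * (a + b + c + d)"
  shows "v\<^sup>2 \<le> 4 * K\<^sup>2 * (a\<^sup>2 + b\<^sup>2 + c\<^sup>2 + d\<^sup>2)"
proof -
  have "v\<^sup>2 \<le> (K * (a + b + c + d))\<^sup>2" using assms by (intro power_mono) auto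
  also have "\<dots> \<le> K\<^sup>2 * (4 * (a\<^sup>2 + b\<^sup>2 + c\<^sup>2 + d\<^sup>2))"
    unfolding power_mult_distrib by (intro mult_left_mono power2_sum4_le) simp
  finally show ?thesis by (simp only: ac_simps)
qed

lemma integral_le_const_interval:
  fixes u :: "real \<Rightarrow> real"
  assumes "continuous_on {a..b} u" "\<And>s. s \<in> {a..b} \<Longrightarrow> u s \<le> c" "a \<le> b"
  shows "integral {a..b} u \<le> (b - a) * c"
proof -
  have "integral {a..b} u \<le> integral {a..b} (\<lambda>_. c)"
    by (rule integral_le) (use assms in \<open>auto intro: integrable_continuous_real\<close>)
  then show ?thesis using assms by simp
qed

lemma norm2_matrix: "(norm (s :: real ^ 'd ^ 'n))\<^sup>2 = (\<Sum>i\<in>UNIV. (norm (s $ i))\<^sup>2)"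
  by (simp add: power2_norm_eq_inner inner_vec_def)

context brownian_filtration
begin

text \<open>The coefficients enter only through their values \<open>\<beta>\<close>, \<open>\<sigma>\<close>, \<open>g\<close> along the solution and the
  growth of these values. The constant \<open>k\<close> is \<open>0\<close> for the difference of two solutions and \<open>1\<close> for a single solution.\<close>

definition fb_system :: "real \<Rightarrow> real \<Rightarrow> real \<Rightarrow> ('w \<Rightarrow> real \<Rightarrow> real ^ 'n) \<Rightarrow> ('w \<Rightarrow> real \<Rightarrow> real) \<Rightarrow> ('w \<Rightarrow> real \<Rightarrow> real ^ 'd) \<Rightarrow>
    ('w \<Rightarrow> real \<Rightarrow> real ^ 'n) \<Rightarrow> ('w \<Rightarrow> real \<Rightarrow> real ^ 'd ^ 'n) \<Rightarrow> ('w \<Rightarrow> real \<Rightarrow> real) \<Rightarrow> bool" where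
  "fb_system t K k x y z \<beta> \<sigma> g \<longleftrightarrow> x \<in> S2 M F t T \<and>
     (\<forall>i. ito_process t (\<lambda>w s. x w s $ i) (\<lambda>w s. \<beta> w s $ i) (\<lambda>w s. \<sigma> w s $ i)) \<and>
     ito_process t y (\<lambda>w s. - g w s) z \<and>
     (AE w in M. \<forall>r\<in>{t..T}.
        norm (\<beta> w r) \<le> K * (norm (x w r) + \<bar>y w r\<bar> + norm (z w r) + k) \<and>
        norm (\<sigma> w r) \<le> K * (norm (x w r) + \<bar>y w r\<bar> + norm (z w r) + k) \<and>
        \<bar>g w r\<bar> \<le> K * (norm (x w r) + \<bar>y w r\<bar> + norm (z w r) + k)) \<and>
     (AE w in M. \<bar>y w T\<bar> \<le> K * (norm (x w T) + k))"

text \<open>The monotonicity condition along the solution, where \<open>\<gamma>\<close> is the only row of \<open>G\<close>. The left-hand side of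
  the first inequality is the drift of \<open>(\<gamma> \<bullet> x) y\<close>. The terms with \<open>K * k\<close> are the error made by comparing a single
  solution with the zero state.\<close>

definition fb_monotone :: "real \<Rightarrow> real ^ 'n \<Rightarrow> real \<Rightarrow> real \<Rightarrow> real \<Rightarrow> real \<Rightarrow> real \<Rightarrow> ('w \<Rightarrow> real \<Rightarrow> real ^ 'n) \<Rightarrow> ('w \<Rightarrow> real \<Rightarrow> real) \<Rightarrow> ('w \<Rightarrow> real \<Rightarrow> real ^ 'd) \<Rightarrow>
    ('w \<Rightarrow> real \<Rightarrow> real ^ 'n) \<Rightarrow> ('w \<Rightarrow> real \<Rightarrow> real ^ 'd ^ 'n) \<Rightarrow> ('w \<Rightarrow> real \<Rightarrow> real) \<Rightarrow> bool" where
  "fb_monotone t \<gamma> b1 b2 m1 K k x y z \<beta> \<sigma> g \<longleftrightarrow>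
     (AE w in M. \<forall>r\<in>{t..T}.
        (\<gamma> \<bullet> \<beta> w r) * y w r - (\<gamma> \<bullet> x w r) * g w r + (\<Sum>i\<in>UNIV. \<gamma> $ i * (\<sigma> w r $ i \<bullet> z w r))
        \<le> - b1 * (\<gamma> \<bullet> x w r)\<^sup>2 - b2 * ((y w r)\<^sup>2 + (norm (z w r))\<^sup>2)
          + K * k * (norm (x w r) + \<bar>y w r\<bar> + norm (z w r))) \<and>
     (AE w in M. m1 * (\<gamma> \<bullet> x w T)\<^sup>2 - K * k * norm (x w T) \<le> y w T * (\<gamma> \<bullet> x w T))"

lemma fb_system_processes:
  assumes S: "fb_system t K k x y z \<beta> \<sigma> g" and t: "0 \<le> t" "t \<le> T"
  shows "x \<in> S2 M F t T" "y \<in> S2 M F t T"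
    "\<And>i. ito_process t (\<lambda>w s. x w s $ i) (\<lambda>w s. \<beta> w s $ i) (\<lambda>w s. \<sigma> w s $ i)"
    "ito_process t y (\<lambda>w s. - g w s) z"
    "sq_process t x" "\<And>i. sq_process t (\<lambda>w r. x w r $ i)" "sq_process t y" "sq_process t z"
    "\<And>i. sq_process t (\<lambda>w r. \<beta> w r $ i)" "\<And>i. sq_process t (\<lambda>w r. \<sigma> w r $ i)" "sq_process t (\<lambda>w r. - g w r)"
    "proc_integrable t (\<lambda>w r. (norm (x w r))\<^sup>2)" "proc_integrable t (\<lambda>w r. (y w r)\<^sup>2)"
    "proc_integrable t (\<lambda>w r. (norm (z w r))\<^sup>2)" "proc_integrable t (\<lambda>w r. (norm (\<beta> w r))\<^sup>2)"
    "proc_integrable t (\<lambda>w r. (norm (\<sigma> w r))\<^sup>2)" "proc_integrable t (\<lambda>w r. (g w r)\<^sup>2)"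
proof -
  show x: "x \<in> S2 M F t T" and xi: "\<And>i. ito_process t (\<lambda>w s. x w s $ i) (\<lambda>w s. \<beta> w s $ i) (\<lambda>w s. \<sigma> w s $ i)"
    and yi: "ito_process t y (\<lambda>w s. - g w s) z" using S by (auto simp: fb_system_def)
  show y: "y \<in> S2 M F t T" by (rule ito_process_S2[OF yi])
  show xp: "sq_process t x" by (rule H2_sq_process[OF S2_H2[OF x t] t])
  show "sq_process t (\<lambda>w r. x w r $ i)" for i by (rule H2_sq_process[OF S2_H2[OF S2_component[OF x t] t] t])
  show yp: "sq_process t y" by (rule H2_sq_process[OF S2_H2[OF y t] t])
  show zp: "sq_process t z" by (rule H2_sq_process[OF ito_process_H2(2)[OF yi t] t])
  show bp: "sq_process t (\<lambda>w r. \<beta> w r $ i)" for i by (rule H2_sq_process[OF ito_process_H2(1)[OF xi t] t])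
  show sp: "sq_process t (\<lambda>w r. \<sigma> w r $ i)" for i by (rule H2_sq_process[OF ito_process_H2(2)[OF xi t] t])
  show gp: "sq_process t (\<lambda>w r. - g w r)" by (rule H2_sq_process[OF ito_process_H2(1)[OF yi t] t])
  show "proc_integrable t (\<lambda>w r. (norm (x w r))\<^sup>2)" by (rule proc_integrable_norm2[OF xp])
  show "proc_integrable t (\<lambda>w r. (y w r)\<^sup>2)" using proc_integrable_norm2[OF yp] by simp
  show "proc_integrable t (\<lambda>w r. (norm (z w r))\<^sup>2)" by (rule proc_integrable_norm2[OF zp])
  show "proc_integrable t (\<lambda>w r. (norm (\<beta> w r))\<^sup>2)" unfolding power2_norm_vec
    using proc_integrable_norm2[OF bp] by (intro proc_integrable_sum) simp
  show "proc_integrable t (\<lambda>w r. (norm (\<sigma> w r))\<^sup>2)" unfolding norm2_matrix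
    by (intro proc_integrable_sum proc_integrable_norm2[OF sp])
  show "proc_integrable t (\<lambda>w r. (g w r)\<^sup>2)" using proc_integrable_norm2[OF gp] by simp
qed

lemma expect_on_norm2_integrable:
  fixes X :: "'w \<Rightarrow> real \<Rightarrow> 'b::euclidean_space"
  assumes "X \<in> S2 M F t T" "s \<in> {t..T}" "0 \<le> t" "A \<in> sets M"
  shows "integrable M (\<lambda>w. indicator A w * (norm (X w s))\<^sup>2)"
  using integrable_mult_indicator[OF assms(4) sq_int_integrable_norm2[OF S2_sq_int[OF assms(1-3)]]] by simp

lemma expect_on_const: "A \<in> sets M \<Longrightarrow> expect_on A (\<lambda>_. c) = c * prob A"
  using sets.sets_into_space[of A M] by (simp add: Int_absorb2)

lemma tint_growth_bound:
  assumes S: "fb_system t K k x y z \<beta> \<sigma> g" and t: "0 \<le> t" "t \<le> T" and A: "A \<in> sets M"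
    and h: "proc_integrable t h" and C: "0 \<le> C" and s: "s \<in> {t..T}"
    and le: "AE w in M. \<forall>r\<in>{t..T}. h w r \<le> C * ((norm (x w r))\<^sup>2 + (y w r)\<^sup>2 + (norm (z w r))\<^sup>2 + k\<^sup>2)"
  shows "tint t A s h \<le> C * (tint t A s (\<lambda>w r. (norm (x w r))\<^sup>2) + tint t A T (\<lambda>w r. (y w r)\<^sup>2)
      + tint t A T (\<lambda>w r. (norm (z w r))\<^sup>2) + T * (k\<^sup>2 * prob A))"
proof -
  note p = fb_system_processes[OF S t]
  have sT: "s \<le> T" using s by simp
  note pk = proc_integrable_const[of t "k\<^sup>2"]
  note p1 = proc_integrable_add[OF p(12,13)]
  note p2 = proc_integrable_add[OF p1 p(14)]
  note p3 = proc_integrable_add[OF p2 pk]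
  have "tint t A s h \<le> tint t A s (\<lambda>w r. C * ((norm (x w r))\<^sup>2 + (y w r)\<^sup>2 + (norm (z w r))\<^sup>2 + k\<^sup>2))"
    by (rule tint_mono_AE[OF h proc_integrable_cmult[OF p3] A sT le])
  also have "\<dots> = C * (tint t A s (\<lambda>w r. (norm (x w r))\<^sup>2) + tint t A s (\<lambda>w r. (y w r)\<^sup>2)
      + tint t A s (\<lambda>w r. (norm (z w r))\<^sup>2) + tint t A s (\<lambda>w r. k\<^sup>2))"
    unfolding tint_cmult tint_add[OF p2 pk A sT] tint_add[OF p1 p(14) A sT] tint_add[OF p(12,13) A sT] ..
  also have "\<dots> \<le> C * (tint t A s (\<lambda>w r. (norm (x w r))\<^sup>2) + tint t A T (\<lambda>w r. (y w r)\<^sup>2)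
      + tint t A T (\<lambda>w r. (norm (z w r))\<^sup>2) + T * (k\<^sup>2 * prob A))"
    using tint_mono_time[OF p(13) _ A sT order_refl] tint_mono_time[OF p(14) _ A sT order_refl]
      tint_const_le[OF A s t(1), of "k\<^sup>2"]
    by (intro mult_left_mono[OF _ C] add_mono) auto
  finally show ?thesis .
qed

text \<open>The product rule for the components of \<open>x\<close> and Gronwall's inequality.\<close>

lemma forward_estimate:
  assumes S: "fb_system t K k x y z \<beta> \<sigma> g" and t: "0 \<le> t" "t \<le> T" and A: "A \<in> sets (F t)"
  defines "C1 \<equiv> 1 + 8 * K\<^sup>2"
  shows "expect_on A (\<lambda>w. (norm (x w T))\<^sup>2) + tint t A T (\<lambda>w r. (norm (x w r))\<^sup>2)
    \<le> (1 + T) * exp (C1 * T) * (1 + C1 + C1 * T) *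
       (expect_on A (\<lambda>w. (norm (x w t))\<^sup>2) + k\<^sup>2 * prob A
        + (tint t A T (\<lambda>w r. (y w r)\<^sup>2) + tint t A T (\<lambda>w r. (norm (z w r))\<^sup>2)))"
proof -
  note p = fb_system_processes[OF S t]
  have tt: "t \<in> {t..T}" "t \<in> {0..T}" "T \<in> {t..T}" using t by auto
  have AM: "A \<in> sets M" by (rule sets_F_M[OF tt(2) A])
  have T0: "0 \<le> T" using t by simp
  define u where "u s = expect_on A (\<lambda>w. (norm (x w s))\<^sup>2)" for s
  define RY where "RY = tint t A T (\<lambda>w r. (y w r)\<^sup>2) + tint t A T (\<lambda>w r. (norm (z w r))\<^sup>2)"
  have RY0: "0 \<le> RY" unfolding RY_def by (intro add_nonneg_nonneg tint_nonneg) auto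
  have C1: "1 \<le> C1" by (simp add: C1_def)
  have u0: "0 \<le> u s" for s unfolding u_def by (intro integral_nonneg_AE AE_I2) simp
  have kp: "0 \<le> k\<^sup>2 * prob A" by simp
  define R where "R = u t + C1 * (RY + T * (k\<^sup>2 * prob A))"
  have R0: "0 \<le> R" unfolding R_def using u0[of t] C1 RY0 T0 kp by (intro add_nonneg_nonneg mult_nonneg_nonneg) auto
  have cu: "continuous_on {t..T} u" unfolding u_def by (rule S2_moment_continuous[OF p(1) t AM])
  \<comment> \<open>the drift of \<open>|x|\<^sup>2\<close>\<close>
  define H where "H w r = (\<Sum>i\<in>UNIV. \<beta> w r $ i * x w r $ i + x w r $ i * \<beta> w r $ i + \<sigma> w r $ i \<bullet> \<sigma> w r $ i)" for w r
  have Hi: "proc_integrable t (\<lambda>w r. \<beta> w r $ i * x w r $ i + x w r $ i * \<beta> w r $ i + \<sigma> w r $ i \<bullet> \<sigma> w r $ i)" for i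
    by (intro proc_integrable_add proc_integrable_mult[OF p(9) p(6)] proc_integrable_mult[OF p(6) p(9)]
        proc_integrable_inner[OF p(10) p(10)])
  have Hp: "proc_integrable t H" unfolding H_def[abs_def] by (rule proc_integrable_sum[OF Hi])
  have Hle: "AE w in M. \<forall>r\<in>{t..T}. H w r \<le> C1 * ((norm (x w r))\<^sup>2 + (y w r)\<^sup>2 + (norm (z w r))\<^sup>2 + k\<^sup>2)"
  proof -
    have bnd: "AE w in M. \<forall>r\<in>{t..T}.
        norm (\<beta> w r) \<le> K * (norm (x w r) + \<bar>y w r\<bar> + norm (z w r) + k) \<and>
        norm (\<sigma> w r) \<le> K * (norm (x w r) + \<bar>y w r\<bar> + norm (z w r) + k)"
      using S unfolding fb_system_def by (auto elim!: eventually_mono)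
    show ?thesis using bnd
    proof eventually_elim
      case (elim w)
      show ?case
      proof
        fix r assume r: "r \<in> {t..T}"
        define N where "N = (norm (x w r))\<^sup>2 + (y w r)\<^sup>2 + (norm (z w r))\<^sup>2 + k\<^sup>2"
        have b: "(norm (\<beta> w r))\<^sup>2 \<le> 4 * K\<^sup>2 * N" and s: "(norm (\<sigma> w r))\<^sup>2 \<le> 4 * K\<^sup>2 * N"
          using bspec[OF elim r] linear_growth_power2[OF norm_ge_zero, of "\<beta> w r" K "norm (x w r)" "\<bar>y w r\<bar>" "norm (z w r)" k]
            linear_growth_power2[OF norm_ge_zero, of "\<sigma> w r" K "norm (x w r)" "\<bar>y w r\<bar>" "norm (z w r)" k]
          by (simp_all add: N_def)
        have "H w r = 2 * (\<beta> w r \<bullet> x w r) + (norm (\<sigma> w r))\<^sup>2"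
          unfolding norm2_matrix by (simp add: H_def inner_vec_def sum.distrib power2_norm_eq_inner mult.commute sum_distrib_left)
        moreover have "2 * (\<beta> w r \<bullet> x w r) \<le> (norm (\<beta> w r))\<^sup>2 + (norm (x w r))\<^sup>2"
          using norm_cauchy_schwarz[of "\<beta> w r" "x w r"] sum_squares_bound[of "norm (\<beta> w r)" "norm (x w r)"] by linarith
        moreover have "(norm (x w r))\<^sup>2 \<le> N" by (simp add: N_def)
        ultimately have "H w r \<le> 4 * K\<^sup>2 * N + N + 4 * K\<^sup>2 * N" using b s by linarith
        also have "\<dots> = C1 * N" by (simp add: C1_def algebra_simps)
        finally show "H w r \<le> C1 * ((norm (x w r))\<^sup>2 + (y w r)\<^sup>2 + (norm (z w r))\<^sup>2 + k\<^sup>2)" unfolding N_def .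
      qed
    qed
  qed
  have us: "u s = u t + tint t A s H" if s: "s \<in> {t..T}" for s
  proof -
    have sT: "s \<le> T" using s by simp
    have comp: "u q = (\<Sum>i\<in>UNIV. expect_on A (\<lambda>w. x w q $ i * x w q $ i))" if q: "q \<in> {t..T}" for q
    proof -
      have xq: "sq_int M (\<lambda>w. x w q $ i)" for i by (rule S2_sq_int[OF S2_component[OF p(1) t] q t(1)])
      have "integrable M (\<lambda>w. indicator A w * (x w q $ i * x w q $ i))" for i
        using integrable_mult_indicator[OF AM sq_int_mult[OF xq xq]] by simp
      then show ?thesis unfolding u_def power2_norm_vec sum_distrib_left
        by (subst Bochner_Integration.integral_sum) (simp_all add: power2_eq_square)
    qed
    have "u s = (\<Sum>i\<in>UNIV. expect_on A (\<lambda>w. x w t $ i * x w t $ i)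
        + tint t A s (\<lambda>w r. \<beta> w r $ i * x w r $ i + x w r $ i * \<beta> w r $ i + \<sigma> w r $ i \<bullet> \<sigma> w r $ i))"
      unfolding comp[OF s] by (intro sum.cong refl ito_product_rule[OF p(3) p(3) t s A])
    also have "\<dots> = u t + tint t A s H"
      unfolding comp[OF tt(1)] H_def tint_sum[OF Hi AM sT] by (simp add: sum.distrib)
    finally show ?thesis .
  qed
  have int_u: "tint t A s (\<lambda>w r. (norm (x w r))\<^sup>2) = integral {t..s} u" if "s \<in> {t..T}" for s
    unfolding u_def by (rule tint_norm2_integral[OF p(1) t AM that])
  have gr: "u s \<le> R + C1 * integral {t..s} u" if s: "s \<in> {t..T}" for s
    using tint_growth_bound[OF S t AM Hp _ s Hle] C1 unfolding us[OF s] int_u[OF s] R_def RY_def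
    by (simp add: algebra_simps)
  have ub: "u s \<le> R * exp (C1 * T)" if s: "s \<in> {t..T}" for s
  proof -
    have "u s \<le> R * exp (C1 * (s - t))"
      by (rule gronwall_forward[OF cu _ gr s]) (use C1 in auto)
    also have "\<dots> \<le> R * exp (C1 * T)"
      using s t C1 R0 by (intro mult_left_mono) auto
    finally show ?thesis .
  qed
  have "integral {t..T} u \<le> (T - t) * (R * exp (C1 * T))"
    by (rule integral_le_const_interval[OF cu ub t(2)])
  also have "\<dots> \<le> T * (R * exp (C1 * T))" using t R0 by (intro mult_right_mono) auto
  finally have iu: "integral {t..T} u \<le> T * (R * exp (C1 * T))" .
  have Rle: "R \<le> (1 + C1 + C1 * T) * (u t + k\<^sup>2 * prob A + RY)"
  proof -
    have "0 \<le> (C1 + C1 * T) * u t" "0 \<le> (1 + C1) * (k\<^sup>2 * prob A)" "0 \<le> (1 + C1 * T) * RY"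
      using C1 T0 u0[of t] RY0 kp by (auto intro!: mult_nonneg_nonneg add_nonneg_nonneg)
    then show ?thesis unfolding R_def by (simp add: algebra_simps)
  qed
  have "u T + tint t A T (\<lambda>w r. (norm (x w r))\<^sup>2) \<le> (1 + T) * exp (C1 * T) * R"
    unfolding int_u[OF tt(3)] using ub[OF tt(3)] iu by (simp add: algebra_simps)
  also have "\<dots> \<le> (1 + T) * exp (C1 * T) * ((1 + C1 + C1 * T) * (u t + k\<^sup>2 * prob A + RY))"
    using Rle T0 by (intro mult_left_mono) auto
  finally show ?thesis unfolding u_def RY_def by (simp add: mult.assoc)
qed

text \<open>The product rule for \<open>y\<^sup>2\<close> between \<open>s\<close> and \<open>T\<close>. Young's inequality bounds the mixed term \<open>2 g y\<close> at the cost of half of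
  \<open>|z|\<^sup>2\<close>, so that the other half of \<open>|z|\<^sup>2\<close> is left to be estimated; Gronwall's inequality runs backward from \<open>T\<close>.\<close>

lemma backward_estimate:
  assumes S: "fb_system t K k x y z \<beta> \<sigma> g" and t: "0 \<le> t" "t \<le> T" and A: "A \<in> sets (F t)" and K: "0 \<le> K" and k: "0 \<le> k"
  defines "C2 \<equiv> 4 * K\<^sup>2 + 2 * K + 1"
  shows "expect_on A (\<lambda>w. (y w t)\<^sup>2) + (tint t A T (\<lambda>w r. (y w r)\<^sup>2) + tint t A T (\<lambda>w r. (norm (z w r))\<^sup>2))
    \<le> (2 * (1 + C2 * T * exp (C2 * T)) + T * exp (C2 * T)) * (2 * K\<^sup>2 + C2 + C2 * T) *
       (expect_on A (\<lambda>w. (norm (x w T))\<^sup>2) + tint t A T (\<lambda>w r. (norm (x w r))\<^sup>2) + k\<^sup>2 * prob A)"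
proof -
  note p = fb_system_processes[OF S t]
  have tt: "t \<in> {t..T}" "t \<in> {0..T}" "T \<in> {t..T}" using t by auto
  have AM: "A \<in> sets M" by (rule sets_F_M[OF tt(2) A])
  have T0: "0 \<le> T" using t by simp
  have C2: "1 \<le> C2" using K by (simp add: C2_def)
  define v where "v s = expect_on A (\<lambda>w. (y w s)\<^sup>2)" for s
  define X2 where "X2 = tint t A T (\<lambda>w r. (norm (x w r))\<^sup>2)"
  define XT where "XT = expect_on A (\<lambda>w. (norm (x w T))\<^sup>2)"
  define Z where "Z s = tint t A s (\<lambda>w r. (norm (z w r))\<^sup>2)" for s
  have X20: "0 \<le> X2" unfolding X2_def by (rule tint_nonneg) simp
  have XT0: "0 \<le> XT" unfolding XT_def by (intro integral_nonneg_AE AE_I2) simp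
  have v0: "0 \<le> v s" for s unfolding v_def by (intro integral_nonneg_AE AE_I2) simp
  have kp: "0 \<le> k\<^sup>2 * prob A" by simp
  define R where "R = v T + C2 * (X2 + T * (k\<^sup>2 * prob A))"
  have R0: "0 \<le> R" unfolding R_def using v0[of T] C2 X20 T0 kp by (intro add_nonneg_nonneg mult_nonneg_nonneg) auto
  have cv: "continuous_on {t..T} v" unfolding v_def using S2_moment_continuous[OF p(2) t AM] by simp
  have int_v: "tint t A s (\<lambda>w r. (y w r)\<^sup>2) = integral {t..s} v" if "s \<in> {t..T}" for s
    unfolding v_def using tint_norm2_integral[OF p(2) t AM that] by simp
  define h where "h w r = - g w r * y w r + y w r * (- g w r) + z w r \<bullet> z w r" for w r
  have gy: "proc_integrable t (\<lambda>w r. - g w r * y w r + y w r * (- g w r))"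
    by (intro proc_integrable_add proc_integrable_mult[OF p(11) p(7)] proc_integrable_mult[OF p(7) p(11)])
  have hp: "proc_integrable t h"
    unfolding h_def[abs_def] by (rule proc_integrable_add[OF gy proc_integrable_inner[OF p(8) p(8)]])
  have vs: "v s = v t + tint t A s h" if s: "s \<in> {t..T}" for s
    using ito_product_rule[OF p(4) p(4) t s A] unfolding v_def h_def[abs_def] power2_eq_square .
  \<comment> \<open>\<open>l\<close> is a lower bound for the drift \<open>h\<close> of \<open>y\<^sup>2\<close>\<close>
  define l where "l w r = (1/2) * (norm (z w r))\<^sup>2 - C2 * (y w r)\<^sup>2 - C2 * ((norm (x w r))\<^sup>2 + k\<^sup>2)" for w r
  have l1: "proc_integrable t (\<lambda>w r. (1/2) * (norm (z w r))\<^sup>2)" by (rule proc_integrable_cmult[OF p(14)])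
  have l2: "proc_integrable t (\<lambda>w r. C2 * (y w r)\<^sup>2)" by (rule proc_integrable_cmult[OF p(13)])
  note l4 = proc_integrable_add[OF p(12) proc_integrable_const[of t "k\<^sup>2"]]
  have l3: "proc_integrable t (\<lambda>w r. C2 * ((norm (x w r))\<^sup>2 + k\<^sup>2))"
    by (rule proc_integrable_cmult[OF l4])
  note l12 = proc_integrable_diff[OF l1 l2]
  have lp: "proc_integrable t l" unfolding l_def[abs_def] by (rule proc_integrable_diff[OF l12 l3])
  have lle: "AE w in M. \<forall>r\<in>{t..T}. l w r \<le> h w r"
  proof -
    have bnd: "AE w in M. \<forall>r\<in>{t..T}. \<bar>g w r\<bar> \<le> K * (norm (x w r) + \<bar>y w r\<bar> + norm (z w r) + k)"
      using S unfolding fb_system_def by (auto elim!: eventually_mono)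
    then show ?thesis
    proof eventually_elim
      case (elim w)
      show ?case
      proof
        fix r assume r: "r \<in> {t..T}"
        define a b c where "a = norm (x w r)" and "b = \<bar>y w r\<bar>" and "c = norm (z w r)"
        have b0: "0 \<le> b" by (simp add: b_def)
        have g: "\<bar>g w r\<bar> \<le> K * (a + b + c + k)" using bspec[OF elim r] by (simp add: a_def b_def c_def)
        have "2 * (g w r * y w r) \<le> 2 * (\<bar>g w r\<bar> * b)"
          unfolding b_def abs_mult[symmetric] by simp
        also have "\<dots> \<le> 2 * ((K * (a + b + c + k)) * b)"
          using g b0 by (intro mult_left_mono mult_right_mono) auto
        also have "\<dots> = 2 * (K * b) * a + 2 * K * b\<^sup>2 + 2 * (K * b) * c + 2 * (K * b) * k"
          by (simp add: algebra_simps power2_eq_square)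
        also have "\<dots> \<le> C2 * b\<^sup>2 + C2 * (a\<^sup>2 + k\<^sup>2) + (1/2) * c\<^sup>2"
        proof -
          have 1: "2 * (K * b) * a \<le> K\<^sup>2 * b\<^sup>2 + a\<^sup>2"
            using sum_squares_bound[of "K * b" a] by (simp add: power_mult_distrib)
          have 2: "2 * (K * b) * k \<le> K\<^sup>2 * b\<^sup>2 + k\<^sup>2"
            using sum_squares_bound[of "K * b" k] by (simp add: power_mult_distrib)
          \<comment> \<open>only half of \<open>c\<^sup>2\<close> may be spent: the other half yields the bound for \<open>z\<close>\<close>
          have 3: "2 * (K * b) * c \<le> 2 * (K\<^sup>2 * b\<^sup>2) + (1/2) * c\<^sup>2"
            using young_mult[of 2 "K * b" "2 * c"] by (simp add: power_mult_distrib)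
          have 4: "a\<^sup>2 + k\<^sup>2 \<le> C2 * (a\<^sup>2 + k\<^sup>2)" using mult_right_mono[OF C2, of "a\<^sup>2 + k\<^sup>2"] by simp
          have 5: "C2 * b\<^sup>2 = 4 * (K\<^sup>2 * b\<^sup>2) + 2 * K * b\<^sup>2 + b\<^sup>2" by (simp add: C2_def algebra_simps)
          have 6: "0 \<le> b\<^sup>2" by simp
          show ?thesis using 1 2 3 4 5 6 by linarith
        qed
        finally have "2 * (g w r * y w r) \<le> C2 * b\<^sup>2 + C2 * (a\<^sup>2 + k\<^sup>2) + (1/2) * c\<^sup>2" .
        then show "l w r \<le> h w r"
          unfolding l_def h_def by (simp add: a_def b_def c_def power2_norm_eq_inner)
      qed
    qed
  qed
  have key: "v s + (1/2) * (Z T - Z s) \<le> R + C2 * integral {s..T} v" if s: "s \<in> {t..T}" for s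
  proof -
    have sT: "s \<le> T" using s by simp
    have lt: "tint t A q l = (1/2) * Z q - C2 * integral {t..q} v - C2 * (tint t A q (\<lambda>w r. (norm (x w r))\<^sup>2) + tint t A q (\<lambda>w r. k\<^sup>2))"
      if q: "q \<in> {t..T}" for q
    proof -
      have qT: "q \<le> T" using q by simp
      show ?thesis unfolding l_def tint_diff[OF l12 l3 AM qT] tint_diff[OF l1 l2 AM qT] tint_cmult
          tint_add[OF p(12) proc_integrable_const AM qT] int_v[OF q] Z_def ..
    qed
    have "tint t A T l - tint t A s l \<le> tint t A T h - tint t A s h"
      by (rule tint_mono_increment[OF lp hp AM sT lle])
    also have "\<dots> = v T - v s" using vs[OF tt(3)] vs[OF s] by simp
    finally have 1: "tint t A T l - tint t A s l \<le> v T - v s" .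
    have 2: "integral {t..s} v + integral {s..T} v = integral {t..T} v"
      using s by (intro Henstock_Kurzweil_Integration.integral_combine integrable_continuous_real cv) auto
    have 3: "0 \<le> tint t A s (\<lambda>w r. (norm (x w r))\<^sup>2)" "0 \<le> tint t A s (\<lambda>w r. k\<^sup>2)"
      by (rule tint_nonneg, simp)+
    have 4: "tint t A T (\<lambda>w r. k\<^sup>2) \<le> T * (k\<^sup>2 * prob A)" by (rule tint_const_le[OF AM tt(3) t(1)]) simp
    have 5: "C2 * ((X2 + tint t A T (\<lambda>w r. k\<^sup>2)) - (tint t A s (\<lambda>w r. (norm (x w r))\<^sup>2) + tint t A s (\<lambda>w r. k\<^sup>2)))
      \<le> C2 * (X2 + T * (k\<^sup>2 * prob A))"
      using C2 3 4 by (intro mult_left_mono) auto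
    have 6: "C2 * integral {t..T} v = C2 * integral {t..s} v + C2 * integral {s..T} v"
      unfolding 2[symmetric] by (rule distrib_left)
    show ?thesis using 1 5 6 unfolding lt[OF tt(3)] lt[OF s] R_def X2_def[symmetric]
      by (simp add: right_diff_distrib)
  qed
  have Zm: "Z s \<le> Z T" if "s \<in> {t..T}" for s
    unfolding Z_def by (rule tint_mono_time[OF p(14) _ AM _ order_refl]) (use that in auto)
  have vb: "v s \<le> R * exp (C2 * T)" if s: "s \<in> {t..T}" for s
  proof -
    have "v s \<le> R * exp (C2 * (T - s))"
    proof (rule gronwall_backward[OF cv _ _ s])
      show "0 \<le> C2" using C2 by simp
      show "v q \<le> R + C2 * integral {q..T} v" if q: "q \<in> {t..T}" for q
        by (rule order_trans[OF _ key[OF q]]) (use Zm[OF q] in simp)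
    qed
    also have "\<dots> \<le> R * exp (C2 * T)" using s t C2 R0 by (intro mult_left_mono) auto
    finally show ?thesis .
  qed
  have "integral {t..T} v \<le> (T - t) * (R * exp (C2 * T))"
    by (rule integral_le_const_interval[OF cv vb t(2)])
  also have "\<dots> \<le> T * (R * exp (C2 * T))" using t R0 by (intro mult_right_mono) auto
  finally have iv: "integral {t..T} v \<le> T * (R * exp (C2 * T))" .
  have Zt: "Z t \<le> 0"
  proof -
    have "Z t = integral {t..t} (\<lambda>r. expect_on A (\<lambda>w. (norm (z w r))\<^sup>2))"
      unfolding Z_def tint_time(1)[OF p(14) tt(1) AM]
      by (rule set_borel_integral_eq_integral(2)[OF tint_time(2)[OF p(14) tt(1) AM]])
    then show ?thesis by simp
  qed
  have vz: "v t + (1/2) * Z T \<le> R * (1 + C2 * T * exp (C2 * T))"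
  proof -
    have "v t + (1/2) * Z T \<le> v t + (1/2) * (Z T - Z t)" using Zt by simp
    also have "\<dots> \<le> R + C2 * integral {t..T} v" by (rule key[OF tt(1)])
    also have "\<dots> \<le> R + C2 * (T * (R * exp (C2 * T)))"
      using iv C2 by (intro add_left_mono mult_left_mono) auto
    finally show ?thesis by (simp add: algebra_simps)
  qed
  have vT: "v T \<le> 2 * K\<^sup>2 * (XT + k\<^sup>2 * prob A)"
  proof -
    have yT: "AE w in M. \<bar>y w T\<bar> \<le> K * (norm (x w T) + k)" using S by (simp add: fb_system_def)
    note xi = expect_on_norm2_integrable[OF p(1) tt(3) t(1) AM]
    have ki: "integrable M (\<lambda>w. indicator A w * k\<^sup>2)"
      using integrable_mult_indicator[OF AM integrable_const[of "k\<^sup>2"]] by simp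
    have "v T \<le> (\<integral>w. 2 * K\<^sup>2 * (indicator A w * (norm (x w T))\<^sup>2 + indicator A w * k\<^sup>2) \<partial>M)"
      unfolding v_def
    proof (rule integral_mono_AE)
      show "integrable M (\<lambda>w. indicator A w * (y w T)\<^sup>2)"
        using expect_on_norm2_integrable[OF p(2) tt(3) t(1) AM] by simp
      show "integrable M (\<lambda>w. 2 * K\<^sup>2 * (indicator A w * (norm (x w T))\<^sup>2 + indicator A w * k\<^sup>2))"
        by (intro integrable_mult_right Bochner_Integration.integrable_add xi ki)
      show "AE w in M. indicator A w * (y w T)\<^sup>2 \<le> 2 * K\<^sup>2 * (indicator A w * (norm (x w T))\<^sup>2 + indicator A w * k\<^sup>2)"
        using yT
      proof eventually_elim
        case (elim w)
        have "(y w T)\<^sup>2 \<le> (K * (norm (x w T) + k))\<^sup>2" using power_mono[OF elim abs_ge_zero, of 2] by simp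
        also have "\<dots> \<le> K\<^sup>2 * (2 * (norm (x w T))\<^sup>2 + 2 * k\<^sup>2)"
          unfolding power_mult_distrib using norm_add_power2_le[of "norm (x w T)" k] by (intro mult_left_mono) auto
        finally have "(y w T)\<^sup>2 \<le> 2 * K\<^sup>2 * ((norm (x w T))\<^sup>2 + k\<^sup>2)" by (simp add: algebra_simps)
        then show ?case by (simp add: indicator_def)
      qed
    qed
    also have "\<dots> = 2 * K\<^sup>2 * (XT + expect_on A (\<lambda>_. k\<^sup>2))"
      unfolding XT_def by (simp only: integral_mult_right_zero Bochner_Integration.integral_add[OF xi ki])
    finally show ?thesis unfolding expect_on_const[OF AM] .
  qed
  have Rle: "R \<le> (2 * K\<^sup>2 + C2 + C2 * T) * (XT + X2 + k\<^sup>2 * prob A)"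
  proof -
    have "0 \<le> (C2 + C2 * T) * XT" "0 \<le> (2 * K\<^sup>2 + C2 * T) * X2" "0 \<le> C2 * (k\<^sup>2 * prob A)"
      using C2 T0 X20 XT0 kp by (auto intro!: mult_nonneg_nonneg add_nonneg_nonneg)
    then show ?thesis using vT unfolding R_def by (simp add: algebra_simps)
  qed
  have "v t + (integral {t..T} v + Z T) \<le> 2 * (v t + (1/2) * Z T) + integral {t..T} v"
    using v0[of t] by simp
  also have "\<dots> \<le> 2 * (R * (1 + C2 * T * exp (C2 * T))) + T * (R * exp (C2 * T))"
    by (intro add_mono mult_left_mono vz iv) simp
  also have "\<dots> = (2 * (1 + C2 * T * exp (C2 * T)) + T * exp (C2 * T)) * R" by (simp add: algebra_simps)
  also have "\<dots> \<le> (2 * (1 + C2 * T * exp (C2 * T)) + T * exp (C2 * T)) * ((2 * K\<^sup>2 + C2 + C2 * T) * (XT + X2 + k\<^sup>2 * prob A))"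
    using T0 C2 by (intro mult_left_mono Rle) auto
  finally show ?thesis
    unfolding v_def[symmetric] int_v[OF tt(3)] Z_def[symmetric] XT_def[symmetric] X2_def[symmetric] by (simp add: mult.assoc)
qed

text \<open>The product rule for \<open>(\<gamma> \<bullet> x) y\<close> on \<open>[t,T]\<close>. The terminal and the drift term have a sign by monotonicity. The initial
  term and the errors with \<open>k\<close> are products to which Young's inequality with weight \<open>e\<close> applies.\<close>

lemma monotone_estimate:
  assumes S: "fb_system t K k x y z \<beta> \<sigma> g" and Mo: "fb_monotone t \<gamma> b1 b2 m1 K k x y z \<beta> \<sigma> g"
    and t: "0 \<le> t" "t \<le> T" and A: "A \<in> sets (F t)" and e: "0 < e"
  shows "m1 * expect_on A (\<lambda>w. (\<gamma> \<bullet> x w T)\<^sup>2) + b1 * tint t A T (\<lambda>w r. (\<gamma> \<bullet> x w r)\<^sup>2)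
      + b2 * (tint t A T (\<lambda>w r. (y w r)\<^sup>2) + tint t A T (\<lambda>w r. (norm (z w r))\<^sup>2))
    \<le> e * (expect_on A (\<lambda>w. (y w t)\<^sup>2) + (expect_on A (\<lambda>w. (norm (x w T))\<^sup>2) + tint t A T (\<lambda>w r. (norm (x w r))\<^sup>2))
        + (tint t A T (\<lambda>w r. (y w r)\<^sup>2) + tint t A T (\<lambda>w r. (norm (z w r))\<^sup>2)))
      + ((norm \<gamma>)\<^sup>2 + K\<^sup>2 + 3 * K\<^sup>2 * T) / (4 * e) * (expect_on A (\<lambda>w. (norm (x w t))\<^sup>2) + k\<^sup>2 * prob A)"
proof -
  note p = fb_system_processes[OF S t]
  have tt: "t \<in> {t..T}" "t \<in> {0..T}" "T \<in> {t..T}" using t by auto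
  have AM: "A \<in> sets M" by (rule sets_F_M[OF tt(2) A])
  have T0: "0 \<le> T" using t by simp
  have gx: "sq_process t (\<lambda>w r. \<gamma> \<bullet> x w r)"
  proof -
    have "sq_process t (\<lambda>w r. \<Sum>i\<in>UNIV. \<gamma> $ i *\<^sub>R x w r $ i)"
      unfolding sq_process_iff using p(6) by (intro sq_int_sum sq_int_scaleR) (simp add: sq_process_iff)
    then show ?thesis by (simp add: inner_vec_def)
  qed
  have xq: "sq_int M (\<lambda>w. x w q $ i)" if q: "q \<in> {t..T}" for q i
    by (rule S2_sq_int[OF S2_component[OF p(1) t] q t(1)])
  have gxq: "sq_int M (\<lambda>w. \<gamma> \<bullet> x w q)" if q: "q \<in> {t..T}" for q
  proof -
    have "sq_int M (\<lambda>w. \<Sum>i\<in>UNIV. \<gamma> $ i *\<^sub>R x w q $ i)" by (intro sq_int_sum sq_int_scaleR xq q)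
    then show ?thesis by (simp add: inner_vec_def)
  qed
  have yq: "sq_int M (\<lambda>w. y w q)" if q: "q \<in> {t..T}" for q by (rule S2_sq_int[OF p(2) q t(1)])
  have iA: "integrable M (\<lambda>w. indicator A w * V w)" if "integrable M V" for V :: "'w \<Rightarrow> real"
    using integrable_mult_indicator[OF AM that] by simp
  define H where "H i w r = \<beta> w r $ i * y w r + x w r $ i * (- g w r) + \<sigma> w r $ i \<bullet> z w r" for i w r
  have Hi: "proc_integrable t (H i)" for i
    unfolding H_def[abs_def]
    by (intro proc_integrable_add proc_integrable_mult[OF p(9) p(7)] proc_integrable_mult[OF p(6) p(11)]
        proc_integrable_inner[OF p(10) p(8)])
  \<comment> \<open>the drift of \<open>(\<gamma> \<bullet> x) y\<close>\<close>
  define HG where "HG w r = (\<Sum>i\<in>UNIV. \<gamma> $ i * H i w r)" for w r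
  have HGp: "proc_integrable t HG" unfolding HG_def[abs_def]
    by (intro proc_integrable_sum proc_integrable_cmult Hi)
  have HG_eq: "HG w r = (\<gamma> \<bullet> \<beta> w r) * y w r - (\<gamma> \<bullet> x w r) * g w r + (\<Sum>i\<in>UNIV. \<gamma> $ i * (\<sigma> w r $ i \<bullet> z w r))" for w r
    unfolding HG_def H_def inner_vec_def[of \<gamma>] sum_distrib_right sum_subtractf[symmetric] sum.distrib[symmetric]
    by (intro sum.cong refl) (simp add: algebra_simps)
  have comp: "expect_on A (\<lambda>w. (\<gamma> \<bullet> x w q) * y w q) = (\<Sum>i\<in>UNIV. \<gamma> $ i * expect_on A (\<lambda>w. x w q $ i * y w q))"
    if q: "q \<in> {t..T}" for q
  proof -
    note ii = iA[OF sq_int_mult[OF xq[OF q] yq[OF q]]]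
    have "indicator A w * ((\<gamma> \<bullet> x w q) * y w q) = (\<Sum>i\<in>UNIV. \<gamma> $ i * (indicator A w * (x w q $ i * y w q)))" for w
      unfolding inner_vec_def sum_distrib_right sum_distrib_left by (intro sum.cong refl) (simp add: ac_simps)
    then show ?thesis using ii by (simp add: Bochner_Integration.integral_sum)
  qed
  have ident: "expect_on A (\<lambda>w. (\<gamma> \<bullet> x w T) * y w T) = expect_on A (\<lambda>w. (\<gamma> \<bullet> x w t) * y w t) + tint t A T HG"
  proof -
    have "expect_on A (\<lambda>w. (\<gamma> \<bullet> x w T) * y w T)
      = (\<Sum>i\<in>UNIV. \<gamma> $ i * (expect_on A (\<lambda>w. x w t $ i * y w t) + tint t A T (H i)))"
      unfolding comp[OF tt(3)] H_def[abs_def]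
      by (intro sum.cong refl arg_cong[where f = "\<lambda>q. \<gamma> $ _ * q"] ito_product_rule[OF p(3) p(4) t tt(3) A])
    also have "\<dots> = expect_on A (\<lambda>w. (\<gamma> \<bullet> x w t) * y w t) + (\<Sum>i\<in>UNIV. \<gamma> $ i * tint t A T (H i))"
      unfolding comp[OF tt(1)] by (simp add: distrib_left sum.distrib)
    also have "(\<Sum>i\<in>UNIV. \<gamma> $ i * tint t A T (H i)) = tint t A T HG"
      unfolding HG_def[abs_def]
      by (subst tint_sum[OF proc_integrable_cmult[OF Hi] AM order_refl]) (simp add: tint_cmult)
    finally show ?thesis .
  qed
  define P1 where "P1 = expect_on A (\<lambda>w. (norm (x w T))\<^sup>2)"
  define P2 where "P2 = tint t A T (\<lambda>w r. (norm (x w r))\<^sup>2)"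
  define RY where "RY = tint t A T (\<lambda>w r. (y w r)\<^sup>2)"
  define RZ where "RZ = tint t A T (\<lambda>w r. (norm (z w r))\<^sup>2)"
  define X0 where "X0 = expect_on A (\<lambda>w. (norm (x w t))\<^sup>2)"
  define V0 where "V0 = expect_on A (\<lambda>w. (y w t)\<^sup>2)"
  define kP where "kP = k\<^sup>2 * prob A"
  define G2 where "G2 = tint t A T (\<lambda>w r. (\<gamma> \<bullet> x w r)\<^sup>2)"
  define GT where "GT = expect_on A (\<lambda>w. (\<gamma> \<bullet> x w T)\<^sup>2)"
  have kp: "0 \<le> kP" by (simp add: kP_def)
  have X00: "0 \<le> X0" unfolding X0_def by (intro integral_nonneg_AE AE_I2) simp
  have ki: "integrable M (\<lambda>w. indicator A w * c)" for c :: real by (rule iA[OF integrable_const])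
  note n1 = expect_on_norm2_integrable[OF p(1) tt(3) t(1) AM]
  note n0 = expect_on_norm2_integrable[OF p(1) tt(1) t(1) AM]
  have y0: "integrable M (\<lambda>w. indicator A w * (y w t)\<^sup>2)" using expect_on_norm2_integrable[OF p(2) tt(1) t(1) AM] by simp
  \<comment> \<open>the terminal term: the monotonicity of \<open>\<Phi>\<close>, with the error in \<open>k\<close> split by Young's inequality\<close>
  have low: "m1 * GT - (e * P1 + K\<^sup>2 / (4 * e) * kP) \<le> expect_on A (\<lambda>w. (\<gamma> \<bullet> x w T) * y w T)"
  proof -
    have iG: "integrable M (\<lambda>w. indicator A w * (\<gamma> \<bullet> x w T)\<^sup>2)"
      by (rule iA[OF sq_int_integrable_power2[OF gxq[OF tt(3)]]])
    have "m1 * GT - (e * P1 + K\<^sup>2 / (4 * e) * kP) =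
      (\<integral>w. m1 * (indicator A w * (\<gamma> \<bullet> x w T)\<^sup>2) - (e * (indicator A w * (norm (x w T))\<^sup>2) + K\<^sup>2 / (4 * e) * (indicator A w * k\<^sup>2)) \<partial>M)"
      unfolding GT_def P1_def kP_def expect_on_const[OF AM, symmetric]
      by (simp only: Bochner_Integration.integral_diff Bochner_Integration.integral_add integrable_mult_right
          Bochner_Integration.integrable_add iG n1 ki integral_mult_right_zero)
    also have "\<dots> \<le> expect_on A (\<lambda>w. (\<gamma> \<bullet> x w T) * y w T)"
    proof (rule integral_mono_AE)
      show "integrable M (\<lambda>w. m1 * (indicator A w * (\<gamma> \<bullet> x w T)\<^sup>2) - (e * (indicator A w * (norm (x w T))\<^sup>2) + K\<^sup>2 / (4 * e) * (indicator A w * k\<^sup>2)))"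
        by (intro Bochner_Integration.integrable_diff Bochner_Integration.integrable_add integrable_mult_right iG n1 ki)
      show "integrable M (\<lambda>w. indicator A w * ((\<gamma> \<bullet> x w T) * y w T))"
        by (rule iA[OF sq_int_mult[OF gxq[OF tt(3)] yq[OF tt(3)]]])
      have "AE w in M. m1 * (\<gamma> \<bullet> x w T)\<^sup>2 - K * k * norm (x w T) \<le> y w T * (\<gamma> \<bullet> x w T)"
        using Mo by (simp add: fb_monotone_def)
      then show "AE w in M. m1 * (indicator A w * (\<gamma> \<bullet> x w T)\<^sup>2) - (e * (indicator A w * (norm (x w T))\<^sup>2) + K\<^sup>2 / (4 * e) * (indicator A w * k\<^sup>2))
          \<le> indicator A w * ((\<gamma> \<bullet> x w T) * y w T)"
      proof eventually_elim
        case (elim w)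
        have "norm (x w T) * (K * k) \<le> e * (norm (x w T))\<^sup>2 + (K * k)\<^sup>2 / (4 * e)" by (rule young_mult[OF e])
        also have "(K * k)\<^sup>2 / (4 * e) = K\<^sup>2 / (4 * e) * k\<^sup>2" by (simp add: power_mult_distrib)
        finally have "m1 * (\<gamma> \<bullet> x w T)\<^sup>2 - (e * (norm (x w T))\<^sup>2 + K\<^sup>2 / (4 * e) * k\<^sup>2) \<le> (\<gamma> \<bullet> x w T) * y w T"
          using elim by (simp add: mult.commute)
        then show ?case by (cases "w \<in> A") simp_all
      qed
    qed
    finally show ?thesis .
  qed
  have up: "expect_on A (\<lambda>w. (\<gamma> \<bullet> x w t) * y w t) \<le> e * V0 + (norm \<gamma>)\<^sup>2 / (4 * e) * X0"
  proof -
    have "expect_on A (\<lambda>w. (\<gamma> \<bullet> x w t) * y w t)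
      \<le> (\<integral>w. e * (indicator A w * (y w t)\<^sup>2) + (norm \<gamma>)\<^sup>2 / (4 * e) * (indicator A w * (norm (x w t))\<^sup>2) \<partial>M)"
    proof (rule integral_mono)
      show "integrable M (\<lambda>w. indicator A w * ((\<gamma> \<bullet> x w t) * y w t))"
        by (rule iA[OF sq_int_mult[OF gxq[OF tt(1)] yq[OF tt(1)]]])
      show "integrable M (\<lambda>w. e * (indicator A w * (y w t)\<^sup>2) + (norm \<gamma>)\<^sup>2 / (4 * e) * (indicator A w * (norm (x w t))\<^sup>2))"
        by (intro Bochner_Integration.integrable_add integrable_mult_right y0 n0)
      fix w
      have "y w t * (\<gamma> \<bullet> x w t) \<le> e * (y w t)\<^sup>2 + (\<gamma> \<bullet> x w t)\<^sup>2 / (4 * e)" by (rule young_mult[OF e])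
      also have "(\<gamma> \<bullet> x w t)\<^sup>2 / (4 * e) \<le> (norm \<gamma> * norm (x w t))\<^sup>2 / (4 * e)"
        using e power_mono[OF Cauchy_Schwarz_ineq2[of \<gamma> "x w t"] abs_ge_zero, of 2]
        by (intro divide_right_mono) auto
      also have "(norm \<gamma> * norm (x w t))\<^sup>2 / (4 * e) = (norm \<gamma>)\<^sup>2 / (4 * e) * (norm (x w t))\<^sup>2"
        by (simp add: power_mult_distrib)
      finally show "indicator A w * ((\<gamma> \<bullet> x w t) * y w t) \<le> e * (indicator A w * (y w t)\<^sup>2) + (norm \<gamma>)\<^sup>2 / (4 * e) * (indicator A w * (norm (x w t))\<^sup>2)"
        by (cases "w \<in> A") (simp_all add: mult.commute)
    qed
    also have "\<dots> = e * V0 + (norm \<gamma>)\<^sup>2 / (4 * e) * X0"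
      unfolding V0_def X0_def
      by (simp only: Bochner_Integration.integral_add integrable_mult_right y0 n0 integral_mult_right_zero)
    finally show ?thesis .
  qed
  \<comment> \<open>the drift term: \<open>l\<close> is the monotone bound with the three errors in \<open>k\<close> split by Young's inequality\<close>
  have drift: "tint t A T HG \<le> - b1 * G2 - b2 * (RY + RZ) + e * (P2 + RY + RZ) + 3 * K\<^sup>2 * T / (4 * e) * kP"
  proof -
    define l where "l w r = ((- b1) * (\<gamma> \<bullet> x w r)\<^sup>2 + (- b2) * ((y w r)\<^sup>2 + (norm (z w r))\<^sup>2))
      + (e * (((norm (x w r))\<^sup>2 + (y w r)\<^sup>2) + (norm (z w r))\<^sup>2) + 3 * K\<^sup>2 / (4 * e) * k\<^sup>2)" for w r
    have g2: "proc_integrable t (\<lambda>w r. (\<gamma> \<bullet> x w r)\<^sup>2)" using proc_integrable_norm2[OF gx] by simp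
    note a1 = proc_integrable_cmult[OF g2, of "- b1"]
    note a2 = proc_integrable_add[OF p(13,14)]
    note a3 = proc_integrable_cmult[OF a2, of "- b2"]
    note a4 = proc_integrable_add[OF p(12,13)]
    note a5 = proc_integrable_add[OF a4 p(14)]
    note a6 = proc_integrable_cmult[OF a5, of e]
    note a7 = proc_integrable_const[of t "k\<^sup>2"]
    note a8 = proc_integrable_cmult[OF a7, of "3 * K\<^sup>2 / (4 * e)"]
    note a9 = proc_integrable_add[OF a1 a3] and a10 = proc_integrable_add[OF a6 a8]
    have lp: "proc_integrable t l" unfolding l_def[abs_def] by (rule proc_integrable_add[OF a9 a10])
    have "AE w in M. \<forall>r\<in>{t..T}. HG w r \<le> - b1 * (\<gamma> \<bullet> x w r)\<^sup>2 - b2 * ((y w r)\<^sup>2 + (norm (z w r))\<^sup>2)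
          + K * k * (norm (x w r) + \<bar>y w r\<bar> + norm (z w r))"
      using Mo unfolding fb_monotone_def HG_eq by simp
    then have "AE w in M. \<forall>r\<in>{t..T}. HG w r \<le> l w r"
    proof eventually_elim
      case (elim w)
      show ?case
      proof
        fix r assume r: "r \<in> {t..T}"
        have y3: "a * (K * k) \<le> e * a\<^sup>2 + K\<^sup>2 / (4 * e) * k\<^sup>2" for a
          using young_mult[OF e, of a "K * k"] by (simp add: power_mult_distrib)
        have "K * k * (norm (x w r) + \<bar>y w r\<bar> + norm (z w r))
          = norm (x w r) * (K * k) + \<bar>y w r\<bar> * (K * k) + norm (z w r) * (K * k)"
          by (simp add: algebra_simps)
        also have "\<dots> \<le> e * (norm (x w r))\<^sup>2 + e * (y w r)\<^sup>2 + e * (norm (z w r))\<^sup>2 + 3 * (K\<^sup>2 / (4 * e) * k\<^sup>2)"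
          using y3[of "norm (x w r)"] y3[of "\<bar>y w r\<bar>"] y3[of "norm (z w r)"] unfolding power2_abs by linarith
        also have "\<dots> = e * (((norm (x w r))\<^sup>2 + (y w r)\<^sup>2) + (norm (z w r))\<^sup>2) + 3 * K\<^sup>2 / (4 * e) * k\<^sup>2"
          by (simp add: distrib_left)
        finally show "HG w r \<le> l w r" using bspec[OF elim r] unfolding l_def by linarith
      qed
    qed
    from tint_mono_AE[OF HGp lp AM order_refl this]
    have "tint t A T HG \<le> tint t A T l" .
    also have "tint t A T l = ((- b1) * G2 + (- b2) * (RY + RZ)) + (e * ((P2 + RY) + RZ) + 3 * K\<^sup>2 / (4 * e) * tint t A T (\<lambda>w r. k\<^sup>2))"
      unfolding l_def tint_add[OF a9 a10 AM order_refl] tint_add[OF a1 a3 AM order_refl] tint_add[OF a6 a8 AM order_refl]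
        tint_cmult tint_add[OF a5 a7 AM order_refl] tint_add[OF p(13,14) AM order_refl] tint_add[OF a4 p(14) AM order_refl]
        tint_add[OF p(12,13) AM order_refl] G2_def RY_def RZ_def P2_def ..
    also have "\<dots> \<le> ((- b1) * G2 + (- b2) * (RY + RZ)) + (e * ((P2 + RY) + RZ) + 3 * K\<^sup>2 / (4 * e) * (T * kP))"
      using tint_const_le[OF AM tt(3) t(1), of "k\<^sup>2"] e unfolding kP_def
      by (intro add_left_mono mult_left_mono) auto
    finally show ?thesis by simp
  qed
  have "m1 * GT + b1 * G2 + b2 * (RY + RZ) \<le> e * (V0 + (P1 + P2) + (RY + RZ))
    + ((norm \<gamma>)\<^sup>2 / (4 * e) * X0 + K\<^sup>2 / (4 * e) * kP + 3 * K\<^sup>2 * T / (4 * e) * kP)"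
    using low up drift ident by (simp add: algebra_simps)
  also have "(norm \<gamma>)\<^sup>2 / (4 * e) * X0 + K\<^sup>2 / (4 * e) * kP + 3 * K\<^sup>2 * T / (4 * e) * kP
    \<le> ((norm \<gamma>)\<^sup>2 / (4 * e) + K\<^sup>2 / (4 * e) + 3 * K\<^sup>2 * T / (4 * e)) * (X0 + kP)"
  proof -
    have "0 \<le> (norm \<gamma>)\<^sup>2 / (4 * e) * kP" "0 \<le> K\<^sup>2 / (4 * e) * X0" "0 \<le> 3 * K\<^sup>2 * T / (4 * e) * X0"
      using e kp X00 T0 by auto
    then show ?thesis by (simp only: distrib_left distrib_right)
  qed
  also have "(norm \<gamma>)\<^sup>2 / (4 * e) + K\<^sup>2 / (4 * e) + 3 * K\<^sup>2 * T / (4 * e) = ((norm \<gamma>)\<^sup>2 + K\<^sup>2 + 3 * K\<^sup>2 * T) / (4 * e)"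
    by (simp only: add_divide_distrib)
  finally show ?thesis
    unfolding GT_def[symmetric] G2_def[symmetric] RY_def[symmetric] RZ_def[symmetric] P1_def[symmetric] P2_def[symmetric]
      X0_def[symmetric] V0_def[symmetric] kP_def[symmetric] by simp
qed

end

text \<open>In the application, \<open>W\<close> is the total energy, \<open>D\<close> the data and \<open>Q\<close> the part of the energy that the monotonicity
  controls. Inserting the first bound into the second one leaves at most half of \<open>c * Q\<close> on the right.\<close>

lemma absorb_estimate:
  fixes D Q W c C e Ce :: real
  assumes W: "W \<le> C * (D + Q)" and Q: "c * Q \<le> e * W + Ce * D" and e: "0 \<le> e" "e * C \<le> c / 2" and c: "0 < c"
    and pos: "0 \<le> D" "0 \<le> Q" "0 \<le> C"
  shows "W \<le> C * (2 + 2 * Ce / c) * D"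
proof -
  have "e * W \<le> e * (C * (D + Q))" using W e by (intro mult_left_mono) auto
  also have "\<dots> = (e * C) * (D + Q)" by simp
  also have "\<dots> \<le> c / 2 * (D + Q)" using e pos by (intro mult_right_mono) auto
  finally have "c * Q \<le> c / 2 * (D + Q) + Ce * D" using Q by linarith
  moreover have "c / 2 * (D + Q) = c * D / 2 + c * Q / 2" by (simp add: field_simps)
  ultimately have "c * Q \<le> c * D + 2 * (Ce * D)" by linarith
  also have "\<dots> = c * ((1 + 2 * Ce / c) * D)" using c by (simp add: field_simps)
  finally have "Q \<le> (1 + 2 * Ce / c) * D" using c by simp
  then have "C * (D + Q) \<le> C * (D + (1 + 2 * Ce / c) * D)" using pos by (intro mult_left_mono) auto
  then show ?thesis using W by (simp add: algebra_simps)
qed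

context brownian_filtration
begin

lemma expect_on_sup_le:
  fixes x :: "'w \<Rightarrow> real \<Rightarrow> 'b::euclidean_space"
  assumes x: "x \<in> S2 M F t T" and t: "0 \<le> t" "t \<le> T" and A: "A \<in> sets M"
  shows "expect_on A (sup_norm2 t T x) \<le> 2 * expect_on A (\<lambda>w. (norm (x w t))\<^sup>2)
    + 2 * expect_on A (sup_norm2 t T (\<lambda>w s. x w s - x w t))"
proof -
  have tt: "t \<in> {t..T}" using t by simp
  note n = expect_on_norm2_integrable[OF x tt t(1) A]
  have i: "integrable M (\<lambda>w. indicator A w * sup_norm2 t T X w)" if "X \<in> S2 M F t T" for X :: "'w \<Rightarrow> real \<Rightarrow> 'b"
    using integrable_mult_indicator[OF A S2_sup_integrable[OF that t(2)]] by simp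
  have "expect_on A (sup_norm2 t T x)
    \<le> (\<integral>w. 2 * (indicator A w * (norm (x w t))\<^sup>2) + 2 * (indicator A w * sup_norm2 t T (\<lambda>w s. x w s - x w t) w) \<partial>M)"
  proof (rule integral_mono[OF i[OF x]])
    show "integrable M (\<lambda>w. 2 * (indicator A w * (norm (x w t))\<^sup>2) + 2 * (indicator A w * sup_norm2 t T (\<lambda>w s. x w s - x w t) w))"
      by (intro Bochner_Integration.integrable_add integrable_mult_right n i centered_S2[OF x t])
    fix w assume "w \<in> space M"
    from sup_norm2_centered[OF x t this]
    show "indicator A w * sup_norm2 t T x w \<le> 2 * (indicator A w * (norm (x w t))\<^sup>2) + 2 * (indicator A w * sup_norm2 t T (\<lambda>w s. x w s - x w t) w)"
      by (simp add: indicator_def)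
  qed
  also have "\<dots> = 2 * expect_on A (\<lambda>w. (norm (x w t))\<^sup>2) + 2 * expect_on A (sup_norm2 t T (\<lambda>w s. x w s - x w t))"
    by (simp only: Bochner_Integration.integral_add integrable_mult_right n i[OF centered_S2[OF x t]] integral_mult_right_zero)
  finally show ?thesis .
qed

lemma fb_system_bounds:
  assumes S: "fb_system t K k x y z \<beta> \<sigma> g"
  shows "AE w in M. \<forall>r\<in>{t..T}. (norm (\<beta> w r))\<^sup>2 \<le> 4 * K\<^sup>2 * ((norm (x w r))\<^sup>2 + (y w r)\<^sup>2 + (norm (z w r))\<^sup>2 + k\<^sup>2)"
    "AE w in M. \<forall>r\<in>{t..T}. (norm (\<sigma> w r))\<^sup>2 \<le> 4 * K\<^sup>2 * ((norm (x w r))\<^sup>2 + (y w r)\<^sup>2 + (norm (z w r))\<^sup>2 + k\<^sup>2)"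
    "AE w in M. \<forall>r\<in>{t..T}. (g w r)\<^sup>2 \<le> 4 * K\<^sup>2 * ((norm (x w r))\<^sup>2 + (y w r)\<^sup>2 + (norm (z w r))\<^sup>2 + k\<^sup>2)"
proof -
  have bnd: "AE w in M. \<forall>r\<in>{t..T}.
        norm (\<beta> w r) \<le> K * (norm (x w r) + \<bar>y w r\<bar> + norm (z w r) + k) \<and>
        norm (\<sigma> w r) \<le> K * (norm (x w r) + \<bar>y w r\<bar> + norm (z w r) + k) \<and>
        \<bar>g w r\<bar> \<le> K * (norm (x w r) + \<bar>y w r\<bar> + norm (z w r) + k)"
    using S by (simp add: fb_system_def)
  have sq: "v\<^sup>2 \<le> 4 * K\<^sup>2 * ((norm (x w r))\<^sup>2 + (y w r)\<^sup>2 + (norm (z w r))\<^sup>2 + k\<^sup>2)"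
    if "0 \<le> v" "v \<le> K * (norm (x w r) + \<bar>y w r\<bar> + norm (z w r) + k)" for v w r
    using linear_growth_power2[OF that] by simp
  show "AE w in M. \<forall>r\<in>{t..T}. (norm (\<beta> w r))\<^sup>2 \<le> 4 * K\<^sup>2 * ((norm (x w r))\<^sup>2 + (y w r)\<^sup>2 + (norm (z w r))\<^sup>2 + k\<^sup>2)"
    using bnd
  proof eventually_elim
    case (elim w)
    show ?case by (intro ballI sq norm_ge_zero) (use elim in blast)
  qed
  show "AE w in M. \<forall>r\<in>{t..T}. (norm (\<sigma> w r))\<^sup>2 \<le> 4 * K\<^sup>2 * ((norm (x w r))\<^sup>2 + (y w r)\<^sup>2 + (norm (z w r))\<^sup>2 + k\<^sup>2)"
    using bnd
  proof eventually_elim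
    case (elim w)
    show ?case by (intro ballI sq norm_ge_zero) (use elim in blast)
  qed
  show "AE w in M. \<forall>r\<in>{t..T}. (g w r)\<^sup>2 \<le> 4 * K\<^sup>2 * ((norm (x w r))\<^sup>2 + (y w r)\<^sup>2 + (norm (z w r))\<^sup>2 + k\<^sup>2)"
    using bnd
  proof eventually_elim
    case (elim w)
    show ?case
    proof
      fix r assume "r \<in> {t..T}"
      then have "\<bar>g w r\<bar> \<le> K * (norm (x w r) + \<bar>y w r\<bar> + norm (z w r) + k)" using elim by blast
      from sq[OF abs_ge_zero this]
      show "(g w r)\<^sup>2 \<le> 4 * K\<^sup>2 * ((norm (x w r))\<^sup>2 + (y w r)\<^sup>2 + (norm (z w r))\<^sup>2 + k\<^sup>2)" by simp
    qed
  qed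
qed

definition energy :: "real \<Rightarrow> 'w set \<Rightarrow> ('w \<Rightarrow> real \<Rightarrow> real ^ 'n) \<Rightarrow> ('w \<Rightarrow> real \<Rightarrow> real) \<Rightarrow> ('w \<Rightarrow> real \<Rightarrow> real ^ 'd) \<Rightarrow> real" where
  "energy t A x y z = expect_on A (\<lambda>w. (y w t)\<^sup>2)
     + (expect_on A (\<lambda>w. (norm (x w T))\<^sup>2) + tint t A T (\<lambda>w r. (norm (x w r))\<^sup>2))
     + (tint t A T (\<lambda>w r. (y w r)\<^sup>2) + tint t A T (\<lambda>w r. (norm (z w r))\<^sup>2))"

text \<open>If \<open>b2 > 0\<close>, monotonicity controls the energy of \<open>y\<close> and \<open>z\<close>, and the forward and then the backward estimate
  control the rest. If \<open>b1\<close>, \<open>m1 > 0\<close> and \<open>\<gamma> \<bullet> x\<close> controls \<open>x\<close>, monotonicity controls the energy of \<open>x\<close>, and the backward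
  estimate controls the rest. In both cases the weight \<open>e\<close> is chosen such that \<open>absorb_estimate\<close> applies.\<close>

lemma energy_estimate:
  fixes \<gamma> :: "real ^ 'n"
  assumes K: "0 \<le> K" and b: "0 \<le> b1" "0 \<le> b2" "0 \<le> m1" and T0: "0 \<le> T"
    and coercive: "0 < b2 \<or> (0 < b1 \<and> 0 < m1 \<and> (\<exists>c>0. \<forall>v. c * (norm v)\<^sup>2 \<le> (\<gamma> \<bullet> v)\<^sup>2))"
  shows "\<exists>C\<ge>0. \<forall>t k x y z \<beta> \<sigma> g A. 0 \<le> t \<longrightarrow> t \<le> T \<longrightarrow> 0 \<le> k \<longrightarrow> fb_system t K k x y z \<beta> \<sigma> g \<longrightarrow>
     fb_monotone t \<gamma> b1 b2 m1 K k x y z \<beta> \<sigma> g \<longrightarrow> A \<in> sets (F t) \<longrightarrow>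
     energy t A x y z \<le> C * (expect_on A (\<lambda>w. (norm (x w t))\<^sup>2) + k\<^sup>2 * prob A)"
proof -
  define C1 where "C1 = 1 + 8 * K\<^sup>2"
  define C2 where "C2 = 4 * K\<^sup>2 + 2 * K + 1"
  define CF where "CF = (1 + T) * exp (C1 * T) * (1 + C1 + C1 * T)"
  define CB where "CB = (2 * (1 + C2 * T * exp (C2 * T)) + T * exp (C2 * T)) * (2 * K\<^sup>2 + C2 + C2 * T)"
  have C0: "0 \<le> C1" "0 \<le> C2" using K by (auto simp: C1_def C2_def)
  have CF0: "0 \<le> CF" unfolding CF_def using C0 T0 by (intro mult_nonneg_nonneg add_nonneg_nonneg) auto
  have CB0: "0 \<le> CB" unfolding CB_def using C0 T0 K by (intro mult_nonneg_nonneg add_nonneg_nonneg) auto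
  have basic: "0 \<le> D \<and> 0 \<le> P \<and> 0 \<le> R \<and> P \<le> CF * (D + R) \<and> v + R \<le> CB * (P + D)
      \<and> energy t A x y z = v + P + R
      \<and> (\<forall>e>0. m1 * expect_on A (\<lambda>w. (\<gamma> \<bullet> x w T)\<^sup>2) + b1 * tint t A T (\<lambda>w r. (\<gamma> \<bullet> x w r)\<^sup>2) + b2 * R
          \<le> e * (v + P + R) + ((norm \<gamma>)\<^sup>2 + K\<^sup>2 + 3 * K\<^sup>2 * T) / (4 * e) * D)"
    if t: "0 \<le> t" "t \<le> T" and k: "0 \<le> k" and S: "fb_system t K k x y z \<beta> \<sigma> g"
      and Mo: "fb_monotone t \<gamma> b1 b2 m1 K k x y z \<beta> \<sigma> g" and A: "A \<in> sets (F t)"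
      and D: "D = expect_on A (\<lambda>w. (norm (x w t))\<^sup>2) + k\<^sup>2 * prob A"
      and P: "P = expect_on A (\<lambda>w. (norm (x w T))\<^sup>2) + tint t A T (\<lambda>w r. (norm (x w r))\<^sup>2)"
      and R: "R = tint t A T (\<lambda>w r. (y w r)\<^sup>2) + tint t A T (\<lambda>w r. (norm (z w r))\<^sup>2)"
      and v: "v = expect_on A (\<lambda>w. (y w t)\<^sup>2)"
    for t k x y z \<beta> \<sigma> g A D P R v
  proof (intro conjI allI impI)
    show "0 \<le> D" unfolding D by (intro add_nonneg_nonneg integral_nonneg_AE AE_I2) auto
    show "0 \<le> P" unfolding P by (intro add_nonneg_nonneg integral_nonneg_AE AE_I2 tint_nonneg) auto
    show "0 \<le> R" unfolding R by (intro add_nonneg_nonneg tint_nonneg) auto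
    show "P \<le> CF * (D + R)" unfolding P D R CF_def C1_def by (rule forward_estimate[OF S t A])
    have "v + R \<le> CB * (P + k\<^sup>2 * prob A)" unfolding P R v CB_def C2_def
      by (rule backward_estimate[OF S t A K k])
    also have "\<dots> \<le> CB * (P + D)" unfolding D
      using CB0 by (intro mult_left_mono add_left_mono) (auto intro!: integral_nonneg_AE)
    finally show "v + R \<le> CB * (P + D)" .
    show "energy t A x y z = v + P + R" unfolding energy_def P R v ..
    fix e :: real assume "0 < e"
    from monotone_estimate[OF S Mo t A this]
    show "m1 * expect_on A (\<lambda>w. (\<gamma> \<bullet> x w T)\<^sup>2) + b1 * tint t A T (\<lambda>w r. (\<gamma> \<bullet> x w r)\<^sup>2) + b2 * R
          \<le> e * (v + P + R) + ((norm \<gamma>)\<^sup>2 + K\<^sup>2 + 3 * K\<^sup>2 * T) / (4 * e) * D"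
      unfolding P D R v .
  qed
  show ?thesis
  proof (cases "0 < b2")
    case True
    define C3 where "C3 = CB + (CB + 1) * CF"
    have C30: "0 \<le> C3" using CF0 CB0 by (simp add: C3_def)
    define e where "e = b2 / (2 * (C3 + 1))"
    have e: "0 < e" "e * C3 \<le> b2 / 2" using True C30 by (auto simp: e_def field_simps)
    define Ce where "Ce = ((norm \<gamma>)\<^sup>2 + K\<^sup>2 + 3 * K\<^sup>2 * T) / (4 * e)"
    have Ce: "0 \<le> Ce" unfolding Ce_def using e T0 by auto
    show ?thesis
    proof (intro exI[of _ "C3 * (2 + 2 * Ce / b2)"] conjI allI impI)
      show "0 \<le> C3 * (2 + 2 * Ce / b2)" using C30 Ce True by auto
      fix t k :: real and x :: "'w \<Rightarrow> real \<Rightarrow> real ^ 'n" and y z \<beta> \<sigma> g A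
      assume t: "0 \<le> t" "t \<le> T" and k: "0 \<le> k" and S: "fb_system t K k x y z \<beta> \<sigma> g"
        and Mo: "fb_monotone t \<gamma> b1 b2 m1 K k x y z \<beta> \<sigma> g" and A: "A \<in> sets (F t)"
      define D where "D = expect_on A (\<lambda>w. (norm (x w t))\<^sup>2) + k\<^sup>2 * prob A"
      define P where "P = expect_on A (\<lambda>w. (norm (x w T))\<^sup>2) + tint t A T (\<lambda>w r. (norm (x w r))\<^sup>2)"
      define R where "R = tint t A T (\<lambda>w r. (y w r)\<^sup>2) + tint t A T (\<lambda>w r. (norm (z w r))\<^sup>2)"
      define v where "v = expect_on A (\<lambda>w. (y w t)\<^sup>2)"
      note B = basic[OF t k S Mo A D_def P_def R_def v_def]
      have "(CB + 1) * P \<le> (CB + 1) * (CF * (D + R))" using B CB0 by (intro mult_left_mono) auto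
      moreover have "0 \<le> CB * R" using B CB0 by simp
      ultimately have W: "v + P + R \<le> C3 * (D + R)"
        using B unfolding C3_def by (simp add: algebra_simps)
      have "0 \<le> m1 * expect_on A (\<lambda>w. (\<gamma> \<bullet> x w T)\<^sup>2)" "0 \<le> b1 * tint t A T (\<lambda>w r. (\<gamma> \<bullet> x w r)\<^sup>2)"
        using b by (auto intro!: mult_nonneg_nonneg integral_nonneg_AE tint_nonneg)
      then have Q: "b2 * R \<le> e * (v + P + R) + Ce * D"
        using B e(1) unfolding Ce_def by fastforce
      show "energy t A x y z \<le> C3 * (2 + 2 * Ce / b2) * (expect_on A (\<lambda>w. (norm (x w t))\<^sup>2) + k\<^sup>2 * prob A)"
        using absorb_estimate[OF W Q less_imp_le[OF e(1)] e(2) True _ _ C30] B by (simp add: D_def)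
    qed
  next
    case False
    then obtain c where c: "0 < b1" "0 < m1" "0 < c" "\<And>v. c * (norm v)\<^sup>2 \<le> (\<gamma> \<bullet> v)\<^sup>2"
      using coercive by auto
    define C3 where "C3 = CB + 1"
    have C30: "0 \<le> C3" using CB0 by (simp add: C3_def)
    define q where "q = min b1 m1 * c"
    have q: "0 < q" using c by (simp add: q_def)
    define e where "e = q / (2 * (C3 + 1))"
    have e: "0 < e" "e * C3 \<le> q / 2" using q C30 by (auto simp: e_def field_simps)
    define Ce where "Ce = ((norm \<gamma>)\<^sup>2 + K\<^sup>2 + 3 * K\<^sup>2 * T) / (4 * e)"
    have Ce: "0 \<le> Ce" unfolding Ce_def using e T0 by auto
    show ?thesis
    proof (intro exI[of _ "C3 * (2 + 2 * Ce / q)"] conjI allI impI)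
      show "0 \<le> C3 * (2 + 2 * Ce / q)" using C30 Ce q by auto
      fix t k :: real and x :: "'w \<Rightarrow> real \<Rightarrow> real ^ 'n" and y z \<beta> \<sigma> g A
      assume t: "0 \<le> t" "t \<le> T" and k: "0 \<le> k" and S: "fb_system t K k x y z \<beta> \<sigma> g"
        and Mo: "fb_monotone t \<gamma> b1 b2 m1 K k x y z \<beta> \<sigma> g" and A: "A \<in> sets (F t)"
      note p = fb_system_processes[OF S t]
      have tt: "t \<in> {t..T}" "t \<in> {0..T}" "T \<in> {t..T}" using t by auto
      have AM: "A \<in> sets M" by (rule sets_F_M[OF tt(2) A])
      define D where "D = expect_on A (\<lambda>w. (norm (x w t))\<^sup>2) + k\<^sup>2 * prob A"
      define P where "P = expect_on A (\<lambda>w. (norm (x w T))\<^sup>2) + tint t A T (\<lambda>w r. (norm (x w r))\<^sup>2)"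
      define R where "R = tint t A T (\<lambda>w r. (y w r)\<^sup>2) + tint t A T (\<lambda>w r. (norm (z w r))\<^sup>2)"
      define v where "v = expect_on A (\<lambda>w. (y w t)\<^sup>2)"
      note B = basic[OF t k S Mo A D_def P_def R_def v_def]
      have W: "v + P + R \<le> C3 * (D + P)"
        using B CB0 unfolding C3_def by (simp add: algebra_simps)
      define GT where "GT = expect_on A (\<lambda>w. (\<gamma> \<bullet> x w T)\<^sup>2)"
      define G2 where "G2 = tint t A T (\<lambda>w r. (\<gamma> \<bullet> x w r)\<^sup>2)"
      have gx: "proc_integrable t (\<lambda>w r. (\<gamma> \<bullet> x w r)\<^sup>2)"
      proof -
        have "sq_process t (\<lambda>w r. \<Sum>i\<in>UNIV. \<gamma> $ i *\<^sub>R x w r $ i)"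
          unfolding sq_process_iff using p(6) by (intro sq_int_sum sq_int_scaleR) (simp add: sq_process_iff)
        from proc_integrable_norm2[OF this] show ?thesis by (simp add: inner_vec_def)
      qed
      have gT: "integrable M (\<lambda>w. indicator A w * (\<gamma> \<bullet> x w T)\<^sup>2)"
      proof -
        have "sq_int M (\<lambda>w. \<Sum>i\<in>UNIV. \<gamma> $ i *\<^sub>R x w T $ i)"
          by (intro sq_int_sum sq_int_scaleR sq_int_component S2_sq_int[OF p(1) tt(3) t(1)])
        from integrable_mult_indicator[OF AM sq_int_integrable_power2[OF this]] show ?thesis by (simp add: inner_vec_def)
      qed
      have 1: "c * expect_on A (\<lambda>w. (norm (x w T))\<^sup>2) \<le> GT"
      proof -
        note n1 = expect_on_norm2_integrable[OF p(1) tt(3) t(1) AM]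
        have "c * expect_on A (\<lambda>w. (norm (x w T))\<^sup>2) = (\<integral>w. c * (indicator A w * (norm (x w T))\<^sup>2) \<partial>M)" by simp
        also have "\<dots> \<le> GT" unfolding GT_def
        proof (rule integral_mono[OF integrable_mult_right[OF n1] gT])
          fix w show "c * (indicator A w * (norm (x w T))\<^sup>2) \<le> indicator A w * (\<gamma> \<bullet> x w T)\<^sup>2"
            using c(4)[of "x w T"] by (simp add: indicator_def)
        qed
        finally show ?thesis .
      qed
      have 2: "c * tint t A T (\<lambda>w r. (norm (x w r))\<^sup>2) \<le> G2"
        unfolding tint_cmult[symmetric] G2_def
        by (rule tint_mono_AE[OF proc_integrable_cmult[OF p(12)] gx AM order_refl]) (simp add: c(4))
      have nn: "0 \<le> GT" "0 \<le> G2" unfolding GT_def G2_def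
        by (auto intro!: integral_nonneg_AE tint_nonneg)
      have "q * P \<le> min b1 m1 * (GT + G2)"
        unfolding q_def P_def mult.assoc distrib_left[of c] using 1 2 c by (intro mult_left_mono add_mono) auto
      also have "\<dots> \<le> m1 * GT + b1 * G2"
        unfolding distrib_left using nn by (intro add_mono mult_right_mono) auto
      also have "\<dots> \<le> m1 * GT + b1 * G2 + b2 * R" using b B by simp
      also have "\<dots> \<le> e * (v + P + R) + Ce * D" using B e(1) unfolding Ce_def GT_def G2_def by blast
      finally have Q: "q * P \<le> e * (v + P + R) + Ce * D" .
      show "energy t A x y z \<le> C3 * (2 + 2 * Ce / q) * (expect_on A (\<lambda>w. (norm (x w t))\<^sup>2) + k\<^sup>2 * prob A)"
        using absorb_estimate[OF W Q less_imp_le[OF e(1)] e(2) q _ _ C30] B by (simp add: D_def)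
    qed
  qed
qed

lemma sup_bound_arith:
  fixes a :: real
  assumes "a \<le> 2 * p + 8 * q" "p \<le> p'" "q \<le> q'" "x \<le> d"
  shows "2 * x + 2 * a \<le> 2 * d + 2 * (2 * p' + 8 * q')"
proof -
  have "a \<le> 2 * p' + 8 * q'" using assms(1-3) by linarith
  then show ?thesis using assms(4) by (intro add_mono mult_left_mono) auto
qed

text \<open>The energy estimate bounds the coefficients in \<open>L\<^sup>2\<close>, and therefore the suprema, by Doob's inequality.\<close>

theorem a_priori_estimate:
  fixes \<gamma> :: "real ^ 'n"
  assumes K: "0 \<le> K" and b: "0 \<le> b1" "0 \<le> b2" "0 \<le> m1" and T0: "0 \<le> T"
    and coercive: "0 < b2 \<or> (0 < b1 \<and> 0 < m1 \<and> (\<exists>c>0. \<forall>v. c * (norm v)\<^sup>2 \<le> (\<gamma> \<bullet> v)\<^sup>2))"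
  shows "\<exists>C>0. \<forall>t k x y z \<beta> \<sigma> g A. 0 \<le> t \<longrightarrow> t \<le> T \<longrightarrow> 0 \<le> k \<longrightarrow> fb_system t K k x y z \<beta> \<sigma> g \<longrightarrow>
     fb_monotone t \<gamma> b1 b2 m1 K k x y z \<beta> \<sigma> g \<longrightarrow> A \<in> sets (F t) \<longrightarrow>
     expect_on A (sup_norm2 t T x) + expect_on A (sup_norm2 t T y) + tint t A T (\<lambda>w r. (norm (z w r))\<^sup>2)
       \<le> C * (expect_on A (\<lambda>w. (norm (x w t))\<^sup>2) + k\<^sup>2 * prob A)"
proof -
  obtain C where C: "0 \<le> C" and en: "\<And>t k (x :: 'w \<Rightarrow> real \<Rightarrow> real ^ 'n) y z \<beta> \<sigma> g A. 0 \<le> t \<Longrightarrow> t \<le> T \<Longrightarrow> 0 \<le> k \<Longrightarrow> fb_system t K k x y z \<beta> \<sigma> g \<Longrightarrow>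
     fb_monotone t \<gamma> b1 b2 m1 K k x y z \<beta> \<sigma> g \<Longrightarrow> A \<in> sets (F t) \<Longrightarrow>
     energy t A x y z \<le> C * (expect_on A (\<lambda>w. (norm (x w t))\<^sup>2) + k\<^sup>2 * prob A)"
    using energy_estimate[OF K b T0 coercive] by blast
  define C5 where "C5 = 4 * K\<^sup>2 * (C + T)"
  have C50: "0 \<le> C5" using C T0 by (simp add: C5_def)
  show ?thesis
  proof (intro exI[of _ "(2 + (4 * T + 16) * C5) + (2 * C + 4 * T * C5 + 16 * C) + C + 1"] conjI allI impI)
    show "0 < (2 + (4 * T + 16) * C5) + (2 * C + 4 * T * C5 + 16 * C) + C + 1"
      using C T0 C50 by (intro add_nonneg_pos add_nonneg_nonneg mult_nonneg_nonneg) auto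
    fix t k :: real and x :: "'w \<Rightarrow> real \<Rightarrow> real ^ 'n" and y z \<beta> \<sigma> g A
    assume t: "0 \<le> t" "t \<le> T" and k: "0 \<le> k" and S: "fb_system t K k x y z \<beta> \<sigma> g"
      and Mo: "fb_monotone t \<gamma> b1 b2 m1 K k x y z \<beta> \<sigma> g" and A: "A \<in> sets (F t)"
    note p = fb_system_processes[OF S t]
    note bn = fb_system_bounds[OF S]
    have tt: "t \<in> {t..T}" "t \<in> {0..T}" "T \<in> {t..T}" using t by auto
    have AM: "A \<in> sets M" by (rule sets_F_M[OF tt(2) A])
    define D where "D = expect_on A (\<lambda>w. (norm (x w t))\<^sup>2) + k\<^sup>2 * prob A"
    define X0 where "X0 = expect_on A (\<lambda>w. (norm (x w t))\<^sup>2)"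
    define V0 where "V0 = expect_on A (\<lambda>w. (y w t)\<^sup>2)"
    define P1 where "P1 = expect_on A (\<lambda>w. (norm (x w T))\<^sup>2)"
    define P2 where "P2 = tint t A T (\<lambda>w r. (norm (x w r))\<^sup>2)"
    define RY where "RY = tint t A T (\<lambda>w r. (y w r)\<^sup>2)"
    define RZ where "RZ = tint t A T (\<lambda>w r. (norm (z w r))\<^sup>2)"
    define kP where "kP = k\<^sup>2 * prob A"
    have nn: "0 \<le> X0" "0 \<le> V0" "0 \<le> P1" "0 \<le> P2" "0 \<le> RY" "0 \<le> RZ" "0 \<le> kP"
      unfolding X0_def V0_def P1_def P2_def RY_def RZ_def kP_def by (auto intro!: integral_nonneg_AE tint_nonneg)
    have D: "D = X0 + kP" by (simp add: D_def X0_def kP_def)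
    have D0: "0 \<le> D" and X0D: "X0 \<le> D" using nn by (simp_all add: D)
    have E: "V0 + (P1 + P2) + (RY + RZ) \<le> C * D"
      using en[OF t k S Mo A] unfolding energy_def V0_def P1_def P2_def RY_def RZ_def D_def .
    have tot: "4 * K\<^sup>2 * (P2 + RY + RZ + T * kP) \<le> C5 * D"
    proof -
      have "P2 + RY + RZ \<le> C * D" using E nn by linarith
      moreover have "T * kP \<le> T * D" using nn T0 by (intro mult_left_mono) (auto simp: D)
      ultimately have "P2 + RY + RZ + T * kP \<le> (C + T) * D" by (simp add: distrib_right)
      then have "4 * K\<^sup>2 * (P2 + RY + RZ + T * kP) \<le> 4 * K\<^sup>2 * ((C + T) * D)" by (intro mult_left_mono) auto
      then show ?thesis by (simp add: C5_def mult.assoc)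
    qed
    have K4: "0 \<le> 4 * K\<^sup>2" by simp
    have tb: "tint t A T (\<lambda>w r. (norm (\<beta> w r))\<^sup>2) \<le> C5 * D"
      using tint_growth_bound[OF S t AM p(15) K4 tt(3) bn(1)] tot unfolding P2_def RY_def RZ_def kP_def by linarith
    have ts: "tint t A T (\<lambda>w r. (norm (\<sigma> w r))\<^sup>2) \<le> C5 * D"
      using tint_growth_bound[OF S t AM p(16) K4 tt(3) bn(2)] tot unfolding P2_def RY_def RZ_def kP_def by linarith
    have tg: "tint t A T (\<lambda>w r. (g w r)\<^sup>2) \<le> C5 * D"
      using tint_growth_bound[OF S t AM p(17) K4 tt(3) bn(3)] tot unfolding P2_def RY_def RZ_def kP_def by linarith
    have time: "(T - t) * q \<le> T * (C5 * D)" if "0 \<le> q" "q \<le> C5 * D" for q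
      using that t T0 by (intro mult_mono) auto
    have nb: "0 \<le> tint t A T (\<lambda>w r. (norm (\<beta> w r))\<^sup>2)" "0 \<le> tint t A T (\<lambda>w r. (g w r)\<^sup>2)"
      by (rule tint_nonneg, simp)+
    have sx: "expect_on A (sup_norm2 t T x) \<le> (2 + (4 * T + 16) * C5) * D"
    proof -
      have "expect_on A (sup_norm2 t T x) \<le> 2 * X0 + 2 * expect_on A (sup_norm2 t T (\<lambda>w s. x w s - x w t))"
        unfolding X0_def by (rule expect_on_sup_le[OF p(1) t AM])
      also have "\<dots> \<le> 2 * D + 2 * (2 * (T * (C5 * D)) + 8 * (C5 * D))"
        by (rule sup_bound_arith[OF vector_process_sup[OF p(1) p(3) t t(2) order_refl A] time[OF nb(1) tb] ts X0D])
      finally show ?thesis by (simp add: algebra_simps)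
    qed
    have sy: "expect_on A (sup_norm2 t T y) \<le> (2 * C + 4 * T * C5 + 16 * C) * D"
    proof -
      have "expect_on A (sup_norm2 t T y) \<le> 2 * V0 + 2 * expect_on A (sup_norm2 t T (\<lambda>w s. y w s - y w t))"
        unfolding V0_def using expect_on_sup_le[OF p(2) t AM] by simp
      also have "\<dots> \<le> 2 * (C * D) + 2 * (2 * (T * (C5 * D)) + 8 * (C * D))"
      proof -
        have "expect_on A (sup_norm2 t T (\<lambda>w s. y w s - y w t)) \<le> 2 * ((T - t) * tint t A T (\<lambda>w r. (g w r)\<^sup>2)) + 8 * RZ"
          using ito_process_sup[OF p(4) t t(2) order_refl A] unfolding RZ_def by simp
        moreover have "RZ \<le> C * D" "V0 \<le> C * D" using E nn by linarith+
        ultimately show ?thesis by (intro sup_bound_arith[OF _ time[OF nb(2) tg]])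
      qed
      finally show ?thesis by (simp add: algebra_simps)
    qed
    have sz: "RZ \<le> C * D" using E nn by linarith
    have "expect_on A (sup_norm2 t T x) + expect_on A (sup_norm2 t T y) + RZ
      \<le> (2 + (4 * T + 16) * C5) * D + (2 * C + 4 * T * C5 + 16 * C) * D + C * D"
      by (intro add_mono sx sy sz)
    also have "\<dots> = ((2 + (4 * T + 16) * C5) + (2 * C + 4 * T * C5 + 16 * C) + C) * D"
      by (simp only: distrib_right)
    also have "\<dots> \<le> ((2 + (4 * T + 16) * C5) + (2 * C + 4 * T * C5 + 16 * C) + C + 1) * D"
      using D0 by (intro mult_right_mono) auto
    finally show "expect_on A (sup_norm2 t T x) + expect_on A (sup_norm2 t T y) + tint t A T (\<lambda>w r. (norm (z w r))\<^sup>2)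
       \<le> ((2 + (4 * T + 16) * C5) + (2 * C + 4 * T * C5 + 16 * C) + C + 1) * (expect_on A (\<lambda>w. (norm (x w t))\<^sup>2) + k\<^sup>2 * prob A)"
      unfolding RZ_def D_def .
  qed
qed

section \<open>Composition of random fields with processes\<close>

lemma H2_minus:
  fixes \<phi> :: "'w \<Rightarrow> real \<Rightarrow> 'b::euclidean_space"
  assumes "\<phi> \<in> H2 M F t T" "0 \<le> t" "t \<le> T"
  shows "(\<lambda>w r. - \<phi> w r) \<in> H2 M F t T"
proof (rule H2_I)
  show "progressive F t T (\<lambda>w r. - \<phi> w r)" unfolding progressive_def
  proof
    fix s assume s: "s \<in> {t..T}"
    have "(\<lambda>x. \<phi> (snd x) (fst x)) \<in> borel_measurable (restrict_space borel {t..s} \<Otimes>\<^sub>M F s)"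
      using H2_progressive[OF assms(1)] s by (simp add: progressive_def case_prod_beta')
    then show "(\<lambda>(r, w). - \<phi> w r) \<in> borel_measurable (restrict_space borel {t..s} \<Otimes>\<^sub>M F s)"
      unfolding case_prod_beta' by (rule borel_measurable_uminus)
  qed
  show "sq_process t (\<lambda>w r. - \<phi> w r)"
    using H2_sq_process[OF assms] unfolding sq_process_iff by (rule sq_int_minus)
qed

lemma H2_component:
  fixes \<phi> :: "'w \<Rightarrow> real \<Rightarrow> real ^ 'm"
  assumes "\<phi> \<in> H2 M F t T" "0 \<le> t" "t \<le> T"
  shows "(\<lambda>w r. \<phi> w r $ i) \<in> H2 M F t T"
proof (rule H2_I)
  show "progressive F t T (\<lambda>w r. \<phi> w r $ i)" unfolding progressive_def
  proof
    fix s assume s: "s \<in> {t..T}"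
    have "(\<lambda>x. \<phi> (snd x) (fst x)) \<in> borel_measurable (restrict_space borel {t..s} \<Otimes>\<^sub>M F s)"
      using H2_progressive[OF assms(1)] s by (simp add: progressive_def case_prod_beta')
    then show "(\<lambda>(r, w). \<phi> w r $ i) \<in> borel_measurable (restrict_space borel {t..s} \<Otimes>\<^sub>M F s)"
      unfolding case_prod_beta' by (rule measurable_compose[OF _ borel_measurable_nth])
  qed
  show "sq_process t (\<lambda>w r. \<phi> w r $ i)"
    using H2_sq_process[OF assms] unfolding sq_process_iff by (rule sq_int_component)
qed

text \<open>For fixed arguments the field is progressively measurable, and it is continuous in its arguments, so that
  \<open>caratheodory_measurable\<close> applies on every \<open>[t,s]\<close>. Continuity may fail on the null set \<open>N\<close>; there the composition
  is set to \<open>0\<close>, which respects the filtration because \<open>N\<close> belongs to every \<open>F s\<close>.\<close>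

lemma composed_field_H2:
  fixes h :: "'w \<Rightarrow> real \<Rightarrow> real ^ 'n \<Rightarrow> real \<Rightarrow> real ^ 'd \<Rightarrow> 'e::euclidean_space"
  assumes prog: "\<And>x y z. progressive F 0 T (\<lambda>w s. h w s x y z)"
    and N: "N \<in> null_sets M"
    and lip: "\<And>w s x y z x' y' z'. w \<in> space M - N \<Longrightarrow> s \<in> {0..T} \<Longrightarrow>
      norm (h w s x y z - h w s x' y' z') \<le> K * (norm (x - x') + \<bar>y - y'\<bar> + norm (z - z'))"
    and growth: "\<And>w s x y z. w \<in> space M - N \<Longrightarrow> s \<in> {0..T} \<Longrightarrow> norm (h w s x y z) \<le> L * (1 + norm x + \<bar>y\<bar> + norm z)"
    and X: "X \<in> S2 M F t T" and Y: "Y \<in> S2 M F t T" and Z: "Z \<in> H2 M F t T" and t: "0 \<le> t" "t \<le> T"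
  shows "(\<lambda>w r. if w \<in> N then 0 else h w r (X w r) (Y w r) (Z w r)) \<in> H2 M F t T"
proof -
  let ?h = "\<lambda>w r. if w \<in> N then 0 else h w r (X w r) (Y w r) (Z w r)"
  have pr: "progressive F t T ?h" unfolding progressive_def
  proof
    fix s assume s: "s \<in> {t..T}"
    have sT: "s \<in> {0..T}" using s t by simp
    let ?N = "restrict_space borel {t..s} \<Otimes>\<^sub>M F s"
    define g where "g x l = (if snd x \<in> N then 0 else h (snd x) (fst x) (fst l) (fst (snd l)) (snd (snd l)))"
      for x :: "real \<times> 'w" and l :: "(real ^ 'n) \<times> real \<times> (real ^ 'd)"
    have NF: "N \<in> sets (F s)" by (rule filtration_null[OF sT N])
    have "(\<lambda>x. g x (X (snd x) (fst x), Y (snd x) (fst x), Z (snd x) (fst x))) \<in> borel_measurable ?N"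
    proof (rule caratheodory_measurable[where g = g])
      fix l :: "(real ^ 'n) \<times> real \<times> (real ^ 'd)"
      have m: "(\<lambda>x. h (snd x) (fst x) (fst l) (fst (snd l)) (snd (snd l))) \<in> borel_measurable ?N"
        using progressive_restrict[OF prog order_refl t(1)] s by (simp add: progressive_def case_prod_beta')
      have "{x \<in> space ?N. snd x \<in> N} \<in> sets ?N"
        using measurable_sets[OF measurable_snd NF, of "restrict_space borel {t..s}"] by (simp add: vimage_def Int_def conj_commute)
      then show "(\<lambda>x. g x l) \<in> borel_measurable ?N"
        unfolding g_def by (intro measurable_If m) auto
    next
      fix x assume x: "x \<in> space ?N"
      show "continuous_on UNIV (g x)"
      proof (cases "snd x \<in> N")
        case False
        have w: "snd x \<in> space M - N" "fst x \<in> {0..T}"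
          using x False s t by (auto simp: space_pair_measure space_restrict_space space_F[OF sT])
        show ?thesis unfolding continuous_on_iff
        proof (intro ballI allI impI)
          fix l :: "(real ^ 'n) \<times> real \<times> (real ^ 'd)" and e :: real assume e: "0 < e"
          \<comment> \<open>the factor \<open>3\<close> accounts for the three components, the summand \<open>1\<close> makes \<open>K'\<close> positive\<close>
          define K' where "K' = \<bar>K\<bar> * 3 + 1"
          have K': "0 < K'" by (simp add: K'_def)
          show "\<exists>d>0. \<forall>l'\<in>UNIV. dist l' l < d \<longrightarrow> dist (g x l') (g x l) < e"
          proof (intro exI[of _ "e / K'"] conjI ballI impI)
            show "0 < e / K'" using e K' by simp
            fix l' assume d: "dist l' l < e / K'"
            let ?q = "norm (fst l' - fst l) + \<bar>fst (snd l') - fst (snd l)\<bar> + norm (snd (snd l') - snd (snd l))"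
            have "dist (fst l') (fst l) \<le> dist l' l" "dist (snd l') (snd l) \<le> dist l' l"
              "dist (fst (snd l')) (fst (snd l)) \<le> dist (snd l') (snd l)" "dist (snd (snd l')) (snd (snd l)) \<le> dist (snd l') (snd l)"
              by (rule dist_fst_le dist_snd_le)+
            then have q: "?q \<le> 3 * dist l' l" by (simp add: dist_norm)
            have "dist (g x l') (g x l) \<le> K * ?q"
              using False lip[OF w] by (simp add: g_def dist_norm)
            also have "\<dots> \<le> \<bar>K\<bar> * ?q" by (intro mult_right_mono) auto
            also have "\<dots> \<le> \<bar>K\<bar> * (3 * dist l' l)" using q by (intro mult_left_mono) auto
            also have "\<dots> \<le> K' * dist l' l" by (simp add: K'_def algebra_simps)
            also have "\<dots> < e" using d K' by (simp add: pos_less_divide_eq mult.commute)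
            finally show "dist (g x l') (g x l) < e" .
          qed
        qed
      qed (simp add: g_def)
    next
      have "(\<lambda>x. X (snd x) (fst x)) \<in> borel_measurable ?N" "(\<lambda>x. Y (snd x) (fst x)) \<in> borel_measurable ?N"
        "(\<lambda>x. Z (snd x) (fst x)) \<in> borel_measurable ?N"
        using S2_progressive[OF X t(1)] S2_progressive[OF Y t(1)] H2_progressive[OF Z] s
        by (simp_all add: progressive_def case_prod_beta')
      then show "(\<lambda>x. (X (snd x) (fst x), Y (snd x) (fst x), Z (snd x) (fst x))) \<in> borel_measurable ?N"
        by (intro borel_measurable_Pair)
    qed
    then show "(\<lambda>(r, w). ?h w r) \<in> borel_measurable ?N"
      unfolding g_def case_prod_beta' fst_conv snd_conv .
  qed
  show ?thesis
  proof (rule H2_I[OF pr])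
    show "sq_process t ?h" unfolding sq_process_def
    proof (rule sq_int_bound[OF _ progressive_time_prod[OF pr t]])
      have xs: "proc_integrable t (\<lambda>w r. (norm (X w r))\<^sup>2)"
        by (rule proc_integrable_norm2[OF H2_sq_process[OF S2_H2[OF X t] t]])
      have ys: "proc_integrable t (\<lambda>w r. (norm (Y w r))\<^sup>2)"
        by (rule proc_integrable_norm2[OF H2_sq_process[OF S2_H2[OF Y t] t]])
      have zs: "proc_integrable t (\<lambda>w r. (norm (Z w r))\<^sup>2)"
        by (rule proc_integrable_norm2[OF H2_sq_process[OF Z t]])
      have "proc_integrable t (\<lambda>w r. 4 * L\<^sup>2 * (1 + (norm (X w r))\<^sup>2 + (norm (Y w r))\<^sup>2 + (norm (Z w r))\<^sup>2))"
        by (intro proc_integrable_cmult proc_integrable_add proc_integrable_const xs ys zs)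
      then show "integrable (time_prod t) (\<lambda>x. 4 * L\<^sup>2 * (1 + (norm (X (snd x) (fst x)))\<^sup>2 + (norm (Y (snd x) (fst x)))\<^sup>2 + (norm (Z (snd x) (fst x)))\<^sup>2))"
        by (simp add: proc_integrable_def)
      show "AE x in time_prod t. (norm (case x of (r, w) \<Rightarrow> ?h w r))\<^sup>2
        \<le> 4 * L\<^sup>2 * (1 + (norm (X (snd x) (fst x)))\<^sup>2 + (norm (Y (snd x) (fst x)))\<^sup>2 + (norm (Z (snd x) (fst x)))\<^sup>2)"
      proof (rule AE_I2)
        fix x assume x: "x \<in> space (time_prod t)"
        show "(norm (case x of (r, w) \<Rightarrow> ?h w r))\<^sup>2
          \<le> 4 * L\<^sup>2 * (1 + (norm (X (snd x) (fst x)))\<^sup>2 + (norm (Y (snd x) (fst x)))\<^sup>2 + (norm (Z (snd x) (fst x)))\<^sup>2)"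
        proof (cases "snd x \<in> N")
          case False
          have w: "snd x \<in> space M - N" "fst x \<in> {0..T}" using x False t by (auto simp: space_time_prod)
          show ?thesis
            using linear_growth_power2[OF norm_ge_zero growth[OF w]] False by (simp add: case_prod_beta)
        qed (simp add: case_prod_beta)
      qed
    qed
  qed
qed

end

section \<open>The equation as a forward-backward system\<close>

lemma matrix_row_norm2:
  fixes G :: "real ^ 'n ^ 1" and z :: "real ^ 'd"
  shows "(norm (G *v x))\<^sup>2 = (G $ 1 \<bullet> x)\<^sup>2"
    "(norm (transpose G *v vec c))\<^sup>2 = (norm (G $ 1))\<^sup>2 * c\<^sup>2"
    "(norm (transpose G ** (vec z :: real ^ 'd ^ 1)))\<^sup>2 = (norm (G $ 1))\<^sup>2 * (norm z)\<^sup>2"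
proof -
  show "(norm (G *v x))\<^sup>2 = (G $ 1 \<bullet> x)\<^sup>2"
    by (simp add: power2_norm_vec sum_1 matrix_vector_mult_def inner_vec_def)
  have "(norm (transpose G *v vec c))\<^sup>2 = (\<Sum>i\<in>UNIV. (G $ 1 $ i)\<^sup>2 * c\<^sup>2)"
    by (simp add: power2_norm_vec matrix_vector_mult_def transpose_def sum_1 power_mult_distrib)
  then show "(norm (transpose G *v vec c))\<^sup>2 = (norm (G $ 1))\<^sup>2 * c\<^sup>2"
    by (simp add: power2_norm_vec[of "G $ 1"] sum_distrib_right)
  have row: "(transpose G ** (vec z :: real ^ 'd ^ 1)) $ i = (G $ 1 $ i) *\<^sub>R z" for i
    by (simp add: vec_eq_iff matrix_matrix_mult_def transpose_def sum_1)
  show "(norm (transpose G ** (vec z :: real ^ 'd ^ 1)))\<^sup>2 = (norm (G $ 1))\<^sup>2 * (norm z)\<^sup>2"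
    unfolding norm2_matrix row power2_norm_vec[of "G $ 1"] sum_distrib_right
    by (simp add: power_mult_distrib)
qed

lemma fbsde_A_inner:
  "fbsde_A G b \<sigma> f w t (x, y, z) \<bullet> (x', y', z')
    = - f w t x y z * (G $ 1 \<bullet> x') + (G $ 1 \<bullet> b w t x y z) * y' + (\<Sum>i\<in>UNIV. G $ 1 $ i * (\<sigma> w t x y z $ i \<bullet> z'))"
proof -
  have 1: "(- (transpose G *v vec c)) \<bullet> x' = - c * (G $ 1 \<bullet> x')" for c
    by (simp add: inner_vec_def matrix_vector_mult_def transpose_def sum_1 sum_distrib_left sum_negf ac_simps)
  have 2: "(G *v v) $ 1 = G $ 1 \<bullet> v" for v
    by (simp add: matrix_vector_mult_def inner_vec_def)
  have 3: "(G ** s) $ 1 \<bullet> z' = (\<Sum>i\<in>UNIV. G $ 1 $ i * (s $ i \<bullet> z'))" for s :: "real ^ 'b ^ 'a"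
  proof -
    have "(G ** s) $ 1 = (\<Sum>i\<in>UNIV. G $ 1 $ i *\<^sub>R s $ i)"
      by (simp add: vec_eq_iff matrix_matrix_mult_def)
    then show ?thesis by (simp add: inner_sum_left)
  qed
  show ?thesis unfolding fbsde_A_def split_conv inner_Pair 1 2 3 inner_real_def by (simp only: add.assoc)
qed

lemma rank_one_row_nonzero:
  fixes G :: "real ^ 'n ^ 1"
  assumes "rank G = 1" shows "G $ 1 \<noteq> 0"
proof
  assume "G $ 1 = 0"
  then have "G = 0" by (simp add: vec_eq_iff forall_1)
  then show False using assms by simp
qed

text \<open>In dimension one the inner product with \<open>\<gamma>\<close> is multiplication by a scalar, so it controls the whole vector. This is
  what rescues the degenerate case \<open>\<beta>\<^sub>2 = 0\<close>.\<close>

lemma inner_power2_card_one: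
  fixes \<gamma> :: "real ^ 'n"
  assumes "CARD('n) = 1" shows "(\<gamma> \<bullet> v)\<^sup>2 = (norm \<gamma>)\<^sup>2 * (norm v)\<^sup>2"
proof -
  obtain a :: 'n where U: "UNIV = {a}" using assms card_1_singletonE by blast
  have "(\<Sum>i\<in>UNIV. h i) = h a" for h :: "'n \<Rightarrow> real" unfolding U by simp
  then show ?thesis by (simp add: power2_norm_vec inner_vec_def power_mult_distrib)
qed

context brownian_filtration
begin

text \<open>The drift of a solution, composed naively, need not be progressively measurable, because the coefficients
  are continuous only almost surely. The processes \<open>\<beta>\<close> and \<open>g\<close> are versions that vanish on the exceptional null set.\<close>

lemma fbsde_solution_ito:
  fixes b :: "'w \<Rightarrow> real \<Rightarrow> real ^ 'n \<Rightarrow> real \<Rightarrow> real ^ 'd \<Rightarrow> real ^ 'n"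
    and \<sigma> :: "'w \<Rightarrow> real \<Rightarrow> real ^ 'n \<Rightarrow> real \<Rightarrow> real ^ 'd \<Rightarrow> real ^ 'd ^ 'n"
  assumes meas: "fbsde_measurable F T b \<sigma> f \<Phi>" and C1: "cond_C1 M T b \<sigma> f \<Phi> K" and C2: "cond_C2 M T b \<sigma> f \<Phi> L"
    and t: "0 \<le> t" "t \<le> T" and sol: "fbsde_solution M F B T b \<sigma> f \<Phi> t \<zeta> X Y Z"
  shows "\<exists>\<beta> \<Sigma> g. X \<in> S2 M F t T \<and>
     (\<forall>i. ito_process t (\<lambda>w s. X w s $ i) (\<lambda>w s. \<beta> w s $ i) (\<lambda>w s. \<Sigma> w s $ i)) \<and>
     ito_process t Y (\<lambda>w s. - g w s) Z \<and>
     (AE w in M. X w t = \<zeta> w \<and> Y w T = \<Phi> w (X w T)) \<and>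
     (AE w in M. \<forall>r\<in>{t..T}. \<beta> w r = b w r (X w r) (Y w r) (Z w r) \<and>
        \<Sigma> w r = \<sigma> w r (X w r) (Y w r) (Z w r) \<and> g w r = f w r (X w r) (Y w r) (Z w r))"
proof -
  have X: "X \<in> S2 M F t T" and Y: "Y \<in> S2 M F t T" and Z: "Z \<in> H2 M F t T"
    using sol by (auto simp: fbsde_solution_def)
  obtain \<Sigma> I J where S: "AE w in M. \<forall>s\<in>{t..T}. \<Sigma> w s = \<sigma> w s (X w s) (Y w s) (Z w s)"
    and I: "\<And>i. has_ito_integral M F B t T (\<lambda>w s. \<Sigma> w s $ i) (\<lambda>w s. I w s $ i)"
    and J: "has_ito_integral M F B t T Z J"
    and eqs: "AE w in M. X w t = \<zeta> w \<and> Y w T = \<Phi> w (X w T) \<and>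
           (\<forall>s\<in>{t..T}.
              X w s = X w t + (LINT r:{t..s}|lborel. b w r (X w r) (Y w r) (Z w r)) + I w s \<and>
              Y w s = Y w t - (LINT r:{t..s}|lborel. f w r (X w r) (Y w r) (Z w r)) + J w s)"
    using sol unfolding fbsde_solution_def by blast
  have C1': "AE w in M. \<forall>t\<in>{0..T}. \<forall>x y z x' y' z'.
        norm (b w t x y z - b w t x' y' z') \<le> K * (norm (x - x') + \<bar>y - y'\<bar> + norm (z - z')) \<and>
        norm (\<sigma> w t x y z - \<sigma> w t x' y' z') \<le> K * (norm (x - x') + \<bar>y - y'\<bar> + norm (z - z')) \<and>
        \<bar>f w t x y z - f w t x' y' z'\<bar> \<le> K * (norm (x - x') + \<bar>y - y'\<bar> + norm (z - z')) \<and>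
        \<bar>\<Phi> w x - \<Phi> w x'\<bar> \<le> K * norm (x - x')"
    using C1 by (simp add: cond_C1_def)
  have C2': "AE w in M. \<forall>t\<in>{0..T}. \<forall>x y z.
        norm (b w t x y z) + norm (\<sigma> w t x y z) + \<bar>f w t x y z\<bar> + \<bar>\<Phi> w x\<bar> \<le> L * (1 + norm x + \<bar>y\<bar> + norm z)"
    using C2 by (simp add: cond_C2_def)
  define R where "R w \<longleftrightarrow> (\<forall>s\<in>{0..T}. \<forall>x y z.
      norm (b w s x y z) \<le> L * (1 + norm x + \<bar>y\<bar> + norm z) \<and> norm (f w s x y z) \<le> L * (1 + norm x + \<bar>y\<bar> + norm z) \<and>
      (\<forall>x' y' z'. norm (b w s x y z - b w s x' y' z') \<le> K * (norm (x - x') + \<bar>y - y'\<bar> + norm (z - z')) \<and>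
        norm (f w s x y z - f w s x' y' z') \<le> K * (norm (x - x') + \<bar>y - y'\<bar> + norm (z - z'))))" for w
  have "AE w in M. R w"
    using C1' C2'
  proof eventually_elim
    case (elim w)
    show ?case unfolding R_def
    proof (intro ballI allI conjI)
      fix s x y z assume s: "s \<in> {0..T}"
      have 2: "norm (b w s x y z) + norm (\<sigma> w s x y z) + \<bar>f w s x y z\<bar> + \<bar>\<Phi> w x\<bar> \<le> L * (1 + norm x + \<bar>y\<bar> + norm z)"
        using elim(2) s by blast
      have nn: "0 \<le> norm (b w s x y z)" "0 \<le> norm (\<sigma> w s x y z)" "0 \<le> \<bar>f w s x y z\<bar>" "0 \<le> \<bar>\<Phi> w x\<bar>" by auto
      show "norm (b w s x y z) \<le> L * (1 + norm x + \<bar>y\<bar> + norm z)" using 2 nn by linarith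
      show "norm (f w s x y z) \<le> L * (1 + norm x + \<bar>y\<bar> + norm z)" unfolding real_norm_def using 2 nn by linarith
      fix x' y' z'
      show "norm (b w s x y z - b w s x' y' z') \<le> K * (norm (x - x') + \<bar>y - y'\<bar> + norm (z - z'))"
        using elim(1) s by blast
      show "norm (f w s x y z - f w s x' y' z') \<le> K * (norm (x - x') + \<bar>y - y'\<bar> + norm (z - z'))"
        unfolding real_norm_def using elim(1) s by blast
    qed
  qed
  then have "\<exists>N\<in>null_sets M. {w \<in> space M. \<not> R w} \<subseteq> N"
    by (simp only: eventually_ae_filter)
  then obtain N where N: "N \<in> null_sets M" and sub: "{w \<in> space M. \<not> R w} \<subseteq> N" by blast
  have good: "norm (b w s x y z) \<le> L * (1 + norm x + \<bar>y\<bar> + norm z)"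
      "norm (f w s x y z) \<le> L * (1 + norm x + \<bar>y\<bar> + norm z)"
      "norm (b w s x y z - b w s x' y' z') \<le> K * (norm (x - x') + \<bar>y - y'\<bar> + norm (z - z'))"
      "norm (f w s x y z - f w s x' y' z') \<le> K * (norm (x - x') + \<bar>y - y'\<bar> + norm (z - z'))"
    if "w \<in> space M - N" "s \<in> {0..T}" for w s x y z x' y' z'
  proof -
    have "R w" using sub that(1) by blast
    note Rw = this[unfolded R_def, rule_format, OF that(2)]
    show "norm (b w s x y z) \<le> L * (1 + norm x + \<bar>y\<bar> + norm z)"
      by (rule conjunct1[OF Rw])
    show "norm (f w s x y z) \<le> L * (1 + norm x + \<bar>y\<bar> + norm z)"
      by (rule conjunct1[OF conjunct2[OF Rw]])
    show "norm (b w s x y z - b w s x' y' z') \<le> K * (norm (x - x') + \<bar>y - y'\<bar> + norm (z - z'))"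
      "norm (f w s x y z - f w s x' y' z') \<le> K * (norm (x - x') + \<bar>y - y'\<bar> + norm (z - z'))"
      using conjunct2[OF conjunct2[OF Rw]] by blast+
  qed
  define \<beta> where "\<beta> w r = (if w \<in> N then 0 else b w r (X w r) (Y w r) (Z w r))" for w r
  define g where "g w r = (if w \<in> N then 0 else f w r (X w r) (Y w r) (Z w r))" for w r
  have bH: "\<beta> \<in> H2 M F t T" unfolding \<beta>_def[abs_def]
  proof (rule composed_field_H2[OF _ N good(3) good(1) X Y Z t])
    show "progressive F 0 T (\<lambda>w s. b w s x y z)" for x y z using meas by (simp add: fbsde_measurable_def)
  qed
  have gH: "g \<in> H2 M F t T" unfolding g_def[abs_def]
  proof (rule composed_field_H2[OF _ N good(4) good(2) X Y Z t])
    show "progressive F 0 T (\<lambda>w s. f w s x y z)" for x y z using meas by (simp add: fbsde_measurable_def)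
  qed
  have NN: "AE w in M. w \<notin> N" by (rule AE_not_in[OF N])
  have coef: "AE w in M. \<forall>r\<in>{t..T}. \<beta> w r = b w r (X w r) (Y w r) (Z w r) \<and>
        \<Sigma> w r = \<sigma> w r (X w r) (Y w r) (Z w r) \<and> g w r = f w r (X w r) (Y w r) (Z w r)"
    using S NN by eventually_elim (simp add: \<beta>_def g_def)
  have ix: "ito_process t (\<lambda>w s. X w s $ i) (\<lambda>w s. \<beta> w s $ i) (\<lambda>w s. \<Sigma> w s $ i)" for i
    unfolding ito_process_def
  proof (intro conjI exI)
    show "(\<lambda>w s. X w s $ i) \<in> S2 M F t T" by (rule S2_component[OF X t])
    show "(\<lambda>w s. \<beta> w s $ i) \<in> H2 M F t T" by (rule H2_component[OF bH t])
    show "ito_span t (\<lambda>w s. \<Sigma> w s $ i) (\<lambda>w s. I w s $ i)" by (rule ito_span.base[OF I])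
    show "AE w in M. \<forall>s\<in>{t..T}. X w s $ i = X w t $ i + (LINT r:{t..s}|lborel. \<beta> w r $ i) + I w s $ i"
      using eqs NN sq_process_AE_set_integrable[OF H2_sq_process[OF bH t] t(2)]
    proof eventually_elim
      case (elim w)
      show ?case
      proof
        fix s assume s: "s \<in> {t..T}"
        have "integrable lborel (\<lambda>r. indicator {t..s} r *\<^sub>R \<beta> w r)"
          using bspec[OF elim(3) s] by (simp add: set_integrable_def)
        from integral_bounded_linear[OF bounded_linear_vec_nth this, of i]
        have 1: "(LINT r:{t..s}|lborel. \<beta> w r $ i) = (LINT r:{t..s}|lborel. \<beta> w r) $ i"
          by (simp add: set_lebesgue_integral_def)
        have 2: "\<beta> w = (\<lambda>r. b w r (X w r) (Y w r) (Z w r))" using elim(2) by (simp add: \<beta>_def fun_eq_iff)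
        note 3 = conjunct1[OF bspec[OF conjunct2[OF conjunct2[OF elim(1)]] s]]
        show "X w s $ i = X w t $ i + (LINT r:{t..s}|lborel. \<beta> w r $ i) + I w s $ i"
          unfolding 1 unfolding 2 by (subst 3) (simp only: vector_add_component)
      qed
    qed
  qed
  have iy: "ito_process t Y (\<lambda>w s. - g w s) Z"
    unfolding ito_process_def
  proof (intro conjI exI)
    show "Y \<in> S2 M F t T" by (rule Y)
    show "(\<lambda>w s. - g w s) \<in> H2 M F t T" by (rule H2_minus[OF gH t])
    show "ito_span t Z J" by (rule ito_span.base[OF J])
    show "AE w in M. \<forall>s\<in>{t..T}. Y w s = Y w t + (LINT r:{t..s}|lborel. - g w r) + J w s"
      using eqs NN
    proof eventually_elim
      case (elim w)
      have 1: "(LINT r:{t..s}|lborel. - g w r) = - (LINT r:{t..s}|lborel. g w r)" for s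
        by (simp add: set_lebesgue_integral_def)
      have 2: "g w = (\<lambda>r. f w r (X w r) (Y w r) (Z w r))" using elim(2) by (simp add: g_def fun_eq_iff)
      show ?case
      proof
        fix s assume s: "s \<in> {t..T}"
        note 3 = conjunct2[OF bspec[OF conjunct2[OF conjunct2[OF elim(1)]] s]]
        show "Y w s = Y w t + (LINT r:{t..s}|lborel. - g w r) + J w s"
          unfolding 1 unfolding 2 by (subst 3) simp
      qed
    qed
  qed
  have "AE w in M. X w t = \<zeta> w \<and> Y w T = \<Phi> w (X w T)" using eqs by eventually_elim simp
  then show ?thesis using X ix iy coef by blast
qed

text \<open>The passage from estimates on the sets of \<open>F t\<close> to the conditional expectation.\<close>

lemma conditional_bound:
  fixes x :: "'w \<Rightarrow> real \<Rightarrow> 'a::euclidean_space" and y :: "'w \<Rightarrow> real \<Rightarrow> real" and z :: "'w \<Rightarrow> real \<Rightarrow> 'b::euclidean_space"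
  assumes t: "0 \<le> t" "t \<le> T" and x: "x \<in> S2 M F t T" and y: "y \<in> S2 M F t T" and z: "sq_process t z"
    and V: "integrable M V" "V \<in> borel_measurable (F t)"
    and le: "\<And>A. A \<in> sets (F t) \<Longrightarrow> expect_on A (sup_norm2 t T x) + expect_on A (sup_norm2 t T y)
       + tint t A T (\<lambda>w r. (norm (z w r))\<^sup>2) \<le> expect_on A V"
  shows "AE w in M. real_cond_exp M (F t) (\<lambda>w. sup_norm2 t T x w + sup_norm2 t T y w
       + (LINT r:{t..T}|lborel. (norm (z w r))\<^sup>2)) w \<le> V w"
proof -
  have tt: "t \<in> {0..T}" "T \<in> {t..T}" using t by auto
  note zz = tint_section(2,3)[OF proc_integrable_norm2[OF z] tt(2)]
  have zi: "integrable M (\<lambda>w. LINT r:{t..T}|lborel. (norm (z w r))\<^sup>2)"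
  proof -
    have "integrable M (\<lambda>w. indicator (space M) w * (LINT r:{t..T}|lborel. (norm (z w r))\<^sup>2))" by (rule zz(1)) simp
    then show ?thesis by (subst (asm) Bochner_Integration.integrable_cong[OF refl]) auto
  qed
  note xi = S2_sup_integrable[OF x t(2)] and yi = S2_sup_integrable[OF y t(2)]
  show ?thesis
  proof (rule sigma_finite_subalgebra.real_cond_exp_le_of_set_integrals_le[OF sigma_finite_F[OF tt(1)] _ V])
    show "integrable M (\<lambda>w. sup_norm2 t T x w + sup_norm2 t T y w + (LINT r:{t..T}|lborel. (norm (z w r))\<^sup>2))"
      by (intro Bochner_Integration.integrable_add xi yi zi)
    fix A assume A: "A \<in> sets (F t)"
    have AM: "A \<in> sets M" by (rule sets_F_M[OF tt(1) A])
    have i: "integrable M (\<lambda>w. indicator A w * U w)" if "integrable M U" for U :: "'w \<Rightarrow> real"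
      using integrable_mult_indicator[OF AM that] by simp
    have "expect_on A (\<lambda>w. sup_norm2 t T x w + sup_norm2 t T y w + (LINT r:{t..T}|lborel. (norm (z w r))\<^sup>2))
      = expect_on A (sup_norm2 t T x) + expect_on A (sup_norm2 t T y) + tint t A T (\<lambda>w r. (norm (z w r))\<^sup>2)"
      unfolding zz(2)[OF AM] distrib_left
      by (simp only: Bochner_Integration.integral_add Bochner_Integration.integrable_add i xi yi zi)
    also have "\<dots> \<le> expect_on A V" by (rule le[OF A])
    finally show "expect_on A (\<lambda>w. sup_norm2 t T x w + sup_norm2 t T y w + (LINT r:{t..T}|lborel. (norm (z w r))\<^sup>2))
      \<le> expect_on A V" .
  qed
qed

lemma tint_le_sup:
  fixes X :: "'w \<Rightarrow> real \<Rightarrow> 'b::euclidean_space"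
  assumes X: "X \<in> S2 M F t T" and t: "0 \<le> t" "t \<le> T" and A: "A \<in> sets M" and u: "t \<le> u" "u \<le> T"
  shows "tint t A u (\<lambda>w r. (norm (X w r))\<^sup>2) \<le> (u - t) * expect_on A (sup_norm2 t T X)"
proof -
  have ut: "u \<in> {t..T}" using u by simp
  show ?thesis unfolding tint_norm2_integral[OF X t A ut]
  proof (rule integral_le_const_interval[OF _ _ u(1)])
    show "continuous_on {t..u} (\<lambda>r. expect_on A (\<lambda>w. (norm (X w r))\<^sup>2))"
      by (rule continuous_on_subset[OF S2_moment_continuous[OF X t A]]) (use u in auto)
    fix s assume "s \<in> {t..u}"
    then have s: "s \<in> {t..T}" using u by auto
    show "expect_on A (\<lambda>w. (norm (X w s))\<^sup>2) \<le> expect_on A (sup_norm2 t T X)"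
    proof (rule integral_mono[OF expect_on_norm2_integrable[OF X s t(1) A]])
      show "integrable M (\<lambda>w. indicator A w * sup_norm2 t T X w)"
        using integrable_mult_indicator[OF A S2_sup_integrable[OF X t(2)]] by simp
      fix w assume w: "w \<in> space M"
      have "(norm (X w s))\<^sup>2 \<le> sup_norm2 t T X w" by (rule sup_norm2_upper[where X = X, OF S2_continuous[OF X w] s])
      then show "indicator A w * (norm (X w s))\<^sup>2 \<le> indicator A w * sup_norm2 t T X w" by (simp add: indicator_def)
    qed
  qed
qed

end

lemma fbsde_A_diff_inner:
  fixes G :: "real ^ 'n ^ 1"
  shows "(fbsde_A G b \<sigma> f w t (x, y, z) - fbsde_A G b \<sigma> f w t (x', y', z')) \<bullet> ((x, y, z) - (x', y', z'))
    = (G $ 1 \<bullet> (b w t x y z - b w t x' y' z')) * (y - y') - (G $ 1 \<bullet> (x - x')) * (f w t x y z - f w t x' y' z')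
      + (\<Sum>i\<in>UNIV. G $ 1 $ i * ((\<sigma> w t x y z - \<sigma> w t x' y' z') $ i \<bullet> (z - z')))"
proof -
  have "(\<Sum>i\<in>UNIV. G $ 1 $ i * ((\<sigma> w t x y z - \<sigma> w t x' y' z') $ i \<bullet> (z - z')))
    = (\<Sum>i\<in>UNIV. G $ 1 $ i * (\<sigma> w t x y z $ i \<bullet> (z - z'))) - (\<Sum>i\<in>UNIV. G $ 1 $ i * (\<sigma> w t x' y' z' $ i \<bullet> (z - z')))"
    by (simp only: vector_minus_component inner_diff_left right_diff_distrib sum_subtractf)
  then show ?thesis
    unfolding diff_Pair inner_diff_left fbsde_A_inner inner_diff_right[of "G $ 1" "b w t x y z"]
    by (simp only: left_diff_distrib right_diff_distrib) simp
qed

lemma row_sum_bound: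
  fixes \<gamma> :: "real ^ 'n" and s :: "real ^ 'd ^ 'n"
  shows "(\<Sum>i\<in>UNIV. \<gamma> $ i * (s $ i \<bullet> z)) \<le> real CARD('n) * norm \<gamma> * norm s * norm z"
proof -
  have "\<gamma> $ i * (s $ i \<bullet> z) \<le> norm \<gamma> * (norm s * norm z)" for i
  proof -
    have "\<gamma> $ i * (s $ i \<bullet> z) \<le> \<bar>\<gamma> $ i\<bar> * \<bar>s $ i \<bullet> z\<bar>" by (simp add: abs_mult[symmetric])
    also have "\<dots> \<le> norm \<gamma> * (norm s * norm z)"
    proof (rule mult_mono[OF component_le_norm_cart])
      have "\<bar>s $ i \<bullet> z\<bar> \<le> norm (s $ i) * norm z" by (rule Cauchy_Schwarz_ineq2)
      also have "\<dots> \<le> norm s * norm z" by (intro mult_right_mono Finite_Cartesian_Product.norm_nth_le) auto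
      finally show "\<bar>s $ i \<bullet> z\<bar> \<le> norm s * norm z" .
    qed auto
    finally show ?thesis .
  qed
  then have "(\<Sum>i\<in>UNIV. \<gamma> $ i * (s $ i \<bullet> z)) \<le> (\<Sum>i\<in>(UNIV :: 'n set). norm \<gamma> * (norm s * norm z))"
    by (intro sum_mono)
  then show ?thesis by (simp add: mult.assoc)
qed

context brownian_filtration
begin

text \<open>Lipschitz continuity bounds the coefficients of the difference, and the monotonicity condition applies
  to the two states directly, without error.\<close>

lemma fbsde_difference_system:
  fixes G :: "real ^ 'n ^ 1"
  assumes meas: "fbsde_measurable F T b \<sigma> f \<Phi>" and B2: "cond_B2 M T G b \<sigma> f \<Phi> \<beta>1 \<beta>2 \<mu>1"
    and C1: "cond_C1 M T b \<sigma> f \<Phi> K" and C2: "cond_C2 M T b \<sigma> f \<Phi> L" and K0: "K \<le> K0"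
    and t: "0 \<le> t" "t \<le> T"
    and sol: "fbsde_solution M F B T b \<sigma> f \<Phi> t \<zeta> X Y Z" and sol': "fbsde_solution M F B T b \<sigma> f \<Phi> t \<zeta>' X' Y' Z'"
  defines "x \<equiv> \<lambda>w s. X w s - X' w s" and "y \<equiv> \<lambda>w s. Y w s - Y' w s" and "z \<equiv> \<lambda>w s. Z w s - Z' w s"
  shows "\<exists>\<beta> \<Sigma> g. fb_system t K0 0 x y z \<beta> \<Sigma> g \<and>
      fb_monotone t (G $ 1) \<beta>1 (\<beta>2 * (norm (G $ 1))\<^sup>2) \<mu>1 K0 0 x y z \<beta> \<Sigma> g \<and> (AE w in M. x w t = \<zeta> w - \<zeta>' w)"
proof -
  obtain \<beta> \<Sigma> g where s: "X \<in> S2 M F t T"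
    "\<And>i. ito_process t (\<lambda>w s. X w s $ i) (\<lambda>w s. \<beta> w s $ i) (\<lambda>w s. \<Sigma> w s $ i)"
    "ito_process t Y (\<lambda>w s. - g w s) Z"
    "AE w in M. X w t = \<zeta> w \<and> Y w T = \<Phi> w (X w T)"
    "AE w in M. \<forall>r\<in>{t..T}. \<beta> w r = b w r (X w r) (Y w r) (Z w r) \<and>
        \<Sigma> w r = \<sigma> w r (X w r) (Y w r) (Z w r) \<and> g w r = f w r (X w r) (Y w r) (Z w r)"
    using fbsde_solution_ito[OF meas C1 C2 t sol] by blast
  obtain \<beta>' \<Sigma>' g' where s': "X' \<in> S2 M F t T"
    "\<And>i. ito_process t (\<lambda>w s. X' w s $ i) (\<lambda>w s. \<beta>' w s $ i) (\<lambda>w s. \<Sigma>' w s $ i)"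
    "ito_process t Y' (\<lambda>w s. - g' w s) Z'"
    "AE w in M. X' w t = \<zeta>' w \<and> Y' w T = \<Phi> w (X' w T)"
    "AE w in M. \<forall>r\<in>{t..T}. \<beta>' w r = b w r (X' w r) (Y' w r) (Z' w r) \<and>
        \<Sigma>' w r = \<sigma> w r (X' w r) (Y' w r) (Z' w r) \<and> g' w r = f w r (X' w r) (Y' w r) (Z' w r)"
    using fbsde_solution_ito[OF meas C1 C2 t sol'] by blast
  have C1': "AE w in M. \<forall>t\<in>{0..T}. \<forall>x y z x' y' z'.
        norm (b w t x y z - b w t x' y' z') \<le> K * (norm (x - x') + \<bar>y - y'\<bar> + norm (z - z')) \<and>
        norm (\<sigma> w t x y z - \<sigma> w t x' y' z') \<le> K * (norm (x - x') + \<bar>y - y'\<bar> + norm (z - z')) \<and>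
        \<bar>f w t x y z - f w t x' y' z'\<bar> \<le> K * (norm (x - x') + \<bar>y - y'\<bar> + norm (z - z')) \<and>
        \<bar>\<Phi> w x - \<Phi> w x'\<bar> \<le> K * norm (x - x')"
    using C1 by (simp add: cond_C1_def)
  have B2a: "AE w in M. \<forall>t\<in>{0..T}. \<forall>x y z x' y' z'.
        (fbsde_A G b \<sigma> f w t (x, y, z) - fbsde_A G b \<sigma> f w t (x', y', z')) \<bullet> ((x, y, z) - (x', y', z'))
        \<le> - \<beta>1 * (norm (G *v (x - x')))\<^sup>2
          - \<beta>2 * ((norm (transpose G *v vec (y - y')))\<^sup>2 + (norm (transpose G ** (vec (z - z') :: real ^ 'd ^ 1)))\<^sup>2)"
    and B2b: "AE w in M. \<forall>x x'. (\<Phi> w x - \<Phi> w x') * (G *v (x - x')) $ 1 \<ge> \<mu>1 * (norm (G *v (x - x')))\<^sup>2"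
    using B2 by (simp_all only: cond_B2_def)
  define be where "be = (\<lambda>w r. \<beta> w r - \<beta>' w r)"
  define si where "si = (\<lambda>w r. \<Sigma> w r - \<Sigma>' w r)"
  define ge where "ge = (\<lambda>w r. g w r - g' w r)"
  have TT: "T \<in> {0..T}" using t by simp
  have S: "fb_system t K0 0 x y z be si ge"
    unfolding fb_system_def
  proof (intro conjI allI)
    show "x \<in> S2 M F t T" unfolding x_def by (rule S2_diff[OF s(1) s'(1) t])
    show "ito_process t (\<lambda>w s. x w s $ i) (\<lambda>w s. be w s $ i) (\<lambda>w s. si w s $ i)" for i
      unfolding x_def be_def si_def vector_minus_component by (rule ito_process_diff[OF s(2) s'(2) t])
    have "(\<lambda>w s. - ge w s) = (\<lambda>w s. - g w s - - g' w s)" by (simp add: ge_def fun_eq_iff)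
    then show "ito_process t y (\<lambda>w s. - ge w s) z"
      unfolding y_def z_def by (simp only:) (rule ito_process_diff[OF s(3) s'(3) t])
    show "AE w in M. \<forall>r\<in>{t..T}.
        norm (be w r) \<le> K0 * (norm (x w r) + \<bar>y w r\<bar> + norm (z w r) + 0) \<and>
        norm (si w r) \<le> K0 * (norm (x w r) + \<bar>y w r\<bar> + norm (z w r) + 0) \<and>
        \<bar>ge w r\<bar> \<le> K0 * (norm (x w r) + \<bar>y w r\<bar> + norm (z w r) + 0)"
      using s(5) s'(5) C1'
    proof eventually_elim
      case (elim w)
      show ?case
      proof
        fix r assume r: "r \<in> {t..T}"
        then have r0: "r \<in> {0..T}" using t by auto
        let ?q = "norm (x w r) + \<bar>y w r\<bar> + norm (z w r)"
        have q: "K * ?q \<le> K0 * (?q + 0)" using K0 by (simp add: mult_right_mono)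
        note lip = elim(3)[rule_format, OF r0, of "X w r" "Y w r" "Z w r" "X' w r" "Y' w r" "Z' w r"]
        have e: "be w r = b w r (X w r) (Y w r) (Z w r) - b w r (X' w r) (Y' w r) (Z' w r)"
          "si w r = \<sigma> w r (X w r) (Y w r) (Z w r) - \<sigma> w r (X' w r) (Y' w r) (Z' w r)"
          "ge w r = f w r (X w r) (Y w r) (Z w r) - f w r (X' w r) (Y' w r) (Z' w r)"
          using elim(1) elim(2) r by (simp_all add: be_def si_def ge_def)
        show "norm (be w r) \<le> K0 * (?q + 0) \<and> norm (si w r) \<le> K0 * (?q + 0) \<and> \<bar>ge w r\<bar> \<le> K0 * (?q + 0)"
          unfolding e using lip q unfolding x_def y_def z_def by linarith
      qed
    qed
    show "AE w in M. \<bar>y w T\<bar> \<le> K0 * (norm (x w T) + 0)"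
      using s(4) s'(4) C1'
    proof eventually_elim
      case (elim w)
      have "\<bar>\<Phi> w (X w T) - \<Phi> w (X' w T)\<bar> \<le> K * norm (X w T - X' w T)"
        using elim(3) TT by blast
      also have "\<dots> \<le> K0 * norm (X w T - X' w T)" using K0 by (intro mult_right_mono) auto
      finally show ?case using elim(1,2) by (simp add: x_def y_def)
    qed
  qed
  have Mo: "fb_monotone t (G $ 1) \<beta>1 (\<beta>2 * (norm (G $ 1))\<^sup>2) \<mu>1 K0 0 x y z be si ge"
    unfolding fb_monotone_def
  proof
    show "AE w in M. \<forall>r\<in>{t..T}.
        (G $ 1 \<bullet> be w r) * y w r - (G $ 1 \<bullet> x w r) * ge w r + (\<Sum>i\<in>UNIV. G $ 1 $ i * (si w r $ i \<bullet> z w r))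
        \<le> - \<beta>1 * (G $ 1 \<bullet> x w r)\<^sup>2 - \<beta>2 * (norm (G $ 1))\<^sup>2 * ((y w r)\<^sup>2 + (norm (z w r))\<^sup>2)
          + K0 * 0 * (norm (x w r) + \<bar>y w r\<bar> + norm (z w r))"
      using s(5) s'(5) B2a
    proof eventually_elim
      case (elim w)
      show ?case
      proof
        fix r assume r: "r \<in> {t..T}"
        then have r0: "r \<in> {0..T}" using t by auto
        have e: "be w r = b w r (X w r) (Y w r) (Z w r) - b w r (X' w r) (Y' w r) (Z' w r)"
          "si w r = \<sigma> w r (X w r) (Y w r) (Z w r) - \<sigma> w r (X' w r) (Y' w r) (Z' w r)"
          "ge w r = f w r (X w r) (Y w r) (Z w r) - f w r (X' w r) (Y' w r) (Z' w r)"
          using elim(1) elim(2) r by (simp_all add: be_def si_def ge_def)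
        show "(G $ 1 \<bullet> be w r) * y w r - (G $ 1 \<bullet> x w r) * ge w r + (\<Sum>i\<in>UNIV. G $ 1 $ i * (si w r $ i \<bullet> z w r))
          \<le> - \<beta>1 * (G $ 1 \<bullet> x w r)\<^sup>2 - \<beta>2 * (norm (G $ 1))\<^sup>2 * ((y w r)\<^sup>2 + (norm (z w r))\<^sup>2)
            + K0 * 0 * (norm (x w r) + \<bar>y w r\<bar> + norm (z w r))"
          using elim(3)[rule_format, OF r0, of "X w r" "Y w r" "Z w r" "X' w r" "Y' w r" "Z' w r"]
          unfolding e fbsde_A_diff_inner matrix_row_norm2 x_def y_def z_def by (simp add: algebra_simps)
      qed
    qed
    show "AE w in M. \<mu>1 * (G $ 1 \<bullet> x w T)\<^sup>2 - K0 * 0 * norm (x w T) \<le> y w T * (G $ 1 \<bullet> x w T)"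
      using s(4) s'(4) B2b
    proof eventually_elim
      case (elim w)
      have "\<mu>1 * (norm (G *v (X w T - X' w T)))\<^sup>2 \<le> (\<Phi> w (X w T) - \<Phi> w (X' w T)) * (G *v (X w T - X' w T)) $ 1"
        using elim(3) by blast
      moreover have "(G *v (X w T - X' w T)) $ 1 = G $ 1 \<bullet> (X w T - X' w T)"
        by (simp add: matrix_vector_mult_def inner_vec_def)
      ultimately show ?case using elim(1,2) by (simp add: x_def y_def matrix_row_norm2)
    qed
  qed
  have "AE w in M. x w t = \<zeta> w - \<zeta>' w"
    using s(4) s'(4) by eventually_elim (simp add: x_def)
  then show ?thesis using S Mo by blast
qed

text \<open>Monotonicity between the solution and the zero state, moving the coefficients at the zero state to the
  right-hand side. These are bounded by \<open>L\<close>, and the sum over the rows of \<open>\<sigma>\<close> gives the factor \<open>CARD('n)\<close> in the constant.\<close>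

lemma fbsde_solution_system:
  fixes G :: "real ^ 'n ^ 1"
  assumes meas: "fbsde_measurable F T b \<sigma> f \<Phi>" and B2: "cond_B2 M T G b \<sigma> f \<Phi> \<beta>1 \<beta>2 \<mu>1"
    and C1: "cond_C1 M T b \<sigma> f \<Phi> K" and C2: "cond_C2 M T b \<sigma> f \<Phi> L"
    and K0: "L \<le> K0" "real CARD('n) * norm (G $ 1) * L \<le> K0"
    and t: "0 \<le> t" "t \<le> T"
    and sol: "fbsde_solution M F B T b \<sigma> f \<Phi> t \<zeta> X Y Z"
  shows "\<exists>\<beta> \<Sigma> g. fb_system t K0 1 X Y Z \<beta> \<Sigma> g \<and>
      fb_monotone t (G $ 1) \<beta>1 (\<beta>2 * (norm (G $ 1))\<^sup>2) \<mu>1 K0 1 X Y Z \<beta> \<Sigma> g \<and> (AE w in M. X w t = \<zeta> w) \<and>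
      (AE w in M. \<forall>r\<in>{t..T}. \<Sigma> w r = \<sigma> w r (X w r) (Y w r) (Z w r))"
proof -
  obtain \<beta> \<Sigma> g where s: "X \<in> S2 M F t T"
    "\<And>i. ito_process t (\<lambda>w s. X w s $ i) (\<lambda>w s. \<beta> w s $ i) (\<lambda>w s. \<Sigma> w s $ i)"
    "ito_process t Y (\<lambda>w s. - g w s) Z"
    "AE w in M. X w t = \<zeta> w \<and> Y w T = \<Phi> w (X w T)"
    "AE w in M. \<forall>r\<in>{t..T}. \<beta> w r = b w r (X w r) (Y w r) (Z w r) \<and>
        \<Sigma> w r = \<sigma> w r (X w r) (Y w r) (Z w r) \<and> g w r = f w r (X w r) (Y w r) (Z w r)"
    using fbsde_solution_ito[OF meas C1 C2 t sol] by blast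
  have L0: "0 \<le> L" using C2 by (simp add: cond_C2_def)
  have C2': "AE w in M. \<forall>t\<in>{0..T}. \<forall>x y z.
        norm (b w t x y z) + norm (\<sigma> w t x y z) + \<bar>f w t x y z\<bar> + \<bar>\<Phi> w x\<bar> \<le> L * (1 + norm x + \<bar>y\<bar> + norm z)"
    using C2 by (simp add: cond_C2_def)
  have growth: "AE w in M. \<forall>r\<in>{0..T}. \<forall>x y z. norm (b w r x y z) \<le> L * (1 + norm x + \<bar>y\<bar> + norm z) \<and>
      norm (\<sigma> w r x y z) \<le> L * (1 + norm x + \<bar>y\<bar> + norm z) \<and> \<bar>f w r x y z\<bar> \<le> L * (1 + norm x + \<bar>y\<bar> + norm z)
      \<and> \<bar>\<Phi> w x\<bar> \<le> L * (1 + norm x + \<bar>y\<bar> + norm z)"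
    using C2'
  proof eventually_elim
    case (elim w)
    show ?case
    proof (intro ballI allI)
      fix r x y z assume r: "r \<in> {0..T}"
      have 2: "norm (b w r x y z) + norm (\<sigma> w r x y z) + \<bar>f w r x y z\<bar> + \<bar>\<Phi> w x\<bar> \<le> L * (1 + norm x + \<bar>y\<bar> + norm z)"
        using elim r by blast
      have nn: "0 \<le> norm (b w r x y z)" "0 \<le> norm (\<sigma> w r x y z)" "0 \<le> \<bar>f w r x y z\<bar>" "0 \<le> \<bar>\<Phi> w x\<bar>" by auto
      show "norm (b w r x y z) \<le> L * (1 + norm x + \<bar>y\<bar> + norm z) \<and>
        norm (\<sigma> w r x y z) \<le> L * (1 + norm x + \<bar>y\<bar> + norm z) \<and> \<bar>f w r x y z\<bar> \<le> L * (1 + norm x + \<bar>y\<bar> + norm z)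
        \<and> \<bar>\<Phi> w x\<bar> \<le> L * (1 + norm x + \<bar>y\<bar> + norm z)"
        using 2 nn by linarith
    qed
  qed
  have TT: "T \<in> {0..T}" using t by simp
  have B2a: "AE w in M. \<forall>t\<in>{0..T}. \<forall>x y z x' y' z'.
        (fbsde_A G b \<sigma> f w t (x, y, z) - fbsde_A G b \<sigma> f w t (x', y', z')) \<bullet> ((x, y, z) - (x', y', z'))
        \<le> - \<beta>1 * (norm (G *v (x - x')))\<^sup>2
          - \<beta>2 * ((norm (transpose G *v vec (y - y')))\<^sup>2 + (norm (transpose G ** (vec (z - z') :: real ^ 'd ^ 1)))\<^sup>2)"
    and B2b: "AE w in M. \<forall>x x'. (\<Phi> w x - \<Phi> w x') * (G *v (x - x')) $ 1 \<ge> \<mu>1 * (norm (G *v (x - x')))\<^sup>2"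
    using B2 by (simp_all only: cond_B2_def)
  have n1: "1 \<le> real CARD('n)" by (simp add: Suc_leI)
  have K1: "norm (G $ 1) * L \<le> K0"
  proof -
    have "1 * (norm (G $ 1) * L) \<le> real CARD('n) * (norm (G $ 1) * L)"
      using n1 L0 by (intro mult_right_mono) auto
    then show ?thesis using K0(2) by (simp add: mult.assoc)
  qed
  have S: "fb_system t K0 1 X Y Z \<beta> \<Sigma> g"
    unfolding fb_system_def
  proof (intro conjI allI s(1) s(2) s(3))
    show "AE w in M. \<forall>r\<in>{t..T}.
        norm (\<beta> w r) \<le> K0 * (norm (X w r) + \<bar>Y w r\<bar> + norm (Z w r) + 1) \<and>
        norm (\<Sigma> w r) \<le> K0 * (norm (X w r) + \<bar>Y w r\<bar> + norm (Z w r) + 1) \<and>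
        \<bar>g w r\<bar> \<le> K0 * (norm (X w r) + \<bar>Y w r\<bar> + norm (Z w r) + 1)"
      using s(5) growth
    proof eventually_elim
      case (elim w)
      show ?case
      proof
        fix r assume r: "r \<in> {t..T}"
        then have r0: "r \<in> {0..T}" using t by auto
        let ?q = "norm (X w r) + \<bar>Y w r\<bar> + norm (Z w r) + 1"
        have q: "L * (1 + norm (X w r) + \<bar>Y w r\<bar> + norm (Z w r)) \<le> K0 * ?q"
          using K0 mult_right_mono[OF K0(1), of ?q] by (simp add: ac_simps)
        note gr = elim(2)[rule_format, OF r0, of "X w r" "Y w r" "Z w r"]
        show "norm (\<beta> w r) \<le> K0 * ?q \<and> norm (\<Sigma> w r) \<le> K0 * ?q \<and> \<bar>g w r\<bar> \<le> K0 * ?q"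
          using gr q bspec[OF elim(1) r] by auto
      qed
    qed
    show "AE w in M. \<bar>Y w T\<bar> \<le> K0 * (norm (X w T) + 1)"
      using s(4) growth
    proof eventually_elim
      case (elim w)
      have "\<bar>\<Phi> w (X w T)\<bar> \<le> L * (1 + norm (X w T) + \<bar>0\<bar> + norm (0 :: real ^ 'd))"
        using elim(2) TT by blast
      also have "\<dots> \<le> K0 * (norm (X w T) + 1)"
        using mult_right_mono[OF K0(1), of "norm (X w T) + 1"] by (simp add: add.commute)
      finally show ?case using elim(1) by simp
    qed
  qed
  have Mo: "fb_monotone t (G $ 1) \<beta>1 (\<beta>2 * (norm (G $ 1))\<^sup>2) \<mu>1 K0 1 X Y Z \<beta> \<Sigma> g"
    unfolding fb_monotone_def
  proof
    show "AE w in M. \<forall>r\<in>{t..T}.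
        (G $ 1 \<bullet> \<beta> w r) * Y w r - (G $ 1 \<bullet> X w r) * g w r + (\<Sum>i\<in>UNIV. G $ 1 $ i * (\<Sigma> w r $ i \<bullet> Z w r))
        \<le> - \<beta>1 * (G $ 1 \<bullet> X w r)\<^sup>2 - \<beta>2 * (norm (G $ 1))\<^sup>2 * ((Y w r)\<^sup>2 + (norm (Z w r))\<^sup>2)
          + K0 * 1 * (norm (X w r) + \<bar>Y w r\<bar> + norm (Z w r))"
      using s(5) growth B2a
    proof eventually_elim
      case (elim w)
      show ?case
      proof
        fix r assume r: "r \<in> {t..T}"
        then have r0: "r \<in> {0..T}" using t by auto
        \<comment> \<open>the values at the zero state are the error terms\<close>
        define b0 s0 f0 where "b0 = b w r 0 0 0" and "s0 = \<sigma> w r 0 0 0" and "f0 = f w r 0 0 0"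
        have c: "norm b0 \<le> L" "norm s0 \<le> L" "\<bar>f0\<bar> \<le> L"
          using elim(2)[rule_format, OF r0, of 0 0 0] by (simp_all add: b0_def s0_def f0_def)
        let ?S = "\<Sum>i\<in>UNIV. G $ 1 $ i * (\<Sigma> w r $ i \<bullet> Z w r)"
        let ?Rz = "\<Sum>i\<in>UNIV. G $ 1 $ i * (s0 $ i \<bullet> Z w r)"
        have e: "\<beta> w r = b w r (X w r) (Y w r) (Z w r)" "\<Sigma> w r = \<sigma> w r (X w r) (Y w r) (Z w r)"
          "g w r = f w r (X w r) (Y w r) (Z w r)" using bspec[OF elim(1) r] by auto
        have "(G $ 1 \<bullet> (\<beta> w r - b0)) * (Y w r - 0) - (G $ 1 \<bullet> (X w r - 0)) * (g w r - f0)
            + (\<Sum>i\<in>UNIV. G $ 1 $ i * ((\<Sigma> w r - s0) $ i \<bullet> (Z w r - 0)))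
          \<le> - \<beta>1 * (G $ 1 \<bullet> (X w r - 0))\<^sup>2 - \<beta>2 * ((norm (G $ 1))\<^sup>2 * (Y w r - 0)\<^sup>2 + (norm (G $ 1))\<^sup>2 * (norm (Z w r - 0))\<^sup>2)"
          using elim(3)[rule_format, OF r0, of "X w r" "Y w r" "Z w r" 0 0 0]
          unfolding e b0_def s0_def f0_def fbsde_A_diff_inner matrix_row_norm2 .
        moreover have "(\<Sum>i\<in>UNIV. G $ 1 $ i * ((\<Sigma> w r - s0) $ i \<bullet> (Z w r - 0))) = ?S - ?Rz"
          by (simp only: vector_minus_component inner_diff_left right_diff_distrib sum_subtractf diff_zero)
        ultimately have main: "(G $ 1 \<bullet> \<beta> w r) * Y w r - (G $ 1 \<bullet> X w r) * g w r + ?S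
          \<le> - \<beta>1 * (G $ 1 \<bullet> X w r)\<^sup>2 - \<beta>2 * (norm (G $ 1))\<^sup>2 * ((Y w r)\<^sup>2 + (norm (Z w r))\<^sup>2)
            + ((G $ 1 \<bullet> b0) * Y w r - (G $ 1 \<bullet> X w r) * f0 + ?Rz)"
          by (simp add: inner_diff_right algebra_simps)
        have 1: "(G $ 1 \<bullet> b0) * Y w r \<le> K0 * \<bar>Y w r\<bar>"
        proof -
          have "(G $ 1 \<bullet> b0) * Y w r \<le> \<bar>G $ 1 \<bullet> b0\<bar> * \<bar>Y w r\<bar>" by (simp add: abs_mult[symmetric])
          also have "\<bar>G $ 1 \<bullet> b0\<bar> \<le> norm (G $ 1) * norm b0" by (rule Cauchy_Schwarz_ineq2)
          also have "norm (G $ 1) * norm b0 \<le> norm (G $ 1) * L" by (rule mult_left_mono[OF c(1)]) simp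
          also have "\<dots> \<le> K0" by (rule K1)
          finally show ?thesis by (simp add: mult_right_mono)
        qed
        have 2: "- ((G $ 1 \<bullet> X w r) * f0) \<le> K0 * norm (X w r)"
        proof -
          have "- ((G $ 1 \<bullet> X w r) * f0) \<le> \<bar>G $ 1 \<bullet> X w r\<bar> * \<bar>f0\<bar>" by (simp add: abs_mult[symmetric])
          also have "\<dots> \<le> (norm (G $ 1) * norm (X w r)) * L"
            by (rule mult_mono[OF Cauchy_Schwarz_ineq2 c(3)]) auto
          also have "\<dots> = (norm (G $ 1) * L) * norm (X w r)" by simp
          also have "\<dots> \<le> K0 * norm (X w r)" by (rule mult_right_mono[OF K1]) simp
          finally show ?thesis .
        qed
        have 3: "?Rz \<le> K0 * norm (Z w r)"
        proof -
          have "?Rz \<le> real CARD('n) * norm (G $ 1) * norm s0 * norm (Z w r)" by (rule row_sum_bound)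
          also have "\<dots> \<le> (real CARD('n) * norm (G $ 1) * L) * norm (Z w r)"
            by (intro mult_right_mono mult_left_mono c(2)) auto
          also have "\<dots> \<le> K0 * norm (Z w r)" by (rule mult_right_mono[OF K0(2)]) simp
          finally show ?thesis .
        qed
        have "(G $ 1 \<bullet> b0) * Y w r - (G $ 1 \<bullet> X w r) * f0 + ?Rz \<le> K0 * norm (X w r) + K0 * \<bar>Y w r\<bar> + K0 * norm (Z w r)"
          using 1 2 3 by linarith
        also have "\<dots> = K0 * 1 * (norm (X w r) + \<bar>Y w r\<bar> + norm (Z w r))" by (simp add: distrib_left)
        finally show "(G $ 1 \<bullet> \<beta> w r) * Y w r - (G $ 1 \<bullet> X w r) * g w r + ?S
          \<le> - \<beta>1 * (G $ 1 \<bullet> X w r)\<^sup>2 - \<beta>2 * (norm (G $ 1))\<^sup>2 * ((Y w r)\<^sup>2 + (norm (Z w r))\<^sup>2)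
            + K0 * 1 * (norm (X w r) + \<bar>Y w r\<bar> + norm (Z w r))"
          using main by (rule order_trans[OF _ add_left_mono, rotated])
      qed
    qed
    show "AE w in M. \<mu>1 * (G $ 1 \<bullet> X w T)\<^sup>2 - K0 * 1 * norm (X w T) \<le> Y w T * (G $ 1 \<bullet> X w T)"
      using s(4) growth B2b
    proof eventually_elim
      case (elim w)
      have "\<mu>1 * (norm (G *v (X w T - 0)))\<^sup>2 \<le> (\<Phi> w (X w T) - \<Phi> w 0) * (G *v (X w T - 0)) $ 1"
        using elim(3) by blast
      moreover have "(G *v (X w T - 0)) $ 1 = G $ 1 \<bullet> X w T"
        by (simp add: matrix_vector_mult_def inner_vec_def)
      ultimately have m: "\<mu>1 * (G $ 1 \<bullet> X w T)\<^sup>2 \<le> Y w T * (G $ 1 \<bullet> X w T) - \<Phi> w 0 * (G $ 1 \<bullet> X w T)"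
        using elim(1) by (simp add: matrix_row_norm2 left_diff_distrib)
      have "\<bar>\<Phi> w 0\<bar> \<le> L * (1 + norm (0 :: real ^ 'n) + \<bar>0\<bar> + norm (0 :: real ^ 'd))"
        using elim(2) TT by blast
      then have p: "\<bar>\<Phi> w 0\<bar> \<le> L" by simp
      have "- (\<Phi> w 0 * (G $ 1 \<bullet> X w T)) \<le> \<bar>\<Phi> w 0\<bar> * \<bar>G $ 1 \<bullet> X w T\<bar>" by (simp add: abs_mult[symmetric])
      also have "\<dots> \<le> L * (norm (G $ 1) * norm (X w T))"
        by (rule mult_mono[OF p Cauchy_Schwarz_ineq2 L0]) simp
      also have "\<dots> = (norm (G $ 1) * L) * norm (X w T)" by simp
      also have "\<dots> \<le> K0 * norm (X w T)" by (rule mult_right_mono[OF K1]) simp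
      finally show ?case using m by simp
    qed
  qed
  have "AE w in M. X w t = \<zeta> w" using s(4) by eventually_elim simp
  moreover have "AE w in M. \<forall>r\<in>{t..T}. \<Sigma> w r = \<sigma> w r (X w r) (Y w r) (Z w r)"
    using s(5) by eventually_elim simp
  ultimately show ?thesis using S Mo by blast
qed

section \<open>Estimates for the solutions\<close>

text \<open>The drift term carries the factor \<open>u - t\<close> from \<open>vector_process_sup\<close>, so its full energy may be used. The diffusion term
  obtains this factor from the bound by \<open>x\<close> and \<open>y\<close>, which integrates to \<open>u - t\<close> times the moments of their suprema.\<close>

lemma small_time_estimate:
  assumes t: "0 \<le> t" "t \<le> T" and u: "t \<le> u" "u \<le> T" and A: "A \<in> sets (F t)"
    and S: "fb_system t K 1 x y z \<beta> \<Sigma> g"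
    and L: "0 \<le> L" "AE w in M. \<forall>r\<in>{t..T}. norm (\<Sigma> w r) \<le> L * (norm (x w r) + \<bar>y w r\<bar> + 1)"
    and D: "expect_on A (sup_norm2 t T x) + expect_on A (sup_norm2 t T y) + tint t A T (\<lambda>w r. (norm (z w r))\<^sup>2) \<le> D"
      "prob A \<le> D"
  shows "expect_on A (sup_norm2 t u (\<lambda>w s. x w s - x w t)) \<le> (u - t) * ((8 * K\<^sup>2 * (2 * T + 1) + 64 * L\<^sup>2) * D)"
proof -
  have AM: "A \<in> sets M" by (rule sets_F_M[OF _ A]) (use t in auto)
  have ut: "u \<in> {t..T}" and T0: "0 \<le> T" using u t by auto
  note p = fb_system_processes[OF S t]
  define P Q R a where "P = expect_on A (sup_norm2 t T x)" and "Q = expect_on A (sup_norm2 t T y)"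
    and "R = tint t A T (\<lambda>w r. (norm (z w r))\<^sup>2)" and "a = prob A"
  have nnsup: "0 \<le> expect_on A (sup_norm2 t T v)" if "v \<in> S2 M F t T" for v :: "'w \<Rightarrow> real \<Rightarrow> 'e::euclidean_space"
    using sup_norm2_integrable_sub(2)[OF that t(1) t(2) order_refl]
    by (intro Bochner_Integration.integral_nonneg) simp
  have P0: "0 \<le> P" and Q0: "0 \<le> Q" using nnsup[OF p(1)] nnsup[OF p(2)] by (simp_all add: P_def Q_def)
  have R0: "0 \<le> R" unfolding R_def by (rule tint_nonneg) simp
  have a0: "0 \<le> a" by (simp add: a_def)
  have D': "P + Q + R \<le> D" "a \<le> D" using D by (simp_all add: P_def Q_def R_def a_def)
  have xu: "tint t A u (\<lambda>w r. (norm (x w r))\<^sup>2) \<le> (u - t) * P"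
    unfolding P_def by (rule tint_le_sup[OF p(1) t AM u])
  have yu: "tint t A u (\<lambda>w r. (y w r)\<^sup>2) \<le> (u - t) * Q"
    using tint_le_sup[OF p(2) t AM u] by (simp add: Q_def)
  have yT: "tint t A T (\<lambda>w r. (y w r)\<^sup>2) \<le> T * Q"
  proof -
    have "tint t A T (\<lambda>w r. (y w r)\<^sup>2) \<le> (T - t) * Q"
      using tint_le_sup[OF p(2) t AM t(2) order_refl] by (simp add: Q_def)
    also have "\<dots> \<le> T * Q" using t Q0 by (intro mult_right_mono) auto
    finally show ?thesis .
  qed
  have xuT: "(u - t) * P \<le> T * P" using t u P0 by (intro mult_right_mono) auto
  have drift: "tint t A u (\<lambda>w r. (norm (\<beta> w r))\<^sup>2) \<le> 4 * K\<^sup>2 * ((2 * T + 1) * D)"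
  proof -
    have "tint t A u (\<lambda>w r. (norm (\<beta> w r))\<^sup>2) \<le> 4 * K\<^sup>2 * (tint t A u (\<lambda>w r. (norm (x w r))\<^sup>2)
        + tint t A T (\<lambda>w r. (y w r)\<^sup>2) + tint t A T (\<lambda>w r. (norm (z w r))\<^sup>2) + T * (1\<^sup>2 * prob A))"
      by (rule tint_growth_bound[OF S t AM p(15) _ ut fb_system_bounds(1)[OF S]]) simp
    also have "\<dots> \<le> 4 * K\<^sup>2 * ((2 * T + 1) * D)"
    proof (rule mult_left_mono)
      have "T * (P + Q + R) \<le> T * D" "T * a \<le> T * D" "0 \<le> T * R"
        using D' T0 R0 by (auto intro: mult_left_mono)
      then show "tint t A u (\<lambda>w r. (norm (x w r))\<^sup>2) + tint t A T (\<lambda>w r. (y w r)\<^sup>2)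
        + tint t A T (\<lambda>w r. (norm (z w r))\<^sup>2) + T * (1\<^sup>2 * prob A) \<le> (2 * T + 1) * D"
        using xu xuT yT D' P0 Q0 unfolding R_def[symmetric] a_def[symmetric] by (simp add: algebra_simps)
    qed simp
    finally show ?thesis .
  qed
  have diffusion: "tint t A u (\<lambda>w r. (norm (\<Sigma> w r))\<^sup>2) \<le> 4 * L\<^sup>2 * ((u - t) * (2 * D))"
  proof -
    note p1 = proc_integrable_add[OF p(12,13)]
    note p2 = proc_integrable_add[OF p1 proc_integrable_const[of t 1]]
    have "AE w in M. \<forall>r\<in>{t..T}. (norm (\<Sigma> w r))\<^sup>2 \<le> 4 * L\<^sup>2 * ((norm (x w r))\<^sup>2 + (y w r)\<^sup>2 + 1)"
      using L(2)
    proof eventually_elim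
      case (elim w)
      show ?case
      proof
        fix r assume "r \<in> {t..T}"
        then have "norm (\<Sigma> w r) \<le> L * (norm (x w r) + \<bar>y w r\<bar> + 0 + 1)" using elim by simp
        from linear_growth_power2[OF norm_ge_zero this]
        show "(norm (\<Sigma> w r))\<^sup>2 \<le> 4 * L\<^sup>2 * ((norm (x w r))\<^sup>2 + (y w r)\<^sup>2 + 1)" by simp
      qed
    qed
    from tint_mono_AE[OF p(16) proc_integrable_cmult[OF p2] AM u(2) this]
    have "tint t A u (\<lambda>w r. (norm (\<Sigma> w r))\<^sup>2) \<le> 4 * L\<^sup>2 * (tint t A u (\<lambda>w r. (norm (x w r))\<^sup>2)
        + tint t A u (\<lambda>w r. (y w r)\<^sup>2) + (u - t) * a)"
      unfolding tint_cmult tint_add[OF p1 proc_integrable_const[of t 1] AM u(2)] tint_add[OF p(12,13) AM u(2)]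
        tint_const[OF AM ut] a_def by simp
    also have "\<dots> \<le> 4 * L\<^sup>2 * ((u - t) * (2 * D))"
    proof (rule mult_left_mono)
      have "(u - t) * (P + Q + a) \<le> (u - t) * (2 * D)" using D' R0 u by (intro mult_left_mono) auto
      then show "tint t A u (\<lambda>w r. (norm (x w r))\<^sup>2) + tint t A u (\<lambda>w r. (y w r)\<^sup>2) + (u - t) * a
          \<le> (u - t) * (2 * D)"
        using xu yu by (simp only: distrib_left)
    qed simp
    finally show ?thesis .
  qed
  have "expect_on A (sup_norm2 t u (\<lambda>w s. x w s - x w t))
      \<le> 2 * ((u - t) * tint t A u (\<lambda>w r. (norm (\<beta> w r))\<^sup>2)) + 8 * tint t A u (\<lambda>w r. (norm (\<Sigma> w r))\<^sup>2)"
    by (rule vector_process_sup[OF p(1) p(3) t u A])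
  also have "\<dots> \<le> 2 * ((u - t) * (4 * K\<^sup>2 * ((2 * T + 1) * D))) + 8 * (4 * L\<^sup>2 * ((u - t) * (2 * D)))"
    using u by (intro add_mono mult_left_mono drift diffusion) auto
  also have "\<dots> = (u - t) * ((8 * K\<^sup>2 * (2 * T + 1) + 64 * L\<^sup>2) * D)" by (simp add: algebra_simps)
  finally show ?thesis .
qed

lemma L2_initial:
  fixes V :: "'w \<Rightarrow> 'a::euclidean_space"
  assumes "V \<in> L2 M (F t)" "t \<in> {0..T}"
  shows "V \<in> borel_measurable (F t)" "sq_int M V"
proof -
  show m: "V \<in> borel_measurable (F t)" using assms(1) by (simp add: L2_def)
  show "sq_int M V" unfolding sq_int_def
    using assms(1) measurable_from_subalg[OF filtration_subalgebra[OF assms(2)] m] by (simp add: L2_def)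
qed

lemma expect_on_initial:
  fixes x :: "'w \<Rightarrow> real \<Rightarrow> 'a::euclidean_space"
  assumes A: "A \<in> sets M" and x: "x \<in> S2 M F t T" "t \<in> {0..T}" and V: "sq_int M V" and ae: "AE w in M. x w t = V w"
  shows "expect_on A (\<lambda>w. (norm (x w t))\<^sup>2) = expect_on A (\<lambda>w. (norm (V w))\<^sup>2)"
proof (rule integral_cong_AE)
  show "(\<lambda>w. indicator A w * (norm (x w t))\<^sup>2) \<in> borel_measurable M"
    by (rule borel_measurable_integrable[OF expect_on_norm2_integrable[OF x(1) _ _ A]]) (use x(2) in auto)
  show "(\<lambda>w. indicator A w * (norm (V w))\<^sup>2) \<in> borel_measurable M"
    using A sq_int_measurable[OF V] by measurable
  show "AE w in M. indicator A w * (norm (x w t))\<^sup>2 = indicator A w * (norm (V w))\<^sup>2"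
    using ae by eventually_elim simp
qed

text \<open>The right-hand sides of the conditional estimates have this form, with \<open>d = 0\<close> for a difference of solutions and
  \<open>d = 1\<close> otherwise.\<close>

lemma initial_bound_function:
  fixes V :: "'w \<Rightarrow> 'a::euclidean_space"
  assumes V: "V \<in> borel_measurable (F t)" "sq_int M V"
  shows "integrable M (\<lambda>w. c * (d + (norm (V w))\<^sup>2))"
    "(\<lambda>w. c * (d + (norm (V w))\<^sup>2)) \<in> borel_measurable (F t)"
    "A \<in> sets M \<Longrightarrow> expect_on A (\<lambda>w. c * (d + (norm (V w))\<^sup>2)) = c * (expect_on A (\<lambda>w. (norm (V w))\<^sup>2) + d * prob A)"
proof -
  note Vi = sq_int_integrable_norm2[OF V(2)]
  show "integrable M (\<lambda>w. c * (d + (norm (V w))\<^sup>2))" using Vi by simp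
  show "(\<lambda>w. c * (d + (norm (V w))\<^sup>2)) \<in> borel_measurable (F t)" using V(1) by measurable
  assume A: "A \<in> sets M"
  have 1: "integrable M (\<lambda>w. indicator A w * (norm (V w))\<^sup>2)" using integrable_mult_indicator[OF A Vi] by simp
  have 2: "integrable M (\<lambda>w. indicator A w * d)" using A by (simp add: emeasure_eq_measure)
  have "expect_on A (\<lambda>w. c * (d + (norm (V w))\<^sup>2))
    = (\<integral>w. c * (indicator A w * d + indicator A w * (norm (V w))\<^sup>2) \<partial>M)"
    by (rule Bochner_Integration.integral_cong) (simp_all add: algebra_simps)
  also have "\<dots> = c * (expect_on A (\<lambda>w. d) + expect_on A (\<lambda>w. (norm (V w))\<^sup>2))"
    using Bochner_Integration.integral_add[OF 2 1] by simp
  finally show "expect_on A (\<lambda>w. c * (d + (norm (V w))\<^sup>2)) = c * (expect_on A (\<lambda>w. (norm (V w))\<^sup>2) + d * prob A)"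
    unfolding expect_on_const[OF A] by simp
qed

end

text \<open>The constant of the a priori estimate serves (i) and (ii); it is enlarged by the one from \<open>small_time_estimate\<close>
  to serve (iii) as well.\<close>

theorem proposition6p1:
  fixes T :: real
    and W M :: "(real \<Rightarrow> real ^ 'd) measure"
    and F :: "real \<Rightarrow> (real \<Rightarrow> real ^ 'd) measure"
    and B :: "(real \<Rightarrow> real ^ 'd) \<Rightarrow> real \<Rightarrow> real ^ 'd"
    and G :: "real ^ 'n ^ 1"
    and b :: "(real \<Rightarrow> real ^ 'd) \<Rightarrow> real \<Rightarrow> real ^ 'n \<Rightarrow> real \<Rightarrow> real ^ 'd \<Rightarrow> real ^ 'n"
    and \<sigma> :: "(real \<Rightarrow> real ^ 'd) \<Rightarrow> real \<Rightarrow> real ^ 'n \<Rightarrow> real \<Rightarrow> real ^ 'd \<Rightarrow> real ^ 'd ^ 'n"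
    and f :: "(real \<Rightarrow> real ^ 'd) \<Rightarrow> real \<Rightarrow> real ^ 'n \<Rightarrow> real \<Rightarrow> real ^ 'd \<Rightarrow> real"
    and \<Phi> :: "(real \<Rightarrow> real ^ 'd) \<Rightarrow> real ^ 'n \<Rightarrow> real"
    and \<beta>1 \<beta>2 \<mu>1 K L :: real
  assumes T: "0 < T"
    and W: "wiener_measure T W"
    and M: "M = completion W"
    and F: "F = aug_filtration W"
    and B: "B = (\<lambda>\<omega> s. \<omega> s)"
    and G: "rank G = 1"
    and meas: "fbsde_measurable F T b \<sigma> f \<Phi>"
    and B1: "cond_B1 M F T G b \<sigma> f \<Phi>"
    and B2: "cond_B2 M T G b \<sigma> f \<Phi> \<beta>1 \<beta>2 \<mu>1"
    and C1: "cond_C1 M T b \<sigma> f \<Phi> K"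
    and C2: "cond_C2 M T b \<sigma> f \<Phi> L"
  shows "\<exists>C>0.
    (\<forall>t\<in>{0..T}. \<forall>\<zeta>\<in>L2 M (F t). \<forall>\<zeta>'\<in>L2 M (F t). \<forall>X Y Z X' Y' Z'.
       fbsde_solution M F B T b \<sigma> f \<Phi> t \<zeta> X Y Z \<longrightarrow>
       fbsde_solution M F B T b \<sigma> f \<Phi> t \<zeta>' X' Y' Z' \<longrightarrow>
       (AE \<omega> in M. real_cond_exp M (F t) (\<lambda>\<omega>.
            (SUP s\<in>{t..T}. (norm (X \<omega> s - X' \<omega> s))\<^sup>2)
          + (SUP s\<in>{t..T}. \<bar>Y \<omega> s - Y' \<omega> s\<bar>\<^sup>2)
          + (LINT s:{t..T}|lborel. (norm (Z \<omega> s - Z' \<omega> s))\<^sup>2)) \<omega>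
        \<le> C * (norm (\<zeta> \<omega> - \<zeta>' \<omega>))\<^sup>2)) \<and>
    (\<forall>t\<in>{0..T}. \<forall>\<zeta>\<in>L2 M (F t). \<forall>X Y Z.
       fbsde_solution M F B T b \<sigma> f \<Phi> t \<zeta> X Y Z \<longrightarrow>
       (AE \<omega> in M. real_cond_exp M (F t) (\<lambda>\<omega>.
            (SUP s\<in>{t..T}. (norm (X \<omega> s))\<^sup>2)
          + (SUP s\<in>{t..T}. \<bar>Y \<omega> s\<bar>\<^sup>2)
          + (LINT s:{t..T}|lborel. (norm (Z \<omega> s))\<^sup>2)) \<omega>
        \<le> C * (1 + (norm (\<zeta> \<omega>))\<^sup>2))) \<and>
    (cond_C3 M T \<sigma> L \<longrightarrow>
      (\<forall>t\<in>{0..T}. \<forall>\<zeta>\<in>L2 M (F t). \<forall>X Y Z.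
         fbsde_solution M F B T b \<sigma> f \<Phi> t \<zeta> X Y Z \<longrightarrow>
         (\<forall>\<delta>\<in>{0..T - t}.
            AE \<omega> in M. real_cond_exp M (F t) (\<lambda>\<omega>.
                (SUP s\<in>{t..t + \<delta>}. (norm (X \<omega> s - \<zeta> \<omega>))\<^sup>2)) \<omega>
              \<le> C * \<delta> * (1 + (norm (\<zeta> \<omega>))\<^sup>2))))"
proof -
  interpret brownian_filtration M F B T
    unfolding M F B by (rule wiener_brownian_filtration[OF W])
  define \<gamma> where "\<gamma> = G $ 1"
  have \<gamma>: "0 < (norm \<gamma>)\<^sup>2" using rank_one_row_nonzero[OF G] by (simp add: \<gamma>_def)
  have K0: "0 \<le> K" and L0: "0 \<le> L" using C1 C2 by (simp_all add: cond_C1_def cond_C2_def)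
  have B2c: "0 \<le> \<beta>1" "0 \<le> \<beta>2" "0 \<le> \<mu>1" "0 < \<beta>1 + \<beta>2" "0 < \<beta>2 + \<mu>1" "CARD('n) > 1 \<longrightarrow> 0 < \<beta>2"
    using B2 unfolding cond_B2_def by blast+
  \<comment> \<open>a single constant that dominates those of \<open>fbsde_difference_system\<close> and \<open>fbsde_solution_system\<close>\<close>
  define K' where "K' = K + L + real CARD('n) * norm \<gamma> * L"
  have g0: "0 \<le> real CARD('n) * norm \<gamma> * L" using L0 by simp
  have K': "0 \<le> K'" "K \<le> K'" "L \<le> K'" "real CARD('n) * norm \<gamma> * L \<le> K'"
    using K0 L0 g0 unfolding K'_def by linarith+
  have coercive: "0 < \<beta>2 * (norm \<gamma>)\<^sup>2 \<or> (0 < \<beta>1 \<and> 0 < \<mu>1 \<and> (\<exists>c>0. \<forall>v. c * (norm v)\<^sup>2 \<le> (\<gamma> \<bullet> v)\<^sup>2))"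
  proof (cases "0 < \<beta>2")
    case True
    then show ?thesis using \<gamma> by simp
  next
    case False
    then have "\<beta>2 = 0" and "\<not> CARD('n) > 1" using B2c by auto
    moreover have "0 < CARD('n)" by (simp add: finite_UNIV_card_ge_0)
    ultimately have n: "CARD('n) = 1" by linarith
    have "\<exists>c>0. \<forall>v. c * (norm v)\<^sup>2 \<le> (\<gamma> \<bullet> v)\<^sup>2"
      using \<gamma> by (intro exI[of _ "(norm \<gamma>)\<^sup>2"]) (simp add: inner_power2_card_one[OF n])
    moreover have "0 < \<beta>1" "0 < \<mu>1" using B2c \<open>\<beta>2 = 0\<close> by simp_all
    ultimately show ?thesis by blast
  qed
  have b2: "0 \<le> \<beta>2 * (norm \<gamma>)\<^sup>2" using B2c by simp
  obtain Ca where Ca: "0 < Ca" and apriori: "\<forall>t k x y z \<beta> \<sigma> g A. 0 \<le> t \<longrightarrow> t \<le> T \<longrightarrow> 0 \<le> k \<longrightarrow>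
      fb_system t K' k x y z \<beta> \<sigma> g \<longrightarrow> fb_monotone t \<gamma> \<beta>1 (\<beta>2 * (norm \<gamma>)\<^sup>2) \<mu>1 K' k x y z \<beta> \<sigma> g \<longrightarrow> A \<in> sets (F t) \<longrightarrow>
      expect_on A (sup_norm2 t T x) + expect_on A (sup_norm2 t T y) + tint t A T (\<lambda>w r. (norm (z w r))\<^sup>2)
        \<le> Ca * (expect_on A (\<lambda>w. (norm (x w t))\<^sup>2) + k\<^sup>2 * prob A)"
    using a_priori_estimate[OF K'(1) B2c(1) b2 B2c(3) less_imp_le[OF T] coercive] by blast
  define Cb where "Cb = (8 * K'\<^sup>2 * (2 * T + 1) + 64 * L\<^sup>2) * (Ca + 1)"
  have Cb: "0 \<le> Cb" unfolding Cb_def using Ca T by simp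
  have part1: "AE w in M. real_cond_exp M (F t) (\<lambda>w.
            (SUP s\<in>{t..T}. (norm (X w s - X' w s))\<^sup>2)
          + (SUP s\<in>{t..T}. \<bar>Y w s - Y' w s\<bar>\<^sup>2)
          + (LINT s:{t..T}|lborel. (norm (Z w s - Z' w s))\<^sup>2)) w
        \<le> (Ca + Cb) * (norm (\<zeta> w - \<zeta>' w))\<^sup>2"
    if tT: "t \<in> {0..T}" and z: "\<zeta> \<in> L2 M (F t)" "\<zeta>' \<in> L2 M (F t)"
      and sol: "fbsde_solution M F B T b \<sigma> f \<Phi> t \<zeta> X Y Z" and sol': "fbsde_solution M F B T b \<sigma> f \<Phi> t \<zeta>' X' Y' Z'"
    for t \<zeta> \<zeta>' X Y Z X' Y' Z'
  proof -
    have t: "0 \<le> t" "t \<le> T" using tT by auto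
    define x where "x = (\<lambda>w s. X w s - X' w s)"
    define y where "y = (\<lambda>w s. Y w s - Y' w s)"
    define z where "z = (\<lambda>w s. Z w s - Z' w s)"
    obtain \<beta> \<Sigma> g where S: "fb_system t K' 0 x y z \<beta> \<Sigma> g"
      and Mo: "fb_monotone t \<gamma> \<beta>1 (\<beta>2 * (norm \<gamma>)\<^sup>2) \<mu>1 K' 0 x y z \<beta> \<Sigma> g"
      and x0: "AE w in M. x w t = \<zeta> w - \<zeta>' w"
      using fbsde_difference_system[OF meas B2 C1 C2 K'(2) t sol sol'] unfolding x_def y_def z_def \<gamma>_def by blast
    note p = fb_system_processes[OF S t]
    have V: "(\<lambda>w. \<zeta> w - \<zeta>' w) \<in> borel_measurable (F t)" "sq_int M (\<lambda>w. \<zeta> w - \<zeta>' w)"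
      using L2_initial[OF that(2) tT] L2_initial[OF that(3) tT] by (auto intro: borel_measurable_diff sq_int_diff)
    note sc = initial_bound_function[where c = Ca and d = 0, OF V, unfolded add_0_left]
    have "AE w in M. real_cond_exp M (F t) (\<lambda>w. sup_norm2 t T x w + sup_norm2 t T y w
        + (LINT r:{t..T}|lborel. (norm (z w r))\<^sup>2)) w \<le> Ca * (norm (\<zeta> w - \<zeta>' w))\<^sup>2"
    proof (rule conditional_bound[OF t p(1,2,8) sc(1,2)])
      fix A assume A: "A \<in> sets (F t)"
      have AM: "A \<in> sets M" by (rule sets_F_M[OF tT A])
      show "expect_on A (sup_norm2 t T x) + expect_on A (sup_norm2 t T y) + tint t A T (\<lambda>w r. (norm (z w r))\<^sup>2)
          \<le> expect_on A (\<lambda>w. Ca * (norm (\<zeta> w - \<zeta>' w))\<^sup>2)"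
        using apriori[rule_format, OF t order_refl S Mo A]
        unfolding sc(3)[OF AM] expect_on_initial[OF AM p(1) tT V(2) x0] by simp
    qed
    then show ?thesis
    proof eventually_elim
      case (elim w)
      have "Ca * (norm (\<zeta> w - \<zeta>' w))\<^sup>2 \<le> (Ca + Cb) * (norm (\<zeta> w - \<zeta>' w))\<^sup>2"
        using Cb by (intro mult_right_mono) auto
      with elim show ?case unfolding sup_norm2_def x_def y_def z_def real_norm_def by (rule order_trans)
    qed
  qed
  have part2: "AE w in M. real_cond_exp M (F t) (\<lambda>w.
            (SUP s\<in>{t..T}. (norm (X w s))\<^sup>2)
          + (SUP s\<in>{t..T}. \<bar>Y w s\<bar>\<^sup>2)
          + (LINT s:{t..T}|lborel. (norm (Z w s))\<^sup>2)) w
        \<le> (Ca + Cb) * (1 + (norm (\<zeta> w))\<^sup>2)"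
      and part3: "cond_C3 M T \<sigma> L \<Longrightarrow> \<delta> \<in> {0..T - t} \<Longrightarrow> AE w in M. real_cond_exp M (F t) (\<lambda>w. (SUP s\<in>{t..t + \<delta>}. (norm (X w s - \<zeta> w))\<^sup>2)) w
              \<le> (Ca + Cb) * \<delta> * (1 + (norm (\<zeta> w))\<^sup>2)"
    if tT: "t \<in> {0..T}" and \<zeta>: "\<zeta> \<in> L2 M (F t)" and sol: "fbsde_solution M F B T b \<sigma> f \<Phi> t \<zeta> X Y Z"
    for t \<zeta> X Y Z \<delta>
  proof -
    have t: "0 \<le> t" "t \<le> T" using tT by auto
    obtain \<beta> \<Sigma> g where S: "fb_system t K' 1 X Y Z \<beta> \<Sigma> g"
      and Mo: "fb_monotone t \<gamma> \<beta>1 (\<beta>2 * (norm \<gamma>)\<^sup>2) \<mu>1 K' 1 X Y Z \<beta> \<Sigma> g"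
      and x0: "AE w in M. X w t = \<zeta> w"
      and \<Sigma>: "AE w in M. \<forall>r\<in>{t..T}. \<Sigma> w r = \<sigma> w r (X w r) (Y w r) (Z w r)"
      using fbsde_solution_system[OF meas B2 C1 C2 K'(3) K'(4)[unfolded \<gamma>_def] t sol] unfolding \<gamma>_def by blast
    note p = fb_system_processes[OF S t]
    note V = L2_initial[OF \<zeta> tT]
    have est: "expect_on A (sup_norm2 t T X) + expect_on A (sup_norm2 t T Y) + tint t A T (\<lambda>w r. (norm (Z w r))\<^sup>2)
        \<le> Ca * (expect_on A (\<lambda>w. (norm (\<zeta> w))\<^sup>2) + 1 * prob A)" if A: "A \<in> sets (F t)" for A
      using apriori[rule_format, OF t zero_le_one S Mo A]
      unfolding expect_on_initial[OF sets_F_M[OF tT A] p(1) tT V(2) x0] by simp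
    note sc = initial_bound_function[where c = Ca and d = 1, OF V]
    have "AE w in M. real_cond_exp M (F t) (\<lambda>w. sup_norm2 t T X w + sup_norm2 t T Y w
        + (LINT r:{t..T}|lborel. (norm (Z w r))\<^sup>2)) w \<le> Ca * (1 + (norm (\<zeta> w))\<^sup>2)"
    proof (rule conditional_bound[OF t p(1,2,8) sc(1,2)])
      fix A assume A: "A \<in> sets (F t)"
      show "expect_on A (sup_norm2 t T X) + expect_on A (sup_norm2 t T Y) + tint t A T (\<lambda>w r. (norm (Z w r))\<^sup>2)
          \<le> expect_on A (\<lambda>w. Ca * (1 + (norm (\<zeta> w))\<^sup>2))"
        unfolding sc(3)[OF sets_F_M[OF tT A]] by (rule est[OF A])
    qed
    then show "AE w in M. real_cond_exp M (F t) (\<lambda>w.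
            (SUP s\<in>{t..T}. (norm (X w s))\<^sup>2)
          + (SUP s\<in>{t..T}. \<bar>Y w s\<bar>\<^sup>2)
          + (LINT s:{t..T}|lborel. (norm (Z w s))\<^sup>2)) w
        \<le> (Ca + Cb) * (1 + (norm (\<zeta> w))\<^sup>2)"
    proof eventually_elim
      case (elim w)
      have "Ca * (1 + (norm (\<zeta> w))\<^sup>2) \<le> (Ca + Cb) * (1 + (norm (\<zeta> w))\<^sup>2)"
        using Cb by (intro mult_right_mono) auto
      with elim show ?case unfolding sup_norm2_def real_norm_def by (rule order_trans)
    qed
    assume C3: "cond_C3 M T \<sigma> L" and \<delta>: "\<delta> \<in> {0..T - t}"
    define u where "u = t + \<delta>"
    have u: "t \<le> u" "u \<le> T" using \<delta> by (auto simp: u_def)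
    have growth: "AE w in M. \<forall>r\<in>{t..T}. norm (\<Sigma> w r) \<le> L * (norm (X w r) + \<bar>Y w r\<bar> + 1)"
      using \<Sigma> C3[unfolded cond_C3_def]
    proof eventually_elim
      case (elim w)
      show ?case
      proof
        fix r assume r: "r \<in> {t..T}"
        then have "norm (\<sigma> w r (X w r) (Y w r) (Z w r)) \<le> L * (1 + norm (X w r) + \<bar>Y w r\<bar>)"
          using elim(2) t by simp
        then show "norm (\<Sigma> w r) \<le> L * (norm (X w r) + \<bar>Y w r\<bar> + 1)"
          using bspec[OF elim(1) r] by (simp add: ac_simps)
      qed
    qed
    have Ui: "integrable M (sup_norm2 t u (\<lambda>w s. X w s - \<zeta> w))"
      by (rule sup_norm2_integrable_sub(1)[OF S2_diff[OF p(1) S2_const[OF V t] t] t(1) u])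
    have ci: "integrable M (sup_norm2 t u (\<lambda>w s. X w s - X w t))"
      by (rule sup_norm2_integrable_sub(1)[OF centered_S2[OF p(1) t] t(1) u])
    note sc\<delta> = initial_bound_function[where c = "Cb * \<delta>" and d = 1, OF V]
    have "AE w in M. real_cond_exp M (F t) (sup_norm2 t u (\<lambda>w s. X w s - \<zeta> w)) w \<le> Cb * \<delta> * (1 + (norm (\<zeta> w))\<^sup>2)"
    proof (rule sigma_finite_subalgebra.real_cond_exp_le_of_set_integrals_le[OF sigma_finite_F[OF tT] Ui sc\<delta>(1,2)])
      fix A assume A: "A \<in> sets (F t)"
      have AM: "A \<in> sets M" by (rule sets_F_M[OF tT A])
      define D where "D = expect_on A (\<lambda>w. (norm (\<zeta> w))\<^sup>2) + 1 * prob A"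
      have e0: "0 \<le> expect_on A (\<lambda>w. (norm (\<zeta> w))\<^sup>2)" by (rule Bochner_Integration.integral_nonneg) simp
      have D: "0 \<le> D" "prob A \<le> D" using e0 by (simp_all add: D_def)
      \<comment> \<open>\<open>Ca + 1\<close> instead of \<open>Ca\<close> dominates \<open>prob A\<close> as well\<close>
      have pD: "prob A \<le> (Ca + 1) * D"
        using D mult_nonneg_nonneg[OF less_imp_le[OF Ca] D(1)] by (simp add: distrib_right)
      have eD: "expect_on A (sup_norm2 t T X) + expect_on A (sup_norm2 t T Y) + tint t A T (\<lambda>w r. (norm (Z w r))\<^sup>2)
          \<le> (Ca + 1) * D"
        using est[OF A] D unfolding D_def[symmetric] distrib_right by linarith
      have "expect_on A (sup_norm2 t u (\<lambda>w s. X w s - \<zeta> w)) = expect_on A (sup_norm2 t u (\<lambda>w s. X w s - X w t))"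
      proof (rule integral_cong_AE)
        show "(\<lambda>w. indicator A w * sup_norm2 t u (\<lambda>w s. X w s - \<zeta> w) w) \<in> borel_measurable M"
          using AM borel_measurable_integrable[OF Ui] by measurable
        show "(\<lambda>w. indicator A w * sup_norm2 t u (\<lambda>w s. X w s - X w t) w) \<in> borel_measurable M"
          using AM borel_measurable_integrable[OF ci] by measurable
        show "AE w in M. indicator A w * sup_norm2 t u (\<lambda>w s. X w s - \<zeta> w) w
            = indicator A w * sup_norm2 t u (\<lambda>w s. X w s - X w t) w"
          using x0 by eventually_elim (simp add: sup_norm2_def)
      qed
      also have "\<dots> \<le> (u - t) * ((8 * K'\<^sup>2 * (2 * T + 1) + 64 * L\<^sup>2) * ((Ca + 1) * D))"
        by (rule small_time_estimate[OF t u A S L0 growth eD pD])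
      also have "\<dots> = Cb * \<delta> * D" by (simp add: Cb_def u_def)
      finally show "expect_on A (sup_norm2 t u (\<lambda>w s. X w s - \<zeta> w)) \<le> expect_on A (\<lambda>w. Cb * \<delta> * (1 + (norm (\<zeta> w))\<^sup>2))"
        unfolding sc\<delta>(3)[OF AM] D_def .
    qed
    then show "AE w in M. real_cond_exp M (F t) (\<lambda>w. (SUP s\<in>{t..t + \<delta>}. (norm (X w s - \<zeta> w))\<^sup>2)) w
        \<le> (Ca + Cb) * \<delta> * (1 + (norm (\<zeta> w))\<^sup>2)"
    proof eventually_elim
      case (elim w)
      have "Cb * \<delta> * (1 + (norm (\<zeta> w))\<^sup>2) \<le> (Ca + Cb) * \<delta> * (1 + (norm (\<zeta> w))\<^sup>2)"
        using Ca \<delta> by (intro mult_right_mono) auto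
      with elim show ?case unfolding sup_norm2_def u_def by (rule order_trans)
    qed
  qed
  show ?thesis
  proof (intro exI[of _ "Ca + Cb"] conjI ballI allI impI)
    show "0 < Ca + Cb" using Ca Cb by simp
  qed (rule part1 part2 part3; assumption)+
qed

end
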